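(* Let $X$ be a finite biquandle, let $R$ be a commutative ring with unity, and let $\beta=(A,B,C,D,E,F)$, $A,B,C,D,E,F\colon X\times X\to R$, together with an element $\delta\in R$ and a unit $w\in R$, satisfy the following relations (writing $A_{x,y}=A(x,y)$, etc.). (i) For all $x\in X$: $\delta A_{x,x}+B_{x,x}=w$, $\delta D_{x,x}+E_{x,x}=w^{-1}$, $C_{x,x}=F_{x,x}=0$. (ii) For all $x,y\in X$: $A_{x,y}F_{x,y}=C_{x,y}D_{x,y}=B_{x,y}F_{x,y}=C_{x,y}E_{x,y}=0$, $A_{x,y}D_{x,y}=B_{x,y}E_{x,y}=1-C_{x,y}F_{x,y}$, $\delta A_{x,y}D_{x,y}=-A_{x,y}E_{x,y}-B_{x,y}D_{x,y}$. (iii) For all $x,y,z\in X$: \begin{gather*} A_{x,y}A_{y,z}A_{x\circ y,z\ast y}+C_{x,y}C_{y,z}A_{x\circ y,z\ast y}=A_{x,z}A_{y\ast x,z\ast x}A_{x\circ z,y\circ z}+A_{x,z}C_{y\ast x,z\ast x}C_{x\circ z,y\circ z},\\ A_{x,y}B_{y,z}B_{x\circ y,z\ast y}+C_{x,y}B_{y,z}C_{x\circ y,z\ast y}=B_{x,z}B_{y\ast x,z\ast x}A_{x\circ z,y\circ z}+C_{x,z}B_{y\ast x,z\ast x}C_{x\circ z,y\circ z},\\ B_{x,y}A_{y,z}B_{x\circ y,z\ast y}+B_{x,y}C_{y,z}C_{x\circ y,z\ast y}=B_{x,z}A_{y\ast x,z\ast x}B_{x\circ z,y\circ z}+C_{x,z}C_{y\ast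 x,z\ast x}B_{x\circ z,y\circ z},\\ A_{x,y}C_{y,z}A_{x\circ y,z\ast y}+C_{x,y}A_{y,z}A_{x\circ y,z\ast y}=C_{x,z}A_{y\ast x,z\ast x}A_{x\circ z,y\circ z},\\ A_{x,y}A_{y,z}C_{x\circ y,z\ast y}=A_{x,z}A_{y\ast x,z\ast x}C_{x\circ z,y\circ z}+A_{x,z}C_{y\ast x,z\ast x}A_{x\circ z,y\circ z},\\ A_{x,y}C_{y,z}B_{x\circ y,z\ast y}=B_{x,z}B_{y\ast x,z\ast x}C_{x\circ z,y\circ z}+C_{x,z}B_{y\ast x,z\ast x}A_{x\circ z,y\circ z},\\ B_{x,y}C_{y,z}B_{x\circ y,z\ast y}+B_{x,y}A_{y,z}C_{x\circ y,z\ast y}=B_{x,z}A_{y\ast x,z\ast x}C_{x\circ z,y\circ z},\\ A_{x,y}B_{y,z}C_{x\circ y,z\ast y}+C_{x,y}B_{y,z}B_{x\circ y,z\ast y}=B_{x,z}C_{y\ast x,z\ast x}A_{x\circ z,y\circ z},\\ C_{x,y}A_{y,z}B_{x\circ y,z\ast y}=B_{x,z}C_{y\ast x,z\ast x}B_{x\circ z,y\circ z}+C_{x,z}A_{y\ast x,z\ast x}B_{x\circ z,y\circ z},\\ C_{x,y}C_{y,z}B_{x\circ y,z\ast y}=B_{x,z}C_{y\ast x,z\ast x}C_{x\circ z,y\circ z},\\ A_{x,y}C_{y,z}C_{x\circ y,z\ast y}=C_{x,z}C_{y\ast x,z\ast x}A_{x\circ z,y\circ z},\\ C_{x,y}A_{y,z}C_{x\circ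 y,z\ast y}=C_{x,z}A_{y\ast x,z\ast x}C_{x\circ z,y\circ z},\\ B_{x,y}C_{y,z}A_{x\circ y,z\ast y}=C_{x,y}B_{y,z}A_{x\circ y,z\ast y}=B_{x,y}B_{y,z}C_{x\circ y,z\ast y}=C_{x,y}C_{y,z}C_{x\circ y,z\ast y}=0,\\ A_{x,z}B_{y\ast x,z\ast x}C_{x\circ z,y\circ z}=A_{x,z}C_{y\ast x,z\ast x}B_{x\circ z,y\circ z}=C_{x,z}B_{y\ast x,z\ast x}B_{x\circ z,y\circ z}=C_{x,z}C_{y\ast x,z\ast x}C_{x\circ z,y\circ z}=0,\\ A_{x,y}A_{y,z}B_{x\circ y,z\ast y}=A_{x,z}B_{y\ast x,z\ast x}A_{x\circ z,y\circ z}+A_{x,z}A_{y\ast x,z\ast x}B_{x\circ z,y\circ z}\\ {}+\delta A_{x,z}B_{y\ast x,z\ast x}B_{x\circ z,y\circ z}+B_{x,z}B_{y\ast x,z\ast x}B_{x\circ z,y\circ z},\\ B_{x,z}A_{y\ast x,z\ast x}A_{x\circ z,y\circ z}=B_{x,y}A_{y,z}A_{x\circ y,z\ast y}+A_{x,y}B_{y,z}A_{x\circ y,z\ast y}\\ {}+\delta B_{x,y}B_{y,z}A_{x\circ y,z\ast y}+B_{x,y}B_{y,z}B_{x\circ y,z\ast y}. \end{gather*} Then the parity-biquandle bracket multiset $\Phi^{\beta,M}_{X,gr}$ is an invariant of oriented virtual links: if two oriented virtual link diagrams $L_1$ and $L_2$ represent the same oriented virtual link, then $\Phi^{\beta,M}_{X,gr}(L_1)=\Phi^{\beta,M}_{X,gr}(L_2)$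 as multisets of elements of $R\mathfrak{G}_\delta$.
   Context: **Virtual links.** An oriented virtual link diagram is a generic immersion of a 4-valent graph (possibly with extra circle components without vertices) in the plane, with over/undercrossing structure at each vertex (classical crossing), each remaining intersection of edges marked as virtual, and edges oriented so that opposite edges at a crossing are oriented coherently. An oriented virtual link is an equivalence class of such diagrams modulo planar isotopy, all oriented classical Reidemeister moves $\Omega1,\Omega2,\Omega3$, and the detour move (an arc containing only virtual crossings may be replaced by any other such arc with the same endpoints). Equivalently, one may work with Gauss diagrams (with arrows and signs) modulo Reidemeister moves. Edges of the diagram are the edges of the underlying 4-valent graph (they run from classical crossing to classical crossing, ignoring virtual crossings); a crossing-free component counts as one edge. "Crossing" means classical crossing. $\mathrm{wr}(L)$ is the sum of the signs of the classical crossings. **Biquandle.** A biquandle is a set $X$ with binary operations $\circ,\ast$ such that: (R1) $x\circ x=x\ast x$ for all $x$; (R2) for every $y$ the maps $x\mapsto x\ast y$ and $x\mapsto x\circ y$ are bijections of $X$; (R3) the map $S(x,y)=(y\ast x,x\circ y)$ is a bijection of $X\times X$; (R4) for all $x,y,z$: $(x\circ z)\circ(y\circ z)=(x\circ y)\circ(z\ast y)$, $(y\circ z)\ast(x\circ z)=(y\ast x)\circ(z\ast x)$, $(z\ast x)\ast(y\ast x)=(z\ast y)\ast(x\circ y)$. **Colourings.** An $X$-colouring $f$ of an oriented diagram $L$ assigns an element of $X$ to each edge so that at each classical crossing there are $x,y\in X$ (the pair $(x,y)$ is called the label pair of the crossing) such that: - at a positive crossing: the incoming under-edge has colour $x$,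 the outgoing under-edge $x\circ y$, the incoming over-edge $y\ast x$, the outgoing over-edge $y$; - at a negative crossing: the incoming under-edge has colour $x\circ y$, the outgoing under-edge $x$, the incoming over-edge $y$, the outgoing over-edge $y\ast x$. The set of $X$-colourings is identified with $\mathrm{Hom}(\mathcal B(L),X)$, the biquandle homomorphisms to $X$ from the fundamental biquandle $\mathcal B(L)$ (generated by the edges of $L$ subject to these crossing relations and the biquandle axioms). **The module $R\mathfrak G_\delta$.** A framed 4-graph (4-valent graph with a cross structure) is a finite 4-valent graph (loops and multiple edges allowed), possibly with additional circle components without vertices, such that at each vertex the four half-edges are split into two pairs of opposite half-edges. $R\mathfrak G_\delta$ is the free $R$-module on isomorphism classes of (nonempty) framed 4-graphs, modulo the relations: 1. (second Reidemeister move) if $u\ne v$ are vertices joined by two edges $a,b$ whose half-edges are not opposite at $u$ and not opposite at $v$, and if at $u$ the half-edges opposite to $a,b$ are $p,q$ and at $v$ the half-edges opposite to $a,b$ are $r,s$, then the graph is identified with the one obtained by deleting $u,v,a,b$ and joining $p$ with $r$ and $q$ with $s$; 2. $G\sqcup\bigcirc=\delta G$, where $\bigcirc$ is a circle without vertices. **The bracket.** Let $L$ be an oriented virtual link diagram with $n$ classical crossings and $f$ an $X$-colouring. A state $s$ chooses at each classical crossing one of: the oriented smoothing (compatible with the orientation of both strands), the other (unoriented) smoothing, or leaving the crossing as a graphical vertex (forgetting over/under, keeping which half-edges are opposite). Each of the $3^n$ states yields a framed 4-graph $L_s$ (virtual crossings are disregarded). At a crossing with label pair $(x,y)$ the state contributes: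 for a positive crossing, $A_{x,y}$ (oriented smoothing), $B_{x,y}$ (unoriented smoothing), $C_{x,y}$ (vertex); for a negative crossing, $D_{x,y}$ (oriented smoothing), $E_{x,y}$ (unoriented smoothing), $F_{x,y}$ (vertex). Let $c_s(f)\in R$ be the product of these factors over all crossings. Then $$\beta(f)_{gr}=w^{-\mathrm{wr}(L)}\sum_s c_s(f)\,L_s\in R\mathfrak G_\delta,$$ and the parity-biquandle bracket multiset is $\Phi^{\beta,M}_{X,gr}(L)=\{\beta(f)_{gr}\mid f\in\mathrm{Hom}(\mathcal B(L),X)\}$ (with multiplicity). *)

theory Defs
  imports
    "HOL-Library.Poly_Mapping"
    "HOL-Library.Multiset"
    "HOL-Library.FuncSet"
    "HOL-Combinatorics.Transposition"
begin

section \<open>Biquandles\<close>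

definition biquandle ::
  "'x set \<Rightarrow> ('x \<Rightarrow> 'x \<Rightarrow> 'x) \<Rightarrow> ('x \<Rightarrow> 'x \<Rightarrow> 'x) \<Rightarrow> bool" where
  "biquandle X circ ast \<longleftrightarrow>
    (\<forall>x\<in>X. \<forall>y\<in>X. circ x y \<in> X \<and> ast x y \<in> X) \<and>
    (\<forall>x\<in>X. circ x x = ast x x) \<and>
    (\<forall>y\<in>X. bij_betw (\<lambda>x. ast x y) X X \<and> bij_betw (\<lambda>x. circ x y) X X) \<and>
    bij_betw (\<lambda>(x, y). (ast y x, circ x y)) (X \<times> X) (X \<times> X) \<and>
    (\<forall>x\<in>X. \<forall>y\<in>X. \<forall>z\<in>X.
      circ (circ x z) (circ y z) = circ (circ x y) (ast z y) \<and>
      ast (circ y z) (circ x z) = circ (ast y x) (ast z x) \<and>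
      ast (ast z x) (ast y x) = ast (ast z y) (circ x y))"


section \<open>Framed 4-graphs\<close>

text \<open>The four half-edges at a vertex \<open>v\<close> are \<open>(v, s, p)\<close>; the half-edges \<open>(v, s, In)\<close> and
  \<open>(v, s, Out)\<close> are opposite.  In a framed 4-graph the names \<open>Over\<close>, \<open>Under\<close>, \<open>In\<close>, \<open>Out\<close> serve
  only to list the two pairs of opposite half-edges, and isomorphisms need not respect them.
  In a link diagram they carry the crossing structure and the orientation.
  Every finite framed 4-graph is isomorphic to one of this shape, with natural numbers as
  vertices.\<close>

datatype strand = Over | Under
datatype port = In | Out

type_synonym half_edge = "nat \<times> strand \<times> port"

fun other_strand :: "strand \<Rightarrow> strand" where
  "other_strand Over = Under"
| "other_strand Under = Over"

fun other_port :: "port \<Rightarrow> port" where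
  "other_port In = Out"
| "other_port Out = In"

fun opposite :: "half_edge \<Rightarrow> half_edge" where
  "opposite (v, s, p) = (v, s, other_port p)"

text \<open>The edges are the sets \<open>{h, mate h}\<close>; the circle components without vertices are only
  counted.  Values of \<open>mate\<close> outside the half-edges of the graph are irrelevant.\<close>

record fgraph =
  verts :: "nat set"
  mate :: "half_edge \<Rightarrow> half_edge"
  circles :: nat

abbreviation halves_at :: "nat set \<Rightarrow> half_edge set" where
  "halves_at V \<equiv> V \<times> UNIV"

abbreviation halves :: "('m) fgraph_scheme \<Rightarrow> half_edge set" where
  "halves G \<equiv> halves_at (verts G)"

definition framed_graph :: "('m) fgraph_scheme \<Rightarrow> bool" where
  "framed_graph G \<longleftrightarrow>
    finite (verts G) \<and>
    (verts G \<noteq> {} \<or> circles G > 0) \<and>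
    (\<forall>h\<in>halves G. mate G h \<in> halves G \<and> mate G h \<noteq> h \<and> mate G (mate G h) = h)"

definition framed_iso :: "fgraph \<Rightarrow> fgraph \<Rightarrow> bool" where
  "framed_iso G H \<longleftrightarrow>
    circles G = circles H \<and>
    (\<exists>\<phi>. bij_betw \<phi> (halves G) (halves H) \<and>
      (\<forall>h\<in>halves G. \<forall>h'\<in>halves G. fst (\<phi> h) = fst (\<phi> h') \<longleftrightarrow> fst h = fst h') \<and>
      (\<forall>h\<in>halves G. \<phi> (opposite h) = opposite (\<phi> h)) \<and>
      (\<forall>h\<in>halves G. \<phi> (mate G h) = mate H (\<phi> h)))"

definition iso_class :: "fgraph \<Rightarrow> fgraph set" where
  "iso_class G = {H. framed_graph H \<and> framed_iso G H}"

text \<open>\<open>splice S j G\<close> removes the vertices in \<open>S\<close> and glues each half-edge \<open>h\<close> at these vertices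
  to the half-edge \<open>j h\<close>, where \<open>j\<close> is a fixed-point free involution of these half-edges.
  Following edges of \<open>G\<close> and gluings alternately decomposes the half-edges of \<open>G\<close> into paths,
  whose two ends are half-edges at the remaining vertices and become mates, and cycles, which
  become new circle components.\<close>

definition splice_rel ::
  "nat set \<Rightarrow> (half_edge \<Rightarrow> half_edge) \<Rightarrow> ('m) fgraph_scheme \<Rightarrow> (half_edge \<times> half_edge) set" where
  "splice_rel S j G =
    ({(h, mate G h) | h. h \<in> halves G} \<union> {(h, j h) | h. h \<in> halves_at S})\<^sup>*"

definition splice ::
  "nat set \<Rightarrow> (half_edge \<Rightarrow> half_edge) \<Rightarrow> ('m) fgraph_scheme \<Rightarrow> ('m) fgraph_scheme" where
  "splice S j G = G
    \<lparr> verts := verts G - S,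
      mate := (\<lambda>h. THE h'. h' \<in> halves_at (verts G - S) \<and> h' \<noteq> h \<and> (h, h') \<in> splice_rel S j G),
      circles := circles G + card {c \<in> halves G // splice_rel S j G. c \<subseteq> halves_at S} \<rparr>"

definition bigon :: "fgraph \<Rightarrow> nat \<Rightarrow> nat \<Rightarrow> bool" where
  "bigon G u v \<longleftrightarrow>
    u \<in> verts G \<and> v \<in> verts G \<and> u \<noteq> v \<and>
    (\<exists>a b. fst a = u \<and> fst b = u \<and> a \<noteq> b \<and> b \<noteq> opposite a \<and>
      fst (mate G a) = v \<and> fst (mate G b) = v \<and> mate G b \<noteq> opposite (mate G a))"


section \<open>The module of framed 4-graphs\<close>

text \<open>The scalars have sort \<open>{comm_ring, comm_monoid_mult}\<close>, that is, they form a commutative ring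
  with unity.  The class \<open>comm_ring_1\<close> would exclude the zero ring.

  The free module on isomorphism classes of framed 4-graphs consists of finitely supported
  functions on these classes, and \<open>graph_relations \<delta>\<close> is the submodule spanned by the relations.
  Gluing opposite half-edges at both vertices of a bigon with edges \<open>a\<close>, \<open>b\<close> joins \<open>p\<close> to \<open>r\<close>
  along \<open>a\<close> and \<open>q\<close> to \<open>s\<close> along \<open>b\<close>, where \<open>p\<close>, \<open>q\<close> and \<open>r\<close>, \<open>s\<close> are the half-edges opposite to
  the ends of \<open>a\<close>, \<open>b\<close>; this is the second Reidemeister move.\<close>

definition scale :: "'r::{comm_ring,comm_monoid_mult} \<Rightarrow> ('k \<Rightarrow>\<^sub>0 'r) \<Rightarrow> ('k \<Rightarrow>\<^sub>0 'r)" where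
  "scale c p = Poly_Mapping.map ((*) c) p"

definition graph_elt :: "fgraph \<Rightarrow> (fgraph set \<Rightarrow>\<^sub>0 'r::{comm_ring,comm_monoid_mult})" where
  "graph_elt G = Poly_Mapping.single (iso_class G) 1"

inductive_set graph_relations ::
  "'r::{comm_ring,comm_monoid_mult} \<Rightarrow> (fgraph set \<Rightarrow>\<^sub>0 'r) set" for \<delta> :: 'r where
  bigon: "framed_graph G \<Longrightarrow> bigon G u v \<Longrightarrow>
    graph_elt G - graph_elt (splice {u, v} opposite G) \<in> graph_relations \<delta>"
| circle: "framed_graph G \<Longrightarrow>
    graph_elt (G\<lparr>circles := Suc (circles G)\<rparr>) - scale \<delta> (graph_elt G) \<in> graph_relations \<delta>"
| zero: "0 \<in> graph_relations \<delta>"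
| add: "p \<in> graph_relations \<delta> \<Longrightarrow> q \<in> graph_relations \<delta> \<Longrightarrow> p + q \<in> graph_relations \<delta>"
| scale: "p \<in> graph_relations \<delta> \<Longrightarrow> scale c p \<in> graph_relations \<delta>"

text \<open>Elements of the quotient module are cosets of \<open>graph_relations \<delta>\<close>.\<close>

definition graph_coset ::
  "'r::{comm_ring,comm_monoid_mult} \<Rightarrow> (fgraph set \<Rightarrow>\<^sub>0 'r) \<Rightarrow> (fgraph set \<Rightarrow>\<^sub>0 'r) set" where
  "graph_coset \<delta> p = {q. q - p \<in> graph_relations \<delta>}"


section \<open>Oriented virtual links\<close>

text \<open>Oriented virtual link diagrams are encoded as Gauss diagrams: the vertices are the classical
  crossings, and virtual crossings are disregarded.  The edge leaving a crossing \<open>c\<close> along a strand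
  \<open>s\<close> enters the crossing \<open>d\<close> along \<open>t\<close> if \<open>mate L (c, s, Out) = (d, t, In)\<close>.  In the usual picture
  of a Gauss diagram the points on the core circles are the pairs \<open>(c, s)\<close>, in the cyclic order
  given by these edges, and the arrow of \<open>c\<close> leads from \<open>(c, Over)\<close> to \<open>(c, Under)\<close>.\<close>

record diagram = fgraph +
  positive :: "nat \<Rightarrow> bool"

definition link_diagram :: "diagram \<Rightarrow> bool" where
  "link_diagram L \<longleftrightarrow>
    framed_graph L \<and> (\<forall>h\<in>halves L. snd (snd (mate L h)) \<noteq> snd (snd h))"

definition crossing_sign :: "diagram \<Rightarrow> nat \<Rightarrow> int" where
  "crossing_sign L c = (if positive L c then 1 else -1)"

definition writhe :: "diagram \<Rightarrow> int" where
  "writhe L = (\<Sum>c\<in>verts L. crossing_sign L c)"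

definition diagram_iso :: "diagram \<Rightarrow> diagram \<Rightarrow> bool" where
  "diagram_iso L L' \<longleftrightarrow>
    circles L = circles L' \<and>
    (\<exists>\<phi>. bij_betw \<phi> (verts L) (verts L') \<and>
      (\<forall>c\<in>verts L. positive L' (\<phi> c) = positive L c) \<and>
      (\<forall>h\<in>halves L. mate L' (map_prod \<phi> id h) = map_prod \<phi> id (mate L h)))"

definition arc :: "diagram \<Rightarrow> nat \<times> strand \<Rightarrow> nat \<times> strand \<Rightarrow> bool" where
  "arc L x y \<longleftrightarrow> mate L (fst x, snd x, Out) = (fst y, snd y, In)"

text \<open>Gluing opposite half-edges at a crossing deletes its arrow from the Gauss diagram.
  The moves below are stated in the direction that deletes crossings; the inverse moves are
  obtained by taking the generated equivalence relation.\<close>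

definition omega1 :: "diagram \<Rightarrow> diagram \<Rightarrow> bool" where
  "omega1 L L' \<longleftrightarrow>
    (\<exists>c\<in>verts L. \<exists>s. arc L (c, s) (c, other_strand s) \<and> L' = splice {c} opposite L)"

definition omega2 :: "diagram \<Rightarrow> diagram \<Rightarrow> bool" where
  "omega2 L L' \<longleftrightarrow>
    (\<exists>c\<in>verts L. \<exists>d\<in>verts L. c \<noteq> d \<and> positive L c \<noteq> positive L d \<and>
      (\<forall>s. arc L (c, s) (d, s) \<or> arc L (d, s) (c, s)) \<and>
      L' = splice {c, d} opposite L)"

text \<open>In the third move the crossings of the triangle are \<open>a\<close> (top over middle), \<open>b\<close> (top over
  bottom) and \<open>c\<close> (middle over bottom).  Let \<open>t\<close>, \<open>m\<close>, \<open>u\<close> be the directions in the plane of the top, middle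
  and bottom strands, so that the signs of \<open>a\<close>, \<open>b\<close>, \<open>c\<close> are those of \<open>det(t, m)\<close>, \<open>det(t, u)\<close>,
  \<open>det(m, u)\<close>, and let \<open>\<eta>\<close> be the sign of \<open>det(q, t)\<close>, where \<open>q\<close> leads from the crossing \<open>c\<close> to the
  top strand.  Elementary geometry gives the order in which each strand meets its two
  crossings, as stated below.  All eight combinations of signs occur; they are the
  eight oriented third moves, and \<open>\<eta>\<close> tells the two sides of the move apart.  The move exchanges
  the two crossings along each of the three strands and keeps all signs.\<close>

definition ordered_arc :: "diagram \<Rightarrow> int \<Rightarrow> nat \<times> strand \<Rightarrow> nat \<times> strand \<Rightarrow> bool" where
  "ordered_arc L k x y \<longleftrightarrow> (if k = 1 then arc L x y else arc L y x)"

definition exchange :: "nat \<Rightarrow> nat \<Rightarrow> nat \<Rightarrow> nat \<times> strand \<Rightarrow> nat \<times> strand" where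
  "exchange a b c =
    transpose (a, Over) (b, Over) \<circ> transpose (a, Under) (c, Over) \<circ> transpose (b, Under) (c, Under)"

definition exchange_half :: "nat \<Rightarrow> nat \<Rightarrow> nat \<Rightarrow> half_edge \<Rightarrow> half_edge" where
  "exchange_half a b c h =
    (case h of (v, s, p) \<Rightarrow> (case exchange a b c (v, s) of (v', s') \<Rightarrow> (v', s', p)))"

definition omega3 :: "diagram \<Rightarrow> diagram \<Rightarrow> bool" where
  "omega3 L L' \<longleftrightarrow>
    (\<exists>a\<in>verts L. \<exists>b\<in>verts L. \<exists>c\<in>verts L. \<exists>\<eta>\<in>{1, -1}.
      a \<noteq> b \<and> a \<noteq> c \<and> b \<noteq> c \<and>
      ordered_arc L (\<eta> * crossing_sign L a * crossing_sign L b * crossing_sign L c)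
        (a, Over) (b, Over) \<and>
      ordered_arc L (\<eta> * crossing_sign L a) (a, Under) (c, Over) \<and>
      ordered_arc L (\<eta> * crossing_sign L b) (b, Under) (c, Under) \<and>
      L' = L\<lparr>mate := exchange_half a b c \<circ> mate L \<circ> exchange_half a b c\<rparr>)"

definition diagram_step :: "diagram \<Rightarrow> diagram \<Rightarrow> bool" where
  "diagram_step L L' \<longleftrightarrow> link_diagram L \<and> link_diagram L' \<and>
    (diagram_iso L L' \<or> omega1 L L' \<or> omega2 L L' \<or> omega3 L L')"

definition same_virtual_link :: "diagram \<Rightarrow> diagram \<Rightarrow> bool" where
  "same_virtual_link = equivclp diagram_step"


section \<open>Colourings\<close>

text \<open>The edges of a diagram are the edges of the 4-valent graph and the crossing-free
  components.\<close>

type_synonym edge = "half_edge set + nat"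

definition edge_at :: "diagram \<Rightarrow> half_edge \<Rightarrow> edge" where
  "edge_at L h = Inl {h, mate L h}"

definition edges :: "diagram \<Rightarrow> edge set" where
  "edges L = edge_at L ` halves L \<union> Inr ` {..<circles L}"

definition is_label_pair ::
  "('x \<Rightarrow> 'x \<Rightarrow> 'x) \<Rightarrow> ('x \<Rightarrow> 'x \<Rightarrow> 'x) \<Rightarrow> diagram \<Rightarrow> (edge \<Rightarrow> 'x) \<Rightarrow> nat \<Rightarrow> 'x \<times> 'x \<Rightarrow> bool" where
  "is_label_pair circ ast L f c = (\<lambda>(x, y).
    if positive L c
    then f (edge_at L (c, Under, In)) = x \<and> f (edge_at L (c, Under, Out)) = circ x y \<and>
         f (edge_at L (c, Over, In)) = ast y x \<and> f (edge_at L (c, Over, Out)) = y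
    else f (edge_at L (c, Under, In)) = circ x y \<and> f (edge_at L (c, Under, Out)) = x \<and>
         f (edge_at L (c, Over, In)) = y \<and> f (edge_at L (c, Over, Out)) = ast y x)"

definition colourings ::
  "'x set \<Rightarrow> ('x \<Rightarrow> 'x \<Rightarrow> 'x) \<Rightarrow> ('x \<Rightarrow> 'x \<Rightarrow> 'x) \<Rightarrow> diagram \<Rightarrow> (edge \<Rightarrow> 'x) set" where
  "colourings X circ ast L =
    {f \<in> edges L \<rightarrow>\<^sub>E X. \<forall>c\<in>verts L. \<exists>x\<in>X. \<exists>y\<in>X. is_label_pair circ ast L f c (x, y)}"

definition label_pair ::
  "('x \<Rightarrow> 'x \<Rightarrow> 'x) \<Rightarrow> ('x \<Rightarrow> 'x \<Rightarrow> 'x) \<Rightarrow> diagram \<Rightarrow> (edge \<Rightarrow> 'x) \<Rightarrow> nat \<Rightarrow> 'x \<times> 'x" where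
  "label_pair circ ast L f c = (THE p. is_label_pair circ ast L f c p)"


section \<open>The parity-biquandle bracket\<close>

datatype resolution = Oriented | Unoriented | Vertex

definition states :: "diagram \<Rightarrow> (nat \<Rightarrow> resolution) set" where
  "states L = verts L \<rightarrow>\<^sub>E UNIV"

text \<open>The oriented smoothing glues each incoming half-edge to the outgoing half-edge of the other
  strand; the unoriented smoothing glues the two incoming half-edges and the two outgoing ones.\<close>

definition smoothing :: "(nat \<Rightarrow> resolution) \<Rightarrow> half_edge \<Rightarrow> half_edge" where
  "smoothing st h = (case h of (c, s, p) \<Rightarrow>
    (c, other_strand s, if st c = Oriented then other_port p else p))"

definition state_graph :: "diagram \<Rightarrow> (nat \<Rightarrow> resolution) \<Rightarrow> fgraph" where
  "state_graph L st =
    splice {c \<in> verts L. st c \<noteq> Vertex} (smoothing st) (fgraph.truncate L)"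

text \<open>A coefficient system \<open>\<beta> = (A, B, C, D, E, F)\<close> as a function of the sign of the crossing,
  the local state and the label pair.\<close>

definition coefficients ::
  "('x \<Rightarrow> 'x \<Rightarrow> 'r) \<Rightarrow> ('x \<Rightarrow> 'x \<Rightarrow> 'r) \<Rightarrow> ('x \<Rightarrow> 'x \<Rightarrow> 'r) \<Rightarrow>
   ('x \<Rightarrow> 'x \<Rightarrow> 'r) \<Rightarrow> ('x \<Rightarrow> 'x \<Rightarrow> 'r) \<Rightarrow> ('x \<Rightarrow> 'x \<Rightarrow> 'r) \<Rightarrow>
   bool \<Rightarrow> resolution \<Rightarrow> 'x \<times> 'x \<Rightarrow> 'r" where
  "coefficients A B C D E F pos r = (\<lambda>(x, y).
    case r of
      Oriented \<Rightarrow> if pos then A x y else D x y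
    | Unoriented \<Rightarrow> if pos then B x y else E x y
    | Vertex \<Rightarrow> if pos then C x y else F x y)"

definition unit_inv :: "'r::comm_monoid_mult \<Rightarrow> 'r" where
  "unit_inv w = (THE v. w * v = 1)"

definition unit_power :: "'r::comm_monoid_mult \<Rightarrow> int \<Rightarrow> 'r" where
  "unit_power w n = (if n \<ge> 0 then w ^ nat n else unit_inv w ^ nat (- n))"

definition bracket ::
  "('x \<Rightarrow> 'x \<Rightarrow> 'x) \<Rightarrow> ('x \<Rightarrow> 'x \<Rightarrow> 'x) \<Rightarrow>
   (bool \<Rightarrow> resolution \<Rightarrow> 'x \<times> 'x \<Rightarrow> 'r) \<Rightarrow> 'r \<Rightarrow> 'r::{comm_ring,comm_monoid_mult} \<Rightarrow>
   diagram \<Rightarrow> (edge \<Rightarrow> 'x) \<Rightarrow> (fgraph set \<Rightarrow>\<^sub>0 'r) set" where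
  "bracket circ ast \<beta> \<delta> w L f =
    graph_coset \<delta>
      (scale (unit_power w (- writhe L))
        (\<Sum>st\<in>states L.
          scale (\<Prod>c\<in>verts L. \<beta> (positive L c) (st c) (label_pair circ ast L f c))
            (graph_elt (state_graph L st))))"

definition bracket_multiset ::
  "'x set \<Rightarrow> ('x \<Rightarrow> 'x \<Rightarrow> 'x) \<Rightarrow> ('x \<Rightarrow> 'x \<Rightarrow> 'x) \<Rightarrow>
   (bool \<Rightarrow> resolution \<Rightarrow> 'x \<times> 'x \<Rightarrow> 'r) \<Rightarrow> 'r \<Rightarrow> 'r::{comm_ring,comm_monoid_mult} \<Rightarrow>
   diagram \<Rightarrow> (fgraph set \<Rightarrow>\<^sub>0 'r) set multiset" where
  "bracket_multiset X circ ast \<beta> \<delta> w L =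
    image_mset (bracket circ ast \<beta> \<delta> w L) (mset_set (colourings X circ ast L))"

end

theory Submission
  imports Defs
begin

text \<open>Colourings are described on half-edges, so that a move replaces a local part of the diagram and
  changes colourings only inside that part.  Two resolutions of local parts give the same graph up to
  circles as soon as they join the ends in the same way, up to renaming the graphical vertices;
  for the first and second moves and for the third move with three positive crossings this is a
  finite computation, which collects the states into groups whose coefficients agree by (i), (ii)
  and (iii).  Third moves with negative crossings are reduced to it: second moves create a pair of
  crossings beside the triangle, one of which replaces a negative crossing of the triangle by a
  positive one.\<close>

section \<open>Linear combinations of graphs modulo the relations\<close>

text \<open>Relations (iii) speak only of a triangle with three positive crossings; the reduction by
  second moves avoids deriving a separate list of identities for every other sign pattern.
  Colourings are hard to compare edge by edge, because deleting a crossing merges edges and may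
  close them up into circles. On the half-edges of the larger diagram all functions have one domain,
  and deletion becomes the condition that opposite half-edges have equal colours. The biquandle
  axioms make the inner colours a function of the outer ones; for a kink this rests on the
  finiteness of \<open>X\<close>. The graph around a local part is arbitrary: ends may be joined to
  one another outside, and a circle may leave the local part several times. Circles are therefore
  counted as components of a relation, split into those closed up inside, which are computed, and
  those that run through the ends, whose number depends only on how the ends are connected. The
  bigon relation does not fit this scheme, since in a triangle the second edge of a bigon may run
  through the smoothed third crossing; it is applied by hand and yields states with crossings passed
  straight through.\<close>

lemma lookup_scale [simp]: "Poly_Mapping.lookup (scale c p) k = c * Poly_Mapping.lookup p k"
  unfolding scale_def by (transfer) (simp add: when_def)

lemma scale_add_right: "scale c (p + q) = scale c p + scale c q"
  by (rule poly_mapping_eqI) (simp add: lookup_add algebra_simps)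

lemma scale_minus_right: "scale c (p - q) = scale c p - scale c q"
  by (rule poly_mapping_eqI) (simp add: lookup_minus algebra_simps)

lemma scale_add_left: "scale (c + d) p = scale c p + scale d p"
  by (rule poly_mapping_eqI) (simp add: lookup_add algebra_simps)

lemma scale_scale [simp]: "scale c (scale d p) = scale (c * d) p"
  by (rule poly_mapping_eqI) (simp add: algebra_simps)

lemma scale_one [simp]: "scale 1 p = p"
  by (rule poly_mapping_eqI) simp

lemma scale_zero_left [simp]: "scale 0 p = 0"
  by (rule poly_mapping_eqI) simp

lemma scale_zero_right [simp]: "scale c 0 = 0"
  by (rule poly_mapping_eqI) simp

lemma scale_minus_one: "scale (- 1) p = - p"
  by (rule poly_mapping_eqI) simp

lemma scale_sum: "scale c (\<Sum>i\<in>I. p i) = (\<Sum>i\<in>I. scale c (p i))"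
  by (induction I rule: infinite_finite_induct) (simp_all add: scale_add_right)

text \<open>Formal sums are rewritten termwise under this congruence; cosets return only through
  \<open>graph_coset_eqI\<close>.\<close>

definition eqv ::
  "'r::{comm_ring,comm_monoid_mult} \<Rightarrow> (fgraph set \<Rightarrow>\<^sub>0 'r) \<Rightarrow> (fgraph set \<Rightarrow>\<^sub>0 'r) \<Rightarrow> bool" where
  "eqv \<delta> p q \<longleftrightarrow> p - q \<in> graph_relations \<delta>"

lemma eqv_refl [simp, intro]: "eqv \<delta> p p"
  by (simp add: eqv_def graph_relations.zero)

lemma eqv_sym: "eqv \<delta> p q \<Longrightarrow> eqv \<delta> q p"
  using graph_relations.scale[of "p - q" \<delta> "- 1"] by (simp add: eqv_def scale_minus_one)

lemma eqv_trans [trans]: "eqv \<delta> p q \<Longrightarrow> eqv \<delta> q r \<Longrightarrow> eqv \<delta> p r"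
  using graph_relations.add[of "p - q" \<delta> "q - r"] by (simp add: eqv_def)

lemma eqv_add: "eqv \<delta> p q \<Longrightarrow> eqv \<delta> p' q' \<Longrightarrow> eqv \<delta> (p + p') (q + q')"
  using graph_relations.add[of "p - q" \<delta> "p' - q'"] by (simp add: eqv_def algebra_simps)

lemma eqv_scale: "eqv \<delta> p q \<Longrightarrow> eqv \<delta> (scale c p) (scale c q)"
  using graph_relations.scale[of "p - q" \<delta> c] by (simp add: eqv_def scale_minus_right)

lemma eqv_sum: "(\<And>i. i \<in> I \<Longrightarrow> eqv \<delta> (p i) (q i)) \<Longrightarrow> eqv \<delta> (\<Sum>i\<in>I. p i) (\<Sum>i\<in>I. q i)"
  by (induction I rule: infinite_finite_induct) (simp_all add: eqv_add)

lemma graph_coset_eqI: "eqv \<delta> p q \<Longrightarrow> graph_coset \<delta> p = graph_coset \<delta> q"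
proof -
  assume a: "eqv \<delta> p q"
  have "eqv \<delta> r p \<longleftrightarrow> eqv \<delta> r q" for r
    using a eqv_sym eqv_trans by blast
  then show ?thesis by (simp add: graph_coset_def eqv_def)
qed

lemma eqv_circle:
  "framed_graph G \<Longrightarrow>
    eqv \<delta> (graph_elt (G\<lparr>circles := Suc (circles G)\<rparr>)) (scale \<delta> (graph_elt G))"
  by (simp add: eqv_def graph_relations.circle)

lemma eqv_bigon:
  "framed_graph G \<Longrightarrow> bigon G u v \<Longrightarrow>
    eqv \<delta> (graph_elt G) (graph_elt (splice {u, v} opposite G))"
  by (simp add: eqv_def graph_relations.bigon)

section \<open>Inverse and integer powers of the unit \<open>w\<close>\<close>

lemma unit_inv_right:
  fixes w :: "'r::comm_monoid_mult"
  assumes "w dvd 1"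
  shows "w * unit_inv w = 1"
proof -
  obtain v where v: "w * v = 1" using assms by (metis dvdE)
  have "u = v" if "w * u = 1" for u
    by (metis v that mult.assoc mult.commute mult_1)
  then show ?thesis unfolding unit_inv_def using v by (metis (mono_tags, lifting) theI')
qed

text \<open>A kink changes the writhe by one. This lemma and the next absorb the factor
  \<open>w\<close> or \<open>unit_inv w\<close> of a kink into the normalisation.\<close>

lemma unit_power_add_one:
  fixes w :: "'r::comm_monoid_mult"
  assumes "w dvd 1"
  shows "unit_power w (n + 1) = unit_power w n * w"
proof (cases "n \<ge> 0")
  case True
  then show ?thesis by (simp add: unit_power_def nat_add_distrib mult.commute)
next
  case False
  then obtain m where m: "n = - int (Suc m)"
    by (metis int_cases of_nat_0_le_iff)
  have "unit_inv w ^ m = unit_inv w ^ m * unit_inv w * w"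
    using unit_inv_right[OF assms] by (simp add: mult.assoc mult.commute[of w])
  \<comment> \<open>Here n + 1 = -m, which belongs to the nonnegative branch of
    \<open>unit_power\<close> exactly when m = 0.\<close>
  then show ?thesis
    by (cases "m = 0") (simp_all add: m unit_power_def mult.commute nat_add_distrib)
qed

lemma unit_power_minus_one:
  fixes w :: "'r::comm_monoid_mult"
  assumes "w dvd 1"
  shows "unit_power w (n - 1) = unit_power w n * unit_inv w"
  using unit_power_add_one[OF assms, of "n - 1"] unit_inv_right[OF assms]
  by (simp add: mult.assoc)

section \<open>Equivalence relations generated by gluings\<close>

text \<open>One new symmetric pair merges at most two classes, so a path needs to cross it at most
  once. This is the induction step both for the existence of mates after splicing and for the
  computed labels.\<close>

lemma rtrancl_Un_pair_iff:
  fixes R :: "('a \<times> 'a) set"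
  assumes "sym R"
  shows "(x, y) \<in> (R \<union> {(p, q), (q, p)})\<^sup>* \<longleftrightarrow>
    (x, y) \<in> R\<^sup>* \<or> (x, p) \<in> R\<^sup>* \<and> (q, y) \<in> R\<^sup>* \<or> (x, q) \<in> R\<^sup>* \<and> (p, y) \<in> R\<^sup>*" (is "?l \<longleftrightarrow> ?r x y")
proof
  have s: "sym (R\<^sup>*)" using assms by (rule sym_rtrancl)
  have t: "(a, c) \<in> R\<^sup>*" if "(a, b) \<in> R\<^sup>*" "(b, c) \<in> R\<^sup>*" for a b c
    using that by (rule rtrancl_trans)
  show "?r x y" if ?l
    using that
  proof (induction rule: rtrancl_induct)
    case base
    then show ?case by simp
  next
    case (step y z)
    show ?case
    proof (cases "(y, z) \<in> R")
      case True
      then show ?thesis using step.IH by (meson rtrancl.rtrancl_into_rtrancl)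
    next
      case False
      then consider "y = p" "z = q" | "y = q" "z = p" using step.hyps by auto
      then show ?thesis
        by cases (use step.IH in \<open>auto intro: t\<close>)
    qed
  qed
next
  let ?E = "(R \<union> {(p, q), (q, p)})\<^sup>*"
  have "R\<^sup>* \<subseteq> ?E" by (rule rtrancl_mono) auto
  moreover have "(p, q) \<in> ?E" "(q, p) \<in> ?E" by auto
  ultimately show "?r x y \<Longrightarrow> ?l" by (meson rtrancl_trans subsetD)
qed

lemma rtrancl_subset_Times:
  assumes "R \<subseteq> P \<times> P" "(x, y) \<in> R\<^sup>*" "x \<in> P"
  shows "y \<in> P"
  using assms(2,3) by (induction) (use assms(1) in auto)

text \<open>Steps of \<open>A\<close> stay in \<open>N\<close>, so every excursion of a path out of
  \<open>N\<close> is made of \<open>B\<close> steps alone and can be contracted to a single step of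
  \<open>B\<^sup>*\<close> between points of \<open>N\<close>.\<close>

lemma rtrancl_Un_restrict_iff:
  assumes "A \<subseteq> N \<times> N" "x \<in> N" "y \<in> N"
  shows "(x, y) \<in> (A \<union> B)\<^sup>* \<longleftrightarrow> (x, y) \<in> (A \<union> (B\<^sup>* \<inter> N \<times> N))\<^sup>*" (is "_ \<longleftrightarrow> _ \<in> ?E'")
proof
  assume "(x, y) \<in> (A \<union> B)\<^sup>*"
  \<comment> \<open>Here z is a point of \<open>N\<close> on the path after which only
    \<open>B\<close> steps have been made.\<close>
  then have "\<exists>z\<in>N. (x, z) \<in> ?E' \<and> (z, y) \<in> B\<^sup>*"
  proof (induction rule: rtrancl_induct)
    case base
    then show ?case using assms(2) by blast
  next
    case (step y y')
    then obtain z where z: "z \<in> N" "(x, z) \<in> ?E'" "(z, y) \<in> B\<^sup>*" by blast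
    show ?case
    proof (cases "(y, y') \<in> A")
      case True
      then have "y \<in> N" "y' \<in> N" using assms(1) by auto
      then have "(z, y) \<in> A \<union> (B\<^sup>* \<inter> N \<times> N)" using z by blast
      with True z have "(x, y') \<in> ?E'" by (meson UnI1 rtrancl.rtrancl_into_rtrancl)
      then show ?thesis using \<open>y' \<in> N\<close> by blast
    next
      case False
      then have "(y, y') \<in> B" using step.hyps by blast
      then show ?thesis using z by (meson rtrancl.rtrancl_into_rtrancl)
    qed
  qed
  then obtain z where z: "z \<in> N" "(x, z) \<in> ?E'" "(z, y) \<in> B\<^sup>*" by blast
  then have "(z, y) \<in> A \<union> (B\<^sup>* \<inter> N \<times> N)" using assms(3) by blast
  with z(2) show "(x, y) \<in> ?E'" by (rule rtrancl.rtrancl_into_rtrancl)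
next
  assume "(x, y) \<in> ?E'"
  moreover have "?E' \<subseteq> ((A \<union> B)\<^sup>*)\<^sup>*"
    by (intro rtrancl_mono Un_least) (auto intro: rtrancl_mono[THEN subsetD, of B "A \<union> B"])
  ultimately show "(x, y) \<in> (A \<union> B)\<^sup>*" by auto
qed

text \<open>The components inside \<open>W\<close> that survive the removal of the interior points correspond to
  components of the contracted relation; the others never leave the interior.\<close>

lemma card_components_contract:
  assumes "sym A" "sym B" "A \<subseteq> N \<times> N" "B \<subseteq> P \<times> P" "N \<subseteq> P" "finite P" "P - N \<subseteq> W"
  shows "card {c \<in> P // (A \<union> B)\<^sup>*. c \<subseteq> W} =
    card {c \<in> N // (A \<union> (B\<^sup>* \<inter> N \<times> N))\<^sup>*. c \<subseteq> W} + card {c \<in> P // B\<^sup>*. c \<subseteq> P - N}"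
proof -
  let ?E = "(A \<union> B)\<^sup>*" and ?E' = "(A \<union> (B\<^sup>* \<inter> N \<times> N))\<^sup>*"
  let ?X = "{c \<in> P // ?E. c \<subseteq> W \<and> c \<inter> N \<noteq> {}}" and ?Y = "{c \<in> P // B\<^sup>*. c \<subseteq> P - N}"
  have sE: "sym ?E" using assms(1,2) by (intro sym_rtrancl sym_Un)
  have tE: "trans ?E" by (rule trans_rtrancl)
  have PE: "y \<in> P" if "(x, y) \<in> ?E" "x \<in> P" for x y
    using rtrancl_subset_Times[of "A \<union> B" P x y] that assms(3-5) by blast
  have NE': "y \<in> N" if "(x, y) \<in> ?E'" "x \<in> N" for x y
    using rtrancl_subset_Times[of "A \<union> (B\<^sup>* \<inter> N \<times> N)" N x y] that assms(3) by blast
  have BE: "B\<^sup>* \<subseteq> ?E" by (rule rtrancl_mono) auto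
  have class_eq: "?E `` {x} = ?E `` {y}" if "(x, y) \<in> ?E" for x y
    using that sE tE by (auto dest: symD transD)
  \<comment> \<open>A \<open>B\<close>-class that avoids \<open>N\<close> offers no point at which a
    step of \<open>A\<close> could start, so it is already a full class.\<close>
  have interior: "?E `` {x} = B\<^sup>* `` {x}" if "B\<^sup>* `` {x} \<subseteq> P - N" for x
  proof -
    have "(x, y) \<in> B\<^sup>*" if "(x, y) \<in> ?E" for y
      using that
    proof (induction rule: rtrancl_induct)
      case (step y z)
      then have "y \<notin> N" using \<open>B\<^sup>* `` {x} \<subseteq> P - N\<close> by auto
      then have "(y, z) \<in> B" using step.hyps assms(3) by auto
      with step.IH show ?case by (rule rtrancl.rtrancl_into_rtrancl)
    qed simp
    then show ?thesis using BE by blast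
  qed
  have Y: "{c \<in> P // ?E. c \<subseteq> W \<and> c \<inter> N = {}} = ?Y"
  proof (intro equalityI subsetI)
    fix c assume "c \<in> {c \<in> P // ?E. c \<subseteq> W \<and> c \<inter> N = {}}"
    then obtain x where x: "x \<in> P" "c = ?E `` {x}" "c \<inter> N = {}" by (auto elim: quotientE)
    then have "c \<subseteq> P - N" using PE by auto
    moreover have "B\<^sup>* `` {x} \<subseteq> c" using x BE by auto
    ultimately have "c = B\<^sup>* `` {x}" using interior[of x] x by blast
    then show "c \<in> ?Y" using x \<open>c \<subseteq> P - N\<close> by (auto intro: quotientI)
  next
    fix c assume "c \<in> ?Y"
    then obtain x where x: "x \<in> P" "c = B\<^sup>* `` {x}" "c \<subseteq> P - N" by (auto elim: quotientE)
    then have "c = ?E `` {x}" using interior by simp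
    then show "c \<in> {c \<in> P // ?E. c \<subseteq> W \<and> c \<inter> N = {}}"
      using x assms(7) by (auto intro: quotientI)
  qed
  have restrict: "?E `` {x} \<inter> N = ?E' `` {x}" if "x \<in> N" for x
    using rtrancl_Un_restrict_iff[OF assms(3) that] NE' that by blast
  \<comment> \<open>A class that meets \<open>N\<close> is recovered from its trace on
    \<open>N\<close>, and by \<open>restrict\<close> these traces are the classes of the contracted
    relation.\<close>
  have X: "bij_betw (\<lambda>c. c \<inter> N) ?X {c \<in> N // ?E'. c \<subseteq> W}"
  proof (rule bij_betw_imageI)
    show "inj_on (\<lambda>c. c \<inter> N) ?X"
    proof (rule inj_onI)
      fix c d assume c: "c \<in> ?X" and d: "d \<in> ?X" and "c \<inter> N = d \<inter> N"
      then obtain z where z: "z \<in> c" "z \<in> d" by blast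
      have "c = ?E `` {z}" "d = ?E `` {z}"
        using c d z by (auto elim!: quotientE dest: class_eq)
      then show "c = d" by simp
    qed
    show "(\<lambda>c. c \<inter> N) ` ?X = {c \<in> N // ?E'. c \<subseteq> W}"
    proof (intro equalityI subsetI)
      fix d assume "d \<in> (\<lambda>c. c \<inter> N) ` ?X"
      then obtain c where c0: "c \<in> P // ?E" "d = c \<inter> N" "c \<subseteq> W" "c \<inter> N \<noteq> {}" by blast
      from c0(1) obtain x where c: "c = ?E `` {x}" by (rule quotientE)
      from c0 obtain z where z: "z \<in> c" "z \<in> N" by blast
      then have "c = ?E `` {z}" using c class_eq by auto
      then have "d = ?E' `` {z}" using c0 z restrict by auto
      then show "d \<in> {c \<in> N // ?E'. c \<subseteq> W}" using z c0 by (auto intro: quotientI)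
    next
      fix d assume "d \<in> {c \<in> N // ?E'. c \<subseteq> W}"
      then obtain x where x: "x \<in> N" "d = ?E' `` {x}" "d \<subseteq> W" by (auto elim: quotientE)
      have "?E `` {x} \<subseteq> W"
        using x PE assms(5,7) restrict[OF x(1)] by blast
      moreover have "x \<in> ?E `` {x} \<inter> N" using x by simp
      ultimately have "?E `` {x} \<in> ?X" using x assms(5) by (blast intro: quotientI)
      moreover have "d = ?E `` {x} \<inter> N" using x restrict by simp
      ultimately show "d \<in> (\<lambda>c. c \<inter> N) ` ?X" by (rule rev_image_eqI)
    qed
  qed
  have fin: "finite (P // ?E)"
    using assms(6) by (simp add: quotient_def)
  have "{c \<in> P // ?E. c \<subseteq> W} = ?X \<union> {c \<in> P // ?E. c \<subseteq> W \<and> c \<inter> N = {}}" by blast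
  then have "card {c \<in> P // ?E. c \<subseteq> W} = card ?X + card {c \<in> P // ?E. c \<subseteq> W \<and> c \<inter> N = {}}"
    by (simp only:) (rule card_Un_disjoint, use fin in auto)
  then show ?thesis using bij_betw_same_card[OF X] Y by simp
qed

section \<open>Splicing\<close>

definition gluing :: "nat set \<Rightarrow> (half_edge \<Rightarrow> half_edge) \<Rightarrow> bool" where
  "gluing S j \<longleftrightarrow> (\<forall>h\<in>halves_at S. j h \<in> halves_at S \<and> j h \<noteq> h \<and> j (j h) = h)"

lemma other_port_simps [simp]:
  "other_port (other_port p) = p" "other_port p \<noteq> p" "p \<noteq> other_port p"
  by (cases p; simp)+

lemma other_strand_simps [simp]:
  "other_strand (other_strand s) = s" "other_strand s \<noteq> s" "s \<noteq> other_strand s"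
  by (cases s; simp)+

lemma opposite_simps [simp]:
  "opposite (opposite h) = h" "opposite h \<noteq> h" "fst (opposite h) = fst h"
  by (cases h; simp)+

lemma gluing_opposite [simp]: "gluing S opposite"
  by (auto simp: gluing_def)

lemma gluing_smoothing [simp]: "gluing S (smoothing st)"
  by (auto simp: gluing_def smoothing_def)

lemma gluing_Un:
  "gluing S j \<Longrightarrow> gluing T k \<Longrightarrow> S \<inter> T = {} \<Longrightarrow>
    gluing (S \<union> T) (\<lambda>h. if fst h \<in> S then j h else k h)"
  unfolding gluing_def mem_Times_iff by (auto simp: disjoint_iff)

lemma finite_half_edges [simp, intro]: "finite V \<Longrightarrow> finite (V \<times> (UNIV :: (strand \<times> port) set))"
proof -
  have "(UNIV :: strand set) = {Over, Under}" "(UNIV :: port set) = {In, Out}"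
    using strand.exhaust port.exhaust by blast+
  then have "finite (UNIV :: strand set)" "finite (UNIV :: port set)" by (metis finite.simps)+
  then have "finite (UNIV :: (strand \<times> port) set)"
    using finite_SigmaI[of "UNIV :: strand set" "\<lambda>_. UNIV :: port set"] by simp
  then show "finite V \<Longrightarrow> ?thesis" by blast
qed

lemma framed_graphD:
  assumes "framed_graph G" "h \<in> halves G"
  shows "mate G h \<in> halves G" "mate G h \<noteq> h" "mate G (mate G h) = h"
  using assms unfolding framed_graph_def by blast+

lemma finite_verts: "framed_graph G \<Longrightarrow> finite (verts G)"
  by (simp add: framed_graph_def)

lemma finite_halves: "framed_graph G \<Longrightarrow> finite (halves G)"
  by (simp add: framed_graph_def finite_half_edges)

lemma finite_quotient_Collect: "finite P \<Longrightarrow> finite {c \<in> P // E. Q c}"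
  unfolding quotient_def by simp

definition mate_pairs :: "('m) fgraph_scheme \<Rightarrow> (half_edge \<times> half_edge) set" where
  "mate_pairs G = {(h, mate G h) | h. h \<in> halves G}"

definition glue_pairs :: "nat set \<Rightarrow> (half_edge \<Rightarrow> half_edge) \<Rightarrow> (half_edge \<times> half_edge) set" where
  "glue_pairs S j = {(h, j h) | h. h \<in> halves_at S}"

lemma splice_rel_eq: "splice_rel S j G = (mate_pairs G \<union> glue_pairs S j)\<^sup>*"
  by (simp add: splice_rel_def mate_pairs_def glue_pairs_def)

lemma sym_glue_pairs: "gluing S j \<Longrightarrow> sym (glue_pairs S j)"
  unfolding gluing_def glue_pairs_def by (fastforce intro!: symI)

lemma sym_mate_pairs: "framed_graph G \<Longrightarrow> sym (mate_pairs G)"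
  unfolding framed_graph_def mate_pairs_def by (fastforce intro!: symI)

lemma mate_pairs_subset: "framed_graph G \<Longrightarrow> mate_pairs G \<subseteq> halves G \<times> halves G"
  unfolding framed_graph_def mate_pairs_def by blast

lemma glue_pairs_subset: "gluing S j \<Longrightarrow> glue_pairs S j \<subseteq> halves_at S \<times> halves_at S"
  unfolding gluing_def glue_pairs_def by blast

lemma sym_splice_rel: "framed_graph G \<Longrightarrow> gluing S j \<Longrightarrow> sym (splice_rel S j G)"
  unfolding splice_rel_eq by (intro sym_rtrancl sym_Un sym_mate_pairs sym_glue_pairs)

lemma splice_rel_halves:
  assumes "framed_graph G" "gluing S j" "S \<subseteq> verts G" "(x, y) \<in> splice_rel S j G" "x \<in> halves G"
  shows "y \<in> halves G"
proof (rule rtrancl_subset_Times)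
  show "(x, y) \<in> (mate_pairs G \<union> glue_pairs S j)\<^sup>*" using assms(4) by (simp add: splice_rel_eq)
  show "mate_pairs G \<union> glue_pairs S j \<subseteq> halves G \<times> halves G"
    using mate_pairs_subset[OF assms(1)] glue_pairs_subset[OF assms(2)] assms(3) by blast
qed (use assms in simp)

text \<open>Each gluing of two half-edges either closes up a path or joins two paths.\<close>

lemma splice_partner_aux:
  fixes G :: "('m) fgraph_scheme"
  assumes "framed_graph G" "finite J" "J \<subseteq> halves G" "\<And>h. h \<in> J \<Longrightarrow> j h \<in> J \<and> j h \<noteq> h \<and> j (j h) = h"
    and "x \<in> halves G - J"
  shows "\<exists>!y. y \<in> halves G - J \<and> y \<noteq> x \<and> (x, y) \<in> (mate_pairs G \<union> {(h, j h) | h. h \<in> J})\<^sup>*"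
  using assms(2-)
proof (induction J arbitrary: x rule: finite_psubset_induct)
  \<comment> \<open>The statement concerns a set \<open>J\<close> of half-edges instead of all
    half-edges at some vertices, so that a single glued pair can be removed.\<close>
  case (psubset J)
  show ?case
  proof (cases "J = {}")
    case True
    have c: "y = x \<or> y = mate G x" if "(x, y) \<in> (mate_pairs G)\<^sup>*" for y
      using that by (induction) (use assms(1) psubset.prems in \<open>auto simp: mate_pairs_def framed_graph_def\<close>)
    have "(x, mate G x) \<in> (mate_pairs G)\<^sup>*"
      using psubset.prems by (auto simp: mate_pairs_def)
    then show ?thesis using True c assms(1) psubset.prems
      by (intro ex1I[of _ "mate G x"]) (auto simp: framed_graph_def)
  next
    case False
    then obtain p where p: "p \<in> J" by blast
    define q where "q = j p"
    define J' where "J' = J - {p, q}"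
    define R where "R = mate_pairs G \<union> {(h, j h) | h. h \<in> J'}"
    have q: "q \<in> J" "q \<noteq> p" "j q = p" using psubset.prems(2)[OF p] by (auto simp: q_def)
    have J': "j h \<in> J' \<and> j h \<noteq> h \<and> j (j h) = h" if "h \<in> J'" for h
    proof -
      have h: "h \<in> J" "h \<noteq> p" "h \<noteq> q" using that by (auto simp: J'_def)
      then have "j h \<noteq> p" "j h \<noteq> q"
        using psubset.prems(2)[of h] q q_def by auto
      then show ?thesis using psubset.prems(2)[OF h(1)] unfolding J'_def by blast
    qed
    have symR: "sym R"
      unfolding R_def using J' by (intro sym_Un sym_mate_pairs assms(1)) (fastforce intro!: symI)
    then have symR': "(b, a) \<in> R\<^sup>*" if "(a, b) \<in> R\<^sup>*" for a b
      using that sym_rtrancl symD by metis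
    have tr: "(a, c) \<in> R\<^sup>*" if "(a, b) \<in> R\<^sup>*" "(b, c) \<in> R\<^sup>*" for a b c
      using that by (rule rtrancl_trans)
    have IH: "\<exists>!y. y \<in> halves G - J' \<and> y \<noteq> x \<and> (x, y) \<in> R\<^sup>*" if "x \<in> halves G - J'" for x
      unfolding R_def by (rule psubset.IH) (use p J' that psubset.prems(1) in \<open>auto simp: J'_def\<close>)
    have eq: "mate_pairs G \<union> {(h, j h) | h. h \<in> J} = R \<union> {(p, q), (q, p)}"
    proof -
      have "(q, p) = (q, j q)" using q by simp
      then have "{(h, j h) | h. h \<in> J} = {(h, j h) | h. h \<in> J'} \<union> {(p, q), (q, p)}"
        using p q unfolding J'_def q_def by blast
      then show ?thesis by (simp add: R_def Un_assoc)
    qed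
    have hJ: "halves G - J' = (halves G - J) \<union> {p, q}" "p \<notin> halves G - J" "q \<notin> halves G - J"
      using p q psubset.prems(1) by (auto simp: J'_def)
    define K where "K = halves G - J"
    have K: "p \<notin> K" "q \<notin> K" "x \<in> K" using hJ psubset.prems(3) by (auto simp: K_def)
    \<comment> \<open>Before p and q are glued, each of x, p and q has a unique partner; the
      induction hypothesis is used at all three.\<close>
    have IH': "\<exists>y. (y \<in> K \<or> y = p \<or> y = q) \<and> y \<noteq> x \<and> (x, y) \<in> R\<^sup>* \<and>
        (\<forall>z. (z \<in> K \<or> z = p \<or> z = q) \<and> z \<noteq> x \<and> (x, z) \<in> R\<^sup>* \<longrightarrow> z = y)"
      if "x \<in> K \<or> x = p \<or> x = q" for x
    proof -
      have m: "z \<in> halves G - J' \<longleftrightarrow> z \<in> K \<or> z = p \<or> z = q" for z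
        using hJ(1) by (auto simp: K_def)
      show ?thesis using IH[of x] that unfolding m Ex1_def by blast
    qed
    obtain y0 where y0: "y0 \<in> K \<or> y0 = p \<or> y0 = q" "y0 \<noteq> x" "(x, y0) \<in> R\<^sup>*"
      and y0u: "\<And>z. z \<in> K \<or> z = p \<or> z = q \<Longrightarrow> z \<noteq> x \<Longrightarrow> (x, z) \<in> R\<^sup>* \<Longrightarrow> z = y0"
      using IH'[of x] K by blast
    obtain p0 where p0: "p0 \<in> K \<or> p0 = q" "(p, p0) \<in> R\<^sup>*" "p0 \<noteq> p"
      and p0u: "\<And>z. z \<in> K \<or> z = q \<Longrightarrow> z \<noteq> p \<Longrightarrow> (p, z) \<in> R\<^sup>* \<Longrightarrow> z = p0"
      using IH'[of p] by blast
    obtain q0 where q0: "q0 \<in> K \<or> q0 = p" "(q, q0) \<in> R\<^sup>*" "q0 \<noteq> q"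
      and q0u: "\<And>z. z \<in> K \<or> z = p \<Longrightarrow> z \<noteq> q \<Longrightarrow> (q, z) \<in> R\<^sup>* \<Longrightarrow> z = q0"
      using IH'[of q] by blast
    have "\<exists>!y. y \<in> K \<and> y \<noteq> x \<and> (x, y) \<in> (R \<union> {(p, q), (q, p)})\<^sup>*"
      unfolding rtrancl_Un_pair_iff[OF symR]
    proof -
      \<comment> \<open>A path from x that ends in \<open>K\<close> is not affected by the new pair.
        One that ends at p now continues from q to \<open>q0\<close>; the value
        \<open>q0 = p\<close> would connect x to q, against the uniqueness of its end p. The third
        case is symmetric.\<close>
      consider "y0 \<in> K" | "y0 = p" | "y0 = q" using y0 by blast
      then show "\<exists>!y. y \<in> K \<and> y \<noteq> x \<and> ((x, y) \<in> R\<^sup>* \<or> (x, p) \<in> R\<^sup>* \<and> (q, y) \<in> R\<^sup>* \<or> (x, q) \<in> R\<^sup>* \<and> (p, y) \<in> R\<^sup>*)"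
      proof cases
        case 1
        have "(x, p) \<notin> R\<^sup>*" "(x, q) \<notin> R\<^sup>*" using y0u K 1 by metis+
        then show ?thesis using 1 y0 y0u by blast
      next
        case 2
        have nq: "(x, q) \<notin> R\<^sup>*" using y0u K 2 q by metis
        have xp: "(x, p) \<in> R\<^sup>*" using 2 y0 by simp
        have "q0 \<noteq> p" using nq xp q0 tr symR' by metis
        then have "q0 \<in> K" using q0 by blast
        moreover have "q0 \<noteq> x" using nq q0 symR' by metis
        moreover have "y \<notin> K" if "(x, y) \<in> R\<^sup>*" "y \<noteq> x" for y using y0u that 2 K by metis
        moreover have "y = q0" if "y \<in> K" "(q, y) \<in> R\<^sup>*" for y
          using q0u[of y] that K by blast
        ultimately show ?thesis using nq xp q0(2) by (intro ex1I[of _ q0]) blast+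
      next
        case 3
        have np: "(x, p) \<notin> R\<^sup>*" using y0u K 3 q by metis
        have xq: "(x, q) \<in> R\<^sup>*" using 3 y0 by simp
        have "p0 \<noteq> q" using np xq p0 tr symR' by metis
        then have "p0 \<in> K" using p0 by blast
        moreover have "p0 \<noteq> x" using np p0 symR' by metis
        moreover have "y \<notin> K" if "(x, y) \<in> R\<^sup>*" "y \<noteq> x" for y using y0u that 3 K by metis
        moreover have "y = p0" if "y \<in> K" "(p, y) \<in> R\<^sup>*" for y
          using p0u[of y] that K by blast
        ultimately show ?thesis using np xq p0(2) by (intro ex1I[of _ p0]) blast+
      qed
    qed
    then show ?thesis unfolding eq K_def .
  qed
qed

lemma splice_partner:
  assumes "framed_graph G" "gluing S j" "S \<subseteq> verts G" "x \<in> halves_at (verts G - S)"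
  shows "\<exists>!y. y \<in> halves_at (verts G - S) \<and> y \<noteq> x \<and> (x, y) \<in> splice_rel S j G"
proof -
  have eq: "halves_at (verts G - S) = halves G - halves_at S" by auto
  have "\<exists>!y. y \<in> halves G - halves_at S \<and> y \<noteq> x \<and>
      (x, y) \<in> (mate_pairs G \<union> {(h, j h) |h. h \<in> halves_at S})\<^sup>*"
  proof (rule splice_partner_aux)
    show "finite (halves_at S)"
      using assms(1,3) finite_subset by (auto simp: framed_graph_def)
  qed (use assms eq in \<open>auto simp: gluing_def\<close>)
  then show ?thesis unfolding eq splice_rel_eq glue_pairs_def .
qed

lemma verts_splice [simp]: "verts (splice S j G) = verts G - S"
  by (simp add: splice_def)

lemma circles_splice:
  "circles (splice S j G) = circles G + card {c \<in> halves G // splice_rel S j G. c \<subseteq> halves_at S}"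
  by (simp add: splice_def)

lemma mate_splice:
  assumes "framed_graph G" "gluing S j" "S \<subseteq> verts G" "h \<in> halves_at (verts G - S)"
  shows "mate (splice S j G) h \<in> halves_at (verts G - S)" "mate (splice S j G) h \<noteq> h"
    "(h, mate (splice S j G) h) \<in> splice_rel S j G"
proof -
  have "mate (splice S j G) h = (THE h'. h' \<in> halves_at (verts G - S) \<and> h' \<noteq> h \<and> (h, h') \<in> splice_rel S j G)"
    by (simp add: splice_def)
  then show "mate (splice S j G) h \<in> halves_at (verts G - S)" "mate (splice S j G) h \<noteq> h"
    "(h, mate (splice S j G) h) \<in> splice_rel S j G"
    using theI'[OF splice_partner[OF assms]] by simp_all
qed

lemma mate_splice_eqI:
  assumes "framed_graph G" "gluing S j" "S \<subseteq> verts G" "h \<in> halves_at (verts G - S)"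
    and "h' \<in> halves_at (verts G - S)" "h' \<noteq> h" "(h, h') \<in> splice_rel S j G"
  shows "mate (splice S j G) h = h'"
  by (rule ex1E[OF splice_partner[OF assms(1-4)]]) (use mate_splice[OF assms(1-4)] assms(5-7) in metis)

lemma splice_rel_iff:
  assumes "framed_graph G" "gluing S j" "S \<subseteq> verts G"
    and "h \<in> halves_at (verts G - S)" "h' \<in> halves_at (verts G - S)"
  shows "(h, h') \<in> splice_rel S j G \<longleftrightarrow> h' = h \<or> h' = mate (splice S j G) h"
  using mate_splice[OF assms(1-4)] mate_splice_eqI[OF assms(1-5)]
  by (auto simp: splice_rel_def)

lemma framed_graph_splice:
  assumes "framed_graph G" "gluing S j" "S \<subseteq> verts G"
  shows "framed_graph (splice S j G)"
  unfolding framed_graph_def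
proof (intro conjI ballI)
  note fG = assms(1)[unfolded framed_graph_def]
  show "finite (verts (splice S j G))" using fG by simp
  \<comment> \<open>If every vertex is removed, the component of any half-edge lies at removed
    vertices and becomes a circle, so the result is again nonempty.\<close>
  have "circles (splice S j G) > 0" if "verts G - S = {}" "circles G = 0"
  proof -
    have "verts G \<noteq> {}" using fG that by simp
    then obtain h where h: "h \<in> halves G" by (metis SigmaI UNIV_I ex_in_conv surj_pair)
    have SG: "S = verts G" using that assms(3) by blast
    have "splice_rel S j G `` {h} \<in> {c \<in> halves G // splice_rel S j G. c \<subseteq> halves_at S}"
      using h splice_rel_halves[OF assms _ h] unfolding SG by (auto intro!: quotientI)
    moreover have "finite {c \<in> halves G // splice_rel S j G. c \<subseteq> halves_at S}"
      by (rule finite_quotient_Collect[OF finite_halves[OF assms(1)]])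
    ultimately have "card {c \<in> halves G // splice_rel S j G. c \<subseteq> halves_at S} > 0"
      by (subst card_gt_0_iff) blast
    then show ?thesis by (simp add: circles_splice)
  qed
  then show "verts (splice S j G) \<noteq> {} \<or> 0 < circles (splice S j G)"
    by (cases "circles G = 0") (auto simp: circles_splice)
  fix h assume "h \<in> halves (splice S j G)"
  then have h: "h \<in> halves_at (verts G - S)" by simp
  note m = mate_splice[OF assms h]
  show "mate (splice S j G) h \<in> halves (splice S j G)" "mate (splice S j G) h \<noteq> h"
    using m by simp_all
  have "(mate (splice S j G) h, h) \<in> splice_rel S j G"
    using m(3) sym_splice_rel[OF assms(1,2)] by (rule symD[rotated])
  then show "mate (splice S j G) (mate (splice S j G) h) = h"
    using mate_splice_eqI[OF assms m(1) h] m(2) by metis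
qed

text \<open>Equality up to the irrelevant values of \<open>mate\<close>.\<close>

definition same_graph :: "('m) fgraph_scheme \<Rightarrow> ('n) fgraph_scheme \<Rightarrow> bool" where
  "same_graph G H \<longleftrightarrow>
    verts G = verts H \<and> circles G = circles H \<and> (\<forall>h\<in>halves G. mate G h = mate H h)"

lemma same_graph_refl [simp]: "same_graph G G"
  by (simp add: same_graph_def)

lemma same_graph_sym: "same_graph G H \<Longrightarrow> same_graph H G"
  by (simp add: same_graph_def)

lemma same_graph_trans: "same_graph G H \<Longrightarrow> same_graph H K \<Longrightarrow> same_graph G K"
  by (simp add: same_graph_def)

lemma framed_graph_same_graph: "same_graph G H \<Longrightarrow> framed_graph G \<Longrightarrow> framed_graph H"
  unfolding same_graph_def framed_graph_def by metis

lemma splice_rel_same_graph: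
  assumes "same_graph G H" "\<And>h. h \<in> halves_at S \<Longrightarrow> j h = k h"
  shows "splice_rel S j G = splice_rel S k H"
proof -
  have "mate_pairs G = mate_pairs H" "glue_pairs S j = glue_pairs S k"
    using assms unfolding same_graph_def mate_pairs_def glue_pairs_def by (force, force)
  then show ?thesis by (simp add: splice_rel_eq)
qed

lemma same_graph_splice:
  assumes "same_graph G H" "\<And>h. h \<in> halves_at S \<Longrightarrow> j h = k h"
  shows "same_graph (splice S j G) (splice S k H)"
  using assms(1) splice_rel_same_graph[OF assms, simplified]
  by (simp add: same_graph_def splice_def)

text \<open>The mates of the intermediate graph are the contracted connections of the first stage.
  Hence the second stage sees exactly the contraction of the joint relation, and
  \<open>card_components_contract\<close> adds up the circles of the two stages. This permits fixing
  the outer part of a state before resolving the local part.\<close>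

lemma splice_splice:
  assumes G: "framed_graph G" and j: "gluing S j" and k: "gluing T k"
    and S: "S \<subseteq> verts G" and T: "T \<subseteq> verts G" and disj: "S \<inter> T = {}"
  shows "same_graph (splice T k (splice S j G))
    (splice (S \<union> T) (\<lambda>h. if fst h \<in> S then j h else k h) G)"
proof -
  define jk where "jk = (\<lambda>h. if fst h \<in> S then j h else k h)"
  define H where "H = splice S j G"
  define N where "N = halves_at (verts G - S)"
  let ?B = "mate_pairs G \<union> glue_pairs S j" and ?A = "glue_pairs T k"
  let ?E' = "(?A \<union> (?B\<^sup>* \<inter> N \<times> N))\<^sup>*"
  have H: "framed_graph H" unfolding H_def by (rule framed_graph_splice[OF G j S])
  have jk: "gluing (S \<union> T) jk" unfolding jk_def by (rule gluing_Un[OF j k disj])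
  have TH: "T \<subseteq> verts H" using T disj by (auto simp: H_def)
  have ST: "S \<union> T \<subseteq> verts G" using S T by simp
  have E: "splice_rel (S \<union> T) jk G = (?A \<union> ?B)\<^sup>*"
  proof -
    have "glue_pairs (S \<union> T) jk = glue_pairs S j \<union> glue_pairs T k"
      using disj by (fastforce simp: glue_pairs_def jk_def)
    then show ?thesis by (simp add: splice_rel_eq Un_ac)
  qed
  have A: "?A \<subseteq> N \<times> N" using glue_pairs_subset[OF k] T disj by (force simp: N_def)
  have E': "splice_rel T k H = ?E'"
  proof -
    have mB: "mate_pairs H \<subseteq> ?B\<^sup>* \<inter> N \<times> N"
    proof
      fix z assume "z \<in> mate_pairs H"
      then obtain h where "z = (h, mate H h)" "h \<in> N"
        by (auto simp: mate_pairs_def H_def N_def)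
      then show "z \<in> ?B\<^sup>* \<inter> N \<times> N"
        using mate_splice[OF G j S, of h] unfolding H_def N_def splice_rel_eq by blast
    qed
    \<comment> \<open>Among the surviving half-edges a class of the first stage consists of a
      half-edge and its new mate, so restricting to \<open>N\<close> loses nothing.\<close>
    have Bm: "?B\<^sup>* \<inter> N \<times> N \<subseteq> Id \<union> mate_pairs H"
    proof
      fix z assume z: "z \<in> ?B\<^sup>* \<inter> N \<times> N"
      obtain x y where xy: "z = (x, y)" by (rule prod.exhaust)
      then have "y = x \<or> y = mate H x"
        using splice_rel_iff[OF G j S, of x y] z unfolding H_def by (auto simp: N_def splice_rel_eq)
      then show "z \<in> Id \<union> mate_pairs H" using z xy by (auto simp: mate_pairs_def H_def N_def)
    qed
    have "?E' \<subseteq> (?A \<union> (Id \<union> mate_pairs H))\<^sup>*" using Bm by (intro rtrancl_mono) blast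
    also have "\<dots> = (?A \<union> mate_pairs H)\<^sup>*"
      by (metis Un_left_commute rtrancl_reflcl sup_commute)
    finally have "?E' \<subseteq> (mate_pairs H \<union> ?A)\<^sup>*" by (simp add: Un_commute)
    moreover have "(mate_pairs H \<union> ?A)\<^sup>* \<subseteq> ?E'" using mB by (intro rtrancl_mono) blast
    ultimately show ?thesis by (simp add: splice_rel_eq)
  qed
  have rel: "(x, y) \<in> splice_rel (S \<union> T) jk G \<longleftrightarrow> (x, y) \<in> splice_rel T k H"
    if "x \<in> N" "y \<in> N" for x y
    unfolding E E' by (rule rtrancl_Un_restrict_iff[OF A that])
  have sub: "halves_at (verts G - (S \<union> T)) \<subseteq> N" by (auto simp: N_def)
  have v: "verts H - T = verts G - (S \<union> T)" by (auto simp: H_def)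
  have m: "mate (splice T k H) h = mate (splice (S \<union> T) jk G) h"
    if h: "h \<in> halves_at (verts G - (S \<union> T))" for h
  proof (rule mate_splice_eqI[OF H k TH])
    note m = mate_splice[OF G jk ST h]
    show "h \<in> halves_at (verts H - T)" using h v by simp
    show "mate (splice (S \<union> T) jk G) h \<in> halves_at (verts H - T)" using m v by simp
    show "mate (splice (S \<union> T) jk G) h \<noteq> h" by (rule m)
    show "(h, mate (splice (S \<union> T) jk G) h) \<in> splice_rel T k H"
      using m rel[of h] h sub by (meson subsetD)
  qed
  have c: "card {c \<in> halves G // splice_rel (S \<union> T) jk G. c \<subseteq> halves_at (S \<union> T)} =
    card {c \<in> halves H // splice_rel T k H. c \<subseteq> halves_at T} +
    card {c \<in> halves G // splice_rel S j G. c \<subseteq> halves_at S}"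
  proof -
    have "card {c \<in> halves G // (?A \<union> ?B)\<^sup>*. c \<subseteq> halves_at (S \<union> T)} =
      card {c \<in> N // ?E'. c \<subseteq> halves_at (S \<union> T)} + card {c \<in> halves G // ?B\<^sup>*. c \<subseteq> halves G - N}"
    proof (rule card_components_contract)
      show "?B \<subseteq> halves G \<times> halves G"
        using mate_pairs_subset[OF G] glue_pairs_subset[OF j] S by blast
      show "finite (halves G)" using G by (auto simp: framed_graph_def)
    qed (use A in \<open>auto simp: N_def intro!: sym_Un sym_mate_pairs sym_glue_pairs G j k\<close>)
    moreover have "halves H = N" by (auto simp: H_def N_def)
    moreover have "halves G - N = halves_at S" using S by (auto simp: N_def)
    moreover have "{c \<in> N // ?E'. c \<subseteq> halves_at (S \<union> T)} = {c \<in> N // ?E'. c \<subseteq> halves_at T}"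
    proof -
      have "c \<subseteq> N" if "c \<in> N // ?E'" for c
        using that rtrancl_subset_Times[of "?A \<union> (?B\<^sup>* \<inter> N \<times> N)" N] A
        by (auto elim!: quotientE)
      moreover have "N \<inter> halves_at (S \<union> T) = halves_at T" using T disj by (auto simp: N_def)
      ultimately show ?thesis by blast
    qed
    ultimately show ?thesis using E E' by (simp add: splice_rel_eq)
  qed
  show ?thesis
    unfolding same_graph_def jk_def[symmetric] H_def[symmetric]
    using v m c by (simp add: circles_splice[of T] circles_splice[of "S \<union> T"])
      (simp add: H_def circles_splice)
qed

section \<open>Isomorphisms of spliced graphs\<close>

lemma framed_iso_sym:
  assumes "framed_graph G" "framed_graph H" "framed_iso G H"
  shows "framed_iso H G"
proof -
  obtain \<phi> where c: "circles G = circles H" and b: "bij_betw \<phi> (halves G) (halves H)"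
    and v: "\<And>h h'. h \<in> halves G \<Longrightarrow> h' \<in> halves G \<Longrightarrow> fst (\<phi> h) = fst (\<phi> h') \<longleftrightarrow> fst h = fst h'"
    and o: "\<And>h. h \<in> halves G \<Longrightarrow> \<phi> (opposite h) = opposite (\<phi> h)"
    and m: "\<And>h. h \<in> halves G \<Longrightarrow> \<phi> (mate G h) = mate H (\<phi> h)"
    using assms(3) unfolding framed_iso_def by blast
  define \<psi> where "\<psi> = the_inv_into (halves G) \<phi>"
  have b': "bij_betw \<psi> (halves H) (halves G)"
    unfolding \<psi>_def by (rule bij_betw_the_inv_into[OF b])
  have \<psi>: "\<psi> h \<in> halves G" "\<phi> (\<psi> h) = h" if "h \<in> halves H" for h
    using bij_betwE[OF b'] f_the_inv_into_f_bij_betw[OF b, of h] that by (auto simp: \<psi>_def)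
  have \<psi>': "\<psi> (\<phi> h) = h" if "h \<in> halves G" for h
    unfolding \<psi>_def by (rule the_inv_into_f_f[OF bij_betw_imp_inj_on[OF b] that])
  have op: "opposite h \<in> halves G \<longleftrightarrow> h \<in> halves G" for h by (cases h) auto
  show ?thesis
    unfolding framed_iso_def
  proof (intro conjI exI[of _ \<psi>] ballI)
    show "circles H = circles G" by (simp add: c)
    show "bij_betw \<psi> (halves H) (halves G)" by (rule b')
  next
    fix h h' assume "h \<in> halves H" "h' \<in> halves H"
    then show "fst (\<psi> h) = fst (\<psi> h') \<longleftrightarrow> fst h = fst h'"
      using v[of "\<psi> h" "\<psi> h'"] \<psi> by metis
  next
    fix h assume h: "h \<in> halves H"
    show "\<psi> (opposite h) = opposite (\<psi> h)"
      using o[OF \<psi>(1)[OF h]] \<psi>(2)[OF h] \<psi>'[of "opposite (\<psi> h)"] op \<psi>(1)[OF h] by metis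
    show "\<psi> (mate H h) = mate G (\<psi> h)"
      using m[OF \<psi>(1)[OF h]] \<psi>(2)[OF h] \<psi>'[of "mate G (\<psi> h)"]
        framed_graphD(1)[OF assms(1) \<psi>(1)[OF h]] by metis
  qed
qed

lemma framed_iso_trans:
  assumes "framed_iso G H" "framed_iso H K"
  shows "framed_iso G K"
proof -
  obtain \<phi> where c: "circles G = circles H" and b: "bij_betw \<phi> (halves G) (halves H)"
    and v: "\<And>h h'. h \<in> halves G \<Longrightarrow> h' \<in> halves G \<Longrightarrow> fst (\<phi> h) = fst (\<phi> h') \<longleftrightarrow> fst h = fst h'"
    and o: "\<And>h. h \<in> halves G \<Longrightarrow> \<phi> (opposite h) = opposite (\<phi> h)"
    and m: "\<And>h. h \<in> halves G \<Longrightarrow> \<phi> (mate G h) = mate H (\<phi> h)"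
    using assms(1) unfolding framed_iso_def by blast
  obtain \<psi> where c': "circles H = circles K" and b': "bij_betw \<psi> (halves H) (halves K)"
    and v': "\<And>h h'. h \<in> halves H \<Longrightarrow> h' \<in> halves H \<Longrightarrow> fst (\<psi> h) = fst (\<psi> h') \<longleftrightarrow> fst h = fst h'"
    and o': "\<And>h. h \<in> halves H \<Longrightarrow> \<psi> (opposite h) = opposite (\<psi> h)"
    and m': "\<And>h. h \<in> halves H \<Longrightarrow> \<psi> (mate H h) = mate K (\<psi> h)"
    using assms(2) unfolding framed_iso_def by blast
  have \<phi>: "\<phi> h \<in> halves H" if "h \<in> halves G" for h using b that by (rule bij_betwE[rule_format])
  show ?thesis
    unfolding framed_iso_def
  proof (intro conjI exI[of _ "\<psi> \<circ> \<phi>"] ballI)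
    show "bij_betw (\<psi> \<circ> \<phi>) (halves G) (halves K)" using b b' by (rule bij_betw_trans)
  qed (use c c' in \<open>simp_all only: comp_apply \<phi> v v' o o' m m'\<close>)
qed

lemma graph_elt_cong:
  assumes "framed_graph G" "framed_graph H" "framed_iso G H"
  shows "graph_elt G = graph_elt H"
proof -
  have "framed_iso G K \<longleftrightarrow> framed_iso H K" for K
    using assms framed_iso_sym framed_iso_trans by blast
  then show ?thesis by (simp add: graph_elt_def iso_class_def)
qed

lemma framed_iso_same_graph: "same_graph G H \<Longrightarrow> framed_iso G H"
  unfolding framed_iso_def same_graph_def by (intro conjI exI[of _ id]) auto

lemma graph_elt_same_graph:
  "framed_graph G \<Longrightarrow> same_graph G H \<Longrightarrow> graph_elt G = graph_elt H"
  using framed_graph_same_graph framed_iso_same_graph graph_elt_cong by blast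

text \<open>It is enough that connections are preserved in one direction: in a splice the mate is
  the only other surviving half-edge in its class, so the image of a mate must be the mate of the
  image. The numbers m and n of added circles allow comparisons up to a power of \<delta>.\<close>

lemma framed_iso_spliceI:
  fixes G H :: fgraph
  assumes G: "framed_graph G" "gluing S j" "S \<subseteq> verts G"
    and H: "framed_graph H" "gluing T k" "T \<subseteq> verts H"
    and bij: "bij_betw \<phi> (halves_at (verts G - S)) (halves_at (verts H - T))"
    and vertex: "\<And>h h'. h \<in> halves_at (verts G - S) \<Longrightarrow> h' \<in> halves_at (verts G - S) \<Longrightarrow>
      fst (\<phi> h) = fst (\<phi> h') \<longleftrightarrow> fst h = fst h'"
    and opp: "\<And>h. h \<in> halves_at (verts G - S) \<Longrightarrow> \<phi> (opposite h) = opposite (\<phi> h)"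
    and rel: "\<And>h h'. h \<in> halves_at (verts G - S) \<Longrightarrow> h' \<in> halves_at (verts G - S) \<Longrightarrow>
      (h, h') \<in> splice_rel S j G \<Longrightarrow> (\<phi> h, \<phi> h') \<in> splice_rel T k H"
    and circ: "circles (splice S j G) + m = circles (splice T k H) + n"
  shows "framed_iso (splice S j G\<lparr>circles := circles (splice S j G) + m\<rparr>)
    (splice T k H\<lparr>circles := circles (splice T k H) + n\<rparr>)"
  unfolding framed_iso_def
proof (intro conjI exI[of _ \<phi>] ballI)
  let ?G = "splice S j G\<lparr>circles := circles (splice S j G) + m\<rparr>"
  let ?H = "splice T k H\<lparr>circles := circles (splice T k H) + n\<rparr>"
  show "circles ?G = circles ?H" using circ by simp
  show "bij_betw \<phi> (halves ?G) (halves ?H)" using bij by simp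
  fix h assume h: "h \<in> halves ?G"
  then have h': "h \<in> halves_at (verts G - S)" by simp
  have \<phi>: "\<phi> h \<in> halves_at (verts H - T)" if "h \<in> halves_at (verts G - S)" for h
    using bij that by (rule bij_betwE[rule_format])
  show "\<phi> (opposite h) = opposite (\<phi> h)" using opp[OF h'] .
  show "fst (\<phi> h) = fst (\<phi> h'') \<longleftrightarrow> fst h = fst h''" if "h'' \<in> halves ?G" for h''
    using vertex[OF h'] that by simp
  note m = mate_splice[OF G h']
  have "mate (splice T k H) (\<phi> h) = \<phi> (mate (splice S j G) h)"
  proof (rule mate_splice_eqI[OF H \<phi>[OF h'] \<phi>[OF m(1)] _ rel[OF h' m(1) m(3)]])
    show "\<phi> (mate (splice S j G) h) \<noteq> \<phi> h"
      using bij_betw_imp_inj_on[OF bij] m(1,2) h' by (meson inj_on_def)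
  qed
  then show "\<phi> (mate ?G h) = mate ?H (\<phi> h)" by simp
qed

section \<open>Replacing a part of a graph\<close>

text \<open>Each half-edge \<open>e\<close> at which the local part is attached to the rest of the graph
  is split into a leg \<open>Inr e\<close>, shared by all fillings of the local part, and the half-edge
  \<open>Inl e\<close> of the filling.  The permutation \<open>x\<close> describes how the legs are attached.\<close>

lemma quotient_rtrancl_subset: "R \<subseteq> P \<times> P \<Longrightarrow> c \<in> P // R\<^sup>* \<Longrightarrow> c \<subseteq> P"
  using rtrancl_subset_Times[of R P] by (elim quotientE) blast

definition outer_pairs ::
  "fgraph \<Rightarrow> nat set \<Rightarrow> half_edge set \<Rightarrow> ((half_edge + half_edge) \<times> (half_edge + half_edge)) set" where
  "outer_pairs G Q I =
    (let \<iota> = (\<lambda>h. if h \<in> halves_at Q - I then Inr h else Inl h)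
     in {(\<iota> h, \<iota> (mate G h)) | h. h \<in> halves G - I})"

definition inner_pairs ::
  "fgraph \<Rightarrow> nat set \<Rightarrow> half_edge set \<Rightarrow> (half_edge \<Rightarrow> half_edge) \<Rightarrow> nat set \<Rightarrow>
    (half_edge \<Rightarrow> half_edge) \<Rightarrow> ((half_edge + half_edge) \<times> (half_edge + half_edge)) set" where
  "inner_pairs G Q I x T k =
    {(Inr e, Inl (x e)) | e. e \<in> halves_at Q - I} \<union>
    {(Inl (x i), Inl (x (mate G i))) | i. i \<in> I} \<union>
    {(Inl h, Inl (k h)) | h. h \<in> halves_at T}"

lemma outer_pairsI:
  "h \<in> halves G - I \<Longrightarrow>
    (if h \<in> halves_at Q - I then Inr h else Inl h,
     if mate G h \<in> halves_at Q - I then Inr (mate G h) else Inl (mate G h)) \<in> outer_pairs G Q I"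
  unfolding outer_pairs_def Let_def by (intro CollectI exI[of _ h] conjI) simp_all

lemma inner_pairsI:
  "e \<in> halves_at Q - I \<Longrightarrow> (Inr e, Inl (x e)) \<in> inner_pairs G Q I x T k"
  "i \<in> I \<Longrightarrow> (Inl (x i), Inl (x (mate G i))) \<in> inner_pairs G Q I x T k"
  "h \<in> halves_at T \<Longrightarrow> (Inl h, Inl (k h)) \<in> inner_pairs G Q I x T k"
  unfolding inner_pairs_def by blast+

text \<open>\<open>H\<close> is \<open>G\<close> with its edges moved by an involution supported at
  the vertices of \<open>Q\<close>. The set \<open>I\<close> holds the ends of edges known to lie
  inside. Any other edge between vertices of \<open>Q\<close> is treated as an outer edge from leg
  to leg, so nothing is assumed about how the legs are joined.\<close>

locale local_part =
  fixes G H :: fgraph and Q :: "nat set" and I :: "half_edge set" and x :: "half_edge \<Rightarrow> half_edge"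
  assumes G: "framed_graph G" and H: "framed_graph H" and verts_H: "verts H = verts G"
    and Q: "Q \<subseteq> verts G"
    and x_x: "\<And>h. x (x h) = h"
    and x_in: "\<And>h. h \<in> halves_at Q \<Longrightarrow> x h \<in> halves_at Q"
    and x_out: "\<And>h. h \<notin> halves_at Q \<Longrightarrow> x h = h"
    and mate_H: "\<And>h. h \<in> halves G \<Longrightarrow> mate H h = x (mate G (x h))"
    and I: "I \<subseteq> halves_at Q" and mate_I: "\<And>h. h \<in> I \<Longrightarrow> mate G h \<in> I"
begin

abbreviation "legs \<equiv> halves_at Q - I"
abbreviation "points \<equiv> Inl ` halves G \<union> Inr ` legs"

lemma QG: "halves_at Q \<subseteq> halves G"
  using Q by blast

lemma x_halves: "h \<in> halves G \<Longrightarrow> x h \<in> halves G"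
proof (cases "h \<in> halves_at Q")
  case True
  show ?thesis by (rule subsetD[OF QG x_in[OF True]])
qed (simp add: x_out)

lemma outer_subset:
  "outer_pairs G Q I \<subseteq> (Inl ` halves_at (verts G - Q) \<union> Inr ` legs) \<times> (Inl ` halves_at (verts G - Q) \<union> Inr ` legs)"
proof -
  have "(if h \<in> legs then Inr h else Inl h) \<in> Inl ` halves_at (verts G - Q) \<union> Inr ` legs"
    if "h \<in> halves G - I" for h
  proof (cases "h \<in> legs")
    case False
    then have "h \<in> halves_at (verts G - Q)" using that by auto
    then show ?thesis using False by simp
  qed simp
  moreover have "mate G h \<in> halves G - I" if "h \<in> halves G - I" for h
    using framed_graphD[OF G, of h] that mate_I[of "mate G h"] by auto
  ultimately show ?thesis unfolding outer_pairs_def Let_def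
    by (intro subsetI, elim CollectE exE conjE) (simp only:, intro SigmaI, blast+)
qed

lemma sym_outer: "sym (outer_pairs G Q I)"
proof (rule symI)
  fix p q assume "(p, q) \<in> outer_pairs G Q I"
  then obtain h where h: "h \<in> halves G - I" "p = (if h \<in> legs then Inr h else Inl h)"
    "q = (if mate G h \<in> legs then Inr (mate G h) else Inl (mate G h))"
    unfolding outer_pairs_def Let_def by blast
  have "mate G h \<in> halves G - I" "mate G (mate G h) = h"
    using framed_graphD[OF G, of h] h(1) mate_I[of "mate G h"] by auto
  then have "(if mate G h \<in> legs then Inr (mate G h) else Inl (mate G h),
      if mate G (mate G h) \<in> legs then Inr (mate G (mate G h)) else Inl (mate G (mate G h)))
      \<in> outer_pairs G Q I"
    by (intro outer_pairsI)
  then show "(q, p) \<in> outer_pairs G Q I"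
    unfolding h(2,3) \<open>mate G (mate G h) = h\<close> .
qed

lemma inner_subset:
  assumes "T \<subseteq> Q" "gluing T k"
  shows "inner_pairs G Q I x T k \<subseteq> (Inl ` halves_at Q \<union> Inr ` legs) \<times> (Inl ` halves_at Q \<union> Inr ` legs)"
proof -
  have TQ: "halves_at T \<subseteq> halves_at Q" using assms(1) by blast
  have "k h \<in> halves_at T" if "h \<in> halves_at T" for h
    using assms(2) that unfolding gluing_def by blast
  then have "k h \<in> halves_at Q" "h \<in> halves_at Q" if "h \<in> halves_at T" for h
    using TQ that by (meson subsetD)+
  moreover have "x i \<in> halves_at Q" "x (mate G i) \<in> halves_at Q" if "i \<in> I" for i
    by (rule x_in[OF subsetD[OF I that]], rule x_in[OF subsetD[OF I mate_I[OF that]]])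
  moreover have "x e \<in> halves_at Q" if "e \<in> legs" for e using that by (intro x_in) (rule DiffD1)
  ultimately show ?thesis unfolding inner_pairs_def by blast
qed

context
  fixes T :: "nat set" and k :: "half_edge \<Rightarrow> half_edge"
  assumes T: "T \<subseteq> Q" and k: "gluing T k"
begin

abbreviation "inner \<equiv> inner_pairs G Q I x T k \<union> (inner_pairs G Q I x T k)\<inverse>"
abbreviation "full_rel \<equiv> (outer_pairs G Q I \<union> inner)\<^sup>*"
text \<open>Only half-edges at resolved vertices are interior to the filling; those at vertices of
  \<open>Q - T\<close> remain as graphical vertices.\<close>

abbreviation "ends \<equiv> Inl ` halves_at (verts G - Q) \<union> Inr ` legs \<union> Inl ` halves_at (Q - T)"

lemma TH: "T \<subseteq> verts H" using T Q verts_H by blast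

lemma inner_sub: "inner \<subseteq> (Inl ` halves_at Q \<union> Inr ` legs) \<times> (Inl ` halves_at Q \<union> Inr ` legs)"
  using inner_subset[OF T k] by blast

lemma generators_subset: "outer_pairs G Q I \<union> inner \<subseteq> points \<times> points"
proof -
  have "Inl ` halves_at Q \<union> Inr ` legs \<subseteq> points"
    "Inl ` halves_at (verts G - Q) \<union> Inr ` legs \<subseteq> points"
    using Q by auto
  then show ?thesis
    by (intro Un_least order.trans[OF inner_sub] order.trans[OF outer_subset] Sigma_mono) simp_all
qed

lemma sym_generators: "sym (outer_pairs G Q I \<union> inner)"
  by (intro sym_Un sym_outer sym_Un_converse)

lemma sym_full: "sym full_rel"
  by (rule sym_rtrancl[OF sym_generators])

text \<open>The projection \<open>?\<pi>\<close> sends a leg to the half-edge of \<open>H\<close> at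
  which it is attached and turns each generator into a path of \<open>H\<close>. Conversely, an edge
  of \<open>H\<close> that is not inside is followed by passing to the leg, along the outer edge,
  and back from a leg where there is one.\<close>

lemma splice_rel_iff_full:
  assumes "h \<in> halves G" "h' \<in> halves G"
  shows "(h, h') \<in> splice_rel T k H \<longleftrightarrow> (Inl h, Inl h') \<in> full_rel"
proof
  let ?\<pi> = "\<lambda>p. case p of Inl h \<Rightarrow> h | Inr e \<Rightarrow> x e"
  have H_pair: "(g, mate H g) \<in> splice_rel T k H" if "g \<in> halves G" for g
    using that verts_H unfolding splice_rel_eq mate_pairs_def by auto
  have sym: "(b, a) \<in> splice_rel T k H" if "(a, b) \<in> splice_rel T k H" for a b
    using that sym_splice_rel[OF H k] by (meson symD)
  have mate_x: "(x g, x (mate G g)) \<in> splice_rel T k H" if "g \<in> halves G" for g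
    using H_pair[OF x_halves[OF that]] mate_H[OF x_halves[OF that]] x_x by simp
  have \<iota>: "?\<pi> (if g \<in> legs then Inr g else Inl g) = x g" if "g \<in> halves G - I" for g
    using that x_out[of g] by (cases "g \<in> halves_at Q") simp_all
  have gen: "(?\<pi> p, ?\<pi> q) \<in> splice_rel T k H" if pq: "(p, q) \<in> outer_pairs G Q I \<union> inner_pairs G Q I x T k" for p q
  proof -
    consider (o) g where "g \<in> halves G - I" "p = (if g \<in> legs then Inr g else Inl g)"
        "q = (if mate G g \<in> legs then Inr (mate G g) else Inl (mate G g))"
      | (l) e where "p = Inr e" "q = Inl (x e)"
      | (i) i where "i \<in> I" "p = Inl (x i)" "q = Inl (x (mate G i))"
      | (g) g where "g \<in> halves_at T" "p = Inl g" "q = Inl (k g)"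
      using pq unfolding outer_pairs_def inner_pairs_def Let_def by blast
    then show ?thesis
    proof cases
      case o
      have m: "mate G g \<in> halves G - I"
        using framed_graphD[OF G, of g] o(1) mate_I[of "mate G g"] by auto
      show ?thesis unfolding o(2,3) \<iota>[OF o(1)] \<iota>[OF m] by (rule mate_x) (use o in blast)
    next
      case l
      then show ?thesis by (simp add: splice_rel_def)
    next
      case i
      then show ?thesis using mate_x[of i] I Q by auto
    next
      case g
      then show ?thesis unfolding splice_rel_eq glue_pairs_def by auto
    qed
  qed
  show "(h, h') \<in> splice_rel T k H" if "(Inl h, Inl h') \<in> full_rel"
  proof -
    have "(?\<pi> p, ?\<pi> q) \<in> splice_rel T k H" if "(p, q) \<in> full_rel" for p q
      using that
    proof (induction rule: rtrancl_induct)
      case base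
      then show ?case by (simp add: splice_rel_def)
    next
      case (step q r)
      then have "(?\<pi> q, ?\<pi> r) \<in> splice_rel T k H" using gen sym by blast
      then show ?case using step.IH unfolding splice_rel_def by (rule rtrancl_trans[rotated])
    qed
    from this[OF that] show ?thesis by simp
  qed
  have leg: "(Inl (x g), if g \<in> legs then Inr g else Inl g) \<in> full_rel" if "g \<in> halves G - I" for g
  proof (cases "g \<in> legs")
    case True
    then have "(Inr g, Inl (x g)) \<in> inner_pairs G Q I x T k" by (rule inner_pairsI)
    then show ?thesis using True by auto
  next
    case False
    then show ?thesis using that x_out[of g] by simp
  qed
  have mate': "(Inl g, Inl (mate H g)) \<in> full_rel" if g: "g \<in> halves G" for g
  proof -
    define g' where "g' = x g"
    have g': "g' \<in> halves G" "g = x g'" "mate H g = x (mate G g')"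
      using g x_halves mate_H x_x by (auto simp: g'_def)
    show ?thesis
    proof (cases "g' \<in> I")
      case True
      then have "(Inl g, Inl (mate H g)) \<in> inner_pairs G Q I x T k"
        unfolding g'(3) unfolding g'_def[symmetric] using inner_pairsI(2)[OF True, of x G Q T k] g'(2) by simp
      then show ?thesis by (intro r_into_rtrancl) simp
    next
      case False
      have m: "mate G g' \<in> halves G - I"
        using framed_graphD[OF G g'(1)] False mate_I[of "mate G g'"] by auto
      have "(if g' \<in> legs then Inr g' else Inl g',
          if mate G g' \<in> legs then Inr (mate G g') else Inl (mate G g')) \<in> full_rel"
        by (intro r_into_rtrancl UnI1 outer_pairsI) (use False g'(1) in blast)
      moreover have "(Inl g, if g' \<in> legs then Inr g' else Inl g') \<in> full_rel"
        using leg[of g'] False g' by simp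
      moreover have "(if mate G g' \<in> legs then Inr (mate G g') else Inl (mate G g'), Inl (mate H g)) \<in> full_rel"
        using leg[OF m] sym_full g'(3) by (metis symD)
      ultimately show ?thesis by (meson rtrancl_trans)
    qed
  qed
  have glue: "(Inl g, Inl (k g)) \<in> full_rel" if "g \<in> halves_at T" for g
  proof -
    have "(Inl g, Inl (k g)) \<in> inner_pairs G Q I x T k" using that by (rule inner_pairsI)
    then show ?thesis by (intro r_into_rtrancl) simp
  qed
  show "(Inl h, Inl h') \<in> full_rel" if "(h, h') \<in> splice_rel T k H"
    using that[unfolded splice_rel_eq]
  proof (induction rule: rtrancl_induct)
    case (step g g')
    have "(Inl g, Inl g') \<in> full_rel"
      using step.hyps(2) mate' glue verts_H unfolding mate_pairs_def glue_pairs_def by auto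
    with step.IH show ?case by (rule rtrancl_trans)
  qed simp
qed

text \<open>Each leg is connected to a half-edge of \<open>H\<close>, so the added leg points
  subdivide components without creating new ones.\<close>

lemma card_circles_eq_full:
  "card {c \<in> halves H // splice_rel T k H. c \<subseteq> halves_at T} =
    card {c \<in> points // full_rel. c \<subseteq> Inl ` halves_at T \<union> Inr ` legs}"
proof -
  let ?N = "Inl ` halves G :: (half_edge + half_edge) set"
  let ?W = "Inl ` halves_at T \<union> Inr ` legs"
  let ?R = "outer_pairs G Q I \<union> inner"
  have "card {c \<in> points // ({} \<union> ?R)\<^sup>*. c \<subseteq> ?W} =
      card {c \<in> ?N // ({} \<union> (?R\<^sup>* \<inter> ?N \<times> ?N))\<^sup>*. c \<subseteq> ?W} + card {c \<in> points // ?R\<^sup>*. c \<subseteq> points - ?N}"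
  proof (rule card_components_contract)
    show "?R \<subseteq> points \<times> points" by (rule generators_subset)
    show "sym ?R" by (rule sym_generators)
    have "finite (halves_at Q)" using Q finite_verts[OF G] finite_subset by blast
    then show "finite points" using finite_halves[OF G] by blast
  qed (auto simp: sym_def)
  moreover have "{c \<in> points // ?R\<^sup>*. c \<subseteq> points - ?N} = {}"
  proof -
    have False if c: "c \<in> points // ?R\<^sup>*" "c \<subseteq> points - ?N" for c
    proof -
      obtain p where p: "c = ?R\<^sup>* `` {p}" "p \<in> points" using c(1) by (rule quotientE)
      then obtain e where e: "p = Inr e" "e \<in> legs" using c(2) by blast
      then have "(Inr e, Inl (x e)) \<in> inner_pairs G Q I x T k" by (intro inner_pairsI)
      then have "Inl (x e) \<in> c" unfolding p e by blast
      moreover have "x e \<in> halves G" using e x_halves Q by blast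
      ultimately show False using c(2) by blast
    qed
    then show ?thesis by blast
  qed
  moreover have E: "(?R\<^sup>* \<inter> ?N \<times> ?N)\<^sup>* `` {Inl h} = Inl ` (splice_rel T k H `` {h})" if h: "h \<in> halves G" for h
  proof -
    have "(p, q) \<in> ?R\<^sup>*" if "(p, q) \<in> (?R\<^sup>* \<inter> ?N \<times> ?N)\<^sup>*" for p q
      using that by (induction) (auto intro: rtrancl_trans)
    moreover have "q \<in> ?N" if "(Inl h, q) \<in> (?R\<^sup>* \<inter> ?N \<times> ?N)\<^sup>*" for q
      using rtrancl_subset_Times[OF _ that] h by blast
    moreover have "(Inl h, Inl h') \<in> ?R\<^sup>* \<inter> ?N \<times> ?N" if "(h, h') \<in> splice_rel T k H" for h'
    proof -
      have "h' \<in> halves G" using splice_rel_halves[OF H k TH that] h verts_H by simp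
      then show ?thesis using splice_rel_iff_full[OF h] that h by blast
    qed
    ultimately show ?thesis using splice_rel_iff_full[OF h] h by blast
  qed
  have "bij_betw (image Inl) {c \<in> halves H // splice_rel T k H. c \<subseteq> halves_at T}
      {c \<in> ?N // (?R\<^sup>* \<inter> ?N \<times> ?N)\<^sup>*. c \<subseteq> ?W}"
  proof (rule bij_betw_imageI)
    show "inj_on (image Inl) {c \<in> halves H // splice_rel T k H. c \<subseteq> halves_at T}"
      by (rule inj_onI) (simp add: inj_image_eq_iff)
    show "image Inl ` {c \<in> halves H // splice_rel T k H. c \<subseteq> halves_at T} =
        {c \<in> ?N // (?R\<^sup>* \<inter> ?N \<times> ?N)\<^sup>*. c \<subseteq> ?W}" (is "?l = ?r")
    proof (intro equalityI subsetI)
      fix d assume "d \<in> ?l"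
      then obtain c h where c: "d = Inl ` c" "c \<subseteq> halves_at T" "c = splice_rel T k H `` {h}" "h \<in> halves G"
        using verts_H by (auto elim!: quotientE)
      then have "d = (?R\<^sup>* \<inter> ?N \<times> ?N)\<^sup>* `` {Inl h}" using E by simp
      moreover have "Inl h \<in> ?N" using c by simp
      ultimately have "d \<in> ?N // (?R\<^sup>* \<inter> ?N \<times> ?N)\<^sup>*" by (simp only: quotientI)
      then show "d \<in> ?r" using c(1,2) by blast
    next
      fix d assume d: "d \<in> ?r"
      then obtain h where h: "h \<in> halves G" "d = Inl ` (splice_rel T k H `` {h})"
        using E by (auto elim!: quotientE)
      then have "splice_rel T k H `` {h} \<subseteq> halves_at T" using d by blast
      then show "d \<in> ?l" using h verts_H by (auto intro!: quotientI)
    qed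
  qed
  ultimately show ?thesis using bij_betw_same_card by fastforce
qed

text \<open>Contracting the filling splits the new circles into those that run through legs and
  those closed up inside the filling. The first number sees the filling only through the connections
  that it makes between \<open>ends\<close>.\<close>

lemma card_circles_eq:
  "card {c \<in> halves H // splice_rel T k H. c \<subseteq> halves_at T} =
    card {c \<in> ends // (outer_pairs G Q I \<union> (inner\<^sup>* \<inter> ends \<times> ends))\<^sup>*. c \<subseteq> Inr ` legs} +
    card {c \<in> points // inner\<^sup>*. c \<subseteq> Inl ` halves_at T}"
proof -
  let ?W = "Inl ` halves_at T \<union> Inr ` legs :: (half_edge + half_edge) set"
  let ?E' = "(outer_pairs G Q I \<union> (inner\<^sup>* \<inter> ends \<times> ends))\<^sup>*"
  have diff: "points - ends = Inl ` halves_at T"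
    using T Q by (auto simp: image_iff)
  have "card {c \<in> points // full_rel. c \<subseteq> ?W} =
      card {c \<in> ends // ?E'. c \<subseteq> ?W} + card {c \<in> points // inner\<^sup>*. c \<subseteq> points - ends}"
  proof (rule card_components_contract)
    show "outer_pairs G Q I \<subseteq> ends \<times> ends" using outer_subset by blast
    show "inner \<subseteq> points \<times> points" using generators_subset by blast
    show "ends \<subseteq> points" using Q by auto
    have "finite (halves_at Q)" using Q finite_verts[OF G] finite_subset by blast
    then show "finite points" using finite_halves[OF G] by blast
    show "points - ends \<subseteq> ?W" using diff by blast
  qed (use sym_outer in \<open>auto simp: sym_def\<close>)
  moreover have "{c \<in> ends // ?E'. c \<subseteq> ?W} = {c \<in> ends // ?E'. c \<subseteq> Inr ` legs}"
  proof -
    have "c \<subseteq> ends" if "c \<in> ends // ?E'" for c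
      by (rule quotient_rtrancl_subset[OF _ that]) (use outer_subset in blast)
    moreover have "ends \<inter> ?W = Inr ` legs" using T by auto
    ultimately show ?thesis by blast
  qed
  ultimately show ?thesis using card_circles_eq_full diff by simp
qed

text \<open>The same contraction shows that the new mates, too, depend on the filling only through
  its connections between \<open>ends\<close>.\<close>

lemma splice_rel_iff_ends:
  assumes "h \<in> halves_at (verts G - T)" "h' \<in> halves_at (verts G - T)"
  shows "(h, h') \<in> splice_rel T k H \<longleftrightarrow>
    (Inl h, Inl h') \<in> (outer_pairs G Q I \<union> (inner\<^sup>* \<inter> ends \<times> ends))\<^sup>*"
proof -
  have e: "Inl h \<in> ends" "Inl h' \<in> ends" using assms by auto
  have "h \<in> halves G" "h' \<in> halves G" using assms by auto
  then have "(h, h') \<in> splice_rel T k H \<longleftrightarrow> (Inl h, Inl h') \<in> full_rel"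
    by (rule splice_rel_iff_full)
  also have "\<dots> \<longleftrightarrow> (Inl h, Inl h') \<in> (outer_pairs G Q I \<union> (inner\<^sup>* \<inter> ends \<times> ends))\<^sup>*"
    by (rule rtrancl_Un_restrict_iff[OF _ e]) (use outer_subset in blast)
  finally show ?thesis .
qed

end

end

section \<open>Transport of connections and components along a bijection\<close>

lemma rtrancl_bij_iff:
  assumes bij: "bij_betw \<Phi> N N'" and R: "R \<subseteq> N \<times> N" and R': "R' \<subseteq> N' \<times> N'"
    and iff: "\<And>p q. p \<in> N \<Longrightarrow> q \<in> N \<Longrightarrow> (p, q) \<in> R \<longleftrightarrow> (\<Phi> p, \<Phi> q) \<in> R'"
    and p: "p \<in> N" and q: "q \<in> N"
  shows "(p, q) \<in> R\<^sup>* \<longleftrightarrow> (\<Phi> p, \<Phi> q) \<in> R'\<^sup>*"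
proof
  show "(\<Phi> p, \<Phi> q) \<in> R'\<^sup>*" if "(p, q) \<in> R\<^sup>*"
    using that
  proof (induction rule: rtrancl_induct)
    case (step y z)
    then have "(\<Phi> y, \<Phi> z) \<in> R'" using iff R by blast
    with step.IH show ?case by (rule rtrancl.rtrancl_into_rtrancl)
  qed simp
  have "\<exists>q\<in>N. \<Phi> q = q' \<and> (p, q) \<in> R\<^sup>*" if "(\<Phi> p, q') \<in> R'\<^sup>*" for q'
    using that
  proof (induction rule: rtrancl_induct)
    case base
    then show ?case using p by blast
  next
    case (step y' z')
    then obtain y where y: "y \<in> N" "\<Phi> y = y'" "(p, y) \<in> R\<^sup>*" by blast
    have "z' \<in> N'" using step.hyps R' by blast
    then obtain z where z: "z \<in> N" "\<Phi> z = z'" using bij by (metis bij_betw_imp_surj_on imageE)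
    then have "(y, z) \<in> R" using iff y step.hyps by blast
    then have "(p, z) \<in> R\<^sup>*" using y by (meson rtrancl.rtrancl_into_rtrancl)
    then show ?case using z by blast
  qed
  then show "(p, q) \<in> R\<^sup>*" if "(\<Phi> p, \<Phi> q) \<in> R'\<^sup>*"
    using that q bij_betw_imp_inj_on[OF bij] by (metis inj_onD)
qed

lemma card_components_bij:
  assumes bij: "bij_betw \<Phi> N N'" and R: "R \<subseteq> N \<times> N" and R': "R' \<subseteq> N' \<times> N'"
    and iff: "\<And>p q. p \<in> N \<Longrightarrow> q \<in> N \<Longrightarrow> (p, q) \<in> R \<longleftrightarrow> (\<Phi> p, \<Phi> q) \<in> R'"
    and L: "L \<subseteq> N" "\<Phi> ` L = L'"
  shows "card {c \<in> N // R\<^sup>*. c \<subseteq> L} = card {c \<in> N' // R'\<^sup>*. c \<subseteq> L'}"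
proof -
  have N: "R\<^sup>* `` {p} \<subseteq> N" if "p \<in> N" for p using rtrancl_subset_Times[OF R _ that] by blast
  have N': "R'\<^sup>* `` {p} \<subseteq> N'" if "p \<in> N'" for p using rtrancl_subset_Times[OF R' _ that] by blast
  have im: "R'\<^sup>* `` {\<Phi> p} = \<Phi> ` (R\<^sup>* `` {p})" if p: "p \<in> N" for p
  proof -
    have "\<Phi> p \<in> N'" using bij p by (rule bij_betwE[rule_format])
    then have "R'\<^sup>* `` {\<Phi> p} \<subseteq> \<Phi> ` N" using N' bij_betw_imp_surj_on[OF bij] by metis
    then show ?thesis using rtrancl_bij_iff[OF bij R R' iff p] N[OF p] by (auto simp: subset_iff image_iff)
  qed
  have inj: "inj_on \<Phi> N" using bij by (rule bij_betw_imp_inj_on)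
  have "bij_betw (image \<Phi>) {c \<in> N // R\<^sup>*. c \<subseteq> L} {c \<in> N' // R'\<^sup>*. c \<subseteq> L'}"
  proof (rule bij_betw_imageI)
    show "inj_on (image \<Phi>) {c \<in> N // R\<^sup>*. c \<subseteq> L}"
    proof (rule inj_onI)
      fix c d assume "c \<in> {c \<in> N // R\<^sup>*. c \<subseteq> L}" "d \<in> {c \<in> N // R\<^sup>*. c \<subseteq> L}" "\<Phi> ` c = \<Phi> ` d"
      moreover from this have "c \<subseteq> N" "d \<subseteq> N" using L(1) by blast+
      ultimately show "c = d" using inj_on_image_eq_iff[OF inj] by blast
    qed
    show "image \<Phi> ` {c \<in> N // R\<^sup>*. c \<subseteq> L} = {c \<in> N' // R'\<^sup>*. c \<subseteq> L'}" (is "?l = ?r")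
    proof (intro equalityI subsetI)
      fix d assume "d \<in> ?l"
      then obtain p where p: "p \<in> N" "d = \<Phi> ` (R\<^sup>* `` {p})" "R\<^sup>* `` {p} \<subseteq> L" by (auto elim!: quotientE)
      have "\<Phi> p \<in> N'" using bij p(1) by (rule bij_betwE[rule_format])
      moreover have "d = R'\<^sup>* `` {\<Phi> p}" using im p by simp
      ultimately show "d \<in> ?r" using p L(2) by (auto intro: quotientI)
    next
      fix d assume d: "d \<in> ?r"
      then obtain p' where p': "p' \<in> N'" "d = R'\<^sup>* `` {p'}" by (auto elim!: quotientE)
      then obtain p where p: "p \<in> N" "p' = \<Phi> p" using bij by (metis bij_betw_imp_surj_on imageE)
      then have dp: "d = \<Phi> ` (R\<^sup>* `` {p})" using im p' by simp
      then have "R\<^sup>* `` {p} \<subseteq> L"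
      proof -
        have "\<Phi> q \<in> \<Phi> ` L \<Longrightarrow> q \<in> N \<Longrightarrow> q \<in> L" for q using L(1) inj inj_onD by fastforce
        then show ?thesis using d L(2) dp N[OF p(1)] by blast
      qed
      then show "d \<in> ?l" using dp p by (auto intro: quotientI)
    qed
  qed
  then show ?thesis by (rule bij_betw_same_card)
qed

definition inner_rel ::
  "fgraph \<Rightarrow> nat set \<Rightarrow> half_edge set \<Rightarrow> (half_edge \<Rightarrow> half_edge) \<Rightarrow> nat set \<Rightarrow>
    (half_edge \<Rightarrow> half_edge) \<Rightarrow> ((half_edge + half_edge) \<times> (half_edge + half_edge)) set" where
  "inner_rel G Q I x T k = (inner_pairs G Q I x T k \<union> (inner_pairs G Q I x T k)\<inverse>)\<^sup>*"

context local_part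
begin

lemma local_part_id: "local_part G G Q I id"
  by unfold_locales (use G Q I mate_I in auto)

text \<open>The hypothesis \<open>rel\<close> transports the contracted filling; together with the
  common outer pairs it fixes the mates and the circles through legs. The remaining circles are
  closed inside the fillings and are compared by \<open>count\<close>, with m and n making up the
  difference.\<close>

theorem replace:
  assumes U: "U \<subseteq> Q" "gluing U j" and T: "T \<subseteq> Q" "gluing T k"
    and bij: "bij_betw \<phi> (halves_at (Q - U)) (halves_at (Q - T))"
    and vertex: "\<And>h h'. h \<in> halves_at (Q - U) \<Longrightarrow> h' \<in> halves_at (Q - U) \<Longrightarrow>
      fst (\<phi> h) = fst (\<phi> h') \<longleftrightarrow> fst h = fst h'"
    and opp: "\<And>h. h \<in> halves_at (Q - U) \<Longrightarrow> \<phi> (opposite h) = opposite (\<phi> h)"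
    and rel: "\<And>p q. p \<in> Inr ` legs \<union> Inl ` halves_at (Q - U) \<Longrightarrow> q \<in> Inr ` legs \<union> Inl ` halves_at (Q - U) \<Longrightarrow>
      (p, q) \<in> inner_rel G Q I id U j \<longleftrightarrow>
      (map_sum \<phi> id p, map_sum \<phi> id q) \<in> inner_rel G Q I x T k"
    and count: "card {c \<in> points // inner_rel G Q I id U j. c \<subseteq> Inl ` halves_at U} + m =
      card {c \<in> points // inner_rel G Q I x T k. c \<subseteq> Inl ` halves_at T} + n"
    and circles: "circles H = circles G"
  shows "framed_iso (splice U j G\<lparr>circles := circles (splice U j G) + m\<rparr>)
    (splice T k H\<lparr>circles := circles (splice T k H) + n\<rparr>)"
proof -
  interpret id: local_part G G Q I id by (rule local_part_id)
  \<comment> \<open>Outside the local part the isomorphism is the identity; on the points of the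
    contracted relation it also fixes every leg.\<close>
  define \<psi> where "\<psi> h = (if h \<in> halves_at Q then \<phi> h else h)" for h
  define \<Phi> where "\<Phi> = map_sum \<psi> (id :: half_edge \<Rightarrow> half_edge)"
  let ?A = "outer_pairs G Q I"
  let ?B1 = "inner_pairs G Q I id U j \<union> (inner_pairs G Q I id U j)\<inverse>"
  let ?B2 = "inner_pairs G Q I x T k \<union> (inner_pairs G Q I x T k)\<inverse>"
  let ?O = "Inl ` halves_at (verts G - Q)" and ?L = "Inr ` legs"
  let ?N1 = "?O \<union> ?L \<union> Inl ` halves_at (Q - U)"
  let ?N2 = "?O \<union> ?L \<union> Inl ` halves_at (Q - T)"
  let ?R1 = "?A \<union> (?B1\<^sup>* \<inter> ?N1 \<times> ?N1)" and ?R2 = "?A \<union> (?B2\<^sup>* \<inter> ?N2 \<times> ?N2)"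
  have QU: "Q - U \<subseteq> Q" "Q - T \<subseteq> Q" by auto
  have \<phi>_in: "\<phi> h \<in> halves_at (Q - T)" if "h \<in> halves_at (Q - U)" for h
    using bij that by (rule bij_betwE[rule_format])
  have \<psi>_out: "\<psi> h = h" if "h \<in> halves_at (verts G - Q)" for h using that by (auto simp: \<psi>_def)
  have \<psi>_in: "\<psi> h = \<phi> h" if "h \<in> halves_at (Q - U)" for h using that by (auto simp: \<psi>_def)
  have split: "halves_at (verts G - V) = halves_at (verts G - Q) \<union> halves_at (Q - V)" if "V \<subseteq> Q" for V
    using that Q by auto
  have disj: "halves_at (verts G - Q) \<inter> halves_at (Q - V) = {}" for V by auto
  have bij\<psi>: "bij_betw \<psi> (halves_at (verts G - U)) (halves_at (verts G - T))"
    unfolding split[OF U(1)] split[OF T(1)]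
  proof (rule bij_betw_combine[OF _ _ disj])
    show "bij_betw \<psi> (halves_at (verts G - Q)) (halves_at (verts G - Q))"
      using bij_betw_cong[of "halves_at (verts G - Q)" \<psi> id] \<psi>_out by simp
    show "bij_betw \<psi> (halves_at (Q - U)) (halves_at (Q - T))"
      using bij_betw_cong[of "halves_at (Q - U)" \<psi> \<phi>] \<psi>_in bij by simp
  qed
  have N: "?N1 = Inl ` halves_at (verts G - U) \<union> ?L" "?N2 = Inl ` halves_at (verts G - T) \<union> ?L"
    unfolding split[OF U(1)] split[OF T(1)] by blast+
  have \<Phi>: "bij_betw \<Phi> ?N1 ?N2"
    unfolding N
  proof (rule bij_betw_imageI)
    show "inj_on \<Phi> (Inl ` halves_at (verts G - U) \<union> ?L)"
      using bij_betw_imp_inj_on[OF bij\<psi>] unfolding \<Phi>_def inj_on_def by auto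
    have "\<Phi> ` Inl ` halves_at (verts G - U) = Inl ` (\<psi> ` halves_at (verts G - U))"
      by (simp add: image_image \<Phi>_def)
    moreover have "\<Phi> ` ?L = ?L" by (simp add: image_image \<Phi>_def)
    ultimately show "\<Phi> ` (Inl ` halves_at (verts G - U) \<union> ?L) = Inl ` halves_at (verts G - T) \<union> ?L"
      using bij_betw_imp_surj_on[OF bij\<psi>] by (simp add: image_Un)
  qed
  have \<Phi>_O: "\<Phi> p = p" if "p \<in> ?O \<union> ?L" for p
    using that \<psi>_out by (auto simp: \<Phi>_def)
  have \<Phi>_I: "\<Phi> p = map_sum \<phi> id p" if "p \<in> ?L \<union> Inl ` halves_at (Q - U)" for p
    using that \<psi>_in by (auto simp: \<Phi>_def)
  have A: "?A \<subseteq> (?O \<union> ?L) \<times> (?O \<union> ?L)" by (rule outer_subset)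
  have B1: "?B1 \<subseteq> (Inl ` halves_at Q \<union> ?L) \<times> (Inl ` halves_at Q \<union> ?L)"
    by (rule id.inner_sub[OF U])
  have B2: "?B2 \<subseteq> (Inl ` halves_at Q \<union> ?L) \<times> (Inl ` halves_at Q \<union> ?L)"
    by (rule inner_sub[OF T])
  \<comment> \<open>No inner pair touches a half-edge outside \<open>Q\<close>, so a path of inner
    pairs from such a point is constant.\<close>
  have fixB: "p = q" if "(p, q) \<in> B\<^sup>*" "p \<in> ?O" "B \<subseteq> (Inl ` halves_at Q \<union> ?L) \<times> (Inl ` halves_at Q \<union> ?L)" for B p q
    using that(1,2) by (cases rule: converse_rtranclE) (use that(3) in auto)
  have fixB': "p = q" if "(p, q) \<in> B\<^sup>*" "q \<in> ?O" "B \<subseteq> (Inl ` halves_at Q \<union> ?L) \<times> (Inl ` halves_at Q \<union> ?L)" for B p q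
    using that(1,2) by (cases rule: rtranclE) (use that(3) in auto)
  have iffB: "(p, q) \<in> ?B1\<^sup>* \<longleftrightarrow> (\<Phi> p, \<Phi> q) \<in> ?B2\<^sup>*" if pq: "p \<in> ?N1" "q \<in> ?N1" for p q
  proof -
    consider "p \<in> ?O" | "q \<in> ?O" | "p \<in> ?L \<union> Inl ` halves_at (Q - U)" "q \<in> ?L \<union> Inl ` halves_at (Q - U)"
      using pq by blast
    then show ?thesis
    proof cases
      case 1
      then have "(p, q) \<in> ?B1\<^sup>* \<longleftrightarrow> p = q" "(\<Phi> p, \<Phi> q) \<in> ?B2\<^sup>* \<longleftrightarrow> \<Phi> p = \<Phi> q"
        using fixB[OF _ _ B1] fixB[OF _ _ B2, of "\<Phi> p"] \<Phi>_O[of p] by auto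
      then show ?thesis using bij_betw_imp_inj_on[OF \<Phi>] pq by (metis inj_onD)
    next
      case 2
      then have "(p, q) \<in> ?B1\<^sup>* \<longleftrightarrow> p = q" "(\<Phi> p, \<Phi> q) \<in> ?B2\<^sup>* \<longleftrightarrow> \<Phi> p = \<Phi> q"
        using fixB'[OF _ _ B1] fixB'[OF _ _ B2, of _ "\<Phi> q"] \<Phi>_O[of q] by auto
      then show ?thesis using bij_betw_imp_inj_on[OF \<Phi>] pq by (metis inj_onD)
    next
      case 3
      then show ?thesis using rel \<Phi>_I unfolding inner_rel_def by simp
    qed
  qed
  have iffA: "(p, q) \<in> ?A \<longleftrightarrow> (\<Phi> p, \<Phi> q) \<in> ?A" if pq: "p \<in> ?N1" "q \<in> ?N1" for p q
  proof -
    have OL: "p \<in> ?O \<union> ?L" if p: "\<Phi> p \<in> ?O \<union> ?L" "p \<in> ?N1" for p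
    proof (rule ccontr)
      assume "p \<notin> ?O \<union> ?L"
      then obtain h where "p = Inl h" "h \<in> halves_at (Q - U)" using p by blast
      then have "\<Phi> p = Inl (\<phi> h)" "\<phi> h \<in> halves_at (Q - T)" using \<Phi>_I \<phi>_in by auto
      then show False using p(1) by auto
    qed
    show ?thesis
    proof
      assume a: "(p, q) \<in> ?A"
      then have "p \<in> ?O \<union> ?L" "q \<in> ?O \<union> ?L" using A by blast+
      then show "(\<Phi> p, \<Phi> q) \<in> ?A" using a by (simp only: \<Phi>_O)
    next
      assume a: "(\<Phi> p, \<Phi> q) \<in> ?A"
      then have "\<Phi> p \<in> ?O \<union> ?L" "\<Phi> q \<in> ?O \<union> ?L" using A by blast+
      from this(1) this(2) have "p \<in> ?O \<union> ?L" "q \<in> ?O \<union> ?L"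
        by (simp_all only: OL[OF _ pq(1)] OL[OF _ pq(2)])
      then show "(p, q) \<in> ?A" using a by (simp only: \<Phi>_O)
    qed
  qed
  have iff: "(p, q) \<in> ?R1 \<longleftrightarrow> (\<Phi> p, \<Phi> q) \<in> ?R2" if pq: "p \<in> ?N1" "q \<in> ?N1" for p q
  proof -
    have "\<Phi> p \<in> ?N2" "\<Phi> q \<in> ?N2" using bij_betwE[OF \<Phi>] pq by blast+
    then show ?thesis using iffA[OF pq] iffB[OF pq] pq by (simp only: Un_iff Int_iff mem_Sigma_iff)
  qed
  have R: "?R1 \<subseteq> ?N1 \<times> ?N1" "?R2 \<subseteq> ?N2 \<times> ?N2" using A by blast+
  have cR: "card {c \<in> ?N1 // ?R1\<^sup>*. c \<subseteq> ?L} = card {c \<in> ?N2 // ?R2\<^sup>*. c \<subseteq> ?L}"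
    by (rule card_components_bij[OF \<Phi> R iff]) (auto simp: \<Phi>_def image_image)
  have circ: "circles (splice U j G) + m = circles (splice T k H) + n"
    using id.card_circles_eq[OF U] card_circles_eq[OF T] cR count circles
    by (simp add: circles_splice inner_rel_def)
  show ?thesis
  proof (rule framed_iso_spliceI)
    show "U \<subseteq> verts G" "T \<subseteq> verts H" using U T Q verts_H by auto
    show "bij_betw \<psi> (halves_at (verts G - U)) (halves_at (verts H - T))"
      using bij\<psi> verts_H by simp
    show "circles (splice U j G) + m = circles (splice T k H) + n" by (rule circ)
    fix h assume h: "h \<in> halves_at (verts G - U)"
    have op: "opposite h \<in> halves_at V \<longleftrightarrow> h \<in> halves_at V" for V by (cases h) auto
    show "\<psi> (opposite h) = opposite (\<psi> h)"
    proof (cases "h \<in> halves_at Q")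
      case True
      then have "h \<in> halves_at (Q - U)" using h by auto
      then show ?thesis using opp True op[of Q] unfolding \<psi>_def by simp
    next
      case False
      then show ?thesis using op[of Q] unfolding \<psi>_def by simp
    qed
    fix h' assume h': "h' \<in> halves_at (verts G - U)"
    show "fst (\<psi> h) = fst (\<psi> h') \<longleftrightarrow> fst h = fst h'"
    proof -
      have "fst (\<psi> h) \<in> Q \<longleftrightarrow> fst h \<in> Q" if "h \<in> halves_at (verts G - U)" for h
      proof (cases "fst h \<in> Q")
        case True
        then have "h \<in> halves_at (Q - U)" using that by auto
        then have "\<psi> h = \<phi> h" "\<phi> h \<in> halves_at (Q - T)" using \<psi>_in \<phi>_in by auto
        then show ?thesis using True by auto
      next
        case False
        then show ?thesis by (auto simp: \<psi>_def)
      qed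
      then have Qiff: "fst (\<psi> h) \<in> Q \<longleftrightarrow> fst h \<in> Q" "fst (\<psi> h') \<in> Q \<longleftrightarrow> fst h' \<in> Q"
        using h h' by auto
      show ?thesis
      proof (cases "fst h \<in> Q \<and> fst h' \<in> Q")
        case True
        then have "h \<in> halves_at (Q - U)" "h' \<in> halves_at (Q - U)" using h h' by auto
        then show ?thesis using vertex \<psi>_in by simp
      next
        case False
        then consider "fst h \<notin> Q" "fst h' \<notin> Q" | "fst h \<in> Q \<longleftrightarrow> fst h' \<notin> Q" by blast
        then show ?thesis
        proof cases
          case 1
          then have "\<psi> h = h" "\<psi> h' = h'" by (auto simp: \<psi>_def)
          then show ?thesis by simp
        next
          case 2
          then show ?thesis using Qiff by metis
        qed
      qed
    qed
    assume "(h, h') \<in> splice_rel U j G"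
    then have "(Inl h, Inl h') \<in> ?R1\<^sup>*"
      using id.splice_rel_iff_ends[OF U h h'] by blast
    moreover have "Inl h \<in> ?N1" "Inl h' \<in> ?N1" unfolding N(1) using h h' by simp_all
    ultimately have "(\<Phi> (Inl h), \<Phi> (Inl h')) \<in> ?R2\<^sup>*"
      by (simp only: rtrancl_bij_iff[OF \<Phi> R iff])
    then show "(\<psi> h, \<psi> h') \<in> splice_rel T k H"
      using splice_rel_iff_ends[OF T, of "\<psi> h" "\<psi> h'"] bij_betwE[OF bij\<psi>] h h'
      by (simp add: \<Phi>_def)
  qed (use U T G H in auto)
qed

end

section \<open>Comparing local states by computation\<close>

type_synonym point = "half_edge + half_edge"

text \<open>Union-find with eager relabelling on an association list, simple enough to be evaluated
  by the simplifier: each edge gives the class of q the label of p.\<close>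

fun merge_labels :: "('a \<times> nat) list \<Rightarrow> 'a \<times> 'a \<Rightarrow> ('a \<times> nat) list" where
  "merge_labels ls (p, q) =
    (let a = the (map_of ls p); b = the (map_of ls q)
     in map (\<lambda>(z, l). (z, if l = b then a else l)) ls)"

definition labels :: "'a list \<Rightarrow> ('a \<times> 'a) list \<Rightarrow> ('a \<times> nat) list" where
  "labels ps es = foldl merge_labels (zip ps [0..<length ps]) es"

definition label :: "('a \<times> nat) list \<Rightarrow> 'a \<Rightarrow> nat" where
  "label ls p = the (map_of ls p)"

lemma map_fst_merge_labels: "map fst (merge_labels ls e) = map fst ls"
  by (cases e) (simp add: Let_def case_prod_unfold)

lemma label_merge_labels:
  assumes "z \<in> set (map fst ls)"
  shows "label (merge_labels ls (p, q)) z =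
    (if label ls z = label ls q then label ls p else label ls z)"
proof -
  obtain l where "map_of ls z = Some l" using assms by (metis map_of_eq_None_iff list.set_map not_None_eq)
  then show ?thesis
    by (simp add: label_def Let_def map_of_map case_prod_unfold[symmetric]
        map_of_map[where f = "\<lambda>l. if l = the (map_of ls q) then the (map_of ls p) else l"])
qed

text \<open>The relation R stands for the edges already processed. Relabelling is exactly the
  merging described by \<open>rtrancl_Un_pair_iff\<close>.\<close>

lemma label_eq_iff_aux:
  assumes "map fst ls = ps" "sym R" "set es \<subseteq> set ps \<times> set ps"
    and "\<And>p q. p \<in> set ps \<Longrightarrow> q \<in> set ps \<Longrightarrow> label ls p = label ls q \<longleftrightarrow> (p, q) \<in> R\<^sup>*"
    and "p \<in> set ps" "q \<in> set ps"
  shows "label (foldl merge_labels ls es) p = label (foldl merge_labels ls es) q \<longleftrightarrow>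
    (p, q) \<in> (R \<union> (set es \<union> (set es)\<inverse>))\<^sup>*"
  using assms
proof (induction es arbitrary: ls R p q)
  case (Cons e es)
  obtain a b where e: "e = (a, b)" by fastforce
  have ab: "a \<in> set ps" "b \<in> set ps" using Cons.prems(3) e by auto
  have lab: "label (merge_labels ls e) z = (if label ls z = label ls b then label ls a else label ls z)"
    if "z \<in> set ps" for z
    using label_merge_labels[of z ls a b] that Cons.prems(1) e by simp
  have symR: "(y, x) \<in> R\<^sup>*" if "(x, y) \<in> R\<^sup>*" for x y
    using that sym_rtrancl[OF Cons.prems(2)] by (metis symD)
  have "label (foldl merge_labels (merge_labels ls e) es) p = label (foldl merge_labels (merge_labels ls e) es) q \<longleftrightarrow>
    (p, q) \<in> ((R \<union> {(a, b), (b, a)}) \<union> (set es \<union> (set es)\<inverse>))\<^sup>*"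
  proof (rule Cons.IH)
    show "map fst (merge_labels ls e) = ps" using Cons.prems(1) by (simp only: map_fst_merge_labels)
    show "sym (R \<union> {(a, b), (b, a)})" using Cons.prems(2) by (auto simp: sym_def)
    fix p q assume pq: "p \<in> set ps" "q \<in> set ps"
    note L = Cons.prems(4)
    show "label (merge_labels ls e) p = label (merge_labels ls e) q \<longleftrightarrow> (p, q) \<in> (R \<union> {(a, b), (b, a)})\<^sup>*"
      unfolding rtrancl_Un_pair_iff[OF Cons.prems(2)] lab[OF pq(1)] lab[OF pq(2)]
        L[OF pq, symmetric] L[OF pq(1) ab(1), symmetric] L[OF pq(1) ab(2), symmetric]
        L[OF ab(1) pq(2), symmetric] L[OF ab(2) pq(2), symmetric]
      by auto
  qed (use Cons.prems in auto)
  moreover have "(R \<union> {(a, b), (b, a)}) \<union> (set es \<union> (set es)\<inverse>) = R \<union> (set (e # es) \<union> (set (e # es))\<inverse>)"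
    using e by auto
  ultimately show ?case by simp
qed simp

lemma label_eq_iff:
  assumes "distinct ps" "set es \<subseteq> set ps \<times> set ps" "p \<in> set ps" "q \<in> set ps"
  shows "label (labels ps es) p = label (labels ps es) q \<longleftrightarrow> (p, q) \<in> (set es \<union> (set es)\<inverse>)\<^sup>*"
proof -
  have "label (zip ps [0..<length ps]) p = label (zip ps [0..<length ps]) q \<longleftrightarrow> (p, q) \<in> {}\<^sup>*"
    if "p \<in> set ps" "q \<in> set ps" for p q
  proof -
    have "label (zip ps [0..<length ps]) (ps ! i) = i" if "i < length ps" for i
      unfolding label_def using map_of_zip_nth[of ps "[0..<length ps]" i] assms(1) that by simp
    then show ?thesis using that by (auto simp: in_set_conv_nth)
  qed
  from label_eq_iff_aux[of "zip ps [0..<length ps]" ps "{}" es p q, OF _ _ assms(2) this assms(3,4)]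
  show ?thesis by (simp add: labels_def sym_def)
qed

text \<open>Common form of \<open>opposite\<close> and \<open>smoothing\<close>, so that one
  resolution can mix crossings that are passed straight through with smoothed ones. Such mixed
  resolutions arise when the bigon relation is applied inside a triangle.\<close>

definition glue :: "(nat \<Rightarrow> resolution option) \<Rightarrow> half_edge \<Rightarrow> half_edge" where
  "glue \<rho> = (\<lambda>(v, s, p). case \<rho> v of
      None \<Rightarrow> (v, s, other_port p)
    | Some r \<Rightarrow> (v, other_strand s, if r = Oriented then other_port p else p))"

lemma gluing_glue [simp]: "gluing S (glue \<rho>)"
  by (auto simp: gluing_def glue_def split: option.split)

text \<open>\<open>None\<close> stands for passing straight through the vertex.\<close>

definition resolve :: "nat set \<Rightarrow> (nat \<Rightarrow> resolution option) \<Rightarrow> fgraph \<Rightarrow> fgraph" where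
  "resolve Q \<rho> = splice {v \<in> Q. \<rho> v \<noteq> Some Vertex} (glue \<rho>)"

definition half_list :: "nat \<Rightarrow> half_edge list" where
  "half_list n = concat (map (\<lambda>v. [(v, Over, In), (v, Over, Out), (v, Under, In), (v, Under, Out)]) [0..<n])"

lemma set_half_list: "set (half_list n) = halves_at {..<n}"
proof -
  have "h \<in> set (half_list n) \<longleftrightarrow> fst h < n" for h
    by (cases h; cases "fst (snd h)"; cases "snd (snd h)") (auto simp: half_list_def)
  then show ?thesis by (auto simp: mem_Times_iff)
qed

lemma distinct_half_list: "distinct (half_list n)"
  by (induction n) (auto simp: half_list_def)

definition local_legs :: "nat \<Rightarrow> (half_edge \<times> half_edge) list \<Rightarrow> half_edge list" where
  "local_legs n es = filter (\<lambda>h. h \<notin> set (map fst es) \<and> h \<notin> set (map snd es)) (half_list n)"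

definition local_points :: "nat \<Rightarrow> (half_edge \<times> half_edge) list \<Rightarrow> point list" where
  "local_points n es = map Inl (half_list n) @ map Inr (local_legs n es)"

definition local_edges ::
  "nat \<Rightarrow> (half_edge \<times> half_edge) list \<Rightarrow> (half_edge \<Rightarrow> half_edge) \<Rightarrow> resolution option list \<Rightarrow>
    (point \<times> point) list" where
  "local_edges n es x rs =
    map (\<lambda>e. (Inr e, Inl (x e))) (local_legs n es) @
    map (\<lambda>(i, i'). (Inl (x i), Inl (x i'))) es @
    map (\<lambda>h. (Inl h, Inl (glue ((!) rs) h))) (filter (\<lambda>h. rs ! fst h \<noteq> Some Vertex) (half_list n))"

definition local_ends :: "nat \<Rightarrow> (half_edge \<times> half_edge) list \<Rightarrow> resolution option list \<Rightarrow> point list" where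
  "local_ends n es rs =
    map Inr (local_legs n es) @ map Inl (filter (\<lambda>h. rs ! fst h = Some Vertex) (half_list n))"

text \<open>A class of points that contains neither a leg nor a half-edge of a graphical vertex is a
  closed loop of the filling.\<close>

definition local_loops :: "point list \<Rightarrow> point list \<Rightarrow> (point \<times> nat) list \<Rightarrow> nat" where
  "local_loops ps ends ls =
    length (filter (\<lambda>l. l \<notin> set (map (label ls) ends)) (remdups (map (label ls) ps)))"

text \<open>A vertex correspondence lists for each vertex its image, whether the strands are exchanged,
  and whether the directions of the first and of the second strand are reversed.\<close>

definition rename_vertex :: "(nat \<times> bool \<times> bool \<times> bool) list \<Rightarrow> half_edge \<Rightarrow> half_edge" where
  "rename_vertex vm = (\<lambda>(v, s, p). case vm ! v of (v', b, b1, b2) \<Rightarrow>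
    (v', if b then other_strand s else s,
     if (case s of Over \<Rightarrow> b1 | Under \<Rightarrow> b2) then other_port p else p))"

text \<open>Executable form of the hypotheses of \<open>replace\<close>: the resolution
  \<open>rs\<close> of the original part is compared with \<open>ss\<close> after the edges are
  moved by \<open>x\<close>. The test on pairs of labels says that both resolutions induce the same
  partition of the ends, up to the renaming \<open>vm\<close>; \<open>d\<close> counts the surplus
  loops of \<open>rs\<close>.\<close>

definition local_check ::
  "nat \<Rightarrow> (half_edge \<times> half_edge) list \<Rightarrow> (half_edge \<Rightarrow> half_edge) \<Rightarrow> resolution option list \<Rightarrow>
    resolution option list \<Rightarrow> (nat \<times> bool \<times> bool \<times> bool) list \<Rightarrow> nat \<Rightarrow> bool" where
  "local_check n es x rs ss vm d \<longleftrightarrow>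
    (let ps = local_points n es; ends = local_ends n es rs;
         l1 = labels ps (local_edges n es id rs); l2 = labels ps (local_edges n es x ss);
         vs = filter (\<lambda>v. rs ! v = Some Vertex) [0..<n]; ws = filter (\<lambda>v. ss ! v = Some Vertex) [0..<n];
         vs' = map (\<lambda>v. fst (vm ! v)) vs;
         ends' = map (\<lambda>p. (label l1 p, label l2 (map_sum (rename_vertex vm) id p))) ends
     in distinct vs' \<and> set vs' = set ws \<and>
       (\<forall>(a, b)\<in>set ends'. \<forall>(a', b')\<in>set ends'. (a = a') = (b = b')) \<and>
       local_loops ps ends l1 = local_loops ps (local_ends n es ss) l2 + d)"

lemma rename_vertex_simps:
  "rename_vertex vm (opposite h) = opposite (rename_vertex vm h)"
  "fst (rename_vertex vm h) = fst (vm ! fst h)"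
  by (cases h; simp add: rename_vertex_def split: prod.split)+

lemma bij_betw_rename_vertex:
  assumes "bij_betw (\<lambda>v. fst (vm ! v)) V W"
  shows "bij_betw (rename_vertex vm) (halves_at V) (halves_at W)"
proof (rule bij_betw_imageI)
  show "inj_on (rename_vertex vm) (halves_at V)"
  proof (rule inj_onI)
    fix h h' assume h: "h \<in> halves_at V" "h' \<in> halves_at V" and eq: "rename_vertex vm h = rename_vertex vm h'"
    obtain v s p v' s' p' where h_eq: "h = (v, s, p)" "h' = (v', s', p')" by (metis prod.exhaust)
    have "fst (vm ! v) = fst (vm ! v')"
      using arg_cong[OF eq, of fst] by (simp add: rename_vertex_simps h_eq)
    then have "v = v'" using bij_betw_imp_inj_on[OF assms] h h_eq by (auto dest: inj_onD)
    then show "h = h'" using eq unfolding h_eq rename_vertex_def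
      by (cases s; cases s'; cases p; cases p') (auto split: prod.splits if_splits)
  qed
  show "rename_vertex vm ` halves_at V = halves_at W"
  proof (intro equalityI subsetI)
    fix h assume "h \<in> rename_vertex vm ` halves_at V"
    then obtain h0 where "h = rename_vertex vm h0" "fst h0 \<in> V" by auto
    then show "h \<in> halves_at W"
      using bij_betwE[OF assms] rename_vertex_simps(2)[of vm h0] by (simp add: mem_Times_iff)
  next
    fix h assume "h \<in> halves_at W"
    then obtain w s p where h: "h = (w, s, p)" "w \<in> W" by auto
    then obtain v where v: "v \<in> V" "w = fst (vm ! v)"
      using bij_betw_imp_surj_on[OF assms] by auto
    obtain b b1 b2 where vm: "vm ! v = (w, b, b1, b2)" using v by (metis prod.exhaust_sel)
    let ?s = "if b then other_strand s else s"
    have "h = rename_vertex vm (v, ?s, if (case ?s of Over \<Rightarrow> b1 | Under \<Rightarrow> b2) then other_port p else p)"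
      by (cases s) (simp_all add: h rename_vertex_def vm)
    then show "h \<in> rename_vertex vm ` halves_at V" using v by auto
  qed
qed

lemma components_inside_cong:
  "L \<subseteq> N \<Longrightarrow> N \<subseteq> P \<Longrightarrow> {c \<in> P // R\<^sup>*. c \<subseteq> L} = {c \<in> N // R\<^sup>*. c \<subseteq> L}"
proof (intro equalityI subsetI)
  fix c assume "L \<subseteq> N" "N \<subseteq> P" and c: "c \<in> {c \<in> P // R\<^sup>*. c \<subseteq> L}"
  then obtain p where p: "c = R\<^sup>* `` {p}" by (auto elim: quotientE)
  then have "p \<in> N" using c \<open>L \<subseteq> N\<close> by blast
  then show "c \<in> {c \<in> N // R\<^sup>*. c \<subseteq> L}" using p c by (auto intro: quotientI)
next
  fix c assume "L \<subseteq> N" "N \<subseteq> P" and c: "c \<in> {c \<in> N // R\<^sup>*. c \<subseteq> L}"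
  then show "c \<in> {c \<in> P // R\<^sup>*. c \<subseteq> L}" unfolding quotient_def by blast
qed

text \<open>A component lies inside L exactly when its label is not attained outside L.\<close>

lemma card_components_label:
  assumes iff: "\<And>p q. p \<in> N \<Longrightarrow> q \<in> N \<Longrightarrow> f p = f q \<longleftrightarrow> (p, q) \<in> R\<^sup>*" and R: "R \<subseteq> N \<times> N"
  shows "card {c \<in> N // R\<^sup>*. c \<subseteq> L} = card (f ` N - f ` (N - L))"
proof -
  have cls: "R\<^sup>* `` {p} = {q \<in> N. f q = f p}" if "p \<in> N" for p
    using rtrancl_subset_Times[OF R _ that] iff[OF that] by (auto simp: eq_commute[of "f p"])
  have "bij_betw (\<lambda>a. {q \<in> N. f q = a}) (f ` N - f ` (N - L)) {c \<in> N // R\<^sup>*. c \<subseteq> L}"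
  proof (rule bij_betw_imageI)
    show "inj_on (\<lambda>a. {q \<in> N. f q = a}) (f ` N - f ` (N - L))"
      by (rule inj_onI) blast
    show "(\<lambda>a. {q \<in> N. f q = a}) ` (f ` N - f ` (N - L)) = {c \<in> N // R\<^sup>*. c \<subseteq> L}" (is "?l = ?r")
    proof (intro equalityI subsetI)
      fix c assume "c \<in> ?l"
      then obtain p where p: "p \<in> N" "f p \<notin> f ` (N - L)" "c = {q \<in> N. f q = f p}" by blast
      have "q \<in> L" if "q \<in> N" "f q = f p" for q using p(2) that by (metis DiffI imageI)
      then have "c \<subseteq> L" using p(3) by blast
      moreover have "c \<in> N // R\<^sup>*" using p cls by (metis quotientI)
      ultimately show "c \<in> ?r" by blast
    next
      fix c assume c: "c \<in> ?r"
      then obtain p where p: "p \<in> N" "c = {q \<in> N. f q = f p}" using cls by (auto elim!: quotientE)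
      have "f p \<notin> f ` (N - L)"
      proof
        assume "f p \<in> f ` (N - L)"
        then obtain q where "f p = f q" "q \<in> N" "q \<notin> L" by blast
        then show False using c p(2) by auto
      qed
      then show "c \<in> ?l" using p by blast
    qed
  qed
  then show ?thesis by (rule bij_betw_same_card[symmetric])
qed

text \<open>The vertices \<open>vs\<close> of \<open>G\<close> are numbered by their positions, and \<open>es\<close> lists the edges between them.\<close>

locale numbered_part =
  fixes G H :: fgraph and vs :: "nat list" and es :: "(half_edge \<times> half_edge) list"
    and x :: "half_edge \<Rightarrow> half_edge" and x0 :: "half_edge \<Rightarrow> half_edge"
  assumes framed: "framed_graph G" "framed_graph H" and verts: "verts H = verts G"
    and circles: "circles H = circles G"
    and vs: "distinct vs" "set vs \<subseteq> verts G"
    and es: "\<And>i i'. (i, i') \<in> set es \<Longrightarrow>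
      fst i < length vs \<and> fst i' < length vs \<and> mate G (map_prod ((!) vs) id i) = map_prod ((!) vs) id i'"
    and invol: "\<And>h. x (x h) = h"
    and outside: "\<And>h. fst h \<notin> set vs \<Longrightarrow> x h = h"
    and x0: "\<And>h. fst h < length vs \<Longrightarrow> fst (x0 h) < length vs \<and> x (map_prod ((!) vs) id h) = map_prod ((!) vs) id (x0 h)"
    and mates: "\<And>h. h \<in> halves G \<Longrightarrow> mate H h = x (mate G (x h))"
begin

abbreviation "n \<equiv> length vs"
abbreviation "\<theta> \<equiv> map_prod ((!) vs) (id :: strand \<times> port \<Rightarrow> strand \<times> port)"
abbreviation "\<Theta> \<equiv> map_sum \<theta> \<theta>"
definition "internal = \<theta> ` (set (map fst es) \<union> set (map snd es))"

lemma inj_\<theta>: "inj_on \<theta> (halves_at {..<n})"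
  using vs(1) by (auto simp: inj_on_def nth_eq_iff_index_eq)

lemma image_\<theta>: "\<theta> ` (halves_at V) = halves_at ((!) vs ` V)"
  by (force simp: image_iff)

lemma nth_image: "(!) vs ` {..<n} = set vs"
  by (auto simp: set_conv_nth)

lemma bij_\<theta>: "bij_betw \<theta> (halves_at {..<n}) (halves_at (set vs))"
  unfolding bij_betw_def image_\<theta> nth_image using inj_\<theta> by simp

lemma es_halves: "set (map fst es) \<union> set (map snd es) \<subseteq> halves_at {..<n}"
  using es by (fastforce simp: mem_Times_iff)

lemma legs_eq: "halves_at (set vs) - internal = \<theta> ` set (local_legs n es)"
proof -
  have "\<theta> ` (halves_at {..<n} - (set (map fst es) \<union> set (map snd es))) =
      halves_at (set vs) - internal"
    unfolding internal_def using inj_on_image_set_diff[OF inj_\<theta> _ es_halves, of "halves_at {..<n}"]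
    by (simp add: image_\<theta> nth_image)
  moreover have "set (local_legs n es) = halves_at {..<n} - (set (map fst es) \<union> set (map snd es))"
    by (auto simp: local_legs_def set_half_list)
  ultimately show ?thesis by simp
qed

text \<open>Each listed edge contributes both of its ends to \<open>internal\<close>, which is
  therefore closed under taking mates.\<close>

sublocale local_part G H "set vs" internal x
proof
  show "x h \<in> halves_at (set vs)" if "h \<in> halves_at (set vs)" for h
  proof -
    have "h \<in> \<theta> ` halves_at {..<n}" using that bij_betw_imp_surj_on[OF bij_\<theta>] by simp
    then obtain g where g: "h = \<theta> g" "g \<in> halves_at {..<n}" by (rule imageE)
    then have "fst (x0 g) < n" "x h = \<theta> (x0 g)" using x0[of g] by (auto simp: mem_Times_iff)
    then show ?thesis by (cases "x0 g") simp
  qed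
  show "internal \<subseteq> halves_at (set vs)"
    unfolding internal_def using image_mono[OF es_halves, of \<theta>] image_\<theta> nth_image by auto
  show "mate G h \<in> internal" if h: "h \<in> internal" for h
  proof -
    obtain i i' where i: "(i, i') \<in> set es" "h = \<theta> i \<or> h = \<theta> i'"
      using h by (auto simp: internal_def)
    have "\<theta> i \<in> halves G" using es[OF i(1)] vs(2) by (cases i) auto
    then have "mate G (\<theta> i') = \<theta> i" using framed_graphD(3)[OF framed(1)] es[OF i(1)] by metis
    then have "mate G h \<in> {\<theta> i, \<theta> i'}" using i es[OF i(1)] by auto
    then show ?thesis using i(1) unfolding internal_def by force
  qed
qed (use framed verts vs invol outside mates in \<open>auto simp: mem_Times_iff\<close>)

end

locale numbered_resolution = numbered_part +
  fixes \<rho> :: "nat \<Rightarrow> resolution option" and rs :: "resolution option list"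
  assumes \<rho>: "map \<rho> vs = rs"
begin

abbreviation "ps \<equiv> local_points n es"
abbreviation "edge_list \<equiv> local_edges n es x0 rs"
abbreviation "edge_rel \<equiv> set edge_list \<union> (set edge_list)\<inverse>"
abbreviation "resolved \<equiv> {v \<in> set vs. \<rho> v \<noteq> Some Vertex}"
abbreviation "inner_gen \<equiv> inner_pairs G (set vs) internal x resolved (glue \<rho>) \<union>
  (inner_pairs G (set vs) internal x resolved (glue \<rho>))\<inverse>"

lemma rs_nth: "v < n \<Longrightarrow> rs ! v = \<rho> (vs ! v)"
  using \<rho> by auto

lemma glue_\<theta>: "fst h < n \<Longrightarrow> glue \<rho> (\<theta> h) = \<theta> (glue ((!) rs) h)"
  by (cases h) (auto simp: glue_def rs_nth split: option.split)

lemma fst_glue [simp]: "fst (glue r h) = fst h"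
  by (cases h) (auto simp: glue_def split: option.split)

lemma resolved_eq: "halves_at resolved = \<theta> ` {h \<in> halves_at {..<n}. rs ! fst h \<noteq> Some Vertex}"
proof -
  have "resolved = (!) vs ` {v. v < n \<and> rs ! v \<noteq> Some Vertex}"
    by (auto simp: rs_nth in_set_conv_nth)
  moreover have "{h \<in> halves_at {..<n}. rs ! fst h \<noteq> Some Vertex} = halves_at {v. v < n \<and> rs ! v \<noteq> Some Vertex}"
    by auto
  ultimately show ?thesis by (simp only: image_\<theta>)
qed

lemma set_ps: "set ps = Inl ` halves_at {..<n} \<union> Inr ` set (local_legs n es)"
  by (simp add: local_points_def set_half_list)

lemma distinct_ps: "distinct ps"
  by (auto simp: local_points_def local_legs_def distinct_map distinct_half_list)

lemma legs_sub: "set (local_legs n es) \<subseteq> halves_at {..<n}"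
  by (auto simp: local_legs_def set_half_list)

lemma edge_list_subset: "set edge_list \<subseteq> set ps \<times> set ps"
proof -
  have X: "x0 h \<in> halves_at {..<n}" if "h \<in> halves_at {..<n}" for h
    using x0[of h] that by (simp add: mem_Times_iff)
  have E: "fst e \<in> halves_at {..<n} \<and> snd e \<in> halves_at {..<n}" if "e \<in> set es" for e
    using es[of "fst e" "snd e"] that by (simp add: mem_Times_iff)
  have L: "h \<in> halves_at {..<n}" if "h \<in> set (local_legs n es)" for h
    using legs_sub that by (rule subsetD)
  have K: "glue r h \<in> halves_at {..<n}" if "h \<in> halves_at {..<n}" for r h
    using that by (simp add: mem_Times_iff)
  show ?thesis
    unfolding local_edges_def set_append set_map set_filter set_half_list set_ps
    by (intro Un_least image_subsetI)
      (use X E L K in \<open>simp_all add: image_iff case_prod_unfold mem_Times_iff del: mem_Sigma_iff\<close>)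
qed

lemma inj_\<Theta>: "inj_on \<Theta> (set ps)"
proof -
  have "inj_on \<theta> (set (local_legs n es))" using inj_\<theta> legs_sub by (rule inj_on_subset)
  then have "g = h" if "g \<in> set (local_legs n es)" "h \<in> set (local_legs n es)" "\<theta> g = \<theta> h" for g h
    using that by (simp only: inj_on_def)
  moreover have "g = h" if "g \<in> halves_at {..<n}" "h \<in> halves_at {..<n}" "\<theta> g = \<theta> h" for g h
    using that inj_\<theta> by (simp only: inj_on_def)
  ultimately show ?thesis
    unfolding set_ps
    by (intro inj_onI, elim UnE imageE) (simp_all only: map_sum.simps sum.inject sum.distinct)
qed

lemma image_\<Theta>: "\<Theta> ` set ps = Inl ` halves_at (set vs) \<union> Inr ` legs"
  unfolding set_ps legs_eq image_Un image_image map_sum.simps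
  using bij_betw_imp_surj_on[OF bij_\<theta>] by (simp add: image_image[symmetric, of Inl \<theta>] image_image[symmetric, of Inr \<theta>])

text \<open>The three kinds of inner pairs match the three parts of the edge list. An internal edge
  is listed once but occurs in \<open>inner_pairs\<close> from both ends, which is why symmetric
  closures are compared.\<close>

lemma inner_gen_eq: "inner_gen = map_prod \<Theta> \<Theta> ` edge_rel"
proof -
  let ?L = "set (local_legs n es)"
  have 1: "{(Inr e, Inl (x e)) | e. e \<in> halves_at (set vs) - internal} =
      map_prod \<Theta> \<Theta> ` set (map (\<lambda>e. (Inr e, Inl (x0 e))) (local_legs n es))"
  proof -
    have "{(Inr e, Inl (x e)) | e. e \<in> halves_at (set vs) - internal} =
        (\<lambda>e. (Inr (\<theta> e), Inl (x (\<theta> e)))) ` ?L"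
      unfolding legs_eq Setcompr_eq_image image_image by simp
    also have "\<dots> = (\<lambda>e. (Inr (\<theta> e), Inl (\<theta> (x0 e)))) ` ?L"
    proof (rule image_cong[OF refl])
      fix e assume "e \<in> ?L"
      then have "fst e < n" using legs_sub by (auto simp: mem_Times_iff)
      then show "(Inr (\<theta> e), Inl (x (\<theta> e))) = (Inr (\<theta> e), Inl (\<theta> (x0 e)))" using x0 by simp
    qed
    finally show ?thesis by (simp add: image_image)
  qed
  have 2: "{(Inl (x i), Inl (x (mate G i))) | i. i \<in> internal} =
      map_prod \<Theta> \<Theta> ` (set (map (\<lambda>(i, i'). (Inl (x0 i), Inl (x0 i'))) es) \<union>
        (set (map (\<lambda>(i, i'). (Inl (x0 i), Inl (x0 i'))) es))\<inverse>)" (is "?l = ?r")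
  proof -
    have m: "mate G (\<theta> (fst e)) = \<theta> (snd e)" "mate G (\<theta> (snd e)) = \<theta> (fst e)"
      "x (\<theta> (fst e)) = \<theta> (x0 (fst e))" "x (\<theta> (snd e)) = \<theta> (x0 (snd e))" if "e \<in> set es" for e
    proof -
      have e: "(fst e, snd e) \<in> set es" using that by simp
      have "\<theta> (fst e) \<in> halves G" using es[OF e] vs(2) by (cases "fst e") auto
      then show "mate G (\<theta> (fst e)) = \<theta> (snd e)" "mate G (\<theta> (snd e)) = \<theta> (fst e)"
        using framed_graphD(3)[OF framed(1)] es[OF e] by metis+
    qed (use es[of "fst e" "snd e"] x0 that in auto)
    let ?F = "\<lambda>i. (Inl (x i), Inl (x (mate G i)))" and ?g = "\<lambda>(i, i'). (Inl (x0 i), Inl (x0 i'))"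
    have swap: "A\<inverse> = prod.swap ` A" for A :: "(point \<times> point) set" by force
    have int: "internal = (\<lambda>e. \<theta> (fst e)) ` set es \<union> (\<lambda>e. \<theta> (snd e)) ` set es"
      by (simp add: internal_def image_Un image_image)
    have "?l = ?F ` internal" by (rule Setcompr_eq_image)
    also have "\<dots> = (\<lambda>e. ?F (\<theta> (fst e))) ` set es \<union> (\<lambda>e. ?F (\<theta> (snd e))) ` set es"
      by (simp add: int image_Un image_image)
    also have "(\<lambda>e. ?F (\<theta> (fst e))) ` set es = (\<lambda>e. map_prod \<Theta> \<Theta> (?g e)) ` set es"
      by (rule image_cong[OF refl]) (use m in \<open>simp add: case_prod_unfold\<close>)
    also have "(\<lambda>e. ?F (\<theta> (snd e))) ` set es = (\<lambda>e. map_prod \<Theta> \<Theta> (prod.swap (?g e))) ` set es"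
      by (rule image_cong[OF refl]) (use m in \<open>simp add: case_prod_unfold\<close>)
    finally show ?thesis by (simp only: swap set_map image_Un image_image)
  qed
  have 3: "{(Inl h, Inl (glue \<rho> h)) | h. h \<in> halves_at resolved} =
      map_prod \<Theta> \<Theta> ` set (map (\<lambda>h. (Inl h, Inl (glue ((!) rs) h))) (filter (\<lambda>h. rs ! fst h \<noteq> Some Vertex) (half_list n)))"
  proof -
    have "{(Inl h, Inl (glue \<rho> h)) | h. h \<in> halves_at resolved} =
      (\<lambda>h. (Inl (\<theta> h), Inl (glue \<rho> (\<theta> h)))) ` {h \<in> halves_at {..<n}. rs ! fst h \<noteq> Some Vertex}"
      unfolding resolved_eq Setcompr_eq_image image_image by (rule refl)
    also have "\<dots> = (\<lambda>h. (Inl (\<theta> h), Inl (\<theta> (glue ((!) rs) h)))) ` {h \<in> halves_at {..<n}. rs ! fst h \<noteq> Some Vertex}"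
      by (rule image_cong) (auto simp: glue_\<theta> mem_Times_iff)
    also have "\<dots> = map_prod \<Theta> \<Theta> ` set (map (\<lambda>h. (Inl h, Inl (glue ((!) rs) h))) (filter (\<lambda>h. rs ! fst h \<noteq> Some Vertex) (half_list n)))"
      by (simp add: image_image set_half_list)
    finally show ?thesis .
  qed
  have conv: "(map_prod \<Theta> \<Theta> ` A)\<inverse> = map_prod \<Theta> \<Theta> ` (A\<inverse>)" for A by force
  show ?thesis
    unfolding inner_pairs_def 1 2 3 local_edges_def set_append converse_Un conv image_Un converse_converse
    by blast
qed

lemma inner_rel_iff_label:
  assumes "p \<in> set ps" "q \<in> set ps"
  shows "(\<Theta> p, \<Theta> q) \<in> inner_rel G (set vs) internal x resolved (glue \<rho>) \<longleftrightarrow>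
    label (labels ps edge_list) p = label (labels ps edge_list) q"
proof -
  have "(p, q) \<in> edge_rel\<^sup>* \<longleftrightarrow> (\<Theta> p, \<Theta> q) \<in> inner_gen\<^sup>*"
  proof (rule rtrancl_bij_iff[OF _ _ _ _ assms])
    show "bij_betw \<Theta> (set ps) (\<Theta> ` set ps)" using inj_\<Theta> by (simp add: bij_betw_def)
    show sub: "edge_rel \<subseteq> set ps \<times> set ps" using edge_list_subset by blast
    then show "inner_gen \<subseteq> \<Theta> ` set ps \<times> \<Theta> ` set ps" unfolding inner_gen_eq by auto
    show "(p, q) \<in> edge_rel \<longleftrightarrow> (\<Theta> p, \<Theta> q) \<in> inner_gen" if "p \<in> set ps" "q \<in> set ps" for p q
    proof
      assume "(\<Theta> p, \<Theta> q) \<in> inner_gen"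
      then obtain p' q' where pq: "(p', q') \<in> edge_rel" "\<Theta> p = \<Theta> p'" "\<Theta> q = \<Theta> q'"
        unfolding inner_gen_eq by auto
      then have "p' \<in> set ps" "q' \<in> set ps" using sub by blast+
      then show "(p, q) \<in> edge_rel" using pq inj_onD[OF inj_\<Theta>] that by metis
    qed (simp only: inner_gen_eq map_prod_imageI)
  qed
  then show ?thesis
    unfolding inner_rel_def using label_eq_iff[OF distinct_ps edge_list_subset assms] by simp
qed

lemma card_loops:
  "card {c \<in> points // inner_rel G (set vs) internal x resolved (glue \<rho>). c \<subseteq> Inl ` halves_at resolved} =
    local_loops ps (local_ends n es rs) (labels ps edge_list)"
proof -
  let ?f = "label (labels ps edge_list)"
  let ?L = "Inl ` {h \<in> halves_at {..<n}. rs ! fst h \<noteq> Some Vertex}"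
  have sub: "edge_rel \<subseteq> set ps \<times> set ps" using edge_list_subset by blast
  have ends: "set (local_ends n es rs) = set ps - ?L"
    unfolding set_ps local_ends_def by (auto simp: set_half_list)
  have sets: "{c \<in> points // inner_gen\<^sup>*. c \<subseteq> Inl ` halves_at resolved} =
      {c \<in> \<Theta> ` set ps // inner_gen\<^sup>*. c \<subseteq> Inl ` halves_at resolved}"
  proof -
    have "Inl ` halves_at resolved \<subseteq> \<Theta> ` set ps" "\<Theta> ` set ps \<subseteq> points"
      unfolding image_\<Theta> using vs(2) by auto
    then show ?thesis by (rule components_inside_cong)
  qed
  have "card {c \<in> points // inner_gen\<^sup>*. c \<subseteq> Inl ` halves_at resolved} =
      card {c \<in> set ps // edge_rel\<^sup>*. c \<subseteq> ?L}"
    unfolding sets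
  proof (rule card_components_bij[symmetric])
    show "bij_betw \<Theta> (set ps) (\<Theta> ` set ps)" using inj_\<Theta> by (simp add: bij_betw_def)
    show "edge_rel \<subseteq> set ps \<times> set ps" by (rule sub)
    then show "inner_gen \<subseteq> \<Theta> ` set ps \<times> \<Theta> ` set ps" unfolding inner_gen_eq by auto
    show "(p, q) \<in> edge_rel \<longleftrightarrow> (\<Theta> p, \<Theta> q) \<in> inner_gen" if "p \<in> set ps" "q \<in> set ps" for p q
    proof
      assume "(\<Theta> p, \<Theta> q) \<in> inner_gen"
      then obtain p' q' where pq: "(p', q') \<in> edge_rel" "\<Theta> p = \<Theta> p'" "\<Theta> q = \<Theta> q'"
        unfolding inner_gen_eq by auto
      then have "p' \<in> set ps" "q' \<in> set ps" using sub by blast+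
      then show "(p, q) \<in> edge_rel" using pq inj_onD[OF inj_\<Theta>] that by metis
    qed (simp only: inner_gen_eq map_prod_imageI)
    show "?L \<subseteq> set ps" unfolding set_ps by blast
    show "\<Theta> ` ?L = Inl ` halves_at resolved" unfolding resolved_eq image_image by simp
  qed
  also have "\<dots> = card (?f ` set ps - ?f ` (set ps - ?L))"
    by (rule card_components_label[OF _ sub]) (rule label_eq_iff[OF distinct_ps edge_list_subset])
  also have "\<dots> = local_loops ps (local_ends n es rs) (labels ps edge_list)"
    unfolding local_loops_def ends[symmetric]
    by (subst distinct_card[symmetric]) (auto intro!: arg_cong[of _ _ card])
  finally show ?thesis by (simp add: inner_rel_def)
qed

end

context numbered_part
begin

lemma numbered_part_id: "numbered_part G G vs es id id"
  by unfold_locales (use framed vs es in auto)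

text \<open>Labels decide the inner relation and loops count the inner components, so a successful
  computation delivers the hypotheses of \<open>replace\<close>, with no added circle on the left
  and \<open>d\<close> on the right.\<close>

theorem local_check_sound:
  assumes \<rho>: "map \<rho> vs = rs" and \<sigma>: "map \<sigma> vs = ss" and chk: "local_check n es x0 rs ss vm d"
  shows "framed_iso (resolve (set vs) \<rho> G)
    (resolve (set vs) \<sigma> H\<lparr>circles := circles (resolve (set vs) \<sigma> H) + d\<rparr>)"
proof -
  interpret i: numbered_part G G vs es id id by (rule numbered_part_id)
  interpret r: numbered_resolution G G vs es id id \<rho> rs by unfold_locales (rule \<rho>)
  interpret s: numbered_resolution G H vs es x x0 \<sigma> ss by unfold_locales (rule \<sigma>)
  let ?U = "{v \<in> set vs. \<rho> v \<noteq> Some Vertex}" and ?T = "{v \<in> set vs. \<sigma> v \<noteq> Some Vertex}"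
  let ?ends = "local_ends n es rs"
  let ?l1 = "label (labels r.ps r.edge_list)" and ?l2 = "label (labels s.ps s.edge_list)"
  let ?V = "{v. v < n \<and> rs ! v = Some Vertex}" and ?W = "{v. v < n \<and> ss ! v = Some Vertex}"
  let ?\<nu> = "rename_vertex vm"
  have "distinct (map (\<lambda>v. fst (vm ! v)) (filter (\<lambda>v. rs ! v = Some Vertex) [0..<n]))"
    "set (map (\<lambda>v. fst (vm ! v)) (filter (\<lambda>v. rs ! v = Some Vertex) [0..<n])) = ?W"
    using chk by (auto simp: local_check_def Let_def)
  then have "bij_betw (\<lambda>v. fst (vm ! v)) ?V ?W"
    by (auto simp: distinct_map bij_betw_def)
  then have bij\<nu>: "bij_betw ?\<nu> (halves_at ?V) (halves_at ?W)" by (rule bij_betw_rename_vertex)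
  have lab: "?l1 p = ?l1 q \<longleftrightarrow> ?l2 (map_sum ?\<nu> id p) = ?l2 (map_sum ?\<nu> id q)"
    if "p \<in> set ?ends" "q \<in> set ?ends" for p q
  proof -
    have "\<forall>(a, b)\<in>set (map (\<lambda>p. (?l1 p, ?l2 (map_sum ?\<nu> id p))) ?ends).
        \<forall>(a', b')\<in>set (map (\<lambda>p. (?l1 p, ?l2 (map_sum ?\<nu> id p))) ?ends). (a = a') = (b = b')"
      using chk unfolding local_check_def Let_def by blast
    then show ?thesis using that by auto
  qed
  have loops: "local_loops r.ps ?ends (labels r.ps r.edge_list) =
      local_loops s.ps (local_ends n es ss) (labels s.ps s.edge_list) + d"
    using chk unfolding local_check_def Let_def by blast
  have V: "halves_at (set vs - ?U) = \<theta> ` halves_at ?V" "halves_at (set vs - ?T) = \<theta> ` halves_at ?W"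
  proof -
    have "set vs - ?U = (!) vs ` ?V" by (auto simp: r.rs_nth in_set_conv_nth)
    moreover have "set vs - ?T = (!) vs ` ?W" by (auto simp: s.rs_nth in_set_conv_nth)
    ultimately show "halves_at (set vs - ?U) = \<theta> ` halves_at ?V" "halves_at (set vs - ?T) = \<theta> ` halves_at ?W"
      by (simp_all only: image_\<theta>)
  qed
  have VW: "halves_at ?V \<subseteq> halves_at {..<n}" "halves_at ?W \<subseteq> halves_at {..<n}" by auto
  \<comment> \<open>The renaming acts on position numbers and is carried to the actual vertices by
    \<theta>.\<close>
  define \<phi> where "\<phi> = \<theta> \<circ> ?\<nu> \<circ> inv_into (halves_at {..<n}) \<theta>"
  have \<phi>\<theta>: "\<phi> (\<theta> h) = \<theta> (?\<nu> h)" if "h \<in> halves_at ?V" for h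
    using inv_into_f_f[OF inj_\<theta>] VW(1) that unfolding \<phi>_def by auto
  have \<nu>W: "?\<nu> h \<in> halves_at ?W" if "h \<in> halves_at ?V" for h
    using bij\<nu> that by (rule bij_betwE[rule_format])
  have "framed_iso (splice ?U (glue \<rho>) G\<lparr>circles := circles (splice ?U (glue \<rho>) G) + 0\<rparr>)
    (splice ?T (glue \<sigma>) H\<lparr>circles := circles (splice ?T (glue \<sigma>) H) + d\<rparr>)"
  proof (rule replace)
    show "bij_betw \<phi> (halves_at (set vs - ?U)) (halves_at (set vs - ?T))"
      unfolding V
    proof (rule bij_betw_imageI)
      show "inj_on \<phi> (\<theta> ` halves_at ?V)"
      proof (rule inj_onI)
        fix a b assume "a \<in> \<theta> ` halves_at ?V" "b \<in> \<theta> ` halves_at ?V" "\<phi> a = \<phi> b"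
        then obtain h g where hg: "a = \<theta> h" "h \<in> halves_at ?V" "b = \<theta> g" "g \<in> halves_at ?V"
          by (elim imageE)
        have "\<theta> (?\<nu> h) = \<theta> (?\<nu> g)"
          using \<open>\<phi> a = \<phi> b\<close> unfolding hg(1,3) \<phi>\<theta>[OF hg(2)] \<phi>\<theta>[OF hg(4)] .
        then have "?\<nu> h = ?\<nu> g"
          by (rule inj_onD[OF inj_\<theta>])
            (rule subsetD[OF VW(2) \<nu>W[OF hg(2)]], rule subsetD[OF VW(2) \<nu>W[OF hg(4)]])
        then have "h = g" by (rule inj_onD[OF bij_betw_imp_inj_on[OF bij\<nu>] _ hg(2,4)])
        then show "a = b" using hg by simp
      qed
      have "\<phi> ` \<theta> ` halves_at ?V = \<theta> ` ?\<nu> ` halves_at ?V"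
        unfolding image_image using \<phi>\<theta> by (rule image_cong[OF refl])
      then show "\<phi> ` \<theta> ` halves_at ?V = \<theta> ` halves_at ?W"
        using bij_betw_imp_surj_on[OF bij\<nu>] by simp
    qed
    fix h assume "h \<in> halves_at (set vs - ?U)"
    then obtain g where g: "h = \<theta> g" "g \<in> halves_at ?V" unfolding V by (rule imageE)
    have op: "opposite (\<theta> g) = \<theta> (opposite g)" for g by (cases g) simp
    show "\<phi> (opposite h) = opposite (\<phi> h)"
    proof -
      have "opposite g \<in> halves_at ?V" using g(2) by (cases g) simp
      then show ?thesis using \<phi>\<theta> g by (simp only: op rename_vertex_simps)
    qed
    fix h' assume "h' \<in> halves_at (set vs - ?U)"
    then obtain g' where g': "h' = \<theta> g'" "g' \<in> halves_at ?V" unfolding V by (rule imageE)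
    have \<theta>_fst: "fst (\<theta> g) = fst (\<theta> g') \<longleftrightarrow> fst g = fst g'" if "fst g < n" "fst g' < n" for g g'
      using that vs(1) by (cases g; cases g') (simp add: nth_eq_iff_index_eq)
    have "fst (\<phi> h) = fst (\<phi> h') \<longleftrightarrow> fst (?\<nu> g) = fst (?\<nu> g')"
      using \<phi>\<theta> g g' \<nu>W[of g] \<nu>W[of g'] \<theta>_fst[of "?\<nu> g" "?\<nu> g'"] by (auto simp: mem_Times_iff)
    also have "\<dots> \<longleftrightarrow> fst g = fst g'"
      using \<open>bij_betw (\<lambda>v. fst (vm ! v)) ?V ?W\<close> g g'
      by (auto simp: rename_vertex_simps bij_betw_def inj_on_def mem_Times_iff)
    also have "\<dots> \<longleftrightarrow> fst h = fst h'" using \<theta>_fst[of g g'] g g' by (auto simp: mem_Times_iff)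
    finally show "fst (\<phi> h) = fst (\<phi> h') \<longleftrightarrow> fst h = fst h'" .
  next
    have ends: "\<exists>e. p = \<Theta> e \<and> e \<in> set ?ends \<and> map_sum \<phi> id p = \<Theta> (map_sum ?\<nu> id e) \<and> map_sum ?\<nu> id e \<in> set s.ps \<and> e \<in> set r.ps"
      if "p \<in> Inr ` legs \<union> Inl ` halves_at (set vs - ?U)" for p
      using that
    proof
      assume "p \<in> Inr ` legs"
      then obtain e where "p = Inr (\<theta> e)" "e \<in> set (local_legs n es)" unfolding legs_eq by (elim imageE) simp
      then show ?thesis
        by (intro exI[of _ "Inr e"]) (auto simp: local_ends_def r.set_ps)
    next
      assume "p \<in> Inl ` halves_at (set vs - ?U)"
      then obtain g where g: "p = Inl (\<theta> g)" "g \<in> halves_at ?V" unfolding V by (elim imageE) simp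
      have "?\<nu> g \<in> halves_at {..<n}" by (rule subsetD[OF VW(2) \<nu>W[OF g(2)]])
      then show ?thesis using g \<phi>\<theta>[OF g(2)]
        by (intro exI[of _ "Inl g"]) (auto simp: local_ends_def r.set_ps set_half_list)
    qed
    fix p q assume "p \<in> Inr ` legs \<union> Inl ` halves_at (set vs - ?U)" "q \<in> Inr ` legs \<union> Inl ` halves_at (set vs - ?U)"
    from ends[OF this(1)] ends[OF this(2)]
    obtain e e' where e: "p = \<Theta> e" "e \<in> set ?ends" "map_sum \<phi> id p = \<Theta> (map_sum ?\<nu> id e)"
        "map_sum ?\<nu> id e \<in> set s.ps" "e \<in> set r.ps"
      and e': "q = \<Theta> e'" "e' \<in> set ?ends" "map_sum \<phi> id q = \<Theta> (map_sum ?\<nu> id e')"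
        "map_sum ?\<nu> id e' \<in> set s.ps" "e' \<in> set r.ps"
      by (elim exE conjE)
    show "(p, q) \<in> inner_rel G (set vs) internal id ?U (glue \<rho>) \<longleftrightarrow>
        (map_sum \<phi> id p, map_sum \<phi> id q) \<in> inner_rel G (set vs) internal x ?T (glue \<sigma>)"
      unfolding e(3) e'(3) s.inner_rel_iff_label[OF e(4) e'(4)] lab[OF e(2) e'(2), symmetric]
      unfolding e(1) e'(1) r.inner_rel_iff_label[OF e(5) e'(5), symmetric] by (rule refl)
  next
    show "card {c \<in> points // inner_rel G (set vs) internal id ?U (glue \<rho>). c \<subseteq> Inl ` halves_at ?U} + 0 =
        card {c \<in> points // inner_rel G (set vs) internal x ?T (glue \<sigma>). c \<subseteq> Inl ` halves_at ?T} + d"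
      using r.card_loops s.card_loops loops by simp
  qed (use circles in auto)
  then show ?thesis unfolding resolve_def by (simp add: framed_iso_def)
qed

end

section \<open>State sums\<close>

lemma truncate_simps [simp]:
  "verts (fgraph.truncate L) = verts L" "mate (fgraph.truncate L) = mate L"
  "circles (fgraph.truncate L) = circles L"
  by (simp_all add: fgraph.truncate_def)

lemma framed_graph_truncate [simp]: "framed_graph (fgraph.truncate L) = framed_graph L"
  by (simp add: framed_graph_def)

lemma truncate_splice: "fgraph.truncate (splice S j L) = splice S j (fgraph.truncate L)"
proof -
  have "splice_rel S j (fgraph.truncate L) = splice_rel S j L" by (simp add: splice_rel_def)
  then show ?thesis by (simp add: splice_def fgraph.truncate_def)
qed

lemma eqv_circles:
  assumes "framed_graph G"
  shows "eqv \<delta> (graph_elt (G\<lparr>circles := circles G + d\<rparr>)) (scale (\<delta> ^ d) (graph_elt G))"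
proof (induction d)
  case (Suc d)
  have "framed_graph (G\<lparr>circles := circles G + d\<rparr>)" using assms by (auto simp: framed_graph_def)
  from eqv_circle[OF this, of \<delta>]
  have "eqv \<delta> (graph_elt (G\<lparr>circles := circles G + Suc d\<rparr>)) (scale \<delta> (graph_elt (G\<lparr>circles := circles G + d\<rparr>)))"
    by simp
  also have "eqv \<delta> \<dots> (scale \<delta> (scale (\<delta> ^ d) (graph_elt G)))" by (rule eqv_scale[OF Suc.IH])
  finally show ?case by simp
qed simp

definition resolve_list :: "nat list \<Rightarrow> resolution option list \<Rightarrow> fgraph \<Rightarrow> fgraph" where
  "resolve_list vs rs = resolve (set vs) (\<lambda>v. the (map_of (zip vs rs) v))"

lemma resolve_cong:
  assumes "same_graph G H" "\<And>v. v \<in> Q \<Longrightarrow> \<rho> v = \<sigma> v"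
  shows "same_graph (resolve Q \<rho> G) (resolve Q \<sigma> H)"
proof -
  have Q: "{v \<in> Q. \<rho> v \<noteq> Some Vertex} = {v \<in> Q. \<sigma> v \<noteq> Some Vertex}" using assms(2) by auto
  show ?thesis
    unfolding resolve_def Q
    by (rule same_graph_splice[OF assms(1)]) (use assms(2) in \<open>auto simp: glue_def\<close>)
qed

lemma framed_graph_resolve:
  "framed_graph G \<Longrightarrow> Q \<subseteq> verts G \<Longrightarrow> framed_graph (resolve Q \<rho> G)"
  unfolding resolve_def by (rule framed_graph_splice) auto

lemma resolve_list_map:
  "same_graph (resolve (set vs) \<rho> G) (resolve_list vs (map \<rho> vs) G)"
  unfolding resolve_list_def by (rule resolve_cong) (simp_all add: map_of_zip_map)

lemma framed_graph_resolve_list: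
  "framed_graph G \<Longrightarrow> set vs \<subseteq> verts G \<Longrightarrow> framed_graph (resolve_list vs rs G)"
  unfolding resolve_list_def by (rule framed_graph_resolve)

lemma resolve_resolve:
  assumes "framed_graph G" "Q \<subseteq> verts G" "R \<subseteq> verts G" "Q \<inter> R = {}"
  shows "same_graph (resolve Q \<rho> (resolve R \<sigma> G)) (resolve (R \<union> Q) (\<lambda>v. if v \<in> R then \<sigma> v else \<rho> v) G)"
proof -
  let ?Q = "{v \<in> Q. \<rho> v \<noteq> Some Vertex}" and ?R = "{v \<in> R. \<sigma> v \<noteq> Some Vertex}"
  let ?\<tau> = "\<lambda>v. if v \<in> R then \<sigma> v else \<rho> v"
  have "same_graph (splice ?Q (glue \<rho>) (splice ?R (glue \<sigma>) G))
      (splice (?R \<union> ?Q) (\<lambda>h. if fst h \<in> ?R then glue \<sigma> h else glue \<rho> h) G)"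
    by (rule splice_splice) (use assms in auto)
  also have "?R \<union> ?Q = {v \<in> R \<union> Q. ?\<tau> v \<noteq> Some Vertex}" using assms(4) by auto
  finally have 1: "same_graph (splice ?Q (glue \<rho>) (splice ?R (glue \<sigma>) G))
      (splice {v \<in> R \<union> Q. ?\<tau> v \<noteq> Some Vertex} (\<lambda>h. if fst h \<in> ?R then glue \<sigma> h else glue \<rho> h) G)" .
  have "same_graph (splice {v \<in> R \<union> Q. ?\<tau> v \<noteq> Some Vertex} (\<lambda>h. if fst h \<in> ?R then glue \<sigma> h else glue \<rho> h) G)
      (splice {v \<in> R \<union> Q. ?\<tau> v \<noteq> Some Vertex} (glue ?\<tau>) G)"
    by (rule same_graph_splice) (use assms(4) in \<open>auto simp: glue_def\<close>)
  with 1 show ?thesis unfolding resolve_def by (rule same_graph_trans)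
qed

lemma glue_None: "glue (\<lambda>_. None) = opposite"
  by (auto simp: glue_def fun_eq_iff)

lemma glue_Some: "glue (\<lambda>v. Some (st v)) = smoothing st"
  by (auto simp: glue_def smoothing_def fun_eq_iff)

lemma splice_opposite_eq_resolve: "splice Q opposite G = resolve Q (\<lambda>_. None) G"
  by (simp add: resolve_def glue_None)

lemma state_graph_eq_resolve:
  "state_graph L st = resolve (verts L) (\<lambda>v. Some (st v)) (fgraph.truncate L)"
  by (simp add: state_graph_def resolve_def glue_Some)

lemma (in numbered_part) eqv_local_check:
  fixes \<delta> :: "'r::{comm_ring,comm_monoid_mult}"
  assumes "local_check (length vs) es x0 rs ss vm d" "length rs = length vs" "length ss = length vs"
  shows "eqv \<delta> (graph_elt (resolve_list vs rs G)) (scale (\<delta> ^ d) (graph_elt (resolve_list vs ss H)))"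
proof -
  have m: "map (\<lambda>v. the (map_of (zip vs ts) v)) vs = ts" if "length ts = length vs" for ts :: "resolution option list"
    using that vs(1) by (intro nth_equalityI) (auto simp: map_of_zip_nth)
  let ?G = "resolve_list vs rs G" and ?H = "resolve_list vs ss H"
  have "framed_iso ?G (?H\<lparr>circles := circles ?H + d\<rparr>)"
    unfolding resolve_list_def by (rule local_check_sound[OF m[OF assms(2)] m[OF assms(3)] assms(1)])
  moreover have "framed_graph ?G" "framed_graph ?H"
    using framed vs(2) verts by (auto intro: framed_graph_resolve_list)
  moreover from this have "framed_graph (?H\<lparr>circles := circles ?H + d\<rparr>)"
    by (auto simp: framed_graph_def)
  ultimately have "graph_elt ?G = (graph_elt (?H\<lparr>circles := circles ?H + d\<rparr>) :: fgraph set \<Rightarrow>\<^sub>0 'r)"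
    by (intro graph_elt_cong)
  then show ?thesis using eqv_circles[OF \<open>framed_graph ?H\<close>, of \<delta> d] by simp
qed

text \<open>The bracket before normalisation by the writhe. The label pairs are an arbitrary
  function of the crossings, which allows labels of different diagrams to be compared on common
  crossings.\<close>

definition state_sum ::
  "(bool \<Rightarrow> resolution \<Rightarrow> 'x \<times> 'x \<Rightarrow> 'r) \<Rightarrow> diagram \<Rightarrow> (nat \<Rightarrow> 'x \<times> 'x) \<Rightarrow>
    (fgraph set \<Rightarrow>\<^sub>0 'r::{comm_ring,comm_monoid_mult})" where
  "state_sum \<beta> L lb =
    (\<Sum>st\<in>states L. scale (\<Prod>c\<in>verts L. \<beta> (positive L c) (st c) (lb c)) (graph_elt (state_graph L st)))"

lemma state_sum_cong:
  "(\<And>c. c \<in> verts L \<Longrightarrow> lb c = lb' c) \<Longrightarrow> state_sum \<beta> L lb = state_sum \<beta> L lb'"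
  unfolding state_sum_def by (intro sum.cong refl arg_cong2[of _ _ _ _ scale] prod.cong) auto

lemma sum_PiE_insert:
  fixes F :: "('a \<Rightarrow> 'b) \<Rightarrow> 'c::comm_monoid_add"
  assumes "c \<notin> V"
  shows "(\<Sum>st\<in>insert c V \<rightarrow>\<^sub>E U. F st) = (\<Sum>st\<in>V \<rightarrow>\<^sub>E U. \<Sum>r\<in>U. F (st(c := r)))"
proof -
  have "(\<Sum>st\<in>insert c V \<rightarrow>\<^sub>E U. F st) = (\<Sum>(r, st)\<in>U \<times> (V \<rightarrow>\<^sub>E U). F (st(c := r)))"
    unfolding PiE_insert_eq
    by (subst sum.reindex[OF inj_combinator[OF assms]]) (simp add: case_prod_unfold)
  also have "\<dots> = (\<Sum>r\<in>U. \<Sum>st\<in>V \<rightarrow>\<^sub>E U. F (st(c := r)))"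
    by (rule sum.cartesian_product[symmetric])
  also have "\<dots> = (\<Sum>st\<in>V \<rightarrow>\<^sub>E U. \<Sum>r\<in>U. F (st(c := r)))" by (rule sum.swap)
  finally show ?thesis .
qed

lemma sum_resolution: "(\<Sum>r\<in>UNIV. F r) = F Oriented + F Unoriented + F Vertex"
proof -
  have "(UNIV :: resolution set) = {Oriented, Unoriented, Vertex}" using resolution.exhaust by blast
  then have "(\<Sum>r\<in>UNIV. F r) = (\<Sum>r\<in>{Oriented, Unoriented, Vertex}. F r)" by (rule arg_cong)
  then show ?thesis by (simp add: add.assoc)
qed

text \<open>The state is applied away from the local part only. The same graph then serves all
  states that differ just at the local crossings.\<close>

definition outer_graph :: "diagram \<Rightarrow> nat set \<Rightarrow> (nat \<Rightarrow> resolution) \<Rightarrow> fgraph" where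
  "outer_graph L V st = resolve V (\<lambda>v. Some (st v)) (fgraph.truncate L)"

lemma state_graph_outer:
  assumes "framed_graph L" "set vs \<union> V = verts L" "set vs \<inter> V = {}"
    and "\<And>v. v \<in> V \<Longrightarrow> st v = st' v"
  shows "graph_elt (state_graph L st') =
    graph_elt (resolve_list vs (map (\<lambda>v. Some (st' v)) vs) (outer_graph L V st))"
proof -
  let ?L = "fgraph.truncate L"
  have "same_graph (resolve_list vs (map (\<lambda>v. Some (st' v)) vs) (outer_graph L V st))
      (resolve (set vs) (\<lambda>v. Some (st' v)) (outer_graph L V st))"
    by (rule same_graph_sym[OF resolve_list_map])
  also have "same_graph \<dots> (resolve (V \<union> set vs) (\<lambda>v. if v \<in> V then Some (st v) else Some (st' v)) ?L)"
    (is "same_graph _ ?M")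
    unfolding outer_graph_def by (rule resolve_resolve) (use assms in auto)
  finally (same_graph_trans) have 1: "same_graph (resolve_list vs (map (\<lambda>v. Some (st' v)) vs) (outer_graph L V st)) ?M" .
  have V: "V \<union> set vs = verts L" using assms(2) by blast
  have "same_graph ?M (state_graph L st')"
    unfolding state_graph_eq_resolve V by (rule resolve_cong) (use assms(4) in auto)
  with 1 have "same_graph (state_graph L st') (resolve_list vs (map (\<lambda>v. Some (st' v)) vs) (outer_graph L V st))"
    by (rule same_graph_sym[OF same_graph_trans])
  moreover have "framed_graph (state_graph L st')"
    unfolding state_graph_eq_resolve using assms(1) by (intro framed_graph_resolve) auto
  ultimately show ?thesis by (intro graph_elt_same_graph)
qed

text \<open>Deleting crossings and then taking a state amounts, by two uses of
  \<open>resolve_resolve\<close>, to taking the outer state first and passing straight through the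
  local crossings afterwards. This puts both sides of a deleting move over the same outer
  graph.\<close>

lemma state_graph_splice_opposite:
  assumes "framed_graph L" "set vs \<union> V = verts L" "set vs \<inter> V = {}"
  shows "graph_elt (state_graph (splice (set vs) opposite L) st) =
    graph_elt (resolve_list vs (map (\<lambda>_. None) vs) (outer_graph L V st))"
proof -
  let ?L = "fgraph.truncate L"
  have V: "verts L - set vs = V" using assms by blast
  have "same_graph (state_graph (splice (set vs) opposite L) st)
      (resolve V (\<lambda>v. Some (st v)) (resolve (set vs) (\<lambda>_. None) ?L))"
    by (simp add: state_graph_eq_resolve truncate_splice splice_opposite_eq_resolve V)
  also have "same_graph \<dots> (resolve (set vs \<union> V) (\<lambda>v. if v \<in> set vs then None else Some (st v)) ?L)" (is "same_graph _ ?M")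
    by (rule resolve_resolve) (use assms in auto)
  finally (same_graph_trans) have 1: "same_graph (state_graph (splice (set vs) opposite L) st) ?M" .
  have "same_graph (resolve (set vs) (\<lambda>_. None) (outer_graph L V st))
      (resolve (V \<union> set vs) (\<lambda>v. if v \<in> V then Some (st v) else None) ?L)" (is "same_graph _ ?N")
    unfolding outer_graph_def by (rule resolve_resolve) (use assms in auto)
  moreover have "same_graph ?M ?N"
    unfolding Un_commute[of V] by (rule resolve_cong) (use assms(3) in auto)
  ultimately have "same_graph (state_graph (splice (set vs) opposite L) st)
      (resolve (set vs) (\<lambda>_. None) (outer_graph L V st))"
    using 1 by (meson same_graph_sym same_graph_trans)
  then have "same_graph (state_graph (splice (set vs) opposite L) st)
      (resolve_list vs (map (\<lambda>_. None) vs) (outer_graph L V st))"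
    using resolve_list_map by (rule same_graph_trans)
  moreover have "framed_graph (state_graph (splice (set vs) opposite L) st)"
    unfolding state_graph_eq_resolve
    by (intro framed_graph_resolve)
      (use assms framed_graph_splice[OF assms(1) gluing_opposite, of "set vs"] in auto)
  ultimately show ?thesis by (intro graph_elt_same_graph)
qed

lemma positive_splice [simp]: "positive (splice S j L) = positive L"
  by (simp add: splice_def)

lemma state_sum_splice_opposite:
  assumes "framed_graph L" "set vs \<union> V = verts L" "set vs \<inter> V = {}"
  shows "state_sum \<beta> (splice (set vs) opposite L) lb =
    (\<Sum>st\<in>V \<rightarrow>\<^sub>E UNIV. scale (\<Prod>c\<in>V. \<beta> (positive L c) (st c) (lb c))
      (graph_elt (resolve_list vs (map (\<lambda>_. None) vs) (outer_graph L V st))))"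
proof -
  have V: "verts L - set vs = V" using assms by blast
  show ?thesis
    unfolding state_sum_def states_def state_graph_splice_opposite[OF assms] by (simp add: V)
qed

text \<open>For a fixed outer state the sum over the local states is an inner sum over one outer
  graph. It is enough to compare these inner sums; the same expansion follows for one and for three
  crossings.\<close>

lemma state_sum_two:
  fixes \<beta> :: "bool \<Rightarrow> resolution \<Rightarrow> 'x \<times> 'x \<Rightarrow> 'r::{comm_ring,comm_monoid_mult}"
  assumes "framed_graph L" "{c, d} \<union> V = verts L" "c \<notin> V" "d \<notin> V" "c \<noteq> d"
  shows "state_sum \<beta> L lb =
    (\<Sum>st\<in>V \<rightarrow>\<^sub>E UNIV. scale (\<Prod>c\<in>V. \<beta> (positive L c) (st c) (lb c))
      (\<Sum>r\<in>UNIV. \<Sum>q\<in>UNIV. scale (\<beta> (positive L c) r (lb c) * \<beta> (positive L d) q (lb d))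
        (graph_elt (resolve_list [c, d] [Some r, Some q] (outer_graph L V st)))))"
proof -
  have fin: "finite V" using assms finite_verts[OF assms(1)] by (metis finite_Un)
  have v: "verts L = insert d (insert c V)" using assms(2) by auto
  have n: "c \<notin> V" "d \<notin> insert c V" using assms by auto
  have "scale (\<Prod>v\<in>verts L. \<beta> (positive L v) ((st(c := r, d := q)) v) (lb v)) (graph_elt (state_graph L (st(c := r, d := q)))) =
      scale (\<Prod>v\<in>V. \<beta> (positive L v) (st v) (lb v))
        (scale (\<beta> (positive L c) r (lb c) * \<beta> (positive L d) q (lb d))
          (graph_elt (resolve_list [c, d] [Some r, Some q] (outer_graph L V st))))" for st r q
  proof -
    have "graph_elt (state_graph L (st(c := r, d := q))) =
        (graph_elt (resolve_list [c, d] (map (\<lambda>v. Some ((st(c := r, d := q)) v)) [c, d]) (outer_graph L V st)) :: fgraph set \<Rightarrow>\<^sub>0 'r)"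
      by (rule state_graph_outer) (use assms in auto)
    moreover have "(\<Prod>v\<in>V. \<beta> (positive L v) ((st(c := r, d := q)) v) (lb v)) =
        (\<Prod>v\<in>V. \<beta> (positive L v) (st v) (lb v))"
      by (rule prod.cong) (use assms in auto)
    ultimately show ?thesis unfolding v using assms fin by (simp add: ac_simps)
  qed
  note eq = this[unfolded v]
  show ?thesis
    unfolding state_sum_def states_def v sum_PiE_insert[OF n(2)] sum_PiE_insert[OF n(1)] eq scale_sum
    by (rule refl)
qed

lemma state_sum_one:
  fixes \<beta> :: "bool \<Rightarrow> resolution \<Rightarrow> 'x \<times> 'x \<Rightarrow> 'r::{comm_ring,comm_monoid_mult}"
  assumes "framed_graph L" "insert c V = verts L" "c \<notin> V"
  shows "state_sum \<beta> L lb =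
    (\<Sum>st\<in>V \<rightarrow>\<^sub>E UNIV. scale (\<Prod>c\<in>V. \<beta> (positive L c) (st c) (lb c))
      (\<Sum>r\<in>UNIV. scale (\<beta> (positive L c) r (lb c))
        (graph_elt (resolve_list [c] [Some r] (outer_graph L V st)))))"
proof -
  have fin: "finite V" using assms finite_verts[OF assms(1)] by (metis finite_insert)
  have "scale (\<Prod>v\<in>verts L. \<beta> (positive L v) ((st(c := r)) v) (lb v)) (graph_elt (state_graph L (st(c := r)))) =
      scale (\<Prod>v\<in>V. \<beta> (positive L v) (st v) (lb v))
        (scale (\<beta> (positive L c) r (lb c)) (graph_elt (resolve_list [c] [Some r] (outer_graph L V st))))" for st r
  proof -
    have "graph_elt (state_graph L (st(c := r))) =
        (graph_elt (resolve_list [c] (map (\<lambda>v. Some ((st(c := r)) v)) [c]) (outer_graph L V st)) :: fgraph set \<Rightarrow>\<^sub>0 'r)"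
      by (rule state_graph_outer) (use assms in auto)
    moreover have "(\<Prod>v\<in>V. \<beta> (positive L v) ((st(c := r)) v) (lb v)) =
        (\<Prod>v\<in>V. \<beta> (positive L v) (st v) (lb v))"
      by (rule prod.cong) (use assms in auto)
    ultimately show ?thesis unfolding assms(2)[symmetric] using assms(3) fin by (simp add: ac_simps)
  qed
  then show ?thesis
    unfolding state_sum_def states_def
    by (simp add: assms(2)[symmetric] sum_PiE_insert assms(3) scale_sum del: fun_upd_apply)
qed

lemma state_sum_three:
  fixes \<beta> :: "bool \<Rightarrow> resolution \<Rightarrow> 'x \<times> 'x \<Rightarrow> 'r::{comm_ring,comm_monoid_mult}"
  assumes "framed_graph L" "{a, b, c} \<union> V = verts L" "a \<notin> V" "b \<notin> V" "c \<notin> V" "a \<noteq> b" "a \<noteq> c" "b \<noteq> c"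
  shows "state_sum \<beta> L lb =
    (\<Sum>st\<in>V \<rightarrow>\<^sub>E UNIV. scale (\<Prod>c\<in>V. \<beta> (positive L c) (st c) (lb c))
      (\<Sum>r\<in>UNIV. \<Sum>q\<in>UNIV. \<Sum>p\<in>UNIV.
        scale (\<beta> (positive L a) r (lb a) * \<beta> (positive L b) q (lb b) * \<beta> (positive L c) p (lb c))
        (graph_elt (resolve_list [a, b, c] [Some r, Some q, Some p] (outer_graph L V st)))))"
proof -
  have fin: "finite V" using assms finite_verts[OF assms(1)] by (metis finite_Un)
  have v: "verts L = insert c (insert b (insert a V))" using assms(2) by auto
  have n: "a \<notin> V" "b \<notin> insert a V" "c \<notin> insert b (insert a V)" using assms by auto
  have "scale (\<Prod>v\<in>verts L. \<beta> (positive L v) ((st(a := r, b := q, c := p)) v) (lb v)) (graph_elt (state_graph L (st(a := r, b := q, c := p)))) =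
      scale (\<Prod>v\<in>V. \<beta> (positive L v) (st v) (lb v))
        (scale (\<beta> (positive L a) r (lb a) * \<beta> (positive L b) q (lb b) * \<beta> (positive L c) p (lb c))
          (graph_elt (resolve_list [a, b, c] [Some r, Some q, Some p] (outer_graph L V st))))" for st r q p
  proof -
    have "graph_elt (state_graph L (st(a := r, b := q, c := p))) =
        (graph_elt (resolve_list [a, b, c] (map (\<lambda>v. Some ((st(a := r, b := q, c := p)) v)) [a, b, c]) (outer_graph L V st)) :: fgraph set \<Rightarrow>\<^sub>0 'r)"
      by (rule state_graph_outer) (use assms in auto)
    moreover have "(\<Prod>v\<in>V. \<beta> (positive L v) ((st(a := r, b := q, c := p)) v) (lb v)) =
        (\<Prod>v\<in>V. \<beta> (positive L v) (st v) (lb v))"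
      by (rule prod.cong) (use assms in auto)
    ultimately show ?thesis unfolding v using assms fin by (simp add: ac_simps)
  qed
  note eq = this[unfolded v]
  show ?thesis
    unfolding state_sum_def states_def v sum_PiE_insert[OF n(3)] sum_PiE_insert[OF n(2)]
      sum_PiE_insert[OF n(1)] eq scale_sum
    by (rule refl)
qed

lemma framed_graph_outer:
  "framed_graph L \<Longrightarrow> V \<subseteq> verts L \<Longrightarrow> framed_graph (outer_graph L V st)"
  unfolding outer_graph_def by (rule framed_graph_resolve) auto

lemma verts_outer: "verts L - V \<subseteq> verts (outer_graph L V st)"
  by (auto simp: outer_graph_def resolve_def)

text \<open>An edge between two untouched crossings survives the outer state unchanged. Hence the
  local picture of a move is present in every outer graph.\<close>

lemma mate_outer:
  assumes "framed_graph L" "V \<subseteq> verts L" "h \<in> halves_at (verts L - V)" "mate L h \<in> halves_at (verts L - V)"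
  shows "mate (outer_graph L V st) h = mate L h"
  unfolding outer_graph_def resolve_def
proof (rule mate_splice_eqI)
  have "(h, mate L h) \<in> mate_pairs (fgraph.truncate L)"
    using assms(3) by (auto simp: mate_pairs_def)
  then show "(h, mate L h) \<in> splice_rel {v \<in> V. Some (st v) \<noteq> Some Vertex} (glue (\<lambda>v. Some (st v))) (fgraph.truncate L)"
    unfolding splice_rel_eq by blast
  have "h \<in> halves L" using assms(3) by auto
  then show "mate L h \<noteq> h" by (rule framed_graphD[OF assms(1)])
qed (use assms in auto)

section \<open>The local relations\<close>

abbreviation (input) "so \<equiv> Some Oriented"
abbreviation (input) "su \<equiv> Some Unoriented"
abbreviation (input) "sv \<equiv> Some Vertex"

text \<open>Besides fixing vertex 0, this entry fills the positions of vertices that do not survive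
  in the correspondences below.\<close>

abbreviation (input) v0 :: "nat \<times> bool \<times> bool \<times> bool" where
  "v0 \<equiv> (0, False, False, False)"

lemma bigonI:
  assumes "u \<in> verts G" "v \<in> verts G" "u \<noteq> v" "mate G (u, s, p) = (v, t, q)"
    "mate G (u, other_strand s, p') = (v, other_strand t, q')"
  shows "bigon G u v"
proof -
  have "\<exists>b. fst (u, s, p) = u \<and> fst b = u \<and> (u, s, p) \<noteq> b \<and> b \<noteq> opposite (u, s, p) \<and>
      fst (mate G (u, s, p)) = v \<and> fst (mate G b) = v \<and> mate G b \<noteq> opposite (mate G (u, s, p))"
    by (rule exI[of _ "(u, other_strand s, p')"]) (simp add: assms)
  then show ?thesis unfolding bigon_def using assms(1-3) by blast
qed

text \<open>One edge of the bigon is an edge of \<open>G\<close>; the other becomes an edge only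
  after the third crossing \<open>w\<close> is smoothed. The relation is applied in the graph
  \<open>K\<close> in which \<open>w\<close> alone is resolved, and it replaces the two graphical
  vertices by passing straight through.\<close>

lemma eqv_bigon_resolve_list:
  fixes \<delta> :: "'r::{comm_ring,comm_monoid_mult}"
  assumes G: "framed_graph G" and vs: "set vs = {u, v, w}" "{u, v, w} \<subseteq> verts G" "u \<noteq> v" "u \<noteq> w" "v \<noteq> w"
    and rs: "map_of (zip vs rs) u = Some (sv)" "map_of (zip vs rs) v = Some (sv)"
      "map_of (zip vs rs) w = Some (Some r)" "r \<noteq> Vertex"
    and ss: "map_of (zip vs ss) u = Some None" "map_of (zip vs ss) v = Some None"
      "map_of (zip vs ss) w = Some (Some r)"
    and direct: "mate G (u, s, p) = (v, t, q)"
    and around: "mate G (u, other_strand s, p') = (w, k, l)"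
      "mate G (w, other_strand k, if r = Oriented then other_port l else l) = (v, other_strand t, q')"
  shows "eqv \<delta> (graph_elt (resolve_list vs rs G)) (graph_elt (resolve_list vs ss G))"
proof -
  let ?\<rho> = "\<lambda>v. the (map_of (zip vs rs) v)" and ?\<sigma> = "\<lambda>v. the (map_of (zip vs ss) v)"
  define K where "K = splice {w} (glue ?\<rho>) G"
  have w: "{w} \<subseteq> verts G" using vs by simp
  have K: "framed_graph K" unfolding K_def by (rule framed_graph_splice[OF G gluing_glue w])
  have pair: "(g, mate G g) \<in> splice_rel {w} (glue ?\<rho>) G" if "g \<in> halves G" for g
    using that unfolding splice_rel_def by (intro r_into_rtrancl) blast
  have 1: "mate K (u, s, p) = (v, t, q)"
    unfolding K_def
    by (rule mate_splice_eqI[OF G gluing_glue w]) (use vs direct pair[of "(u, s, p)"] in auto)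
  have 2: "mate K (u, other_strand s, p') = (v, other_strand t, q')"
    unfolding K_def
  proof (rule mate_splice_eqI[OF G gluing_glue w])
    let ?r = "(w, other_strand k, if r = Oriented then other_port l else l)"
    have "(?r, (v, other_strand t, q')) \<in> splice_rel {w} (glue ?\<rho>) G"
      using pair[of ?r] vs around by simp
    moreover have "((w, k, l), ?r) \<in> splice_rel {w} (glue ?\<rho>) G"
    proof -
      have "glue ?\<rho> (w, k, l) = ?r" using rs by (simp add: glue_def)
      then show ?thesis unfolding splice_rel_eq glue_pairs_def by (intro r_into_rtrancl) force
    qed
    moreover have "((u, other_strand s, p'), (w, k, l)) \<in> splice_rel {w} (glue ?\<rho>) G"
      using pair[of "(u, other_strand s, p')"] vs around by simp
    ultimately show "((u, other_strand s, p'), (v, other_strand t, q')) \<in> splice_rel {w} (glue ?\<rho>) G"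
      unfolding splice_rel_def by (meson rtrancl_trans)
  qed (use vs in auto)
  have "bigon K u v"
    by (rule bigonI[OF _ _ vs(3) 1 2]) (use vs in \<open>auto simp: K_def\<close>)
  then have "eqv \<delta> (graph_elt K) (graph_elt (splice {u, v} opposite K))"
    using K by (rule eqv_bigon[rotated])
  moreover have "K = resolve_list vs rs G"
  proof -
    have "{x \<in> {u, v, w}. ?\<rho> x \<noteq> sv} = {w}" using rs vs by auto
    then show ?thesis by (simp add: K_def resolve_list_def resolve_def vs)
  qed
  moreover have "graph_elt (resolve_list vs ss G) = (graph_elt (splice {u, v} opposite K) :: fgraph set \<Rightarrow>\<^sub>0 'r)"
  proof (rule graph_elt_same_graph)
    have "K = resolve {w} ?\<rho> G"
    proof -
      have "{x \<in> {w}. ?\<rho> x \<noteq> sv} = {w}" using rs by auto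
      then show ?thesis by (simp add: K_def resolve_def)
    qed
    then have "same_graph (splice {u, v} opposite K)
        (resolve ({w} \<union> {u, v}) (\<lambda>x. if x \<in> {w} then ?\<rho> x else None) G)"
      unfolding splice_opposite_eq_resolve by (simp only:) (rule resolve_resolve, use G vs in auto)
    moreover have "same_graph (resolve ({w} \<union> {u, v}) (\<lambda>x. if x \<in> {w} then ?\<rho> x else None) G) (resolve_list vs ss G)"
    proof -
      have "{w} \<union> {u, v} = set vs" using vs by auto
      then show ?thesis
        unfolding resolve_list_def by (simp only:) (rule resolve_cong, use rs ss vs in auto)
    qed
    ultimately show "same_graph (resolve_list vs ss G) (splice {u, v} opposite K)"
      by (meson same_graph_sym same_graph_trans)
    show "framed_graph (resolve_list vs ss G)" using G vs by (intro framed_graph_resolve_list) auto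
  qed
  ultimately show ?thesis by simp
qed

text \<open>Only \<open>same_graph\<close> can be claimed, since splicing also redefines the values
  of \<open>mate\<close> outside the graph.\<close>

lemma same_graph_splice_empty:
  assumes "framed_graph G"
  shows "same_graph G (splice {} j G)"
proof -
  have "mate (splice {} j G) h = mate G h" if "h \<in> halves G" for h
  proof (rule mate_splice_eqI[OF assms])
    show "(h, mate G h) \<in> splice_rel {} j G"
      using that unfolding splice_rel_def by (intro r_into_rtrancl) blast
  qed (use that framed_graphD[OF assms that] in \<open>auto simp: gluing_def\<close>)
  moreover have no: "{c \<in> halves G // splice_rel {} j G. c \<subseteq> halves_at {}} = {}"
    unfolding quotient_def splice_rel_def by auto
  ultimately show ?thesis
    unfolding same_graph_def circles_splice by (simp only: no) simp
qed

text \<open>With both crossings of a second move left as vertices, the graph before the move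
  contains the bigon of the module relation.\<close>

lemma eqv_bigon_two:
  fixes \<delta> :: "'r::{comm_ring,comm_monoid_mult}"
  assumes G: "framed_graph G" and cd: "c \<in> verts G" "d \<in> verts G" "c \<noteq> d"
    and arcs: "\<And>s. mate G (c, s, Out) = (d, s, In) \<or> mate G (d, s, Out) = (c, s, In)"
  shows "eqv \<delta> (graph_elt (resolve_list [c, d] [sv, sv] G))
    (graph_elt (resolve_list [c, d] [None, None] G))"
proof -
  \<comment> \<open>The bigon relation ignores orientation, so only the existence of suitable ports
    on each strand is kept.\<close>
  have m: "\<exists>p q. mate G (c, s, p) = (d, s, q)" for s
    using arcs[of s] framed_graphD(3)[OF G, of "(d, s, Out)"] cd by fastforce
  then obtain p q p' q' where "mate G (c, Over, p) = (d, Over, q)" "mate G (c, Under, p') = (d, Under, q')"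
    by metis
  then have "bigon G c d"
    by (intro bigonI[OF cd, of Over _ Over _ p']) simp_all
  then have "eqv \<delta> (graph_elt G) (graph_elt (splice {c, d} opposite G))" by (rule eqv_bigon[OF G])
  moreover have "resolve_list [c, d] [sv, sv] G =
      splice {} (glue (\<lambda>v. the (map_of (zip [c, d] [sv, sv]) v))) G"
  proof -
    have "{v \<in> set [c, d]. the (map_of (zip [c, d] [sv, sv]) v) \<noteq> sv} = {}"
      using cd by auto
    then show ?thesis unfolding resolve_list_def resolve_def by (rule arg_cong)
  qed
  moreover have "graph_elt (splice {} j G) = (graph_elt G :: fgraph set \<Rightarrow>\<^sub>0 'r)" for j
    by (rule graph_elt_same_graph[symmetric, OF G same_graph_splice_empty[OF G]])
  moreover have "splice {c, d} opposite G = resolve_list [c, d] [None, None] G"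
  proof -
    have "{v \<in> {c, d}. the (map_of (zip [c, d] [None, None]) v) \<noteq> sv} = {c, d}" by auto
    moreover have "same_graph (splice {c, d} opposite G) (splice {c, d} opposite G)" by simp
    moreover have "splice_rel {c, d} opposite G =
        splice_rel {c, d} (glue (\<lambda>v. the (map_of (zip [c, d] [None, None]) v))) G"
      by (rule splice_rel_same_graph) (auto simp: glue_def)
    ultimately show ?thesis by (simp add: resolve_list_def resolve_def splice_def)
  qed
  ultimately show ?thesis by metis
qed

context
  fixes G :: fgraph and \<delta> :: "'r::{comm_ring,comm_monoid_mult}"
  assumes G: "framed_graph G"
begin

lemma numbered_part_same:
  assumes "distinct vs" "set vs \<subseteq> verts G"
    and "\<And>i i'. (i, i') \<in> set es \<Longrightarrow>
      fst i < length vs \<and> fst i' < length vs \<and> mate G (map_prod ((!) vs) id i) = map_prod ((!) vs) id i'"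
  shows "numbered_part G G vs es id id"
  by unfold_locales (use G assms in auto)

text \<open>The oriented smoothing cuts the loop of the kink off as a circle, whence \<delta>; the
  unoriented one runs through the loop and leaves a single strand.\<close>

lemma eqv_kink:
  assumes "c \<in> verts G" "mate G (c, s, Out) = (c, other_strand s, In)"
  shows "eqv \<delta> (graph_elt (resolve_list [c] [so] G)) (scale \<delta> (graph_elt (resolve_list [c] [None] G)))"
    and "eqv \<delta> (graph_elt (resolve_list [c] [su] G)) (graph_elt (resolve_list [c] [None] G))"
proof -
  let ?es = "[((0, s, Out), (0, other_strand s, In))]"
  interpret numbered_part G G "[c]" ?es id id
    by (rule numbered_part_same) (use assms in auto)
  have chk: "local_check 1 ?es id [so] [None] [v0] 1"
    "local_check 1 ?es id [su] [None] [v0] 0"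
    by (cases s; simp only: other_strand.simps; code_simp)+
  show "eqv \<delta> (graph_elt (resolve_list [c] [so] G)) (scale \<delta> (graph_elt (resolve_list [c] [None] G)))"
    using eqv_local_check[of "[so]" "[None]" _ 1 \<delta>] chk(1) by simp
  show "eqv \<delta> (graph_elt (resolve_list [c] [su] G)) (graph_elt (resolve_list [c] [None] G))"
    using eqv_local_check[of "[su]" "[None]" _ 0 \<delta>] chk(2) by simp
qed

context
  fixes c d :: nat
  assumes cd: "c \<in> verts G" "d \<in> verts G" "c \<noteq> d"
begin

abbreviation "e2 r q \<equiv> graph_elt (resolve_list [c, d] [r, q] G)"

text \<open>For parallel strands two oriented smoothings restore the strands, while any unoriented
  smoothing makes them turn back; two unoriented ones enclose a circle.\<close>

lemma eqv_bigon_coherent: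
  assumes "(\<forall>s. mate G (c, s, Out) = (d, s, In)) \<or> (\<forall>s. mate G (d, s, Out) = (c, s, In))"
  shows "eqv \<delta> (e2 (so) (so)) (e2 None None)"
    "eqv \<delta> (e2 (su) (so)) (e2 (so) (su))"
    "eqv \<delta> (e2 (su) (su)) (scale \<delta> (e2 (so) (su)))"
proof -
  let ?es = "\<lambda>i j. [((i, Over, Out), (j, Over, In)), ((i, Under, Out), (j, Under, In))]"
  let ?vm = "[v0, (1, False, False, False)]"
  obtain i j where ij: "(i, j) = (0, 1) \<or> (i, j) = (1, 0)" and np: "numbered_part G G [c, d] (?es i j) id id"
  proof -
    consider "\<forall>s. mate G (c, s, Out) = (d, s, In)" | "\<forall>s. mate G (d, s, Out) = (c, s, In)"
      using assms by blast
    then show ?thesis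
    proof cases
      case 1
      then show ?thesis by (intro that[of 0 1] numbered_part_same) (use cd in auto)
    next
      case 2
      then show ?thesis by (intro that[of 1 0] numbered_part_same) (use cd in auto)
    qed
  qed
  interpret numbered_part G G "[c, d]" "?es i j" id id by (rule np)
  have "local_check 2 (?es 0 1) id [so, so] [None, None] ?vm 0"
    "local_check 2 (?es 0 1) id [su, so] [so, su] ?vm 0"
    "local_check 2 (?es 0 1) id [su, su] [so, su] ?vm 1"
    "local_check 2 (?es 1 0) id [so, so] [None, None] ?vm 0"
    "local_check 2 (?es 1 0) id [su, so] [so, su] ?vm 0"
    "local_check 2 (?es 1 0) id [su, su] [so, su] ?vm 1"
    by code_simp+
  then have chk: "local_check 2 (?es i j) id [so, so] [None, None] ?vm 0"
    "local_check 2 (?es i j) id [su, so] [so, su] ?vm 0"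
    "local_check 2 (?es i j) id [su, su] [so, su] ?vm 1"
    using ij by auto
  have two: "length [c, d] = 2" by simp
  note e = eqv_local_check[unfolded two]
  show "eqv \<delta> (e2 (so) (so)) (e2 None None)"
    "eqv \<delta> (e2 (su) (so)) (e2 (so) (su))"
    "eqv \<delta> (e2 (su) (su)) (scale \<delta> (e2 (so) (su)))"
    using e[OF chk(1)] e[OF chk(2)] e[OF chk(3)] by simp_all
qed

text \<open>For antiparallel strands the two kinds of smoothing exchange their roles.\<close>

lemma eqv_bigon_contrary:
  assumes "mate G (c, s, Out) = (d, s, In)" "mate G (d, other_strand s, Out) = (c, other_strand s, In)"
  shows "eqv \<delta> (e2 (su) (su)) (e2 None None)"
    "eqv \<delta> (e2 (su) (so)) (e2 (so) (su))"
    "eqv \<delta> (e2 (so) (so)) (scale \<delta> (e2 (so) (su)))"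
proof -
  let ?es = "[((0, s, Out), (1, s, In)), ((1, other_strand s, Out), (0, other_strand s, In))]"
  let ?vm = "[v0, (1, False, False, False)]"
  interpret numbered_part G G "[c, d]" ?es id id
    by (rule numbered_part_same) (use cd assms in auto)
  have chk: "local_check 2 ?es id [su, su] [None, None] ?vm 0"
    "local_check 2 ?es id [su, so] [so, su] ?vm 0"
    "local_check 2 ?es id [so, so] [so, su] ?vm 1"
    by (cases s; simp only: other_strand.simps; code_simp)+
  have two: "length [c, d] = 2" by simp
  note e = eqv_local_check[unfolded two]
  show "eqv \<delta> (e2 (su) (su)) (e2 None None)"
    "eqv \<delta> (e2 (su) (so)) (e2 (so) (su))"
    "eqv \<delta> (e2 (so) (so)) (scale \<delta> (e2 (so) (su)))"
    using e[OF chk(1)] e[OF chk(2)] e[OF chk(3)] by simp_all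
qed

end

end

text \<open>Positions 0, 1, 2 stand for the crossings a, b, c. This is the triangle with three
  positive crossings and \<eta> = -1: the middle strand runs from c to a, the bottom strand from c
  to b, the top strand from b to a. The primed list describes the triangle after the
  exchange.\<close>

definition triangle_edges :: "(half_edge \<times> half_edge) list" where
  "triangle_edges = [((2, Over, Out), (0, Under, In)), ((2, Under, Out), (1, Under, In)), ((1, Over, Out), (0, Over, In))]"

definition triangle_edges' :: "(half_edge \<times> half_edge) list" where
  "triangle_edges' = [((0, Under, Out), (2, Over, In)), ((1, Under, Out), (2, Under, In)), ((0, Over, Out), (1, Over, In))]"

text \<open>A row consists of two resolutions, the correspondence of their graphical vertices, and
  the surplus of loops in the first. These rows reduce states before the move to representatives
  among them; the entries \<open>None\<close> come from the bigon relation.\<close>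

definition triangle_left ::
  "(resolution option list \<times> resolution option list \<times> (nat \<times> bool \<times> bool \<times> bool) list \<times> nat) list" where
  "triangle_left = [
    ([None, so, None], [so, so, so], [v0, v0, v0], 0),
    ([su, so, so], [so, so, su], [v0, v0, v0], 0),
    ([su, so, su], [so, so, su], [v0, v0, v0], 1),
    ([su, su, su], [so, so, su], [v0, v0, v0], 0),
    ([su, None, None], [su, su, so], [v0, v0, v0], 0),
    ([su, su, sv], [su, sv, so], [v0, v0, (1, True, False, True)], 0),
    ([so, so, sv], [sv, so, so], [v0, v0, v0], 0),
    ([None, None, su], [so, su, su], [v0, v0, v0], 0),
    ([sv, su, su], [so, sv, su], [(1, True, True, False), v0, v0], 0)]"

text \<open>The first resolution is a representative before the move, the second a resolution after
  the move, where the edges are attached through the exchange.\<close>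

definition triangle_across ::
  "(resolution option list \<times> resolution option list \<times> (nat \<times> bool \<times> bool \<times> bool) list \<times> nat) list" where
  "triangle_across = [
    ([so, so, so], [so, so, so], [v0, v0, v0], 0),
    ([so, so, so], [None, so, None], [v0, v0, v0], 0),
    ([so, su, so], [so, so, su], [v0, v0, v0], 0),
    ([so, su, so], [su, so, so], [v0, v0, v0], 0),
    ([so, su, so], [su, su, su], [v0, v0, v0], 0),
    ([so, sv, so], [so, so, sv], [v0, (2, False, False, False), v0], 0),
    ([so, sv, so], [sv, so, so], [v0, v0, v0], 0),
    ([so, so, su], [so, su, so], [v0, v0, v0], 0),
    ([su, su, so], [su, su, so], [v0, v0, v0], 0),
    ([su, su, so], [su, None, None], [v0, v0, v0], 0),
    ([su, sv, so], [sv, su, so], [v0, v0, v0], 0),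
    ([sv, so, so], [so, sv, so], [(1, False, False, False), v0, v0], 0),
    ([sv, su, so], [su, su, sv], [(2, True, True, False), v0, v0], 0),
    ([sv, su, so], [su, sv, so], [(1, False, False, False), v0, v0], 0),
    ([sv, sv, so], [sv, sv, so], [(1, False, False, False), v0, v0], 0),
    ([so, su, su], [so, su, su], [v0, v0, v0], 0),
    ([so, su, su], [None, None, su], [v0, v0, v0], 0),
    ([so, sv, su], [so, su, sv], [v0, (2, False, False, False), v0], 0),
    ([so, su, sv], [sv, su, su], [v0, v0, (0, True, False, True)], 0),
    ([so, su, sv], [so, sv, su], [v0, v0, (1, False, False, False)], 0),
    ([so, sv, sv], [so, sv, sv], [v0, (2, False, False, False), (1, False, False, False)], 0),
    ([sv, su, sv], [sv, su, sv], [(2, True, True, False), v0, (0, True, False, True)], 0)]"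

text \<open>This state after the move splits off a circle. It is first reduced within the new
  triangle and then carried across.\<close>

definition triangle_right ::
  "(resolution option list \<times> resolution option list \<times> (nat \<times> bool \<times> bool \<times> bool) list \<times> nat) list" where
  "triangle_right = [
    ([su, so, su], [so, so, su], [v0, v0, v0], 1)]"

lemma triangle_checks:
  "list_all (\<lambda>(rs, ss, vm, d). local_check 3 triangle_edges id rs ss vm d) triangle_left"
  "list_all (\<lambda>(rs, ss, vm, d). local_check 3 triangle_edges (exchange_half 0 1 2) rs ss vm d) triangle_across"
  "list_all (\<lambda>(rs, ss, vm, d). local_check 3 triangle_edges' id rs ss vm d) triangle_right"
  by code_simp+

lemma exchange_half_simps:
  assumes "a \<noteq> b" "a \<noteq> c" "b \<noteq> c"
  shows "exchange_half a b c (a, Over, p) = (b, Over, p)" "exchange_half a b c (b, Over, p) = (a, Over, p)"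
    "exchange_half a b c (a, Under, p) = (c, Over, p)" "exchange_half a b c (c, Over, p) = (a, Under, p)"
    "exchange_half a b c (b, Under, p) = (c, Under, p)" "exchange_half a b c (c, Under, p) = (b, Under, p)"
    "v \<noteq> a \<Longrightarrow> v \<noteq> b \<Longrightarrow> v \<noteq> c \<Longrightarrow> exchange_half a b c (v, s, p) = (v, s, p)"
  using assms by (auto simp: exchange_half_def exchange_def transpose_def)

lemma exchange_half_cases:
  fixes h :: half_edge
  obtains p where "h = (a, Over, p)" | p where "h = (b, Over, p)" | p where "h = (a, Under, p)"
    | p where "h = (c, Over, p)" | p where "h = (b, Under, p)" | p where "h = (c, Under, p)"
    | v s p where "h = (v, s, p)" "v \<noteq> a" "v \<noteq> b" "v \<noteq> c"
proof -
  obtain v s p where "h = (v, s, p)" by (rule prod_cases3)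
  then show ?thesis
    by (cases s; cases "v = a"; cases "v = b"; cases "v = c") (simp_all add: that)
qed

lemma exchange_half_exchange_half:
  assumes "a \<noteq> b" "a \<noteq> c" "b \<noteq> c"
  shows "exchange_half a b c (exchange_half a b c h) = h"
  by (rule exchange_half_cases[where h = h and a = a and b = b and c = c]) (simp_all add: exchange_half_simps[OF assms])

lemma fst_exchange_half:
  assumes "a \<noteq> b" "a \<noteq> c" "b \<noteq> c"
  shows "fst (exchange_half a b c h) \<in> {a, b, c} \<longleftrightarrow> fst h \<in> {a, b, c}"
    "fst h \<notin> {a, b, c} \<Longrightarrow> exchange_half a b c h = h"
    "snd (snd (exchange_half a b c h)) = snd (snd h)"
  by (rule exchange_half_cases[where h = h and a = a and b = b and c = c]; simp add: exchange_half_simps[OF assms])+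

lemma framed_graph_conj:
  assumes G: "framed_graph G" and H: "verts H = verts G" "circles H = circles G"
    and mates: "\<And>h. h \<in> halves G \<Longrightarrow> mate H h = x (mate G (x h))"
    and x: "\<And>h. x (x h) = h" "\<And>h. h \<in> halves G \<Longrightarrow> x h \<in> halves G"
  shows "framed_graph H"
  unfolding framed_graph_def
proof (intro conjI ballI)
  show "finite (verts H)" "verts H \<noteq> {} \<or> 0 < circles H" using G H by (auto simp: framed_graph_def)
  fix h assume "h \<in> halves H"
  then have h: "h \<in> halves G" using H by simp
  note m = framed_graphD[OF G x(2)[OF h]]
  show "mate H h \<in> halves H" using mates[OF h] x(2)[OF m(1)] H by simp
  show "mate H h \<noteq> h" using mates[OF h] m(2) x(1) by metis
  show "mate H (mate H h) = h"
    using mates[OF h] mates[OF x(2)[OF m(1)]] m(3) x(1) by simp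
qed

text \<open>Splicing commutes with conjugation by an involution that fixes the spliced half-edges.
  Consequently, whatever the outer state, the outer graphs before and after a third move again
  differ by the exchange at the triangle.\<close>

lemma splice_conj:
  fixes G H :: fgraph
  assumes G: "framed_graph G" and H: "verts H = verts G" "circles H = circles G"
    and mates: "\<And>h. h \<in> halves G \<Longrightarrow> mate H h = x (mate G (x h))"
    and x: "\<And>h. x (x h) = h" "\<And>h. h \<in> halves_at S \<Longrightarrow> x h = h" "\<And>h. h \<in> halves G \<Longrightarrow> x h \<in> halves G"
    and j: "gluing S j" "S \<subseteq> verts G"
  shows "circles (splice S j H) = circles (splice S j G)"
    and "h \<in> halves_at (verts G - S) \<Longrightarrow> mate (splice S j H) h = x (mate (splice S j G) (x h))"
proof -
  have fH: "framed_graph H" by (rule framed_graph_conj[OF G H mates x(1,3)])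
  have SH: "S \<subseteq> verts H" using j H by simp
  let ?R = "mate_pairs G \<union> glue_pairs S j" and ?R' = "mate_pairs H \<union> glue_pairs S j"
  have sub: "?R \<subseteq> halves G \<times> halves G" "?R' \<subseteq> halves G \<times> halves G"
    using mate_pairs_subset[OF G] mate_pairs_subset[OF fH] glue_pairs_subset[OF j(1)] j(2) H by blast+
  have bij: "bij_betw x (halves G) (halves G)"
    by (rule bij_betwI[of _ _ _ x]) (use x in auto)
  have jS: "j g \<in> halves_at S" if "g \<in> halves_at S" for g
    using j(1) that unfolding gluing_def by blast
  have iff: "(p, q) \<in> ?R \<longleftrightarrow> (x p, x q) \<in> ?R'" if p: "p \<in> halves G" "q \<in> halves G" for p q
  proof -
    have "(p, q) \<in> mate_pairs G \<longleftrightarrow> (x p, x q) \<in> mate_pairs H"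
    proof -
      have "(x p, x q) \<in> mate_pairs H \<longleftrightarrow> x q = x (mate G p)"
        using mates[OF x(3)[OF p(1)]] x(3)[OF p(1)] H(1) by (auto simp: mate_pairs_def x(1))
      also have "\<dots> \<longleftrightarrow> q = mate G p" using x(1) by metis
      finally show ?thesis using p by (auto simp: mate_pairs_def)
    qed
    moreover have "(p, q) \<in> glue_pairs S j \<longleftrightarrow> (x p, x q) \<in> glue_pairs S j"
    proof
      assume "(p, q) \<in> glue_pairs S j"
      then have "q = j p" "p \<in> halves_at S" unfolding glue_pairs_def by blast+
      then have "(x p, x q) = (p, q)" using x(2) jS by simp
      then show "(x p, x q) \<in> glue_pairs S j" using \<open>(p, q) \<in> _\<close> by simp
    next
      assume a: "(x p, x q) \<in> glue_pairs S j"
      then have b: "x q = j (x p)" "x p \<in> halves_at S" unfolding glue_pairs_def by blast+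
      then have "x (x p) = x p" "x (x q) = x q" using x(2) jS by simp_all
      then show "(p, q) \<in> glue_pairs S j" using a x(1) by simp
    qed
    ultimately show ?thesis by blast
  qed
  have "x ` halves_at S = (\<lambda>h. h) ` halves_at S" by (rule image_cong[OF refl x(2)])
  then have "x ` halves_at S = halves_at S" by simp
  then have "card {c \<in> halves G // ?R\<^sup>*. c \<subseteq> halves_at S} = card {c \<in> halves G // ?R'\<^sup>*. c \<subseteq> halves_at S}"
    by (intro card_components_bij[OF bij sub iff]) (use j(2) in auto)
  then show "circles (splice S j H) = circles (splice S j G)"
    by (simp add: circles_splice splice_rel_eq H)
  have x_out: "x g \<in> halves_at (verts G - S)" if "g \<in> halves_at (verts G - S)" for g
  proof -
    have "x g \<in> halves G" using that x(3) by blast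
    moreover have "x g \<notin> halves_at S"
    proof
      assume "x g \<in> halves_at S"
      then have "g \<in> halves_at S" using x(2)[of "x g"] x(1)[of g] by simp
      then show False using that by auto
    qed
    ultimately show ?thesis by auto
  qed
  assume h: "h \<in> halves_at (verts G - S)"
  note m = mate_splice[OF G j x_out[OF h]]
  show "mate (splice S j H) h = x (mate (splice S j G) (x h))"
  proof (rule mate_splice_eqI[OF fH j(1) SH])
    show "h \<in> halves_at (verts H - S)" "x (mate (splice S j G) (x h)) \<in> halves_at (verts H - S)"
      using h x_out[OF m(1)] H by simp_all
    show "x (mate (splice S j G) (x h)) \<noteq> h" using m(2) x(1) by metis
    have subK: "halves_at (verts G - S) \<subseteq> halves G" by (rule Sigma_mono) auto
    have "x h \<in> halves G" "mate (splice S j G) (x h) \<in> halves G"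
      by (rule subsetD[OF subK x_out[OF h]], rule subsetD[OF subK m(1)])
    from rtrancl_bij_iff[OF bij sub iff this] m(3)
    have "(x (x h), x (mate (splice S j G) (x h))) \<in> ?R'\<^sup>*"
      unfolding splice_rel_eq by simp
    then show "(h, x (mate (splice S j G) (x h))) \<in> splice_rel S j H"
      unfolding splice_rel_eq x(1) .
  qed
qed

locale triangle = numbered_part G H "[a, b, c]" triangle_edges "exchange_half a b c" "exchange_half 0 1 2"
  for G H :: fgraph and a b c :: nat
begin

abbreviation "e rs \<equiv> graph_elt (resolve_list [a, b, c] rs G)"
abbreviation "e' rs \<equiv> graph_elt (resolve_list [a, b, c] rs H)"

lemma abc: "a \<noteq> b" "a \<noteq> c" "b \<noteq> c" "{a, b, c} \<subseteq> verts G" "{a, b, c} \<subseteq> verts H"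
  using vs verts by auto

lemma mates_G:
  "mate G (c, Over, Out) = (a, Under, In)" "mate G (a, Under, In) = (c, Over, Out)"
  "mate G (c, Under, Out) = (b, Under, In)" "mate G (b, Under, In) = (c, Under, Out)"
  "mate G (b, Over, Out) = (a, Over, In)" "mate G (a, Over, In) = (b, Over, Out)"
proof -
  show m: "mate G (c, Over, Out) = (a, Under, In)" "mate G (c, Under, Out) = (b, Under, In)"
    "mate G (b, Over, Out) = (a, Over, In)"
    using es[of "(2, Over, Out)" "(0, Under, In)"] es[of "(2, Under, Out)" "(1, Under, In)"]
      es[of "(1, Over, Out)" "(0, Over, In)"] by (simp_all add: triangle_edges_def)
  have "b \<in> verts G" "c \<in> verts G" using abc(4) by auto
  then show "mate G (a, Under, In) = (c, Over, Out)" "mate G (b, Under, In) = (c, Under, Out)"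
    "mate G (a, Over, In) = (b, Over, Out)"
    using framed_graphD(3)[OF framed(1), of "(c, Over, Out)"] framed_graphD(3)[OF framed(1), of "(c, Under, Out)"]
      framed_graphD(3)[OF framed(1), of "(b, Over, Out)"] m by simp_all
qed

lemma mates_H:
  "mate H (a, Under, Out) = (c, Over, In)" "mate H (c, Over, In) = (a, Under, Out)"
  "mate H (b, Under, Out) = (c, Under, In)" "mate H (c, Under, In) = (b, Under, Out)"
  "mate H (a, Over, Out) = (b, Over, In)" "mate H (b, Over, In) = (a, Over, Out)"
  using abc by (simp_all add: mates exchange_half_simps[OF abc(1-3)] mates_G)

lemma numbered_part_H: "numbered_part H H [a, b, c] triangle_edges' id id"
  by (rule numbered_part_same[OF framed(2)])
    (use abc mates_H in \<open>auto simp: triangle_edges'_def\<close>)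

lemma eqv_triangle:
  fixes \<delta> :: "'r::{comm_ring,comm_monoid_mult}" and vm :: "(nat \<times> bool \<times> bool \<times> bool) list"
  shows "(rs, ss, vm, d) \<in> set triangle_left \<Longrightarrow> length rs = 3 \<Longrightarrow> length ss = 3 \<Longrightarrow>
      eqv \<delta> (e rs) (scale (\<delta> ^ d) (e ss))"
    and "(rs, ss, vm, d) \<in> set triangle_across \<Longrightarrow> length rs = 3 \<Longrightarrow> length ss = 3 \<Longrightarrow>
      eqv \<delta> (e rs) (scale (\<delta> ^ d) (e' ss))"
    and "(rs, ss, vm, d) \<in> set triangle_right \<Longrightarrow> length rs = 3 \<Longrightarrow> length ss = 3 \<Longrightarrow>
      eqv \<delta> (e' rs) (scale (\<delta> ^ d) (e' ss))"
proof -
  have three: "length [a, b, c] = 3" by simp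
  interpret l: numbered_part G G "[a, b, c]" triangle_edges id id by (rule numbered_part_id)
  interpret r: numbered_part H H "[a, b, c]" triangle_edges' id id by (rule numbered_part_H)
  show "(rs, ss, vm, d) \<in> set triangle_left \<Longrightarrow> length rs = 3 \<Longrightarrow> length ss = 3 \<Longrightarrow>
      eqv \<delta> (e rs) (scale (\<delta> ^ d) (e ss))"
    using triangle_checks(1) by (intro l.eqv_local_check[unfolded three, where vm = vm]) (auto simp: list_all_iff)
  show "(rs, ss, vm, d) \<in> set triangle_across \<Longrightarrow> length rs = 3 \<Longrightarrow> length ss = 3 \<Longrightarrow>
      eqv \<delta> (e rs) (scale (\<delta> ^ d) (e' ss))"
    using triangle_checks(2) by (intro eqv_local_check[unfolded three, where vm = vm]) (auto simp: list_all_iff)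
  show "(rs, ss, vm, d) \<in> set triangle_right \<Longrightarrow> length rs = 3 \<Longrightarrow> length ss = 3 \<Longrightarrow>
      eqv \<delta> (e' rs) (scale (\<delta> ^ d) (e' ss))"
    using triangle_checks(3) by (intro r.eqv_local_check[unfolded three, where vm = vm]) (auto simp: list_all_iff)
qed

text \<open>Two graphical crossings of the triangle share one of its edges. The smoothing of the
  third crossing listed here joins the two remaining edges into a second connection, so that a bigon
  appears: oriented if the third crossing is b, unoriented if it is a or c.\<close>

lemma eqv_triangle_bigon:
  fixes \<delta> :: "'r::{comm_ring,comm_monoid_mult}"
  shows "eqv \<delta> (e [sv, so, sv]) (e [None, so, None])"
    "eqv \<delta> (e [sv, sv, su]) (e [None, None, su])"
    "eqv \<delta> (e [su, sv, sv]) (e [su, None, None])"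
    "eqv \<delta> (e' [sv, so, sv]) (e' [None, so, None])"
    "eqv \<delta> (e' [sv, sv, su]) (e' [None, None, su])"
    "eqv \<delta> (e' [su, sv, sv]) (e' [su, None, None])"
proof -
  show "eqv \<delta> (e [sv, so, sv]) (e [None, so, None])"
    by (rule eqv_bigon_resolve_list[OF framed(1), where u = c and v = a and w = b and s = Over and t = Under
          and r = Oriented and p = Out and q = In and p' = Out and k = Under and l = In and q' = In])
      (use abc in \<open>auto simp: mates_G\<close>)
  show "eqv \<delta> (e [sv, sv, su]) (e [None, None, su])"
    by (rule eqv_bigon_resolve_list[OF framed(1), where u = b and v = a and w = c and s = Over and t = Over
          and r = Unoriented and p = Out and q = In and p' = In and k = Under and l = Out and q' = In])
      (use abc in \<open>auto simp: mates_G\<close>)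
  show "eqv \<delta> (e [su, sv, sv]) (e [su, None, None])"
    by (rule eqv_bigon_resolve_list[OF framed(1), where u = c and v = b and w = a and s = Under and t = Under
          and r = Unoriented and p = Out and q = In and p' = Out and k = Under and l = In and q' = Out])
      (use abc in \<open>auto simp: mates_G\<close>)
  show "eqv \<delta> (e' [sv, so, sv]) (e' [None, so, None])"
    by (rule eqv_bigon_resolve_list[OF framed(2), where u = a and v = c and w = b and s = Under and t = Over
          and r = Oriented and p = Out and q = In and p' = Out and k = Over and l = In and q' = In])
      (use abc in \<open>auto simp: mates_H\<close>)
  show "eqv \<delta> (e' [sv, sv, su]) (e' [None, None, su])"
    by (rule eqv_bigon_resolve_list[OF framed(2), where u = a and v = b and w = c and s = Over and t = Over
          and r = Unoriented and p = Out and q = In and p' = Out and k = Over and l = In and q' = Out])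
      (use abc in \<open>auto simp: mates_H\<close>)
  show "eqv \<delta> (e' [su, sv, sv]) (e' [su, None, None])"
    by (rule eqv_bigon_resolve_list[OF framed(2), where u = b and v = c and w = a and s = Under and t = Under
          and r = Unoriented and p = Out and q = In and p' = In and k = Over and l = Out and q' = In])
      (use abc in \<open>auto simp: mates_H\<close>)
qed

text \<open>Nine of the 27 states reduce to others. Setting aside the four whose coefficients vanish
  by (iii), 14 representatives remain, one for each nonvanishing equation of (iii).\<close>

lemma eqv_left_states:
  fixes \<delta> :: "'r::{comm_ring,comm_monoid_mult}"
  shows "eqv \<delta> (e [sv, so, sv]) (e [so, so, so])"
    "eqv \<delta> (e [su, so, so]) (e [so, so, su])"
    "eqv \<delta> (e [su, so, su]) (scale \<delta> (e [so, so, su]))"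
    "eqv \<delta> (e [su, su, su]) (e [so, so, su])"
    "eqv \<delta> (e [su, sv, sv]) (e [su, su, so])"
    "eqv \<delta> (e [su, su, sv]) (e [su, sv, so])"
    "eqv \<delta> (e [so, so, sv]) (e [sv, so, so])"
    "eqv \<delta> (e [sv, sv, su]) (e [so, su, su])"
    "eqv \<delta> (e [sv, su, su]) (e [so, sv, su])"
proof -
  note t = eqv_triangle[where \<delta> = \<delta>] and b = eqv_triangle_bigon[of \<delta>]
  have "eqv \<delta> (e [sv, so, sv]) (e [None, so, None])" by (rule b)
  also have "eqv \<delta> (e [None, so, None]) (e [so, so, so])"
    using t(1)[of "[None, so, None]" "[so, so, so]" "[v0, v0, v0]" 0] by (simp add: triangle_left_def)
  finally show "eqv \<delta> (e [sv, so, sv]) (e [so, so, so])" .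
  show "eqv \<delta> (e [su, so, so]) (e [so, so, su])"
    using t(1)[of "[su, so, so]" "[so, so, su]" "[v0, v0, v0]" 0] by (simp add: triangle_left_def)
  show "eqv \<delta> (e [su, so, su]) (scale \<delta> (e [so, so, su]))"
    using t(1)[of "[su, so, su]" "[so, so, su]" "[v0, v0, v0]" 1] by (simp add: triangle_left_def)
  show "eqv \<delta> (e [su, su, su]) (e [so, so, su])"
    using t(1)[of "[su, su, su]" "[so, so, su]" "[v0, v0, v0]" 0] by (simp add: triangle_left_def)
  have "eqv \<delta> (e [su, sv, sv]) (e [su, None, None])" by (rule b)
  also have "eqv \<delta> (e [su, None, None]) (e [su, su, so])"
    using t(1)[of "[su, None, None]" "[su, su, so]" "[v0, v0, v0]" 0] by (simp add: triangle_left_def)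
  finally show "eqv \<delta> (e [su, sv, sv]) (e [su, su, so])" .
  show "eqv \<delta> (e [su, su, sv]) (e [su, sv, so])"
    using t(1)[of "[su, su, sv]" "[su, sv, so]" "[v0, v0, (1, True, False, True)]" 0] by (simp add: triangle_left_def)
  show "eqv \<delta> (e [so, so, sv]) (e [sv, so, so])"
    using t(1)[of "[so, so, sv]" "[sv, so, so]" "[v0, v0, v0]" 0] by (simp add: triangle_left_def)
  have "eqv \<delta> (e [sv, sv, su]) (e [None, None, su])" by (rule b)
  also have "eqv \<delta> (e [None, None, su]) (e [so, su, su])"
    using t(1)[of "[None, None, su]" "[so, su, su]" "[v0, v0, v0]" 0] by (simp add: triangle_left_def)
  finally show "eqv \<delta> (e [sv, sv, su]) (e [so, su, su])" .
  show "eqv \<delta> (e [sv, su, su]) (e [so, sv, su])"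
    using t(1)[of "[sv, su, su]" "[so, sv, su]" "[(1, True, True, False), v0, v0]" 0] by (simp add: triangle_left_def)
qed

text \<open>The states after the move, except for four with vanishing coefficient, are expressed by
  the same 14 representatives before the move.\<close>

lemma eqv_right_states:
  fixes \<delta> :: "'r::{comm_ring,comm_monoid_mult}"
  shows "eqv \<delta> (e' [so, so, so]) (e [so, so, so])"
    "eqv \<delta> (e' [sv, so, sv]) (e [so, so, so])"
    "eqv \<delta> (e' [so, so, su]) (e [so, su, so])"
    "eqv \<delta> (e' [su, so, so]) (e [so, su, so])"
    "eqv \<delta> (e' [su, so, su]) (scale \<delta> (e [so, su, so]))"
    "eqv \<delta> (e' [su, su, su]) (e [so, su, so])"
    "eqv \<delta> (e' [so, so, sv]) (e [so, sv, so])"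
    "eqv \<delta> (e' [sv, so, so]) (e [so, sv, so])"
    "eqv \<delta> (e' [so, su, so]) (e [so, so, su])"
    "eqv \<delta> (e' [su, su, so]) (e [su, su, so])"
    "eqv \<delta> (e' [su, sv, sv]) (e [su, su, so])"
    "eqv \<delta> (e' [sv, su, so]) (e [su, sv, so])"
    "eqv \<delta> (e' [so, sv, so]) (e [sv, so, so])"
    "eqv \<delta> (e' [su, su, sv]) (e [sv, su, so])"
    "eqv \<delta> (e' [su, sv, so]) (e [sv, su, so])"
    "eqv \<delta> (e' [sv, sv, so]) (e [sv, sv, so])"
    "eqv \<delta> (e' [so, su, su]) (e [so, su, su])"
    "eqv \<delta> (e' [sv, sv, su]) (e [so, su, su])"
    "eqv \<delta> (e' [so, su, sv]) (e [so, sv, su])"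
    "eqv \<delta> (e' [sv, su, su]) (e [so, su, sv])"
    "eqv \<delta> (e' [so, sv, su]) (e [so, su, sv])"
    "eqv \<delta> (e' [so, sv, sv]) (e [so, sv, sv])"
    "eqv \<delta> (e' [sv, su, sv]) (e [sv, su, sv])"
proof -
  note t = eqv_triangle[where \<delta> = \<delta>] and b = eqv_triangle_bigon[of \<delta>]
  show "eqv \<delta> (e' [so, so, so]) (e [so, so, so])"
    using t(2)[of "[so, so, so]" "[so, so, so]" "[v0, v0, v0]" 0, THEN eqv_sym] by (simp add: triangle_across_def)
  have "eqv \<delta> (e' [sv, so, sv]) (e' [None, so, None])" by (rule b)
  also have "eqv \<delta> (e' [None, so, None]) (e [so, so, so])"
    using t(2)[of "[so, so, so]" "[None, so, None]" "[v0, v0, v0]" 0, THEN eqv_sym] by (simp add: triangle_across_def)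
  finally show "eqv \<delta> (e' [sv, so, sv]) (e [so, so, so])" .
  show "eqv \<delta> (e' [so, so, su]) (e [so, su, so])"
    using t(2)[of "[so, su, so]" "[so, so, su]" "[v0, v0, v0]" 0, THEN eqv_sym] by (simp add: triangle_across_def)
  show "eqv \<delta> (e' [su, so, so]) (e [so, su, so])"
    using t(2)[of "[so, su, so]" "[su, so, so]" "[v0, v0, v0]" 0, THEN eqv_sym] by (simp add: triangle_across_def)
  have "eqv \<delta> (e' [su, so, su]) (scale \<delta> (e' [so, so, su]))"
    using t(3)[of "[su, so, su]" "[so, so, su]" "[v0, v0, v0]" 1] by (simp add: triangle_right_def)
  also have "eqv \<delta> \<dots> (scale \<delta> (e [so, su, so]))"
    using t(2)[of "[so, su, so]" "[so, so, su]" "[v0, v0, v0]" 0, THEN eqv_sym]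
    by (intro eqv_scale) (simp add: triangle_across_def)
  finally show "eqv \<delta> (e' [su, so, su]) (scale \<delta> (e [so, su, so]))" .
  show "eqv \<delta> (e' [su, su, su]) (e [so, su, so])"
    using t(2)[of "[so, su, so]" "[su, su, su]" "[v0, v0, v0]" 0, THEN eqv_sym] by (simp add: triangle_across_def)
  show "eqv \<delta> (e' [so, so, sv]) (e [so, sv, so])"
    using t(2)[of "[so, sv, so]" "[so, so, sv]" "[v0, (2, False, False, False), v0]" 0, THEN eqv_sym] by (simp add: triangle_across_def)
  show "eqv \<delta> (e' [sv, so, so]) (e [so, sv, so])"
    using t(2)[of "[so, sv, so]" "[sv, so, so]" "[v0, v0, v0]" 0, THEN eqv_sym] by (simp add: triangle_across_def)
  show "eqv \<delta> (e' [so, su, so]) (e [so, so, su])"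
    using t(2)[of "[so, so, su]" "[so, su, so]" "[v0, v0, v0]" 0, THEN eqv_sym] by (simp add: triangle_across_def)
  show "eqv \<delta> (e' [su, su, so]) (e [su, su, so])"
    using t(2)[of "[su, su, so]" "[su, su, so]" "[v0, v0, v0]" 0, THEN eqv_sym] by (simp add: triangle_across_def)
  have "eqv \<delta> (e' [su, sv, sv]) (e' [su, None, None])" by (rule b)
  also have "eqv \<delta> (e' [su, None, None]) (e [su, su, so])"
    using t(2)[of "[su, su, so]" "[su, None, None]" "[v0, v0, v0]" 0, THEN eqv_sym] by (simp add: triangle_across_def)
  finally show "eqv \<delta> (e' [su, sv, sv]) (e [su, su, so])" .
  show "eqv \<delta> (e' [sv, su, so]) (e [su, sv, so])"
    using t(2)[of "[su, sv, so]" "[sv, su, so]" "[v0, v0, v0]" 0, THEN eqv_sym] by (simp add: triangle_across_def)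
  show "eqv \<delta> (e' [so, sv, so]) (e [sv, so, so])"
    using t(2)[of "[sv, so, so]" "[so, sv, so]" "[(1, False, False, False), v0, v0]" 0, THEN eqv_sym] by (simp add: triangle_across_def)
  show "eqv \<delta> (e' [su, su, sv]) (e [sv, su, so])"
    using t(2)[of "[sv, su, so]" "[su, su, sv]" "[(2, True, True, False), v0, v0]" 0, THEN eqv_sym] by (simp add: triangle_across_def)
  show "eqv \<delta> (e' [su, sv, so]) (e [sv, su, so])"
    using t(2)[of "[sv, su, so]" "[su, sv, so]" "[(1, False, False, False), v0, v0]" 0, THEN eqv_sym] by (simp add: triangle_across_def)
  show "eqv \<delta> (e' [sv, sv, so]) (e [sv, sv, so])"
    using t(2)[of "[sv, sv, so]" "[sv, sv, so]" "[(1, False, False, False), v0, v0]" 0, THEN eqv_sym] by (simp add: triangle_across_def)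
  show "eqv \<delta> (e' [so, su, su]) (e [so, su, su])"
    using t(2)[of "[so, su, su]" "[so, su, su]" "[v0, v0, v0]" 0, THEN eqv_sym] by (simp add: triangle_across_def)
  have "eqv \<delta> (e' [sv, sv, su]) (e' [None, None, su])" by (rule b)
  also have "eqv \<delta> (e' [None, None, su]) (e [so, su, su])"
    using t(2)[of "[so, su, su]" "[None, None, su]" "[v0, v0, v0]" 0, THEN eqv_sym] by (simp add: triangle_across_def)
  finally show "eqv \<delta> (e' [sv, sv, su]) (e [so, su, su])" .
  show "eqv \<delta> (e' [so, su, sv]) (e [so, sv, su])"
    using t(2)[of "[so, sv, su]" "[so, su, sv]" "[v0, (2, False, False, False), v0]" 0, THEN eqv_sym] by (simp add: triangle_across_def)
  show "eqv \<delta> (e' [sv, su, su]) (e [so, su, sv])"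
    using t(2)[of "[so, su, sv]" "[sv, su, su]" "[v0, v0, (0, True, False, True)]" 0, THEN eqv_sym] by (simp add: triangle_across_def)
  show "eqv \<delta> (e' [so, sv, su]) (e [so, su, sv])"
    using t(2)[of "[so, su, sv]" "[so, sv, su]" "[v0, v0, (1, False, False, False)]" 0, THEN eqv_sym] by (simp add: triangle_across_def)
  show "eqv \<delta> (e' [so, sv, sv]) (e [so, sv, sv])"
    using t(2)[of "[so, sv, sv]" "[so, sv, sv]" "[v0, (2, False, False, False), (1, False, False, False)]" 0, THEN eqv_sym] by (simp add: triangle_across_def)
  show "eqv \<delta> (e' [sv, su, sv]) (e [sv, su, sv])"
    using t(2)[of "[sv, su, sv]" "[sv, su, sv]" "[(2, True, True, False), v0, (0, True, False, True)]" 0, THEN eqv_sym] by (simp add: triangle_across_def)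
qed

end

section \<open>Local sums collected by graph and compared by (i), (ii), (iii)\<close>

lemma eqv_kink_sum:
  fixes f :: "resolution \<Rightarrow> 'r::{comm_ring,comm_monoid_mult}"
  assumes "framed_graph G" "c \<in> verts G" "mate G (c, s, Out) = (c, other_strand s, In)"
    and "\<delta> * f Oriented + f Unoriented = u" "f Vertex = 0"
  shows "eqv \<delta> (\<Sum>r\<in>UNIV. scale (f r) (graph_elt (resolve_list [c] [Some r] G)))
    (scale u (graph_elt (resolve_list [c] [None] G)))"
proof -
  let ?e = "graph_elt (resolve_list [c] [None] G)"
  have "eqv \<delta> (\<Sum>r\<in>UNIV. scale (f r) (graph_elt (resolve_list [c] [Some r] G)))
      (scale (f Oriented) (scale \<delta> ?e) + scale (f Unoriented) ?e + scale (f Vertex) (graph_elt (resolve_list [c] [sv] G)))"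
    unfolding sum_resolution by (intro eqv_add eqv_scale eqv_kink[OF assms(1-3)] eqv_refl)
  also have "\<dots> = scale u ?e"
    using assms(4,5) by (simp flip: scale_add_left add: mult.commute)
  finally show ?thesis .
qed

text \<open>The coefficient of the two restored strands is AD + CF or BE + CF, both equal to 1. The
  coefficient of the turning back is AE + BD plus \<delta> BE or \<delta> AD according to the
  orientation; since AD = BE, one equation of (ii) makes both vanish.\<close>

lemma eqv_bigon_sum:
  fixes f g :: "resolution \<Rightarrow> 'r::{comm_ring,comm_monoid_mult}"
  assumes G: "framed_graph G" and cd: "c \<in> verts G" "d \<in> verts G" "c \<noteq> d"
    and arcs: "\<And>s. mate G (c, s, Out) = (d, s, In) \<or> mate G (d, s, Out) = (c, s, In)"
    and zero: "f Oriented * g Vertex = 0" "f Vertex * g Oriented = 0" "f Unoriented * g Vertex = 0"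
      "f Vertex * g Unoriented = 0"
    and unit: "f Oriented * g Oriented = 1 - f Vertex * g Vertex" "f Unoriented * g Unoriented = 1 - f Vertex * g Vertex"
    and cup: "\<delta> * f Oriented * g Oriented = - (f Oriented * g Unoriented) - f Unoriented * g Oriented"
  shows "eqv \<delta> (\<Sum>r\<in>UNIV. \<Sum>q\<in>UNIV. scale (f r * g q) (graph_elt (resolve_list [c, d] [Some r, Some q] G)))
    (graph_elt (resolve_list [c, d] [None, None] G))"
proof -
  let ?e = "\<lambda>r q. graph_elt (resolve_list [c, d] [r, q] G) :: fgraph set \<Rightarrow>\<^sub>0 'r"
  let ?t = "?e (so) (su)" and ?n = "?e None None"
  have V: "eqv \<delta> (?e (sv) (sv)) ?n" by (rule eqv_bigon_two[OF G cd arcs])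
  have collect: "(\<Sum>r\<in>UNIV. \<Sum>q\<in>UNIV. scale (f r * g q) (?e (Some r) (Some q))) =
      scale (f Oriented * g Oriented) (?e (so) (so)) +
      scale (f Oriented * g Unoriented) ?t + scale (f Unoriented * g Oriented) (?e (su) (so)) +
      scale (f Unoriented * g Unoriented) (?e (su) (su)) +
      scale (f Vertex * g Vertex) (?e (sv) (sv))"
    unfolding sum_resolution zero by (simp add: add.assoc)
  \<comment> \<open>By \<open>unit\<close> the two products AD and BE agree, which transfers the
    equation for antiparallel strands to parallel ones.\<close>
  have cup': "\<delta> * (f Unoriented * g Unoriented) = - (f Oriented * g Unoriented) - f Unoriented * g Oriented"
    using cup unit by (simp add: mult.assoc)
  consider (same) "(\<forall>s. mate G (c, s, Out) = (d, s, In)) \<or> (\<forall>s. mate G (d, s, Out) = (c, s, In))"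
    | (other) s where "mate G (c, s, Out) = (d, s, In)" "mate G (d, other_strand s, Out) = (c, other_strand s, In)"
  proof -
    have all: "(\<forall>s. Q s) \<longleftrightarrow> Q Over \<and> Q Under" for Q by (metis strand.exhaust)
    show ?thesis
      using arcs[of Over] arcs[of Under] that(1)[unfolded all] that(2)[of Over] that(2)[of Under] by auto
  qed
  then show ?thesis
  proof cases
    case same
    note e = eqv_bigon_coherent[OF G cd same]
    have "eqv \<delta> (\<Sum>r\<in>UNIV. \<Sum>q\<in>UNIV. scale (f r * g q) (?e (Some r) (Some q)))
        (scale (f Oriented * g Oriented) ?n + scale (f Oriented * g Unoriented) ?t +
         scale (f Unoriented * g Oriented) ?t + scale (f Unoriented * g Unoriented) (scale \<delta> ?t) +
         scale (f Vertex * g Vertex) ?n)"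
      unfolding collect by (intro eqv_add eqv_scale e V eqv_refl)
    also have "\<dots> = scale (f Oriented * g Oriented + f Vertex * g Vertex) ?n +
        scale (f Oriented * g Unoriented + f Unoriented * g Oriented + \<delta> * (f Unoriented * g Unoriented)) ?t"
      by (rule poly_mapping_eqI) (simp add: lookup_add algebra_simps)
    also have "\<dots> = ?n" unfolding unit(1) cup' by simp
    finally show ?thesis .
  next
    case other
    note e = eqv_bigon_contrary[OF G cd other]
    have "eqv \<delta> (\<Sum>r\<in>UNIV. \<Sum>q\<in>UNIV. scale (f r * g q) (?e (Some r) (Some q)))
        (scale (f Oriented * g Oriented) (scale \<delta> ?t) + scale (f Oriented * g Unoriented) ?t +
         scale (f Unoriented * g Oriented) ?t + scale (f Unoriented * g Unoriented) ?n +
         scale (f Vertex * g Vertex) ?n)"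
      unfolding collect by (intro eqv_add eqv_scale e V eqv_refl)
    also have "\<dots> = scale (f Unoriented * g Unoriented + f Vertex * g Vertex) ?n +
        scale (f Oriented * g Unoriented + f Unoriented * g Oriented + \<delta> * f Oriented * g Oriented) ?t"
      by (rule poly_mapping_eqI) (simp add: lookup_add algebra_simps)
    also have "\<dots> = ?n" unfolding unit(2) cup by simp
    finally show ?thesis .
  qed
qed

text \<open>The first letter of a coefficient names the crossing, the second the local state. The
  variables \<open>va\<close> to \<open>vn\<close> stand for the 14 representatives and
  \<open>za\<close> to \<open>zd\<close> for the states with vanishing coefficient. Factors are
  ordered c, a, b on this side, and b, a, c in the next lemma, as in (iii). Plain variables keep the
  expansion by distributivity small.\<close>

lemma collect_triangle_left:
  fixes ao au av bo bu bv co cu cv \<delta> va vb vc vd ve vf vg vh vi vj vk vl vm vn za zb zc zd :: "'r::{comm_ring,comm_monoid_mult}"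
  shows "((ao * bo * co * va + ao * bo * cu * vd + ao * bo * cv * vg) +
       (ao * bu * co * vb + ao * bu * cu * vj + ao * bu * cv * vl) +
       (ao * bv * co * vc + ao * bv * cu * vk + ao * bv * cv * vm)) +
      ((au * bo * co * vd + au * bo * cu * (\<delta> * vd) + au * bo * cv * zb) +
       (au * bu * co * ve + au * bu * cu * vd + au * bu * cv * vf) +
       (au * bv * co * vf + au * bv * cu * zc + au * bv * cv * ve)) +
      ((av * bo * co * vg + av * bo * cu * za + av * bo * cv * va) +
       (av * bu * co * vh + av * bu * cu * vk + av * bu * cv * vn) +
       (av * bv * co * vi + av * bv * cu * vj + av * bv * cv * zd)) =
      (co * ao * bo + cv * av * bo) * va +
      (co * ao * bu) * vb +
      (co * ao * bv) * vc +
      (cu * ao * bo + co * au * bo + \<delta> * cu * au * bo + cu * au * bu) * vd +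
      (co * au * bu + cv * au * bv) * ve +
      (co * au * bv + cv * au * bu) * vf +
      (co * av * bo + cv * ao * bo) * vg +
      (co * av * bu) * vh +
      (co * av * bv) * vi +
      (cu * ao * bu + cu * av * bv) * vj +
      (cu * ao * bv + cu * av * bu) * vk +
      (cv * ao * bu) * vl +
      (cv * ao * bv) * vm +
      (cv * av * bu) * vn +
      (cu * av * bo) * za +
      (cv * au * bo) * zb +
      (cu * au * bv) * zc +
      (cv * av * bv) * zd"
  by (simp only: distrib_left distrib_right ac_simps)

lemma collect_triangle_right:
  fixes ao au av bo bu bv co cu cv \<delta> va vb vc vd ve vf vg vh vi vj vk vl vm vn za zb zc zd :: "'r::{comm_ring,comm_monoid_mult}"
  shows "((ao * bo * co * va + ao * bo * cu * vb + ao * bo * cv * vc) +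
       (ao * bu * co * vd + ao * bu * cu * vj + ao * bu * cv * vk) +
       (ao * bv * co * vg + ao * bv * cu * vl + ao * bv * cv * vm)) +
      ((au * bo * co * vb + au * bo * cu * (\<delta> * vb) + au * bo * cv * za) +
       (au * bu * co * ve + au * bu * cu * vb + au * bu * cv * vh) +
       (au * bv * co * vh + au * bv * cu * zc + au * bv * cv * ve)) +
      ((av * bo * co * vc + av * bo * cu * zb + av * bo * cv * va) +
       (av * bu * co * vf + av * bu * cu * vl + av * bu * cv * vn) +
       (av * bv * co * vi + av * bv * cu * vj + av * bv * cv * zd)) =
      (bo * ao * co + bo * av * cv) * va +
      (bo * ao * cu + bo * au * co + \<delta> * bo * au * cu + bu * au * cu) * vb +
      (bo * ao * cv + bo * av * co) * vc +
      (bu * ao * co) * vd +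
      (bu * au * co + bv * au * cv) * ve +
      (bu * av * co) * vf +
      (bv * ao * co) * vg +
      (bu * au * cv + bv * au * co) * vh +
      (bv * av * co) * vi +
      (bu * ao * cu + bv * av * cu) * vj +
      (bu * ao * cv) * vk +
      (bu * av * cu + bv * ao * cu) * vl +
      (bv * ao * cv) * vm +
      (bu * av * cv) * vn +
      (bo * au * cv) * za +
      (bo * av * cu) * zb +
      (bv * au * cu) * zc +
      (bv * av * cv) * zd"
  by (simp only: distrib_left distrib_right ac_simps)

context triangle
begin

text \<open>There is one equation in \<open>hyps\<close> for each representative, in the order
  \<open>va\<close> to \<open>vn\<close>; it equates the total coefficients of that graph before and
  after the move.\<close>

lemma eqv_triangle_sum:
  fixes fa fb fc ga gb gc :: "resolution \<Rightarrow> 'r::{comm_ring,comm_monoid_mult}" and \<delta> :: 'r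
  assumes hyps: "fc Oriented * fa Oriented * fb Oriented + fc Vertex * fa Vertex * fb Oriented = gb Oriented * ga Oriented * gc Oriented + gb Oriented * ga Vertex * gc Vertex"
    "fc Oriented * fa Oriented * fb Unoriented = gb Oriented * ga Oriented * gc Unoriented + gb Oriented * ga Unoriented * gc Oriented + \<delta> * gb Oriented * ga Unoriented * gc Unoriented + gb Unoriented * ga Unoriented * gc Unoriented"
    "fc Oriented * fa Oriented * fb Vertex = gb Oriented * ga Oriented * gc Vertex + gb Oriented * ga Vertex * gc Oriented"
    "fc Unoriented * fa Oriented * fb Oriented + fc Oriented * fa Unoriented * fb Oriented + \<delta> * fc Unoriented * fa Unoriented * fb Oriented + fc Unoriented * fa Unoriented * fb Unoriented = gb Unoriented * ga Oriented * gc Oriented"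
    "fc Oriented * fa Unoriented * fb Unoriented + fc Vertex * fa Unoriented * fb Vertex = gb Unoriented * ga Unoriented * gc Oriented + gb Vertex * ga Unoriented * gc Vertex"
    "fc Oriented * fa Unoriented * fb Vertex + fc Vertex * fa Unoriented * fb Unoriented = gb Unoriented * ga Vertex * gc Oriented"
    "fc Oriented * fa Vertex * fb Oriented + fc Vertex * fa Oriented * fb Oriented = gb Vertex * ga Oriented * gc Oriented"
    "fc Oriented * fa Vertex * fb Unoriented = gb Unoriented * ga Unoriented * gc Vertex + gb Vertex * ga Unoriented * gc Oriented"
    "fc Oriented * fa Vertex * fb Vertex = gb Vertex * ga Vertex * gc Oriented"
    "fc Unoriented * fa Oriented * fb Unoriented + fc Unoriented * fa Vertex * fb Vertex = gb Unoriented * ga Oriented * gc Unoriented + gb Vertex * ga Vertex * gc Unoriented"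
    "fc Unoriented * fa Oriented * fb Vertex + fc Unoriented * fa Vertex * fb Unoriented = gb Unoriented * ga Oriented * gc Vertex"
    "fc Vertex * fa Oriented * fb Unoriented = gb Unoriented * ga Vertex * gc Unoriented + gb Vertex * ga Oriented * gc Unoriented"
    "fc Vertex * fa Oriented * fb Vertex = gb Vertex * ga Oriented * gc Vertex"
    "fc Vertex * fa Vertex * fb Unoriented = gb Unoriented * ga Vertex * gc Vertex"
    and zeros: "fc Unoriented * fa Vertex * fb Oriented = 0"
    "fc Vertex * fa Unoriented * fb Oriented = 0"
    "fc Unoriented * fa Unoriented * fb Vertex = 0"
    "fc Vertex * fa Vertex * fb Vertex = 0"
    "gb Oriented * ga Unoriented * gc Vertex = 0"
    "gb Oriented * ga Vertex * gc Unoriented = 0"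
    "gb Vertex * ga Unoriented * gc Unoriented = 0"
    "gb Vertex * ga Vertex * gc Vertex = 0"
  shows "eqv \<delta>
    (\<Sum>r\<in>UNIV. \<Sum>q\<in>UNIV. \<Sum>p\<in>UNIV. scale (fa r * fb q * fc p) (e [Some r, Some q, Some p]))
    (\<Sum>r\<in>UNIV. \<Sum>q\<in>UNIV. \<Sum>p\<in>UNIV. scale (ga r * gb q * gc p) (e' [Some r, Some q, Some p]))"
proof -
  let ?L = "((scale (fa Oriented * fb Oriented * fc Oriented) (e [so, so, so]) + scale (fa Oriented * fb Oriented * fc Unoriented) (e [so, so, su]) + scale (fa Oriented * fb Oriented * fc Vertex) (e [sv, so, so])) +
       (scale (fa Oriented * fb Unoriented * fc Oriented) (e [so, su, so]) + scale (fa Oriented * fb Unoriented * fc Unoriented) (e [so, su, su]) + scale (fa Oriented * fb Unoriented * fc Vertex) (e [so, su, sv])) +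
       (scale (fa Oriented * fb Vertex * fc Oriented) (e [so, sv, so]) + scale (fa Oriented * fb Vertex * fc Unoriented) (e [so, sv, su]) + scale (fa Oriented * fb Vertex * fc Vertex) (e [so, sv, sv]))) +
      ((scale (fa Unoriented * fb Oriented * fc Oriented) (e [so, so, su]) + scale (fa Unoriented * fb Oriented * fc Unoriented) (scale \<delta> (e [so, so, su])) + scale (fa Unoriented * fb Oriented * fc Vertex) (e [su, so, sv])) +
       (scale (fa Unoriented * fb Unoriented * fc Oriented) (e [su, su, so]) + scale (fa Unoriented * fb Unoriented * fc Unoriented) (e [so, so, su]) + scale (fa Unoriented * fb Unoriented * fc Vertex) (e [su, sv, so])) +
       (scale (fa Unoriented * fb Vertex * fc Oriented) (e [su, sv, so]) + scale (fa Unoriented * fb Vertex * fc Unoriented) (e [su, sv, su]) + scale (fa Unoriented * fb Vertex * fc Vertex) (e [su, su, so]))) +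
      ((scale (fa Vertex * fb Oriented * fc Oriented) (e [sv, so, so]) + scale (fa Vertex * fb Oriented * fc Unoriented) (e [sv, so, su]) + scale (fa Vertex * fb Oriented * fc Vertex) (e [so, so, so])) +
       (scale (fa Vertex * fb Unoriented * fc Oriented) (e [sv, su, so]) + scale (fa Vertex * fb Unoriented * fc Unoriented) (e [so, sv, su]) + scale (fa Vertex * fb Unoriented * fc Vertex) (e [sv, su, sv])) +
       (scale (fa Vertex * fb Vertex * fc Oriented) (e [sv, sv, so]) + scale (fa Vertex * fb Vertex * fc Unoriented) (e [so, su, su]) + scale (fa Vertex * fb Vertex * fc Vertex) (e [sv, sv, sv])))"
  let ?R = "((scale (ga Oriented * gb Oriented * gc Oriented) (e [so, so, so]) + scale (ga Oriented * gb Oriented * gc Unoriented) (e [so, su, so]) + scale (ga Oriented * gb Oriented * gc Vertex) (e [so, sv, so])) +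
       (scale (ga Oriented * gb Unoriented * gc Oriented) (e [so, so, su]) + scale (ga Oriented * gb Unoriented * gc Unoriented) (e [so, su, su]) + scale (ga Oriented * gb Unoriented * gc Vertex) (e [so, sv, su])) +
       (scale (ga Oriented * gb Vertex * gc Oriented) (e [sv, so, so]) + scale (ga Oriented * gb Vertex * gc Unoriented) (e [so, su, sv]) + scale (ga Oriented * gb Vertex * gc Vertex) (e [so, sv, sv]))) +
      ((scale (ga Unoriented * gb Oriented * gc Oriented) (e [so, su, so]) + scale (ga Unoriented * gb Oriented * gc Unoriented) (scale \<delta> (e [so, su, so])) + scale (ga Unoriented * gb Oriented * gc Vertex) (e' [su, so, sv])) +
       (scale (ga Unoriented * gb Unoriented * gc Oriented) (e [su, su, so]) + scale (ga Unoriented * gb Unoriented * gc Unoriented) (e [so, su, so]) + scale (ga Unoriented * gb Unoriented * gc Vertex) (e [sv, su, so])) +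
       (scale (ga Unoriented * gb Vertex * gc Oriented) (e [sv, su, so]) + scale (ga Unoriented * gb Vertex * gc Unoriented) (e' [su, sv, su]) + scale (ga Unoriented * gb Vertex * gc Vertex) (e [su, su, so]))) +
      ((scale (ga Vertex * gb Oriented * gc Oriented) (e [so, sv, so]) + scale (ga Vertex * gb Oriented * gc Unoriented) (e' [sv, so, su]) + scale (ga Vertex * gb Oriented * gc Vertex) (e [so, so, so])) +
       (scale (ga Vertex * gb Unoriented * gc Oriented) (e [su, sv, so]) + scale (ga Vertex * gb Unoriented * gc Unoriented) (e [so, su, sv]) + scale (ga Vertex * gb Unoriented * gc Vertex) (e [sv, su, sv])) +
       (scale (ga Vertex * gb Vertex * gc Oriented) (e [sv, sv, so]) + scale (ga Vertex * gb Vertex * gc Unoriented) (e [so, su, su]) + scale (ga Vertex * gb Vertex * gc Vertex) (e' [sv, sv, sv])))"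
  have l: "eqv \<delta> (\<Sum>r\<in>UNIV. \<Sum>q\<in>UNIV. \<Sum>p\<in>UNIV. scale (fa r * fb q * fc p) (e [Some r, Some q, Some p])) ?L"
    unfolding sum_resolution by (intro eqv_add eqv_scale) (simp_all only: eqv_refl eqv_left_states)
  have r: "eqv \<delta> (\<Sum>r\<in>UNIV. \<Sum>q\<in>UNIV. \<Sum>p\<in>UNIV. scale (ga r * gb q * gc p) (e' [Some r, Some q, Some p])) ?R"
    unfolding sum_resolution by (intro eqv_add eqv_scale) (simp_all only: eqv_refl eqv_right_states)
  \<comment> \<open>The variables \<open>za\<close> to \<open>zd\<close> are filled by unreduced
    states, which may be different graphs on the two sides, since their coefficients vanish by
    \<open>zeros\<close>.\<close>
  have eq: "?L = ?R"
  proof (rule poly_mapping_eqI)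
    fix k
    show "Poly_Mapping.lookup ?L k = Poly_Mapping.lookup ?R k"
      unfolding lookup_add lookup_scale
        collect_triangle_left[where va = "Poly_Mapping.lookup (e [so, so, so]) k" and
      vb = "Poly_Mapping.lookup (e [so, su, so]) k" and
      vc = "Poly_Mapping.lookup (e [so, sv, so]) k" and
      vd = "Poly_Mapping.lookup (e [so, so, su]) k" and
      ve = "Poly_Mapping.lookup (e [su, su, so]) k" and
      vf = "Poly_Mapping.lookup (e [su, sv, so]) k" and
      vg = "Poly_Mapping.lookup (e [sv, so, so]) k" and
      vh = "Poly_Mapping.lookup (e [sv, su, so]) k" and
      vi = "Poly_Mapping.lookup (e [sv, sv, so]) k" and
      vj = "Poly_Mapping.lookup (e [so, su, su]) k" and
      vk = "Poly_Mapping.lookup (e [so, sv, su]) k" and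
      vl = "Poly_Mapping.lookup (e [so, su, sv]) k" and
      vm = "Poly_Mapping.lookup (e [so, sv, sv]) k" and
      vn = "Poly_Mapping.lookup (e [sv, su, sv]) k" and
      za = "Poly_Mapping.lookup (e [sv, so, su]) k" and
      zb = "Poly_Mapping.lookup (e [su, so, sv]) k" and
      zc = "Poly_Mapping.lookup (e [su, sv, su]) k" and
      zd = "Poly_Mapping.lookup (e [sv, sv, sv]) k"]
        collect_triangle_right[where va = "Poly_Mapping.lookup (e [so, so, so]) k" and
      vb = "Poly_Mapping.lookup (e [so, su, so]) k" and
      vc = "Poly_Mapping.lookup (e [so, sv, so]) k" and
      vd = "Poly_Mapping.lookup (e [so, so, su]) k" and
      ve = "Poly_Mapping.lookup (e [su, su, so]) k" and
      vf = "Poly_Mapping.lookup (e [su, sv, so]) k" and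
      vg = "Poly_Mapping.lookup (e [sv, so, so]) k" and
      vh = "Poly_Mapping.lookup (e [sv, su, so]) k" and
      vi = "Poly_Mapping.lookup (e [sv, sv, so]) k" and
      vj = "Poly_Mapping.lookup (e [so, su, su]) k" and
      vk = "Poly_Mapping.lookup (e [so, sv, su]) k" and
      vl = "Poly_Mapping.lookup (e [so, su, sv]) k" and
      vm = "Poly_Mapping.lookup (e [so, sv, sv]) k" and
      vn = "Poly_Mapping.lookup (e [sv, su, sv]) k" and
      za = "Poly_Mapping.lookup (e' [su, so, sv]) k" and
      zb = "Poly_Mapping.lookup (e' [sv, so, su]) k" and
      zc = "Poly_Mapping.lookup (e' [su, sv, su]) k" and
      zd = "Poly_Mapping.lookup (e' [sv, sv, sv]) k"]
        hyps zeros
      by simp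
  qed
  show ?thesis by (rule eqv_trans[OF l[unfolded eq] eqv_sym[OF r]])
qed

end

section \<open>State sums under the moves\<close>

locale parity_bracket =
  fixes X :: "'x set"
    and circ :: "'x \<Rightarrow> 'x \<Rightarrow> 'x" (infixl "\<odot>" 75)
    and ast :: "'x \<Rightarrow> 'x \<Rightarrow> 'x" (infixl "\<star>" 75)
    and A B C D E F :: "'x \<Rightarrow> 'x \<Rightarrow> 'r::{comm_ring,comm_monoid_mult}"
    and \<delta> w :: 'r
  assumes finite_X: "finite X" and biquandle: "biquandle X (\<odot>) (\<star>)"
    and w: "w dvd 1"
    and rel1: "\<forall>x\<in>X.
      \<delta> * A x x + B x x = w \<and>
      \<delta> * D x x + E x x = unit_inv w \<and>
      C x x = 0 \<and> F x x = 0"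
    and rel2: "\<forall>x\<in>X. \<forall>y\<in>X.
      A x y * F x y = 0 \<and> C x y * D x y = 0 \<and> B x y * F x y = 0 \<and> C x y * E x y = 0 \<and>
      A x y * D x y = 1 - C x y * F x y \<and>
      B x y * E x y = 1 - C x y * F x y \<and>
      \<delta> * A x y * D x y = - (A x y * E x y) - B x y * D x y"
    and rel3: "\<forall>x\<in>X. \<forall>y\<in>X. \<forall>z\<in>X.
      A x y * A y z * A (x \<odot> y) (z \<star> y) + C x y * C y z * A (x \<odot> y) (z \<star> y) =
        A x z * A (y \<star> x) (z \<star> x) * A (x \<odot> z) (y \<odot> z) + A x z * C (y \<star> x) (z \<star> x) * C (x \<odot> z) (y \<odot> z) \<and>
      A x y * B y z * B (x \<odot> y) (z \<star> y) + C x y * B y z * C (x \<odot> y) (z \<star> y) =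
        B x z * B (y \<star> x) (z \<star> x) * A (x \<odot> z) (y \<odot> z) + C x z * B (y \<star> x) (z \<star> x) * C (x \<odot> z) (y \<odot> z) \<and>
      B x y * A y z * B (x \<odot> y) (z \<star> y) + B x y * C y z * C (x \<odot> y) (z \<star> y) =
        B x z * A (y \<star> x) (z \<star> x) * B (x \<odot> z) (y \<odot> z) + C x z * C (y \<star> x) (z \<star> x) * B (x \<odot> z) (y \<odot> z) \<and>
      A x y * C y z * A (x \<odot> y) (z \<star> y) + C x y * A y z * A (x \<odot> y) (z \<star> y) =
        C x z * A (y \<star> x) (z \<star> x) * A (x \<odot> z) (y \<odot> z) \<and>
      A x y * A y z * C (x \<odot> y) (z \<star> y) =
        A x z * A (y \<star> x) (z \<star> x) * C (x \<odot> z) (y \<odot> z) + A x z * C (y \<star> x) (z \<star> x) * A (x \<odot> z) (y \<odot> z) \<and>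
      A x y * C y z * B (x \<odot> y) (z \<star> y) =
        B x z * B (y \<star> x) (z \<star> x) * C (x \<odot> z) (y \<odot> z) + C x z * B (y \<star> x) (z \<star> x) * A (x \<odot> z) (y \<odot> z) \<and>
      B x y * C y z * B (x \<odot> y) (z \<star> y) + B x y * A y z * C (x \<odot> y) (z \<star> y) =
        B x z * A (y \<star> x) (z \<star> x) * C (x \<odot> z) (y \<odot> z) \<and>
      A x y * B y z * C (x \<odot> y) (z \<star> y) + C x y * B y z * B (x \<odot> y) (z \<star> y) =
        B x z * C (y \<star> x) (z \<star> x) * A (x \<odot> z) (y \<odot> z) \<and>
      C x y * A y z * B (x \<odot> y) (z \<star> y) =
        B x z * C (y \<star> x) (z \<star> x) * B (x \<odot> z) (y \<odot> z) + C x z * A (y \<star> x) (z \<star> x) * B (x \<odot> z) (y \<odot> z) \<and>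
      C x y * C y z * B (x \<odot> y) (z \<star> y) =
        B x z * C (y \<star> x) (z \<star> x) * C (x \<odot> z) (y \<odot> z) \<and>
      A x y * C y z * C (x \<odot> y) (z \<star> y) =
        C x z * C (y \<star> x) (z \<star> x) * A (x \<odot> z) (y \<odot> z) \<and>
      C x y * A y z * C (x \<odot> y) (z \<star> y) =
        C x z * A (y \<star> x) (z \<star> x) * C (x \<odot> z) (y \<odot> z) \<and>
      B x y * C y z * A (x \<odot> y) (z \<star> y) = 0 \<and>
      C x y * B y z * A (x \<odot> y) (z \<star> y) = 0 \<and>
      B x y * B y z * C (x \<odot> y) (z \<star> y) = 0 \<and>
      C x y * C y z * C (x \<odot> y) (z \<star> y) = 0 \<and>
      A x z * B (y \<star> x) (z \<star> x) * C (x \<odot> z) (y \<odot> z) = 0 \<and>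
      A x z * C (y \<star> x) (z \<star> x) * B (x \<odot> z) (y \<odot> z) = 0 \<and>
      C x z * B (y \<star> x) (z \<star> x) * B (x \<odot> z) (y \<odot> z) = 0 \<and>
      C x z * C (y \<star> x) (z \<star> x) * C (x \<odot> z) (y \<odot> z) = 0 \<and>
      A x y * A y z * B (x \<odot> y) (z \<star> y) =
        A x z * B (y \<star> x) (z \<star> x) * A (x \<odot> z) (y \<odot> z) + A x z * A (y \<star> x) (z \<star> x) * B (x \<odot> z) (y \<odot> z) + \<delta> * A x z * B (y \<star> x) (z \<star> x) * B (x \<odot> z) (y \<odot> z) + B x z * B (y \<star> x) (z \<star> x) * B (x \<odot> z) (y \<odot> z) \<and>
      B x z * A (y \<star> x) (z \<star> x) * A (x \<odot> z) (y \<odot> z) =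
        B x y * A y z * A (x \<odot> y) (z \<star> y) + A x y * B y z * A (x \<odot> y) (z \<star> y) + \<delta> * B x y * B y z * A (x \<odot> y) (z \<star> y) + B x y * B y z * B (x \<odot> y) (z \<star> y)"
begin

abbreviation "\<beta> \<equiv> coefficients A B C D E F"
abbreviation "\<Phi> \<equiv> bracket_multiset X (\<odot>) (\<star>) \<beta> \<delta> w"

lemma coefficients_simps [simp]:
  "\<beta> True Oriented (x, y) = A x y" "\<beta> True Unoriented (x, y) = B x y" "\<beta> True Vertex (x, y) = C x y"
  "\<beta> False Oriented (x, y) = D x y" "\<beta> False Unoriented (x, y) = E x y" "\<beta> False Vertex (x, y) = F x y"
  by (simp_all add: coefficients_def)

lemma state_sum_omega1:
  assumes L: "framed_graph L" and c: "c \<in> verts L" "mate L (c, s, Out) = (c, other_strand s, In)"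
    and lb: "lb c = (x, x)" "x \<in> X"
  shows "eqv \<delta> (state_sum \<beta> L lb)
    (scale (if positive L c then w else unit_inv w) (state_sum \<beta> (splice {c} opposite L) lb))"
proof -
  define V where "V = verts L - {c}"
  have V: "insert c V = verts L" "c \<notin> V" "V \<subseteq> verts L" "verts L - V = {c}" using c by (auto simp: V_def)
  let ?u = "if positive L c then w else unit_inv w"
  have "eqv \<delta> (\<Sum>r\<in>UNIV. scale (\<beta> (positive L c) r (lb c)) (graph_elt (resolve_list [c] [Some r] (outer_graph L V st))))
      (scale ?u (graph_elt (resolve_list [c] [None] (outer_graph L V st))))" for st
  proof (rule eqv_kink_sum)
    show "framed_graph (outer_graph L V st)" by (rule framed_graph_outer[OF L V(3)])
    show "c \<in> verts (outer_graph L V st)" using verts_outer[of L V st] V(4) by auto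
    show "mate (outer_graph L V st) (c, s, Out) = (c, other_strand s, In)"
      using mate_outer[OF L V(3), of "(c, s, Out)"] c V(4) by simp
    show "\<delta> * \<beta> (positive L c) Oriented (lb c) + \<beta> (positive L c) Unoriented (lb c) = ?u"
      "\<beta> (positive L c) Vertex (lb c) = 0"
      using rel1 lb by (cases "positive L c"; simp)+
  qed
  then have "eqv \<delta> (state_sum \<beta> L lb)
      (\<Sum>st\<in>V \<rightarrow>\<^sub>E UNIV. scale (\<Prod>c\<in>V. \<beta> (positive L c) (st c) (lb c))
        (scale ?u (graph_elt (resolve_list [c] [None] (outer_graph L V st)))))"
    unfolding state_sum_one[OF L V(1,2)] by (intro eqv_sum eqv_scale)
  also have "\<dots> = scale ?u (state_sum \<beta> (splice {c} opposite L) lb)"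
    using state_sum_splice_opposite[OF L, of "[c]" V \<beta> lb] V by (simp add: scale_sum mult.commute)
  finally show ?thesis .
qed

text \<open>Both crossings carry the same label pair, so the positive one contributes A, B, C and
  the negative one D, E, F at the same arguments, as (ii) requires.\<close>

lemma state_sum_omega2:
  assumes L: "framed_graph L" and cd: "c \<in> verts L" "d \<in> verts L" "c \<noteq> d"
    and sign: "positive L c \<noteq> positive L d"
    and arcs: "\<And>s. mate L (c, s, Out) = (d, s, In) \<or> mate L (d, s, Out) = (c, s, In)"
    and lb: "lb c = (x, y)" "lb d = (x, y)" "x \<in> X" "y \<in> X"
  shows "eqv \<delta> (state_sum \<beta> L lb) (state_sum \<beta> (splice {c, d} opposite L) lb)"
proof -
  define V where "V = verts L - {c, d}"
  have V: "{c, d} \<union> V = verts L" "c \<notin> V" "d \<notin> V" "V \<subseteq> verts L" "verts L - V = {c, d}"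
    using cd by (auto simp: V_def)
  note r = rel2[rule_format, OF lb(3,4)]
  have "eqv \<delta> (\<Sum>r\<in>UNIV. \<Sum>q\<in>UNIV. scale (\<beta> (positive L c) r (lb c) * \<beta> (positive L d) q (lb d))
        (graph_elt (resolve_list [c, d] [Some r, Some q] (outer_graph L V st))))
      (graph_elt (resolve_list [c, d] [None, None] (outer_graph L V st)))" for st
  proof (rule eqv_bigon_sum)
    show "framed_graph (outer_graph L V st)" by (rule framed_graph_outer[OF L V(4)])
    show "c \<in> verts (outer_graph L V st)" "d \<in> verts (outer_graph L V st)"
      using verts_outer[of L V st] V(5) by auto
    show "mate (outer_graph L V st) (c, s, Out) = (d, s, In) \<or> mate (outer_graph L V st) (d, s, Out) = (c, s, In)" for s
      using mate_outer[OF L V(4), of "(c, s, Out)"] mate_outer[OF L V(4), of "(d, s, Out)"] arcs[of s] V(5)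
      by auto
  qed (use r sign lb cd in \<open>cases "positive L c"; simp add: mult.commute mult.left_commute\<close>)+
  then have "eqv \<delta> (state_sum \<beta> L lb)
      (\<Sum>st\<in>V \<rightarrow>\<^sub>E UNIV. scale (\<Prod>c\<in>V. \<beta> (positive L c) (st c) (lb c))
        (graph_elt (resolve_list [c, d] [None, None] (outer_graph L V st))))"
    unfolding state_sum_two[OF L V(1-3) cd(3)] by (intro eqv_sum eqv_scale)
  also have "\<dots> = state_sum \<beta> (splice {c, d} opposite L) lb"
    using state_sum_splice_opposite[OF L, of "[c, d]" V \<beta> lb] V by simp
  finally show ?thesis .
qed

text \<open>The prescribed label pairs are the index pairs of (iii): at c, a, b before the move and
  at b, a, c after it.\<close>

lemma state_sum_omega3:
  assumes L: "framed_graph L" and abc: "a \<in> verts L" "b \<in> verts L" "c \<in> verts L" "a \<noteq> b" "a \<noteq> c" "b \<noteq> c"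
    and pos: "positive L a" "positive L b" "positive L c"
    and arcs: "mate L (b, Over, Out) = (a, Over, In)" "mate L (c, Over, Out) = (a, Under, In)"
      "mate L (c, Under, Out) = (b, Under, In)"
    and L': "L' = L\<lparr>mate := exchange_half a b c \<circ> mate L \<circ> exchange_half a b c\<rparr>"
    and lb: "lb c = (x, y)" "lb a = (y, z)" "lb b = (x \<odot> y, z \<star> y)"
      "lb' b = (x, z)" "lb' a = (y \<star> x, z \<star> x)" "lb' c = (x \<odot> z, y \<odot> z)"
      "\<And>v. v \<in> verts L \<Longrightarrow> v \<notin> {a, b, c} \<Longrightarrow> lb v = lb' v"
    and xyz: "x \<in> X" "y \<in> X" "z \<in> X"
  shows "eqv \<delta> (state_sum \<beta> L lb) (state_sum \<beta> L' lb')"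
proof -
  define V where "V = verts L - {a, b, c}"
  have V: "{a, b, c} \<union> V = verts L" "a \<notin> V" "b \<notin> V" "c \<notin> V" "V \<subseteq> verts L" "verts L - V = {a, b, c}"
    using abc by (auto simp: V_def)
  let ?x = "exchange_half a b c"
  note xx = exchange_half_exchange_half[OF abc(4-6)] and fx = fst_exchange_half[OF abc(4-6)]
  have L'_simps: "verts L' = verts L" "circles L' = circles L" "positive L' = positive L"
    "\<And>h. mate L' h = ?x (mate L (?x h))" by (simp_all add: L')
  have x_halves: "?x h \<in> halves L" if "h \<in> halves L" for h
    using fx[of h] that abc by (cases "fst h \<in> {a, b, c}") (auto simp: mem_Times_iff)
  have L'f: "framed_graph L'"
    unfolding framed_graph_truncate[symmetric, of L']
    by (rule framed_graph_conj[of "fgraph.truncate L" _ ?x]) (use L L'_simps xx x_halves in simp_all)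
  \<comment> \<open>By \<open>splice_conj\<close> every outer state leaves a pair of graphs related
    by the exchange, and by \<open>mate_outer\<close> the triangle edges are still present.\<close>
  have tri: "triangle (outer_graph L V st) (outer_graph L' V st) a b c" for st
  proof -
    let ?G = "outer_graph L V st" and ?H = "outer_graph L' V st"
    let ?S = "{v \<in> V. Some (st v) \<noteq> Some Vertex}"
    have conj: "circles ?H = circles ?G"
      "h \<in> halves_at (verts L - ?S) \<Longrightarrow> mate ?H h = ?x (mate ?G (?x h))" for h
    proof -
      have out: "?x h = h" if "h \<in> halves_at ?S" for h
        using fx(2)[of h] that V by (auto simp: mem_Times_iff)
      note c = splice_conj[of "fgraph.truncate L" "fgraph.truncate L'" ?x ?S "glue (\<lambda>v. Some (st v))"]
      show "circles ?H = circles ?G"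
        unfolding outer_graph_def resolve_def
        by (rule c(1)) (use L L'_simps xx x_halves out V in auto)
      show "mate ?H h = ?x (mate ?G (?x h))" if "h \<in> halves_at (verts L - ?S)"
        unfolding outer_graph_def resolve_def
        by (rule c(2)) (use that L L'_simps xx x_halves out V in auto)
    qed
    have vG: "verts ?G = verts L - ?S" "verts ?H = verts L - ?S"
      by (simp_all add: outer_graph_def resolve_def L'_simps)
    show ?thesis
    proof (unfold_locales)
      show "framed_graph ?G" "framed_graph ?H"
        using framed_graph_outer[OF L V(5)] framed_graph_outer[OF L'f] V(5) L'_simps by simp_all
      show "verts ?H = verts ?G" by (simp add: vG)
      show "circles ?H = circles ?G" by (rule conj)
      show "distinct [a, b, c]" using abc by simp
      show "set [a, b, c] \<subseteq> verts ?G" using vG V by auto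
      show "?x (?x h) = h" for h by (rule xx)
      show "?x h = h" if "fst h \<notin> set [a, b, c]" for h using fx(2)[of h] that by simp
      show "mate ?H h = ?x (mate ?G (?x h))" if "h \<in> halves ?G" for h using conj(2) that vG by simp
      show "fst i < length [a, b, c] \<and> fst i' < length [a, b, c] \<and>
          mate ?G (map_prod ((!) [a, b, c]) id i) = map_prod ((!) [a, b, c]) id i'"
        if "(i, i') \<in> set triangle_edges" for i i'
        using that mate_outer[OF L V(5), of "(c, Over, Out)"] mate_outer[OF L V(5), of "(c, Under, Out)"]
          mate_outer[OF L V(5), of "(b, Over, Out)"] arcs V(6)
        by (auto simp: triangle_edges_def)
      show "fst (exchange_half 0 1 2 h) < length [a, b, c] \<and>
          ?x (map_prod ((!) [a, b, c]) id h) = map_prod ((!) [a, b, c]) id (exchange_half 0 1 2 h)"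
        if "fst h < length [a, b, c]" for h
      proof -
        have d: "(0::nat) \<noteq> 1" "(0::nat) \<noteq> 2" "(1::nat) \<noteq> 2" by simp_all
        show ?thesis
          by (rule exchange_half_cases[where h = h and a = 0 and b = 1 and c = 2])
            (use that in \<open>auto simp: exchange_half_simps[OF abc(4-6)] exchange_half_simps[OF d, unfolded One_nat_def]\<close>)
      qed
    qed
  qed
  have X: "p \<odot> q \<in> X" "p \<star> q \<in> X" if "p \<in> X" "q \<in> X" for p q
    using biquandle that unfolding biquandle_def by blast+
  note r = rel3[rule_format, OF xyz]
  have local: "eqv \<delta> (\<Sum>r\<in>UNIV. \<Sum>q\<in>UNIV. \<Sum>p\<in>UNIV.
        scale (\<beta> (positive L a) r (lb a) * \<beta> (positive L b) q (lb b) * \<beta> (positive L c) p (lb c))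
        (graph_elt (resolve_list [a, b, c] [Some r, Some q, Some p] (outer_graph L V st))))
      (\<Sum>r\<in>UNIV. \<Sum>q\<in>UNIV. \<Sum>p\<in>UNIV.
        scale (\<beta> (positive L' a) r (lb' a) * \<beta> (positive L' b) q (lb' b) * \<beta> (positive L' c) p (lb' c))
        (graph_elt (resolve_list [a, b, c] [Some r, Some q, Some p] (outer_graph L' V st))))" for st
    by (rule triangle.eqv_triangle_sum[OF tri]; use r in \<open>simp add: pos L'_simps lb add_ac\<close>)
  have lbV: "lb' v = lb v" if "v \<in> V" for v
  proof -
    have "v \<in> verts L" "v \<notin> {a, b, c}" using that V(2-5) by auto
    then show ?thesis by (rule lb(7)[symmetric])
  qed
  have V': "{a, b, c} \<union> V = verts L'" using V L'_simps by simp
  have "state_sum \<beta> L' lb' = (\<Sum>st\<in>V \<rightarrow>\<^sub>E UNIV. scale (\<Prod>c\<in>V. \<beta> (positive L c) (st c) (lb c))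
      (\<Sum>r\<in>UNIV. \<Sum>q\<in>UNIV. \<Sum>p\<in>UNIV.
        scale (\<beta> (positive L' a) r (lb' a) * \<beta> (positive L' b) q (lb' b) * \<beta> (positive L' c) p (lb' c))
        (graph_elt (resolve_list [a, b, c] [Some r, Some q, Some p] (outer_graph L' V st)))))"
    unfolding state_sum_three[OF L'f V' V(2-4) abc(4-6)]
    by (intro sum.cong refl arg_cong2[of _ _ _ _ scale] prod.cong)
      (simp_all add: L'_simps lbV)
  moreover have "eqv \<delta> (state_sum \<beta> L lb) \<dots>"
    unfolding state_sum_three[OF L V(1-4) abc(4-6)]
    by (intro eqv_sum eqv_scale local)
  ultimately show ?thesis by simp
qed

end

section \<open>Colourings of half-edges\<close>

definition half_label ::
  "('x \<Rightarrow> 'x \<Rightarrow> 'x) \<Rightarrow> ('x \<Rightarrow> 'x \<Rightarrow> 'x) \<Rightarrow> bool \<Rightarrow> (half_edge \<Rightarrow> 'x) \<Rightarrow> nat \<Rightarrow> 'x \<times> 'x \<Rightarrow> bool" where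
  "half_label circ ast pos g c = (\<lambda>(x, y).
    if pos
    then g (c, Under, In) = x \<and> g (c, Under, Out) = circ x y \<and> g (c, Over, In) = ast y x \<and> g (c, Over, Out) = y
    else g (c, Under, In) = circ x y \<and> g (c, Under, Out) = x \<and> g (c, Over, In) = y \<and> g (c, Over, Out) = ast y x)"

definition half_label_pair where
  "half_label_pair circ ast L g c = (THE p. half_label circ ast (positive L c) g c p)"

lemma half_label_pair_eq:
  "half_label circ ast (positive L c) g c p \<Longrightarrow> half_label_pair circ ast L g c = p"
  unfolding half_label_pair_def
proof (rule the_equality)
  fix q assume "half_label circ ast (positive L c) g c p" "half_label circ ast (positive L c) g c q"
  then show "q = p" by (cases p; cases q; cases "positive L c") (simp_all add: half_label_def)
qed

lemma half_label_cong:
  "(\<And>s p. g (c, s, p) = g' (c, s, p)) \<Longrightarrow> half_label circ ast pos g c = half_label circ ast pos g' c"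
  by (simp add: half_label_def)

text \<open>At the crossings in \<open>Q\<close> the predicate \<open>P\<close> takes the place of
  the crossing relations. The colourings before and after a move thus become two conditions on
  functions on the same half-edges.\<close>

definition half_colourings ::
  "'x set \<Rightarrow> ('x \<Rightarrow> 'x \<Rightarrow> 'x) \<Rightarrow> ('x \<Rightarrow> 'x \<Rightarrow> 'x) \<Rightarrow> diagram \<Rightarrow> nat set \<Rightarrow>
    ((half_edge \<Rightarrow> 'x) \<Rightarrow> bool) \<Rightarrow> (half_edge \<Rightarrow> 'x) set" where
  "half_colourings X circ ast L Q P =
    {g \<in> halves L \<rightarrow>\<^sub>E X. (\<forall>h\<in>halves L. g (mate L h) = g h) \<and>
      (\<forall>c\<in>verts L - Q. \<exists>x\<in>X. \<exists>y\<in>X. half_label circ ast (positive L c) g c (x, y)) \<and> P g}"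

lemma image_mset_mset_set_bij:
  assumes "bij_betw T M N" "\<And>a. a \<in> M \<Longrightarrow> F' (T a) = F a"
  shows "image_mset F (mset_set M) = image_mset F' (mset_set N)"
proof -
  have "image_mset F (mset_set M) = image_mset F' (image_mset T (mset_set M))"
    unfolding image_mset.compositionality
    by (rule image_mset_cong) (use assms(2) in \<open>cases "finite M"; simp\<close>)
  also have "image_mset T (mset_set M) = mset_set N"
    using assms(1) by (simp add: image_mset_mset_set bij_betw_def)
  finally show ?thesis .
qed

text \<open>The edges of \<open>splice S opposite L\<close> are the components of the relation generated by edges and
  gluings, together with the old circles.\<close>

lemma edges_splice:
  assumes L: "framed_graph L" and S: "S \<subseteq> verts L" and L': "same_graph L' (splice S opposite L)"
  obtains \<epsilon> where "edges L' = \<epsilon> ` halves L \<union> Inr ` {..<circles L}"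
    and "\<epsilon> ` halves L \<inter> Inr ` {..<circles L} = {}"
    and "\<And>h. h \<in> halves L' \<Longrightarrow> \<epsilon> h = edge_at L' h"
    and "\<And>h h'. h \<in> halves L \<Longrightarrow> h' \<in> halves L \<Longrightarrow> \<epsilon> h = \<epsilon> h' \<longleftrightarrow> (h, h') \<in> splice_rel S opposite L"
proof -
  let ?R = "splice_rel S opposite L"
  define K where "K = halves_at (verts L - S)"
  define Q where "Q = {c \<in> halves L // ?R. c \<subseteq> halves_at S}"
  have finQ: "finite Q" unfolding Q_def by (rule finite_quotient_Collect[OF finite_halves[OF L]])
  obtain idx0 where idx0: "bij_betw idx0 Q {..<card Q}"
    using ex_bij_betw_finite_nat[OF finQ] by (auto simp: lessThan_atLeast0)
  \<comment> \<open>Circles created by the splice are numbered after the old ones.\<close>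
  define idx where "idx c = circles L + idx0 c" for c
  have L'_simps: "halves L' = K" "circles L' = circles L + card Q"
    "\<And>h. h \<in> K \<Longrightarrow> mate L' h = mate (splice S opposite L) h"
    using L' by (auto simp: same_graph_def K_def circles_splice Q_def)
  have refl: "(h, h) \<in> ?R" for h by (simp add: splice_rel_def)
  have sym: "(b, a) \<in> ?R" if "(a, b) \<in> ?R" for a b
    using that sym_splice_rel[OF L gluing_opposite] by (meson symD)
  have tr: "(a, c) \<in> ?R" if "(a, b) \<in> ?R" "(b, c) \<in> ?R" for a b c
    using that unfolding splice_rel_def by (rule rtrancl_trans)
  have cls: "?R `` {h} = ?R `` {h'} \<longleftrightarrow> (h, h') \<in> ?R" for h h'
    using refl sym tr by blast
  have sub: "K \<subseteq> halves L" by (auto simp: K_def)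
  have RK: "(h, h') \<in> ?R \<longleftrightarrow> edge_at L' h = edge_at L' h'" if "h \<in> K" "h' \<in> K" for h h'
  proof -
    have "(h, h') \<in> ?R \<longleftrightarrow> h' = h \<or> h' = mate L' h"
      using splice_rel_iff[OF L gluing_opposite S] that L'_simps(3) unfolding K_def by simp
    also have "\<dots> \<longleftrightarrow> edge_at L' h = edge_at L' h'"
    proof -
      have "framed_graph L'"
        using framed_graph_same_graph[OF same_graph_sym[OF L'] framed_graph_splice[OF L gluing_opposite S]] .
      then have "mate L' (mate L' h) = h" "mate L' (mate L' h') = h'"
        using framed_graphD(3) that L'_simps(1) by auto
      then show ?thesis by (auto simp: edge_at_def doubleton_eq_iff)
    qed
    finally show ?thesis .
  qed
  \<comment> \<open>A component inside the removed part is a new circle. Any other component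
    contains exactly one edge of the result, so every choice of a surviving half-edge in it names
    the same edge.\<close>
  define \<epsilon> where "\<epsilon> h = (if ?R `` {h} \<subseteq> halves_at S then Inr (idx (?R `` {h}))
    else edge_at L' (SOME h'. h' \<in> K \<and> (h, h') \<in> ?R))" for h
  have R_halves: "h' \<in> halves L" if "(h, h') \<in> ?R" "h \<in> halves L" for h h'
    using splice_rel_halves[OF L gluing_opposite S that] .
  have some: "(SOME h'. h' \<in> K \<and> (h, h') \<in> ?R) \<in> K \<and> (h, SOME h'. h' \<in> K \<and> (h, h') \<in> ?R) \<in> ?R"
    if "\<not> ?R `` {h} \<subseteq> halves_at S" "h \<in> halves L" for h
  proof -
    from that(1) obtain h' where h': "(h, h') \<in> ?R" "h' \<notin> halves_at S" by blast
    have "h' \<in> K" using R_halves[OF h'(1) that(2)] h'(2) unfolding K_def by auto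
    then show ?thesis using h'(1) by (intro someI[of "\<lambda>h'. h' \<in> K \<and> (h, h') \<in> ?R"]) blast
  qed
  have closed: "?R `` {h} \<subseteq> halves_at S \<longleftrightarrow> ?R `` {h} \<in> Q" if "h \<in> halves L" for h
    using that unfolding Q_def by (auto intro: quotientI)
  have \<epsilon>K: "\<epsilon> h = edge_at L' h" if "h \<in> K" for h
  proof -
    have "h \<in> ?R `` {h}" "h \<notin> halves_at S" using refl that by (auto simp: K_def)
    then have n: "\<not> ?R `` {h} \<subseteq> halves_at S" by blast
    have "h \<in> halves L" using that sub by blast
    from some[OF n this] have "edge_at L' h = edge_at L' (SOME h'. h' \<in> K \<and> (h, h') \<in> ?R)"
      using RK[OF that] by blast
    then show ?thesis using n unfolding \<epsilon>_def by simp
  qed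
  have \<epsilon>_iff: "\<epsilon> h = \<epsilon> h' \<longleftrightarrow> (h, h') \<in> ?R" if h: "h \<in> halves L" "h' \<in> halves L" for h h'
  proof (cases "?R `` {h} \<subseteq> halves_at S"; cases "?R `` {h'} \<subseteq> halves_at S")
    assume a: "?R `` {h} \<subseteq> halves_at S" "?R `` {h'} \<subseteq> halves_at S"
    then have "\<epsilon> h = \<epsilon> h' \<longleftrightarrow> idx0 (?R `` {h}) = idx0 (?R `` {h'})"
      by (simp add: \<epsilon>_def idx_def)
    also have "\<dots> \<longleftrightarrow> ?R `` {h} = ?R `` {h'}"
      using a closed h bij_betw_imp_inj_on[OF idx0] by (metis inj_onD)
    finally show ?thesis by (simp add: cls)
  next
    assume a: "?R `` {h} \<subseteq> halves_at S" "\<not> ?R `` {h'} \<subseteq> halves_at S"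
    then have "\<epsilon> h \<noteq> \<epsilon> h'" by (simp add: \<epsilon>_def edge_at_def)
    moreover have "(h, h') \<notin> ?R" using a cls[of h h'] by auto
    ultimately show ?thesis by blast
  next
    assume a: "\<not> ?R `` {h} \<subseteq> halves_at S" "?R `` {h'} \<subseteq> halves_at S"
    then have "\<epsilon> h \<noteq> \<epsilon> h'" by (simp add: \<epsilon>_def edge_at_def)
    moreover have "(h, h') \<notin> ?R" using a cls[of h h'] by auto
    ultimately show ?thesis by blast
  next
    assume a: "\<not> ?R `` {h} \<subseteq> halves_at S" "\<not> ?R `` {h'} \<subseteq> halves_at S"
    let ?k = "\<lambda>h. SOME h'. h' \<in> K \<and> (h, h') \<in> ?R"
    have \<epsilon>_eq: "\<epsilon> h = edge_at L' (?k h)" "\<epsilon> h' = edge_at L' (?k h')" using a by (simp_all add: \<epsilon>_def)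
    note k = some[OF a(1) h(1)] and k' = some[OF a(2) h(2)]
    have "(h, h') \<in> ?R \<longleftrightarrow> (?k h, ?k h') \<in> ?R" using k k' sym tr by blast
    then show ?thesis unfolding \<epsilon>_eq using RK[OF conjunct1[OF k] conjunct1[OF k']] by simp
  qed
  have new: "\<epsilon> ` halves L = edge_at L' ` K \<union> Inr ` {circles L..<circles L + card Q}"
  proof (intro equalityI subsetI)
    fix e assume "e \<in> \<epsilon> ` halves L"
    then obtain h where h: "e = \<epsilon> h" "h \<in> halves L" by (rule imageE)
    show "e \<in> edge_at L' ` K \<union> Inr ` {circles L..<circles L + card Q}"
    proof (cases "?R `` {h} \<subseteq> halves_at S")
      case True
      then have "idx0 (?R `` {h}) \<in> {..<card Q}" using closed h bij_betwE[OF idx0] by blast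
      then have "idx (?R `` {h}) \<in> {circles L..<circles L + card Q}" by (simp add: idx_def)
      moreover have "e = Inr (idx (?R `` {h}))" using True by (simp add: h(1) \<epsilon>_def)
      ultimately show ?thesis by blast
    next
      case False
      then have "e = edge_at L' (SOME h'. h' \<in> K \<and> (h, h') \<in> ?R)" by (simp add: h(1) \<epsilon>_def)
      then show ?thesis using some[OF False h(2)] by blast
    qed
  next
    fix e assume "e \<in> edge_at L' ` K \<union> Inr ` {circles L..<circles L + card Q}"
    then show "e \<in> \<epsilon> ` halves L"
    proof
      assume "e \<in> edge_at L' ` K"
      then obtain h where "e = edge_at L' h" "h \<in> K" by (rule imageE)
      then show ?thesis using \<epsilon>K sub by (intro image_eqI[of _ _ h]) auto
    next
      assume "e \<in> Inr ` {circles L..<circles L + card Q}"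
      then obtain i where i: "e = Inr (circles L + i)" "i < card Q"
        by (auto simp: nat_le_iff_add)
      then obtain c where c: "c \<in> Q" "i = idx0 c" using bij_betw_imp_surj_on[OF idx0] by (metis imageE lessThan_iff)
      then obtain h where h: "h \<in> halves L" "c = ?R `` {h}" unfolding Q_def by (auto elim: quotientE)
      then have "\<epsilon> h = e" using c i closed[OF h(1)] by (simp add: \<epsilon>_def idx_def)
      then show ?thesis using h(1) by blast
    qed
  qed
  show ?thesis
  proof (rule that[of \<epsilon>])
    show "edges L' = \<epsilon> ` halves L \<union> Inr ` {..<circles L}"
      unfolding edges_def L'_simps new by (auto simp: image_iff)
    show "\<epsilon> ` halves L \<inter> Inr ` {..<circles L} = {}"
      unfolding new by (auto simp: edge_at_def)
    show "\<epsilon> h = edge_at L' h" if "h \<in> halves L'" for h using \<epsilon>K that L'_simps(1) by simp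
    show "\<epsilon> h = \<epsilon> h' \<longleftrightarrow> (h, h') \<in> ?R" if "h \<in> halves L" "h' \<in> halves L" for h h'
      by (rule \<epsilon>_iff[OF that])
  qed
qed

context parity_bracket
begin

definition half_bracket :: "diagram \<Rightarrow> (nat \<Rightarrow> 'x \<times> 'x) \<Rightarrow> (fgraph set \<Rightarrow>\<^sub>0 'r) set" where
  "half_bracket L lb = graph_coset \<delta> (scale (unit_power w (- writhe L)) (state_sum \<beta> L lb))"

lemma bracket_eq: "bracket (\<odot>) (\<star>) \<beta> \<delta> w L f = half_bracket L (label_pair (\<odot>) (\<star>) L f)"
  by (simp add: bracket_def half_bracket_def state_sum_def)

lemma half_bracket_cong:
  "(\<And>c. c \<in> verts L \<Longrightarrow> lb c = lb' c) \<Longrightarrow> half_bracket L lb = half_bracket L lb'"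
  unfolding half_bracket_def by (subst state_sum_cong) auto

text \<open>A circle created by the deletion is coloured through the half-edges of the deleted
  crossings, so only the old circles need a separate factor. For empty \<open>S\<close> this
  describes the diagram itself. Colours of circles do not enter the value of the bracket, only its
  multiplicity.\<close>

lemma bracket_multiset_half:
  assumes L: "framed_graph L" and S: "S \<subseteq> verts L" and L': "same_graph L' (splice S opposite L)"
    and pos: "\<And>c. c \<in> verts L' \<Longrightarrow> positive L' c = positive L c"
  shows "\<Phi> L' =
    image_mset (\<lambda>(k, g). half_bracket L' (half_label_pair (\<odot>) (\<star>) L g))
      (mset_set (({..<circles L} \<rightarrow>\<^sub>E X) \<times>
        half_colourings X (\<odot>) (\<star>) L S (\<lambda>g. \<forall>h\<in>halves_at S. g (opposite h) = g h)))"
proof -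
  let ?R = "splice_rel S opposite L"
  let ?HC = "half_colourings X (\<odot>) (\<star>) L S (\<lambda>g. \<forall>h\<in>halves_at S. g (opposite h) = g h)"
  let ?col = "colourings X (\<odot>) (\<star>) L'"
  obtain \<epsilon> where edges: "edges L' = \<epsilon> ` halves L \<union> Inr ` {..<circles L}"
    and disj: "\<epsilon> ` halves L \<inter> Inr ` {..<circles L} = {}"
    and \<epsilon>K: "\<And>h. h \<in> halves L' \<Longrightarrow> \<epsilon> h = edge_at L' h"
    and \<epsilon>_iff: "\<And>h h'. h \<in> halves L \<Longrightarrow> h' \<in> halves L \<Longrightarrow> \<epsilon> h = \<epsilon> h' \<longleftrightarrow> (h, h') \<in> ?R"
    using edges_splice[OF L S L'] by blast
  have vL': "verts L' = verts L - S" using L' by (simp add: same_graph_def)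
  define T where "T f = (restrict (f \<circ> Inr) {..<circles L}, restrict (f \<circ> \<epsilon>) (halves L))" for f :: "edge \<Rightarrow> 'x"
  have at: "snd (T f) (c, s, p) = f (edge_at L' (c, s, p))" if "c \<in> verts L'" for f c s p
    using that \<epsilon>K[of "(c, s, p)"] vL' by (simp add: T_def)
  have label: "is_label_pair (\<odot>) (\<star>) L' f c q \<longleftrightarrow> half_label (\<odot>) (\<star>) (positive L c) (snd (T f)) c q"
    if "c \<in> verts L'" for f c q
    using pos[OF that] at[OF that] by (cases q) (simp add: is_label_pair_def half_label_def)
  have gen: "(h, mate L h) \<in> ?R" if "h \<in> halves L" for h
    using that unfolding splice_rel_def by (intro r_into_rtrancl) blast
  have gen': "(h, opposite h) \<in> ?R" if "h \<in> halves_at S" for h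
    using that unfolding splice_rel_def by (intro r_into_rtrancl) blast
  have SL: "halves_at S \<subseteq> halves L" using S by auto
  have opS: "opposite h \<in> halves_at S" if "h \<in> halves_at S" for h using that by (cases h) auto
  have "bij_betw T ?col (({..<circles L} \<rightarrow>\<^sub>E X) \<times> ?HC)"
  proof (rule bij_betw_imageI)
    show "inj_on T ?col"
    proof (rule inj_onI)
      fix f f' assume f: "f \<in> ?col" "f' \<in> ?col" "T f = T f'"
      show "f = f'"
      proof (rule PiE_ext)
        show "f \<in> edges L' \<rightarrow>\<^sub>E X" "f' \<in> edges L' \<rightarrow>\<^sub>E X" using f by (auto simp: colourings_def)
        fix e assume "e \<in> edges L'"
        then consider h where "h \<in> halves L" "e = \<epsilon> h" | i where "i < circles L" "e = Inr i"
          unfolding edges by blast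
        then show "f e = f' e"
        proof cases
          case 1
          have "snd (T f) h = snd (T f') h" using f by simp
          then show ?thesis using 1 by (simp add: T_def)
        next
          case 2
          have "fst (T f) i = fst (T f') i" using f by simp
          then show ?thesis using 2 by (simp add: T_def)
        qed
      qed
    qed
    show "T ` ?col = ({..<circles L} \<rightarrow>\<^sub>E X) \<times> ?HC"
    proof (intro equalityI subsetI)
      fix kg assume "kg \<in> T ` ?col"
      then obtain f where f: "f \<in> ?col" "kg = T f" by blast
      have fX: "f e \<in> X" if "e \<in> edges L'" for e using f(1) that by (auto simp: colourings_def)
      have fst: "fst (T f) \<in> {..<circles L} \<rightarrow>\<^sub>E X" using fX edges by (auto simp: T_def)
      have snd: "snd (T f) \<in> halves L \<rightarrow>\<^sub>E X" using fX edges by (auto simp: T_def)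
      have R: "snd (T f) h' = snd (T f) h" if "(h, h') \<in> ?R" "h \<in> halves L" for h h'
      proof -
        have "h' \<in> halves L" by (rule splice_rel_halves[OF L gluing_opposite S that])
        then show ?thesis using \<epsilon>_iff that by (simp add: T_def) metis
      qed
      have "snd (T f) \<in> ?HC"
        unfolding half_colourings_def
      proof (intro CollectI conjI ballI)
        show "snd (T f) \<in> halves L \<rightarrow>\<^sub>E X" by (rule snd)
        show "snd (T f) (mate L h) = snd (T f) h" if "h \<in> halves L" for h
          by (rule R[OF gen[OF that] that])
        show "snd (T f) (opposite h) = snd (T f) h" if "h \<in> halves_at S" for h
          by (rule R[OF gen'[OF that] subsetD[OF SL that]])
        show "\<exists>x\<in>X. \<exists>y\<in>X. half_label (\<odot>) (\<star>) (positive L c) (snd (T f)) c (x, y)"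
          if "c \<in> verts L - S" for c
        proof -
          have c: "c \<in> verts L'" using that vL' by simp
          then show ?thesis using f(1) unfolding label[OF c, symmetric] by (simp add: colourings_def)
        qed
      qed
      then show "kg \<in> ({..<circles L} \<rightarrow>\<^sub>E X) \<times> ?HC" using fst f(2) by (simp add: mem_Times_iff)
    next
      fix kg assume kg: "kg \<in> ({..<circles L} \<rightarrow>\<^sub>E X) \<times> ?HC"
      obtain k g where kg_eq: "kg = (k, g)" by (rule prod.exhaust)
      have k: "k \<in> {..<circles L} \<rightarrow>\<^sub>E X" and g: "g \<in> ?HC" using kg kg_eq by simp_all
      have gX: "g \<in> halves L \<rightarrow>\<^sub>E X" using g by (simp add: half_colourings_def)
      have gR: "g h' = g h" if "(h, h') \<in> ?R" "h \<in> halves L" for h h'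
        using that(1)[unfolded splice_rel_eq]
      proof (induction rule: rtrancl_induct)
        case (step y z)
        have "(h, y) \<in> ?R" using step.hyps(1) by (simp add: splice_rel_eq)
        then have "y \<in> halves L" by (rule splice_rel_halves[OF L gluing_opposite S _ that(2)])
        then have "g z = g y"
          using step.hyps(2) g unfolding half_colourings_def mate_pairs_def glue_pairs_def by blast
        then show ?case using step.IH by simp
      qed simp
      \<comment> \<open>The chosen half-edge of an edge does not matter, because \<open>gR\<close>
        makes g constant on components.\<close>
      define f where "f = (\<lambda>e\<in>edges L'. if e \<in> Inr ` {..<circles L} then k (projr e)
        else g (SOME h. h \<in> halves L \<and> \<epsilon> h = e))"
      have f1: "f (Inr i) = k i" if "i < circles L" for i using that edges by (simp add: f_def)
      have f2: "f (\<epsilon> h) = g h" if h: "h \<in> halves L" for h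
      proof -
        have s: "(SOME h'. h' \<in> halves L \<and> \<epsilon> h' = \<epsilon> h) \<in> halves L \<and> \<epsilon> (SOME h'. h' \<in> halves L \<and> \<epsilon> h' = \<epsilon> h) = \<epsilon> h"
          using h by (intro someI[of "\<lambda>h'. h' \<in> halves L \<and> \<epsilon> h' = \<epsilon> h"]) blast
        have "\<epsilon> h \<notin> Inr ` {..<circles L}" "\<epsilon> h \<in> edges L'" using disj h edges by blast+
        then have "f (\<epsilon> h) = g (SOME h'. h' \<in> halves L \<and> \<epsilon> h' = \<epsilon> h)" by (simp add: f_def)
        also have "\<dots> = g h"
          using gR[OF \<epsilon>_iff[OF h conjunct1[OF s], THEN iffD1, OF conjunct2[OF s, symmetric]] h] .
        finally show ?thesis .
      qed
      have Tf: "T f = (k, g)"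
      proof -
        have "restrict (f \<circ> Inr) {..<circles L} = k"
          by (rule PiE_ext[OF _ k]) (use k f1 in auto)
        moreover have "restrict (f \<circ> \<epsilon>) (halves L) = g"
          by (rule PiE_ext[OF _ gX]) (use gX f2 in auto)
        ultimately show ?thesis by (simp add: T_def)
      qed
      have "f \<in> ?col"
        unfolding colourings_def
      proof (intro CollectI conjI ballI)
        show "f \<in> edges L' \<rightarrow>\<^sub>E X"
        proof (rule PiE_I)
          fix e assume "e \<in> edges L'"
          then show "f e \<in> X" using f1 f2 k gX unfolding edges by (auto simp: PiE_mem)
        qed (simp add: f_def)
        fix c assume c: "c \<in> verts L'"
        then show "\<exists>x\<in>X. \<exists>y\<in>X. is_label_pair (\<odot>) (\<star>) L' f c (x, y)"
          using g vL' unfolding label[OF c] Tf by (simp add: half_colourings_def)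
      qed
      then show "kg \<in> T ` ?col" using Tf kg_eq by force
    qed
  qed
  then show ?thesis
    unfolding bracket_multiset_def
  proof (rule image_mset_mset_set_bij)
    fix f assume "f \<in> ?col"
    have "label_pair (\<odot>) (\<star>) L' f c = half_label_pair (\<odot>) (\<star>) L (snd (T f)) c" if "c \<in> verts L'" for c
      unfolding label_pair_def half_label_pair_def label[OF that] by (rule refl)
    then show "(case T f of (k, g) \<Rightarrow> half_bracket L' (half_label_pair (\<odot>) (\<star>) L g)) =
        bracket (\<odot>) (\<star>) \<beta> \<delta> w L' f"
      unfolding bracket_eq by (simp add: case_prod_unfold cong: half_bracket_cong)
  qed
qed

text \<open>Colourings that differ only on the inner half-edges of the local part are matched.\<close>

lemma half_colourings_transfer:
  assumes L: "framed_graph L" and I: "I \<subseteq> halves_at Q" "Q \<subseteq> verts L" "\<And>i. i \<in> I \<Longrightarrow> mate L i \<in> I"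
    and ex: "\<And>g. g \<in> half_colourings X (\<odot>) (\<star>) L Q P \<Longrightarrow> \<exists>u. (\<forall>i\<in>I. u i \<in> X \<and> u (mate L i) = u i) \<and> P' (override_on g u I)"
      "\<And>g. g \<in> half_colourings X (\<odot>) (\<star>) L Q P' \<Longrightarrow> \<exists>u. (\<forall>i\<in>I. u i \<in> X \<and> u (mate L i) = u i) \<and> P (override_on g u I)"
    and uniq: "\<And>g g'. g \<in> half_colourings X (\<odot>) (\<star>) L Q P \<Longrightarrow> g' \<in> half_colourings X (\<odot>) (\<star>) L Q P \<Longrightarrow>
        (\<And>h. h \<notin> I \<Longrightarrow> g h = g' h) \<Longrightarrow> (\<And>h. h \<in> I \<Longrightarrow> g h = g' h)"
      "\<And>g g'. g \<in> half_colourings X (\<odot>) (\<star>) L Q P' \<Longrightarrow> g' \<in> half_colourings X (\<odot>) (\<star>) L Q P' \<Longrightarrow>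
        (\<And>h. h \<notin> I \<Longrightarrow> g h = g' h) \<Longrightarrow> (\<And>h. h \<in> I \<Longrightarrow> g h = g' h)"
    and val: "\<And>g g'. g \<in> half_colourings X (\<odot>) (\<star>) L Q P \<Longrightarrow> g' \<in> half_colourings X (\<odot>) (\<star>) L Q P' \<Longrightarrow>
        (\<And>h. h \<notin> I \<Longrightarrow> g h = g' h) \<Longrightarrow> v g = v' g'"
  shows "image_mset (\<lambda>(k, g). v g) (mset_set (M \<times> half_colourings X (\<odot>) (\<star>) L Q P)) =
    image_mset (\<lambda>(k, g). v' g) (mset_set (M \<times> half_colourings X (\<odot>) (\<star>) L Q P'))"
proof -
  let ?H = "half_colourings X (\<odot>) (\<star>) L Q"
  \<comment> \<open>The inner half-edges belong to crossings in \<open>Q\<close> and form whole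
    edges, so recolouring them preserves all conditions other than the predicate.\<close>
  have over: "override_on g u I \<in> ?H P2"
    if g: "g \<in> ?H P1" and u: "\<forall>i\<in>I. u i \<in> X \<and> u (mate L i) = u i" and P2: "P2 (override_on g u I)" for g u P1 P2
  proof -
    have IL: "I \<subseteq> halves L" using I(1,2) by blast
    have out: "override_on g u I (c, s, p) = g (c, s, p)" if "c \<notin> Q" for c s p
      using that I(1) by (auto simp: override_on_def)
    have mI: "mate L h \<in> I \<longleftrightarrow> h \<in> I" if "h \<in> halves L" for h
      using I(3) framed_graphD(3)[OF L that] by metis
    show ?thesis
      unfolding half_colourings_def
    proof (intro CollectI conjI ballI)
      show "override_on g u I \<in> halves L \<rightarrow>\<^sub>E X"
        using g u IL by (auto simp: half_colourings_def override_on_def PiE_iff extensional_def)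
      show "override_on g u I (mate L h) = override_on g u I h" if "h \<in> halves L" for h
        using g u mI[OF that] that by (auto simp: half_colourings_def override_on_def)
      show "\<exists>x\<in>X. \<exists>y\<in>X. half_label (\<odot>) (\<star>) (positive L c) (override_on g u I) c (x, y)"
        if "c \<in> verts L - Q" for c
      proof -
        have "half_label (\<odot>) (\<star>) (positive L c) (override_on g u I) c = half_label (\<odot>) (\<star>) (positive L c) g c"
          by (rule half_label_cong) (use out that in auto)
        then show ?thesis using g that by (simp add: half_colourings_def)
      qed
    qed (rule P2)
  qed
  define r where "r g g' \<longleftrightarrow> (\<forall>h. h \<notin> I \<longrightarrow> g h = g' h)" for g g' :: "half_edge \<Rightarrow> 'x"
  have r_over: "r g (override_on g u I)" for g u by (simp add: r_def override_on_def)
  \<comment> \<open>Colourings correspond when they agree away from \<open>I\<close>. Existence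
    comes from recolouring; injectivity and surjectivity follow because the outer colours determine
    the inner ones on either side.\<close>
  define T where "T g = (SOME g'. g' \<in> ?H P' \<and> r g g')" for g
  have T: "T g \<in> ?H P' \<and> r g (T g)" if g: "g \<in> ?H P" for g
  proof -
    obtain u where "\<forall>i\<in>I. u i \<in> X \<and> u (mate L i) = u i" "P' (override_on g u I)" using ex(1)[OF g] by blast
    then have "override_on g u I \<in> ?H P' \<and> r g (override_on g u I)" using over[OF g] r_over by blast
    then show ?thesis unfolding T_def by (rule someI[of "\<lambda>g'. g' \<in> ?H P' \<and> r g g'"])
  qed
  have "bij_betw T (?H P) (?H P')"
  proof (rule bij_betw_imageI)
    show "inj_on T (?H P)"
    proof (rule inj_onI)
      fix g g' assume g: "g \<in> ?H P" "g' \<in> ?H P" "T g = T g'"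
      then have "g h = g' h" if "h \<notin> I" for h using T[OF g(1)] T[OF g(2)] that unfolding r_def by metis
      with uniq(1)[OF g(1,2)] show "g = g'" by blast
    qed
    show "T ` ?H P = ?H P'"
    proof (intro equalityI subsetI)
      fix g' assume g': "g' \<in> ?H P'"
      obtain u where "\<forall>i\<in>I. u i \<in> X \<and> u (mate L i) = u i" "P (override_on g' u I)" using ex(2)[OF g'] by blast
      then have g: "override_on g' u I \<in> ?H P" using over[OF g'] by blast
      have "T (override_on g' u I) h = g' h" if "h \<notin> I" for h
        using T[OF g] r_over[of g' u] that unfolding r_def by metis
      with uniq(2)[OF conjunct1[OF T[OF g]] g'] have "T (override_on g' u I) = g'" by blast
      then show "g' \<in> T ` ?H P" using g by force
    qed (use T in blast)
  qed
  then have "bij_betw (map_prod id T) (M \<times> ?H P) (M \<times> ?H P')"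
    by (intro bij_betw_map_prod) simp
  then show ?thesis
  proof (rule image_mset_mset_set_bij)
    fix kg assume "kg \<in> M \<times> ?H P"
    then show "(case map_prod id T kg of (k, g) \<Rightarrow> v' g) = (case kg of (k, g) \<Rightarrow> v g)"
      using T val[of "snd kg" "T (snd kg)"] unfolding r_def by (auto simp: case_prod_unfold)
  qed
qed

end

context parity_bracket
begin

section \<open>Consequences of the biquandle axioms and colours around a crossing\<close>

lemma closed_ops: "x \<in> X \<Longrightarrow> y \<in> X \<Longrightarrow> x \<odot> y \<in> X" "x \<in> X \<Longrightarrow> y \<in> X \<Longrightarrow> x \<star> y \<in> X"
  using biquandle unfolding biquandle_def by blast+

lemma self_op: "x \<in> X \<Longrightarrow> x \<odot> x = x \<star> x"
  using biquandle unfolding biquandle_def by blast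

lemma bij_ast: "y \<in> X \<Longrightarrow> bij_betw (\<lambda>x. x \<star> y) X X" and bij_circ: "y \<in> X \<Longrightarrow> bij_betw (\<lambda>x. x \<odot> y) X X"
  using biquandle unfolding biquandle_def by blast+

lemma bij_switch: "bij_betw (\<lambda>(x, y). (y \<star> x, x \<odot> y)) (X \<times> X) (X \<times> X)"
  using biquandle unfolding biquandle_def by blast

lemma exchange_laws:
  assumes "x \<in> X" "y \<in> X" "z \<in> X"
  shows "(x \<odot> z) \<odot> (y \<odot> z) = (x \<odot> y) \<odot> (z \<star> y)"
    "(y \<odot> z) \<star> (x \<odot> z) = (y \<star> x) \<odot> (z \<star> x)"
    "(z \<star> x) \<star> (y \<star> x) = (z \<star> y) \<star> (x \<odot> y)"
  using biquandle assms unfolding biquandle_def by blast+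

lemma ast_cancel: "x \<in> X \<Longrightarrow> x' \<in> X \<Longrightarrow> y \<in> X \<Longrightarrow> x \<star> y = x' \<star> y \<Longrightarrow> x = x'"
  using bij_betw_imp_inj_on[OF bij_ast] by (meson inj_onD)

lemma circ_cancel: "x \<in> X \<Longrightarrow> x' \<in> X \<Longrightarrow> y \<in> X \<Longrightarrow> x \<odot> y = x' \<odot> y \<Longrightarrow> x = x'"
  using bij_betw_imp_inj_on[OF bij_circ] by (meson inj_onD)

lemma switch_cancel:
  assumes "x \<in> X" "y \<in> X" "x' \<in> X" "y' \<in> X" "y \<star> x = y' \<star> x'" "x \<odot> y = x' \<odot> y'"
  shows "x = x'" "y = y'"
proof -
  have "(x, y) = (x', y')"
    by (rule inj_onD[OF bij_betw_imp_inj_on[OF bij_switch]]) (use assms in auto)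
  then show "x = x'" "y = y'" by simp_all
qed

text \<open>Since \<open>X\<close> is finite, the injection \<open>x \<mapsto> x \<odot> x\<close> is onto, so the switch has no other
  values on the diagonal.\<close>

lemma bij_self: "bij_betw (\<lambda>x. x \<odot> x) X X"
proof -
  have inj: "inj_on (\<lambda>x. x \<odot> x) X"
  proof (rule inj_onI)
    fix x y assume "x \<in> X" "y \<in> X" "x \<odot> x = y \<odot> y"
    then show "x = y" using switch_cancel(1)[of x x y y] self_op[of x] self_op[of y] by simp
  qed
  have "(\<lambda>x. x \<odot> x) ` X = X"
    by (rule endo_inj_surj[OF finite_X _ inj]) (use closed_ops in blast)
  with inj show ?thesis by (simp add: bij_betw_def)
qed

text \<open>At a kink the loop identifies two colours. This lemma covers the kinks where that gives
  only x \<odot> y = y \<star> x, and forces the label pair onto the diagonal, where (i)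
  applies.\<close>

lemma diagonal:
  assumes "x \<in> X" "y \<in> X" "x \<odot> y = y \<star> x"
  shows "x = y"
proof -
  have "x \<odot> y \<in> X" using assms closed_ops by blast
  then have "x \<odot> y \<in> (\<lambda>x. x \<odot> x) ` X" using bij_betw_imp_surj_on[OF bij_self] by simp
  then obtain z where z: "z \<in> X" "x \<odot> y = z \<odot> z" by blast
  then have "x = z" "y = z"
    using switch_cancel[of x y z z] assms self_op[of z] by simp_all
  then show ?thesis by simp
qed

text \<open>The flag selects the incoming side at a positive crossing: the under strand passes from
  x to x \<odot> y, the over strand from y \<star> x to y.\<close>

definition under_colour :: "bool \<Rightarrow> 'x \<Rightarrow> 'x \<Rightarrow> 'x" where
  "under_colour b x y = (if b then x else x \<odot> y)"

definition over_colour :: "bool \<Rightarrow> 'x \<Rightarrow> 'x \<Rightarrow> 'x" where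
  "over_colour b x y = (if b then y \<star> x else y)"

lemma colour_closed:
  "x \<in> X \<Longrightarrow> y \<in> X \<Longrightarrow> under_colour b x y \<in> X" "x \<in> X \<Longrightarrow> y \<in> X \<Longrightarrow> over_colour b x y \<in> X"
  by (simp_all add: under_colour_def over_colour_def closed_ops)

text \<open>One colour on each strand determines the label pair. Of the four choices of sides, one
  reads off the pair, two use a bijection of (R2), and the last one is injectivity of the switch
  (R3). Surjectivity in the next lemma has the same four cases.\<close>

lemma colours_inject:
  assumes "x \<in> X" "y \<in> X" "x' \<in> X" "y' \<in> X"
    "under_colour a x y = under_colour a x' y'" "over_colour b x y = over_colour b x' y'"
  shows "x = x' \<and> y = y'"
proof -
  have "x = x' \<Longrightarrow> y \<star> x = y' \<star> x' \<Longrightarrow> y = y'" "y = y' \<Longrightarrow> x \<odot> y = x' \<odot> y' \<Longrightarrow> x = x'"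
    using assms(1-4) ast_cancel circ_cancel by blast+
  then show ?thesis
    using assms(5,6) switch_cancel[OF assms(1-4)]
    by (cases a; cases b; simp add: under_colour_def over_colour_def)
qed

lemma colours_surj:
  assumes "u \<in> X" "v \<in> X"
  obtains x y where "x \<in> X" "y \<in> X" "under_colour a x y = u" "over_colour b x y = v"
proof -
  have "v \<in> (\<lambda>y. y \<star> u) ` X" "u \<in> (\<lambda>x. x \<odot> v) ` X"
    using bij_betw_imp_surj_on[OF bij_ast[OF assms(1)]] bij_betw_imp_surj_on[OF bij_circ[OF assms(2)]]
      assms by simp_all
  then have ast: "\<exists>y\<in>X. y \<star> u = v" and circ: "\<exists>x\<in>X. x \<odot> v = u"
    unfolding image_iff by metis+
  have "(v, u) \<in> (\<lambda>(x, y). (y \<star> x, x \<odot> y)) ` (X \<times> X)"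
    using bij_betw_imp_surj_on[OF bij_switch] assms by simp
  then have switch: "\<exists>x\<in>X. \<exists>y\<in>X. y \<star> x = v \<and> x \<odot> y = u" by auto
  show ?thesis
  proof (cases a)
    case True
    show ?thesis
    proof (cases b)
      case True
      then show ?thesis using ast that[of u] \<open>a\<close> assms(1) by (auto simp: under_colour_def over_colour_def)
    next
      case False
      then show ?thesis using that[of u v] \<open>a\<close> assms by (simp add: under_colour_def over_colour_def)
    qed
  next
    case False
    show ?thesis
    proof (cases b)
      case True
      then show ?thesis using switch that \<open>\<not> a\<close> by (auto simp: under_colour_def over_colour_def)
    next
      case False
      then show ?thesis using circ that[of _ v] \<open>\<not> a\<close> assms(2) by (auto simp: under_colour_def over_colour_def)
    qed
  qed
qed

text \<open>The colour of a half-edge as a function of the label pair: a strand of a crossing carries the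
  same colours at a positive and at a negative crossing, in opposite directions.\<close>

fun crossing_colour :: "bool \<Rightarrow> strand \<times> port \<Rightarrow> 'x \<Rightarrow> 'x \<Rightarrow> 'x" where
  "crossing_colour pos (Under, p) = under_colour (pos = (p = In))"
| "crossing_colour pos (Over, p) = over_colour (pos = (p = In))"

lemma half_label_iff:
  "half_label (\<odot>) (\<star>) pos g c (x, y) \<longleftrightarrow> (\<forall>s p. g (c, s, p) = crossing_colour pos (s, p) x y)"
proof -
  have S: "(\<forall>s. Q s) \<longleftrightarrow> Q Under \<and> Q Over" for Q by (metis strand.exhaust)
  have P: "(\<forall>p. Q p) \<longleftrightarrow> Q In \<and> Q Out" for Q by (metis port.exhaust)
  show ?thesis
    by (cases pos) (simp_all add: S P half_label_def under_colour_def over_colour_def)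
qed

lemma crossing_colour_closed: "x \<in> X \<Longrightarrow> y \<in> X \<Longrightarrow> crossing_colour pos sp x y \<in> X"
  by (cases "(pos, sp)" rule: crossing_colour.cases) (simp_all add: colour_closed)

lemma crossing_colour_opposite: "crossing_colour (\<not> pos) (s, other_port p) = crossing_colour pos (s, p)"
  by (cases s; cases p) simp_all

lemma crossing_colours_inject:
  assumes "x \<in> X" "y \<in> X" "x' \<in> X" "y' \<in> X"
    "\<And>s. crossing_colour pos (s, p s) x y = crossing_colour pos (s, p s) x' y'"
  shows "x = x' \<and> y = y'"
  using assms(5)[of Under] assms(5)[of Over] by (intro colours_inject[OF assms(1-4)]) simp_all

lemma crossing_colours_surj:
  assumes "\<And>s. u s \<in> X"
  obtains x y where "x \<in> X" "y \<in> X" "\<And>s. crossing_colour pos (s, p s) x y = u s"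
proof -
  obtain x y where "x \<in> X" "y \<in> X" "under_colour (pos = (p Under = In)) x y = u Under"
    "over_colour (pos = (p Over = In)) x y = u Over"
    using colours_surj[OF assms assms] by blast
  moreover from this have "crossing_colour pos (s, p s) x y = u s" for s by (cases s) simp_all
  ultimately show ?thesis using that by blast
qed

text \<open>Moves the crossing relations at \<open>Q\<close> into the predicate, the form in which
  \<open>half_colourings_transfer\<close> compares them with the deletion or the exchange.\<close>

lemma half_colourings_delete:
  "half_colourings X (\<odot>) (\<star>) L {} (\<lambda>g. \<forall>h\<in>halves_at {}. g (opposite h) = g h) =
    half_colourings X (\<odot>) (\<star>) L Q
      (\<lambda>g. \<forall>c\<in>Q. \<exists>x\<in>X. \<exists>y\<in>X. \<forall>s p. g (c, s, p) = crossing_colour (positive L c) (s, p) x y)"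
  if "Q \<subseteq> verts L"
proof -
  have "(\<forall>c\<in>verts L - {}. R c) \<longleftrightarrow> (\<forall>c\<in>verts L - Q. R c) \<and> (\<forall>c\<in>Q. R c)" for R
    using that by blast
  then show ?thesis unfolding half_colourings_def half_label_iff by simp
qed

lemma bracket_multiset_whole:
  assumes "framed_graph L" "Q \<subseteq> verts L"
  shows "\<Phi> L =
    image_mset (\<lambda>(k, g). half_bracket L (half_label_pair (\<odot>) (\<star>) L g))
      (mset_set (({..<circles L} \<rightarrow>\<^sub>E X) \<times>
        half_colourings X (\<odot>) (\<star>) L Q
          (\<lambda>g. \<forall>c\<in>Q. \<exists>x\<in>X. \<exists>y\<in>X. \<forall>s p. g (c, s, p) = crossing_colour (positive L c) (s, p) x y)))"
  using bracket_multiset_half[OF assms(1) _ same_graph_splice_empty[OF assms(1)]]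
    half_colourings_delete[OF assms(2)] by simp

lemma writhe_splice:
  assumes "finite (verts L)" "S \<subseteq> verts L"
  shows "writhe L = writhe (splice S j L) + (\<Sum>c\<in>S. crossing_sign L c)"
  using sum.subset_diff[OF assms(2,1), of "crossing_sign L"]
  by (simp add: writhe_def crossing_sign_def)

lemma half_label_pair_half_colouring:
  assumes "g \<in> half_colourings X (\<odot>) (\<star>) L Q P" "c \<in> verts L - Q" "\<And>s p. g (c, s, p) = g' (c, s, p)"
  shows "half_label_pair (\<odot>) (\<star>) L g c = half_label_pair (\<odot>) (\<star>) L g' c"
  unfolding half_label_pair_def using half_label_cong[of g c g'] assms(3) by simp

text \<open>The two crossings have opposite signs, so their colours are those of one crossing read
  in opposite directions. They share the label pair, and the outer colours on the two sides of the
  bigon agree.\<close>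

lemma bracket_multiset_omega2:
  assumes L: "framed_graph L" and cd: "c \<in> verts L" "d \<in> verts L" "c \<noteq> d"
    and sign: "positive L c" "\<not> positive L d"
    and arcs: "\<And>s. mate L (c, s, Out) = (d, s, In) \<or> mate L (d, s, Out) = (c, s, In)"
  shows "\<Phi> L = \<Phi> (splice {c, d} opposite L)"
proof -
  let ?L' = "splice {c, d} opposite L"
  \<comment> \<open>The port through which (c, s) meets its edge to d, whichever way the strand is
    oriented.\<close>
  define p where "p s = (if mate L (c, s, Out) = (d, s, In) then Out else In)" for s
  have m: "mate L (c, s, p s) = (d, s, other_port (p s))" "mate L (d, s, other_port (p s)) = (c, s, p s)" for s
  proof -
    have "(c, s, Out) \<in> halves L" "(d, s, Out) \<in> halves L" using cd by auto
    from framed_graphD(3)[OF L this(1)] framed_graphD(3)[OF L this(2)] arcs[of s]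
    show "mate L (c, s, p s) = (d, s, other_port (p s))" "mate L (d, s, other_port (p s)) = (c, s, p s)"
      by (auto simp: p_def)
  qed
  define I where "I = {h. \<exists>s. h = (c, s, p s) \<or> h = (d, s, other_port (p s))}"
  have Ic: "(c, s, q) \<in> I \<longleftrightarrow> q = p s" and Id: "(d, s, q) \<in> I \<longleftrightarrow> q = other_port (p s)" for s q
    using cd(3) by (auto simp: I_def)
  have ports: "q = p s \<or> q = other_port (p s)" for q s by (cases q; cases "p s") simp_all
  let ?P = "\<lambda>g. \<forall>v\<in>{c, d}. \<exists>x\<in>X. \<exists>y\<in>X. \<forall>s q. g (v, s, q) = crossing_colour (positive L v) (s, q) x y"
  let ?P' = "\<lambda>g. \<forall>h\<in>halves_at {c, d}. g (opposite h) = g h"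
  let ?H = "half_colourings X (\<odot>) (\<star>) L {c, d}"
  \<comment> \<open>Both crossings see the same colours on the two edges of the bigon, and one
    colour on each strand determines the label pair.\<close>
  have labels: "\<exists>x\<in>X. \<exists>y\<in>X. (\<forall>s q. g (c, s, q) = crossing_colour True (s, q) x y) \<and>
      (\<forall>s q. g (d, s, q) = crossing_colour True (s, other_port q) x y)" if g: "g \<in> ?H ?P" for g
  proof -
    obtain x y x' y' where xy: "x \<in> X" "y \<in> X" "\<And>s q. g (c, s, q) = crossing_colour True (s, q) x y"
      and xy': "x' \<in> X" "y' \<in> X" "\<And>s q. g (d, s, q) = crossing_colour False (s, q) x' y'"
      using g sign unfolding half_colourings_def by force
    have d: "g (d, s, q) = crossing_colour True (s, other_port q) x' y'" for s q
      using xy'(3)[of s q] crossing_colour_opposite[of True s "other_port q"] by simp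
    have "g (c, s, p s) = g (d, s, other_port (p s))" for s
    proof -
      have "(c, s, p s) \<in> halves L" using cd by simp
      then have "g (mate L (c, s, p s)) = g (c, s, p s)" using g unfolding half_colourings_def by blast
      then show ?thesis by (simp add: m)
    qed
    then have "crossing_colour True (s, p s) x y = crossing_colour True (s, p s) x' y'" for s
      using xy(3) d by (metis other_port_simps(1))
    then have "x = x' \<and> y = y'" by (rule crossing_colours_inject[OF xy(1,2) xy'(1,2)])
    then show ?thesis using xy d by blast
  qed
  have "image_mset (\<lambda>(k, g). half_bracket L (half_label_pair (\<odot>) (\<star>) L g))
        (mset_set (({..<circles L} \<rightarrow>\<^sub>E X) \<times> ?H ?P)) =
      image_mset (\<lambda>(k, g). half_bracket ?L' (half_label_pair (\<odot>) (\<star>) L g))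
        (mset_set (({..<circles L} \<rightarrow>\<^sub>E X) \<times> ?H ?P'))"
  proof (rule half_colourings_transfer[OF L])
    show "I \<subseteq> halves_at {c, d}" by (auto simp: I_def)
    show "{c, d} \<subseteq> verts L" using cd by simp
    show "mate L i \<in> I" if "i \<in> I" for i using that m unfolding I_def by auto
  next
    fix g assume g: "g \<in> ?H ?P"
    obtain x y where xy: "x \<in> X" "y \<in> X" "\<And>s q. g (c, s, q) = crossing_colour True (s, q) x y"
      "\<And>s q. g (d, s, q) = crossing_colour True (s, other_port q) x y"
      using labels[OF g] by blast
    \<comment> \<open>After deletion the inner edge of a strand takes the colour of its outer
      half-edge at c, which is also the colour beyond d.\<close>
    define u where "u h = crossing_colour True (fst (snd h), other_port (p (fst (snd h)))) x y" for h :: half_edge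
    have "?P' (override_on g u I)"
    proof
      fix h assume "h \<in> halves_at {c, d}"
      moreover obtain v s q where h: "h = (v, s, q)" by (rule prod_cases3)
      ultimately have "v = c \<or> v = d" by simp
      then show "override_on g u I (opposite h) = override_on g u I h"
        using ports[of q s] unfolding h by (auto simp: override_on_def Ic Id u_def xy)
    qed
    moreover have "u i \<in> X \<and> u (mate L i) = u i" if "i \<in> I" for i
      using that m xy crossing_colour_closed unfolding I_def by (auto simp: u_def)
    ultimately show "\<exists>u. (\<forall>i\<in>I. u i \<in> X \<and> u (mate L i) = u i) \<and> ?P' (override_on g u I)" by blast
  next
    fix g assume g: "g \<in> ?H ?P'"
    have gX: "g (v, s, q) \<in> X" if "v \<in> {c, d}" for v s q
      using g that cd unfolding half_colourings_def by (auto simp: PiE_iff)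
    \<comment> \<open>Conversely, colours constant along the strands are arbitrary outer colours at
      c. They determine a label pair, which supplies the inner colours.\<close>
    obtain x y where xy: "x \<in> X" "y \<in> X" "\<And>s. crossing_colour True (s, other_port (p s)) x y = g (c, s, p s)"
      using crossing_colours_surj[of "\<lambda>s. g (c, s, p s)" True "\<lambda>s. other_port (p s)"] gX by blast
    define u where "u h = crossing_colour True (fst (snd h), p (fst (snd h))) x y" for h :: half_edge
    have opp: "g (v, s, other_port q) = g (v, s, q)" if "v \<in> {c, d}" for v s q
      using g that unfolding half_colourings_def by fastforce
    have gm: "g (d, s, other_port (p s)) = g (c, s, p s)" for s
    proof -
      have "(c, s, p s) \<in> halves L" using cd by simp
      then have "g (mate L (c, s, p s)) = g (c, s, p s)" using g unfolding half_colourings_def by blast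
      then show ?thesis by (simp add: m)
    qed
    have c: "override_on g u I (c, s, q) = crossing_colour True (s, q) x y" for s q
      using ports[of q s] xy(3)[of s] opp[of c s "p s"] by (auto simp: override_on_def Ic u_def)
    have d: "override_on g u I (d, s, q) = crossing_colour False (s, q) x y" for s q
      using ports[of q s] xy(3)[of s] gm[of s] opp[of d s "p s"] crossing_colour_opposite[of True s "p s"]
        crossing_colour_opposite[of True s "other_port (p s)"]
      by (auto simp: override_on_def Id u_def)
    have "?P (override_on g u I)"
    proof
      fix v assume "v \<in> {c, d}"
      then show "\<exists>x\<in>X. \<exists>y\<in>X. \<forall>s q. override_on g u I (v, s, q) = crossing_colour (positive L v) (s, q) x y"
        using c d xy sign by (intro bexI[of _ x] bexI[of _ y]) auto
    qed
    moreover have "u i \<in> X \<and> u (mate L i) = u i" if "i \<in> I" for i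
      using that m xy crossing_colour_closed unfolding I_def by (auto simp: u_def)
    ultimately show "\<exists>u. (\<forall>i\<in>I. u i \<in> X \<and> u (mate L i) = u i) \<and> ?P (override_on g u I)" by blast
  next
    fix g g' h assume g: "g \<in> ?H ?P" "g' \<in> ?H ?P" and eq: "\<And>h. h \<notin> I \<Longrightarrow> g h = g' h"
    obtain x y where xy: "x \<in> X" "y \<in> X" "\<And>s q. g (c, s, q) = crossing_colour True (s, q) x y"
      "\<And>s q. g (d, s, q) = crossing_colour True (s, other_port q) x y"
      using labels[OF g(1)] by blast
    obtain x' y' where xy': "x' \<in> X" "y' \<in> X" "\<And>s q. g' (c, s, q) = crossing_colour True (s, q) x' y'"
      "\<And>s q. g' (d, s, q) = crossing_colour True (s, other_port q) x' y'"
      using labels[OF g(2)] by blast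
    have "g (c, s, other_port (p s)) = g' (c, s, other_port (p s))" for s by (rule eq) (simp add: Ic)
    then have "x = x' \<and> y = y'"
      unfolding xy xy' by (rule crossing_colours_inject[OF xy(1,2) xy'(1,2)])
    moreover assume "h \<in> I"
    ultimately show "g h = g' h" using xy xy' unfolding I_def by auto
  next
    fix g g' h assume g: "g \<in> ?H ?P'" "g' \<in> ?H ?P'" and eq: "\<And>h. h \<notin> I \<Longrightarrow> g h = g' h"
    assume h: "h \<in> I"
    then obtain s where "h = (c, s, p s) \<or> h = (d, s, other_port (p s))" unfolding I_def by blast
    then have "opposite h \<notin> I" "h \<in> halves_at {c, d}" by (auto simp: Ic Id)
    then have "g (opposite h) = g h" "g' (opposite h) = g' h"
      using g unfolding half_colourings_def by blast+
    then show "g h = g' h" using eq[OF \<open>opposite h \<notin> I\<close>] by simp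
  next
    fix g g' assume g: "g \<in> ?H ?P" "g' \<in> ?H ?P'" and eq: "\<And>h. h \<notin> I \<Longrightarrow> g h = g' h"
    let ?lb = "half_label_pair (\<odot>) (\<star>) L g"
    obtain x y where xy: "x \<in> X" "y \<in> X" "\<And>s q. g (c, s, q) = crossing_colour True (s, q) x y"
      "\<And>s q. g (d, s, q) = crossing_colour True (s, other_port q) x y"
      using labels[OF g(1)] by blast
    have "?lb c = (x, y)"
      by (rule half_label_pair_eq) (use sign xy in \<open>simp add: half_label_iff\<close>)
    moreover have "?lb d = (x, y)"
      by (rule half_label_pair_eq)
        (use sign xy crossing_colour_opposite[of True] in \<open>simp add: half_label_iff, metis other_port_simps(1)\<close>)
    ultimately have "eqv \<delta> (state_sum \<beta> L ?lb) (state_sum \<beta> ?L' ?lb)"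
      by (intro state_sum_omega2[OF L cd _ arcs, where x = x and y = y]) (use sign xy in auto)
    moreover have "writhe L = writhe ?L'"
      using writhe_splice[of L "{c, d}"] finite_verts[OF L] cd sign by (simp add: crossing_sign_def)
    ultimately have "half_bracket L ?lb = half_bracket ?L' ?lb"
      unfolding half_bracket_def by (simp add: graph_coset_eqI eqv_scale)
    also have "\<dots> = half_bracket ?L' (half_label_pair (\<odot>) (\<star>) L g')"
    proof (rule half_bracket_cong)
      fix v assume "v \<in> verts ?L'"
      then show "?lb v = half_label_pair (\<odot>) (\<star>) L g' v"
        by (intro half_label_pair_half_colouring[OF g(1)] eq) (auto simp: I_def)
    qed
    finally show "half_bracket L ?lb = half_bracket ?L' (half_label_pair (\<odot>) (\<star>) L g')" .
  qed
  then show ?thesis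
    using bracket_multiset_half[OF L _ same_graph_refl, of "{c, d}"] bracket_multiset_whole[OF L, of "{c, d}"] cd
    by (simp only: insert_subset empty_subsetI positive_splice simp_thms)
qed

end

context parity_bracket
begin

text \<open>On the diagonal (R1) makes a kink transparent: the colour in which one strand enters is
  the colour in which the other leaves.\<close>

lemma crossing_colour_diagonal:
  assumes "x \<in> X"
  shows "crossing_colour pos (other_strand s, other_port q) x x = crossing_colour pos (s, q) x x"
  using self_op[OF assms] by (cases s; cases q; cases pos) (simp_all add: under_colour_def over_colour_def)

text \<open>Depending on the strand and the sign, the loop gives either x = y directly or the
  equation handled by \<open>diagonal\<close>.\<close>

lemma crossing_colour_kink:
  assumes "x \<in> X" "y \<in> X" "crossing_colour pos (s, Out) x y = crossing_colour pos (other_strand s, In) x y"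
  shows "x = y"
  using assms diagonal[OF assms(1,2)]
  by (cases s; cases pos) (simp_all add: under_colour_def over_colour_def)

text \<open>Makes the outer colour at a kink determine its diagonal label, and lets every colour
  occur there.\<close>

lemma bij_crossing_colour_diagonal: "bij_betw (\<lambda>x. crossing_colour pos (s, q) x x) X X"
proof -
  have star: "bij_betw (\<lambda>x. x \<star> x) X X"
    using bij_self self_op bij_betw_cong[of X "\<lambda>x. x \<odot> x" "\<lambda>x. x \<star> x" X] by blast
  have "bij_betw (\<lambda>x. under_colour b x x) X X" "bij_betw (\<lambda>x. over_colour b x x) X X" for b
    using bij_self star by (cases b; simp add: under_colour_def over_colour_def bij_betw_id[unfolded id_def])+
  then show ?thesis by (cases s) simp_all
qed

lemma bracket_multiset_omega1:
  assumes L: "framed_graph L" and c: "c \<in> verts L" and arc: "mate L (c, s, Out) = (c, other_strand s, In)"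
  shows "\<Phi> L = \<Phi> (splice {c} opposite L)"
proof -
  let ?L' = "splice {c} opposite L" and ?cc = "crossing_colour (positive L c)"
  define I where "I = {(c, s, Out), (c, other_strand s, In)}"
  let ?P = "\<lambda>g. \<forall>v\<in>{c}. \<exists>x\<in>X. \<exists>y\<in>X. \<forall>s q. g (v, s, q) = crossing_colour (positive L v) (s, q) x y"
  let ?P' = "\<lambda>g. \<forall>h\<in>halves_at {c}. g (opposite h) = g h"
  let ?H = "half_colourings X (\<odot>) (\<star>) L {c}"
  have arc': "mate L (c, other_strand s, In) = (c, s, Out)"
  proof -
    have "(c, s, Out) \<in> halves L" using c by simp
    from framed_graphD(3)[OF L this] show ?thesis by (simp add: arc)
  qed
  have I_out: "(c, s, In) \<notin> I" "(c, other_strand s, Out) \<notin> I" by (simp_all add: I_def)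
  have strands: "t = s \<or> t = other_strand s" for t by (cases t; cases s) simp_all
  have g_mate: "g (c, other_strand s, In) = g (c, s, Out)" if "g \<in> ?H P" for g P
  proof -
    have "(c, s, Out) \<in> halves L" using c by simp
    then have "g (mate L (c, s, Out)) = g (c, s, Out)" using that unfolding half_colourings_def by blast
    then show ?thesis by (simp add: arc)
  qed
  have labels: "\<exists>x\<in>X. \<forall>t q. g (c, t, q) = ?cc (t, q) x x" if g: "g \<in> ?H ?P" for g
  proof -
    obtain x y where xy: "x \<in> X" "y \<in> X" "\<And>t q. g (c, t, q) = ?cc (t, q) x y"
      using g unfolding half_colourings_def by force
    have "x = y"
      using crossing_colour_kink[OF xy(1,2)] g_mate[OF g] xy(3) by metis
    then show ?thesis using xy by blast
  qed
  have "image_mset (\<lambda>(k, g). half_bracket L (half_label_pair (\<odot>) (\<star>) L g))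
        (mset_set (({..<circles L} \<rightarrow>\<^sub>E X) \<times> ?H ?P)) =
      image_mset (\<lambda>(k, g). half_bracket ?L' (half_label_pair (\<odot>) (\<star>) L g))
        (mset_set (({..<circles L} \<rightarrow>\<^sub>E X) \<times> ?H ?P'))"
  proof (rule half_colourings_transfer[OF L])
    show "I \<subseteq> halves_at {c}" by (auto simp: I_def)
    show "{c} \<subseteq> verts L" using c by simp
    show "mate L i \<in> I" if "i \<in> I" for i using that arc arc' unfolding I_def by auto
  next
    fix g assume g: "g \<in> ?H ?P"
    obtain x where x: "x \<in> X" "\<And>t q. g (c, t, q) = ?cc (t, q) x x" using labels[OF g] by blast
    have "?P' (override_on g (\<lambda>_. ?cc (s, In) x x) I)"
    proof
      fix h assume "h \<in> halves_at {c}"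
      then obtain t q where h: "h = (c, t, q)" by auto
      have "?cc (other_strand s, Out) x x = ?cc (s, In) x x"
        using crossing_colour_diagonal[OF x(1), of "positive L c" s In] by simp
      then show "override_on g (\<lambda>_. ?cc (s, In) x x) I (opposite h) = override_on g (\<lambda>_. ?cc (s, In) x x) I h"
        using strands[of t] by (cases q) (auto simp: h override_on_def I_def x(2))
    qed
    then show "\<exists>u. (\<forall>i\<in>I. u i \<in> X \<and> u (mate L i) = u i) \<and> ?P' (override_on g u I)"
      using crossing_colour_closed[OF x(1,1)] by (intro exI[of _ "\<lambda>_. ?cc (s, In) x x"]) simp
  next
    fix g assume g: "g \<in> ?H ?P'"
    have "g (c, s, In) \<in> X" using g c unfolding half_colourings_def by (auto simp: PiE_iff)
    \<comment> \<open>The colour arriving at the deleted kink becomes the outer colour of a diagonal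
      label, whose loop colour then fills \<open>I\<close>.\<close>
    then have "g (c, s, In) \<in> (\<lambda>x. ?cc (s, In) x x) ` X"
      using bij_betw_imp_surj_on[OF bij_crossing_colour_diagonal] by simp
    then obtain x where x: "x \<in> X" "g (c, s, In) = ?cc (s, In) x x" by blast
    have opp: "g (c, t, other_port q) = g (c, t, q)" for t q
      using g unfolding half_colourings_def by fastforce
    have e: "g (c, other_strand s, Out) = ?cc (other_strand s, Out) x x"
      using opp[of s Out] opp[of "other_strand s" In] g_mate[OF g] x(2)
        crossing_colour_diagonal[OF x(1), of "positive L c" s In] by simp
    have "override_on g (\<lambda>_. ?cc (s, Out) x x) I (c, t, q) = ?cc (t, q) x x" for t q
      using strands[of t] x(2) e crossing_colour_diagonal[OF x(1), of "positive L c" s Out]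
      by (cases q) (auto simp: override_on_def I_def)
    then have "?P (override_on g (\<lambda>_. ?cc (s, Out) x x) I)" using x(1) by blast
    then show "\<exists>u. (\<forall>i\<in>I. u i \<in> X \<and> u (mate L i) = u i) \<and> ?P (override_on g u I)"
      using crossing_colour_closed[OF x(1,1)] by (intro exI[of _ "\<lambda>_. ?cc (s, Out) x x"]) simp
  next
    fix g g' h assume g: "g \<in> ?H ?P" "g' \<in> ?H ?P" and eq: "\<And>h. h \<notin> I \<Longrightarrow> g h = g' h"
    obtain x where x: "x \<in> X" "\<And>t q. g (c, t, q) = ?cc (t, q) x x" using labels[OF g(1)] by blast
    obtain x' where x': "x' \<in> X" "\<And>t q. g' (c, t, q) = ?cc (t, q) x' x'" using labels[OF g(2)] by blast
    have "?cc (s, In) x x = ?cc (s, In) x' x'" using eq[OF I_out(1)] x x' by simp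
    then have "x = x'"
      using bij_betw_imp_inj_on[OF bij_crossing_colour_diagonal] x(1) x'(1) by (meson inj_onD)
    moreover assume "h \<in> I"
    ultimately show "g h = g' h" using x(2) x'(2) unfolding I_def by auto
  next
    fix g g' h assume g: "g \<in> ?H ?P'" "g' \<in> ?H ?P'" and eq: "\<And>h. h \<notin> I \<Longrightarrow> g h = g' h"
    assume h: "h \<in> I"
    then have "opposite h \<notin> I" "h \<in> halves_at {c}" using I_out by (auto simp: I_def)
    then have "g (opposite h) = g h" "g' (opposite h) = g' h"
      using g unfolding half_colourings_def by blast+
    then show "g h = g' h" using eq[OF \<open>opposite h \<notin> I\<close>] by simp
  next
    fix g g' assume g: "g \<in> ?H ?P" "g' \<in> ?H ?P'" and eq: "\<And>h. h \<notin> I \<Longrightarrow> g h = g' h"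
    let ?lb = "half_label_pair (\<odot>) (\<star>) L g" and ?u = "if positive L c then w else unit_inv w"
    obtain x where x: "x \<in> X" "\<And>t q. g (c, t, q) = ?cc (t, q) x x" using labels[OF g(1)] by blast
    have "?lb c = (x, x)"
      by (rule half_label_pair_eq) (simp add: half_label_iff x)
    then have "eqv \<delta> (state_sum \<beta> L ?lb) (scale ?u (state_sum \<beta> ?L' ?lb))"
      by (rule state_sum_omega1[OF L c arc _ x(1)])
    then have "eqv \<delta> (scale (unit_power w (- writhe L)) (state_sum \<beta> L ?lb))
        (scale (unit_power w (- writhe L) * ?u) (state_sum \<beta> ?L' ?lb))"
      using eqv_scale by fastforce
    \<comment> \<open>The factor of the kink accounts exactly for the writhe that the deletion
      removes.\<close>
    moreover have "unit_power w (- writhe L) * ?u = unit_power w (- writhe ?L')"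
    proof (cases "positive L c")
      case True
      then have "- writhe ?L' = - writhe L + 1"
        using writhe_splice[OF finite_verts[OF L], of "{c}" opposite] c by (simp add: crossing_sign_def)
      then show ?thesis using True unit_power_add_one[OF w, of "- writhe L"] by simp
    next
      case False
      then have "- writhe ?L' = - writhe L - 1"
        using writhe_splice[OF finite_verts[OF L], of "{c}" opposite] c by (simp add: crossing_sign_def)
      then show ?thesis using False unit_power_minus_one[OF w, of "- writhe L"] by simp
    qed
    ultimately have "half_bracket L ?lb = half_bracket ?L' ?lb"
      unfolding half_bracket_def by (intro graph_coset_eqI) simp
    also have "\<dots> = half_bracket ?L' (half_label_pair (\<odot>) (\<star>) L g')"
    proof (rule half_bracket_cong)
      fix v assume "v \<in> verts ?L'"
      then show "?lb v = half_label_pair (\<odot>) (\<star>) L g' v"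
        by (intro half_label_pair_half_colouring[OF g(1)] eq) (auto simp: I_def)
    qed
    finally show "half_bracket L ?lb = half_bracket ?L' (half_label_pair (\<odot>) (\<star>) L g')" .
  qed
  then show ?thesis
    using bracket_multiset_half[OF L _ same_graph_refl, of "{c}"] bracket_multiset_whole[OF L, of "{c}"] c
    by (simp only: insert_subset empty_subsetI positive_splice simp_thms)
qed

text \<open>All colours at a positive triangle in terms of three: x enters on the bottom strand, y
  is the inner colour of the middle strand, z leaves on the top strand. The laws (R4) say that the
  colours at the six outer ends agree with those in \<open>right_colours\<close>.\<close>

definition left_colours :: "nat \<Rightarrow> nat \<Rightarrow> nat \<Rightarrow> (half_edge \<Rightarrow> 'x) \<Rightarrow> 'x \<Rightarrow> 'x \<Rightarrow> 'x \<Rightarrow> bool" where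
  "left_colours a b c g x y z \<longleftrightarrow>
    g (c, Under, In) = x \<and> g (c, Under, Out) = x \<odot> y \<and> g (c, Over, In) = y \<star> x \<and> g (c, Over, Out) = y \<and>
    g (a, Under, In) = y \<and> g (a, Under, Out) = y \<odot> z \<and> g (a, Over, In) = z \<star> y \<and> g (a, Over, Out) = z \<and>
    g (b, Under, In) = x \<odot> y \<and> g (b, Under, Out) = (x \<odot> y) \<odot> (z \<star> y) \<and>
    g (b, Over, In) = (z \<star> y) \<star> (x \<odot> y) \<and> g (b, Over, Out) = z \<star> y"

definition right_colours :: "nat \<Rightarrow> nat \<Rightarrow> nat \<Rightarrow> (half_edge \<Rightarrow> 'x) \<Rightarrow> 'x \<Rightarrow> 'x \<Rightarrow> 'x \<Rightarrow> bool" where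
  "right_colours a b c g x y z \<longleftrightarrow>
    g (b, Under, In) = x \<and> g (b, Under, Out) = x \<odot> z \<and> g (b, Over, In) = z \<star> x \<and> g (b, Over, Out) = z \<and>
    g (a, Under, In) = y \<star> x \<and> g (a, Under, Out) = (y \<star> x) \<odot> (z \<star> x) \<and>
    g (a, Over, In) = (z \<star> x) \<star> (y \<star> x) \<and> g (a, Over, Out) = z \<star> x \<and>
    g (c, Under, In) = x \<odot> z \<and> g (c, Under, Out) = (x \<odot> z) \<odot> (y \<odot> z) \<and>
    g (c, Over, In) = (y \<odot> z) \<star> (x \<odot> z) \<and> g (c, Over, Out) = y \<odot> z"

lemma positive_label_iff:
  fixes g :: "half_edge \<Rightarrow> 'x"
  shows "(\<forall>s p. g (c, s, p) = crossing_colour True (s, p) x y) \<longleftrightarrow>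
    g (c, Under, In) = x \<and> g (c, Under, Out) = x \<odot> y \<and> g (c, Over, In) = y \<star> x \<and> g (c, Over, Out) = y"
  using half_label_iff[of True g c x y] by (simp add: half_label_def)

text \<open>The axioms (R4) identify the outer colours on the two sides of the move, the inner
  colours follow from the outer ones, and the label pairs are those of
  \<open>state_sum_omega3\<close>.\<close>

lemma bracket_multiset_positive_omega3:
  assumes L: "framed_graph L" and abc: "a \<in> verts L" "b \<in> verts L" "c \<in> verts L" "a \<noteq> b" "a \<noteq> c" "b \<noteq> c"
    and pos: "positive L a" "positive L b" "positive L c"
    and arcs: "mate L (b, Over, Out) = (a, Over, In)" "mate L (c, Over, Out) = (a, Under, In)"
      "mate L (c, Under, Out) = (b, Under, In)"
    and L': "L' = L\<lparr>mate := exchange_half a b c \<circ> mate L \<circ> exchange_half a b c\<rparr>"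
  shows "\<Phi> L = \<Phi> L'"
proof -
  let ?x = "exchange_half a b c"
  note xx = exchange_half_exchange_half[OF abc(4-6)] and fx = fst_exchange_half[OF abc(4-6)]
    and xs = exchange_half_simps[OF abc(4-6)]
  have L'_simps: "verts L' = verts L" "circles L' = circles L" "positive L' = positive L"
    "\<And>h. mate L' h = ?x (mate L (?x h))" by (simp_all add: L')
  have x_halves: "?x h \<in> halves L \<longleftrightarrow> h \<in> halves L" for h
    using fx(1,2)[of h] abc by (cases "fst h \<in> {a, b, c}") (auto simp: mem_Times_iff)
  have L'f: "framed_graph L'"
    unfolding framed_graph_truncate[symmetric, of L']
    by (rule framed_graph_conj[of "fgraph.truncate L" _ ?x]) (use L L'_simps xx x_halves in simp_all)
  have Q: "{a, b, c} \<subseteq> verts L" "{a, b, c} \<subseteq> verts L'" using abc L'_simps by simp_all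
  let ?Q = "{a, b, c}"
  let ?P = "\<lambda>g. \<forall>v\<in>?Q. \<exists>x\<in>X. \<exists>y\<in>X. \<forall>s q. g (v, s, q) = crossing_colour (positive L v) (s, q) x y"
  let ?M = "{..<circles L} \<rightarrow>\<^sub>E X"
  let ?H = "half_colourings X (\<odot>) (\<star>) L ?Q" and ?H' = "half_colourings X (\<odot>) (\<star>) L' ?Q"
  \<comment> \<open>Colourings of \<open>L'\<close> are pulled back along the exchange, so that both
    families live on the edges of \<open>L\<close> and differ only on the three inner ones.\<close>
  let ?P' = "\<lambda>g. ?P (g \<circ> ?x)"
  let ?v' = "\<lambda>g. half_bracket L' (half_label_pair (\<odot>) (\<star>) L' g)"
  have inv: "(g \<circ> ?x) \<circ> ?x = g" for g :: "half_edge \<Rightarrow> 'x" by (simp add: fun_eq_iff xx)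
  have fix_out: "(g \<circ> ?x) (v, s, p) = g (v, s, p)" if "v \<in> verts L - ?Q" for g :: "half_edge \<Rightarrow> 'x" and v s p
    using fx(2)[of "(v, s, p)"] that by simp
  have conv: "g \<circ> ?x \<in> ?H R' \<longleftrightarrow> g \<in> ?H' R" if R: "\<And>g. R' (g \<circ> ?x) = R g" for g R R'
  proof -
    have ext: "g \<circ> ?x \<in> halves L \<rightarrow>\<^sub>E X \<longleftrightarrow> g \<in> halves L \<rightarrow>\<^sub>E X"
      unfolding PiE_iff extensional_def comp_apply mem_Collect_eq using xx x_halves by metis
    have mates: "(\<forall>h\<in>halves L. (g \<circ> ?x) (mate L h) = (g \<circ> ?x) h) \<longleftrightarrow> (\<forall>h\<in>halves L. g (mate L' h) = g h)"
      unfolding L'_simps comp_apply using xx x_halves by metis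
    have lab: "half_label (\<odot>) (\<star>) (positive L v) (g \<circ> ?x) v = half_label (\<odot>) (\<star>) (positive L v) g v"
      if "v \<in> verts L - ?Q" for v
      by (rule half_label_cong) (rule fix_out[OF that])
    show ?thesis
      unfolding half_colourings_def L'_simps(1,3) mem_Collect_eq ext mates R using lab by auto
  qed
  have "bij_betw (\<lambda>g. g \<circ> ?x) (?H' ?P) (?H ?P')"
  proof (rule bij_betwI[of _ _ _ "\<lambda>g. g \<circ> ?x"])
    show "(\<lambda>g. g \<circ> ?x) \<in> ?H' ?P \<rightarrow> ?H ?P'" using conv[of ?P' ?P] by (simp add: inv)
    show "(\<lambda>g. g \<circ> ?x) \<in> ?H ?P' \<rightarrow> ?H' ?P"
    proof
      fix g assume "g \<in> ?H ?P'"
      then have "(g \<circ> ?x) \<circ> ?x \<in> ?H ?P'" by (simp only: inv)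
      then show "g \<circ> ?x \<in> ?H' ?P" using conv[of ?P' ?P "g \<circ> ?x"] by (simp only: inv)
    qed
  qed (simp_all add: inv)
  then have bij: "bij_betw (map_prod id (\<lambda>g. g \<circ> ?x)) (?M \<times> ?H' ?P) (?M \<times> ?H ?P')"
    by (intro bij_betw_map_prod) simp
  have right: "\<Phi> L' = image_mset (\<lambda>(k, g). ?v' (g \<circ> ?x)) (mset_set (?M \<times> ?H ?P'))"
    unfolding bracket_multiset_whole[OF L'f Q(2)] L'_simps(2,3)
    by (rule image_mset_mset_set_bij[OF bij]) (simp add: case_prod_unfold inv)
  define I where "I = {(c, Under, Out), (b, Under, In), (c, Over, Out), (a, Under, In), (b, Over, Out), (a, Over, In)}"
  have arcs': "mate L (a, Over, In) = (b, Over, Out)" "mate L (a, Under, In) = (c, Over, Out)"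
      "mate L (b, Under, In) = (c, Under, Out)"
  proof -
    have "(b, Over, Out) \<in> halves L" "(c, Over, Out) \<in> halves L" "(c, Under, Out) \<in> halves L" using abc by auto
    from framed_graphD(3)[OF L this(1)] framed_graphD(3)[OF L this(2)] framed_graphD(3)[OF L this(3)] arcs
    show "mate L (a, Over, In) = (b, Over, Out)" "mate L (a, Under, In) = (c, Over, Out)"
      "mate L (b, Under, In) = (c, Under, Out)" by simp_all
  qed
  have g_mate: "g (a, Over, In) = g (b, Over, Out)" "g (a, Under, In) = g (c, Over, Out)"
    "g (b, Under, In) = g (c, Under, Out)" if "g \<in> ?H R" for g R
  proof -
    have "g (mate L h) = g h" if "h \<in> halves L" for h
      using \<open>g \<in> ?H R\<close> that unfolding half_colourings_def by blast
    from this[of "(b, Over, Out)"] this[of "(c, Over, Out)"] this[of "(c, Under, Out)"]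
    show "g (a, Over, In) = g (b, Over, Out)" "g (a, Under, In) = g (c, Over, Out)"
      "g (b, Under, In) = g (c, Under, Out)" using abc arcs by simp_all
  qed
  have left: "\<exists>x\<in>X. \<exists>y\<in>X. \<exists>z\<in>X. left_colours a b c g x y z" if g: "g \<in> ?H ?P" for g
  proof -
    have P: "?P g" using g unfolding half_colourings_def by blast
    obtain x y where xy: "x \<in> X" "y \<in> X" "\<forall>s p. g (c, s, p) = crossing_colour True (s, p) x y"
      using P pos by force
    obtain y1 z where yz: "y1 \<in> X" "z \<in> X" "\<forall>s p. g (a, s, p) = crossing_colour True (s, p) y1 z"
      using P pos by force
    obtain x1 z1 where xz: "x1 \<in> X" "z1 \<in> X" "\<forall>s p. g (b, s, p) = crossing_colour True (s, p) x1 z1"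
      using P pos by force
    note e = xy(3)[unfolded positive_label_iff] yz(3)[unfolded positive_label_iff] xz(3)[unfolded positive_label_iff]
    have "y1 = y" "x1 = x \<odot> y" "z1 = z \<star> y" using g_mate[OF g] e by auto
    then have "left_colours a b c g x y z" unfolding left_colours_def using e by simp
    then show ?thesis using xy yz by blast
  qed
  have left': "?P g" if "left_colours a b c g x y z" "x \<in> X" "y \<in> X" "z \<in> X" for g x y z
    using that closed_ops[OF that(2,3)] closed_ops[OF that(4,3)] pos abc
    by (auto simp: left_colours_def positive_label_iff)
  have right_cols: "\<exists>x\<in>X. \<exists>y\<in>X. \<exists>z\<in>X. right_colours a b c (g \<circ> ?x) x y z" if g: "g \<in> ?H ?P'" for g
  proof -
    have P: "?P (g \<circ> ?x)" using g unfolding half_colourings_def by blast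
    obtain x z where xz: "x \<in> X" "z \<in> X" "\<forall>s p. (g \<circ> ?x) (b, s, p) = crossing_colour True (s, p) x z"
      using P pos by force
    obtain y1 z1 where yz: "y1 \<in> X" "z1 \<in> X" "\<forall>s p. (g \<circ> ?x) (a, s, p) = crossing_colour True (s, p) y1 z1"
      using P pos by force
    obtain x2 y2 where xy: "x2 \<in> X" "y2 \<in> X" "\<forall>s p. (g \<circ> ?x) (c, s, p) = crossing_colour True (s, p) x2 y2"
      using P pos by force
    have "y1 \<in> (\<lambda>y. y \<star> x) ` X" using yz(1) bij_betw_imp_surj_on[OF bij_ast[OF xz(1)]] by simp
    then obtain y where y: "y \<in> X" "y1 = y \<star> x" by blast
    note e = xy(3)[unfolded positive_label_iff] yz(3)[unfolded positive_label_iff] xz(3)[unfolded positive_label_iff]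
    have 1: "z1 = z \<star> x" "x2 = x \<odot> z" "y2 \<star> x2 = y1 \<odot> z1"
      using g_mate[OF g] e by (simp_all add: xs)
    \<comment> \<open>The second law of (R4) rewrites the colour of the middle inner edge;
      cancelling x2 then yields the second label at c.\<close>
    then have "y2 \<star> x2 = (y \<odot> z) \<star> x2" using exchange_laws(2)[OF xz(1) y(1) xz(2)] y(2) by simp
    then have "y2 = y \<odot> z" by (rule ast_cancel[OF xy(2) closed_ops(1)[OF y(1) xz(2)] xy(1)])
    with 1 y(2) have "right_colours a b c (g \<circ> ?x) x y z" unfolding right_colours_def using e by simp
    then show ?thesis using xz y(1) by blast
  qed
  have right': "?P g" if "right_colours a b c g x y z" "x \<in> X" "y \<in> X" "z \<in> X" for g x y z
    using that closed_ops pos abc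
    by (auto simp: right_colours_def positive_label_iff)
  have RI: "right_colours a b c (k \<circ> ?x) x y z \<longleftrightarrow>
      k (c, Under, In) = x \<and> k (c, Under, Out) = x \<odot> z \<and> k (a, Over, In) = z \<star> x \<and> k (a, Over, Out) = z \<and>
      k (c, Over, In) = y \<star> x \<and> k (c, Over, Out) = (y \<star> x) \<odot> (z \<star> x) \<and>
      k (b, Over, In) = (z \<star> x) \<star> (y \<star> x) \<and> k (b, Over, Out) = z \<star> x \<and>
      k (b, Under, In) = x \<odot> z \<and> k (b, Under, Out) = (x \<odot> z) \<odot> (y \<odot> z) \<and>
      k (a, Under, In) = (y \<odot> z) \<star> (x \<odot> z) \<and> k (a, Under, Out) = y \<odot> z" for k x y z
    by (simp add: right_colours_def xs)
  \<comment> \<open>Here m, t and q are the colours of the inner edges on the middle, top and bottom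
    strand.\<close>
  define u where "u m t q h = (if h \<in> {(c, Over, Out), (a, Under, In)} then m
    else if h \<in> {(b, Over, Out), (a, Over, In)} then t else q)" for m t q :: 'x and h :: half_edge
  have u_ok: "\<forall>i\<in>I. u m t q i \<in> X \<and> u m t q (mate L i) = u m t q i" if "m \<in> X" "t \<in> X" "q \<in> X" for m t q
    using that abc arcs arcs' by (simp add: u_def I_def)
  have "image_mset (\<lambda>(k, g). half_bracket L (half_label_pair (\<odot>) (\<star>) L g)) (mset_set (?M \<times> ?H ?P)) =
      image_mset (\<lambda>(k, g). ?v' (g \<circ> ?x)) (mset_set (?M \<times> ?H ?P'))"
  proof (rule half_colourings_transfer[OF L])
    show "I \<subseteq> halves_at ?Q" by (auto simp: I_def)
    show "?Q \<subseteq> verts L" by (rule Q)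
    show "mate L i \<in> I" if "i \<in> I" for i using that arcs arcs' unfolding I_def by auto
  next
    fix g assume "g \<in> ?H ?P"
    then obtain x y z where xyz: "x \<in> X" "y \<in> X" "z \<in> X" "left_colours a b c g x y z" using left by blast
    let ?u = "u ((y \<star> x) \<odot> (z \<star> x)) (z \<star> x) (x \<odot> z)"
    have "right_colours a b c (override_on g ?u I \<circ> ?x) x y z"
      unfolding RI using xyz(4) abc exchange_laws[OF xyz(1-3)]
      by (simp add: left_colours_def override_on_def I_def u_def)
    then have "?P' (override_on g ?u I)" using right' xyz by blast
    moreover have "\<forall>i\<in>I. ?u i \<in> X \<and> ?u (mate L i) = ?u i" using xyz by (intro u_ok closed_ops)
    ultimately show "\<exists>u. (\<forall>i\<in>I. u i \<in> X \<and> u (mate L i) = u i) \<and> ?P' (override_on g u I)" by blast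
  next
    fix g assume "g \<in> ?H ?P'"
    then obtain x y z where xyz: "x \<in> X" "y \<in> X" "z \<in> X" "right_colours a b c (g \<circ> ?x) x y z" using right_cols by blast
    let ?u = "u y (z \<star> y) (x \<odot> y)"
    have "left_colours a b c (override_on g ?u I) x y z"
      using xyz(4) abc exchange_laws[OF xyz(1-3)] unfolding RI
      by (simp add: left_colours_def override_on_def I_def u_def)
    then have "?P (override_on g ?u I)" using left' xyz by blast
    moreover have "\<forall>i\<in>I. ?u i \<in> X \<and> ?u (mate L i) = ?u i" using xyz by (intro u_ok closed_ops)
    ultimately show "\<exists>u. (\<forall>i\<in>I. u i \<in> X \<and> u (mate L i) = u i) \<and> ?P (override_on g u I)" by blast
  next
    fix g g' h assume g: "g \<in> ?H ?P" "g' \<in> ?H ?P" and eq: "\<And>h. h \<notin> I \<Longrightarrow> g h = g' h" and h: "h \<in> I"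
    obtain x y z where xyz: "x \<in> X" "y \<in> X" "z \<in> X" "left_colours a b c g x y z" using left[OF g(1)] by blast
    obtain x' y' z' where xyz': "x' \<in> X" "y' \<in> X" "z' \<in> X" "left_colours a b c g' x' y' z'" using left[OF g(2)] by blast
    \<comment> \<open>These three outer half-edges carry x, y \<star> x and z on both sides of the
      move; cancelling x recovers y.\<close>
    have "g (c, Under, In) = g' (c, Under, In)" "g (c, Over, In) = g' (c, Over, In)" "g (a, Over, Out) = g' (a, Over, Out)"
      using abc by (intro eq; simp add: I_def)+
    moreover have "g (c, Under, In) = x" "g (c, Over, In) = y \<star> x" "g (a, Over, Out) = z"
      "g' (c, Under, In) = x'" "g' (c, Over, In) = y' \<star> x'" "g' (a, Over, Out) = z'"
      using xyz(4) xyz'(4) by (simp_all only: left_colours_def)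
    ultimately have "x = x'" "y \<star> x = y' \<star> x'" "z = z'" by simp_all
    moreover from this have "y = y'" using ast_cancel xyz xyz' by blast
    ultimately show "g h = g' h" using xyz(4) xyz'(4) h by (auto simp: left_colours_def I_def)
  next
    fix g g' h assume g: "g \<in> ?H ?P'" "g' \<in> ?H ?P'" and eq: "\<And>h. h \<notin> I \<Longrightarrow> g h = g' h" and h: "h \<in> I"
    obtain x y z where xyz: "x \<in> X" "y \<in> X" "z \<in> X" "right_colours a b c (g \<circ> ?x) x y z"
      using right_cols[OF g(1)] by blast
    obtain x' y' z' where xyz': "x' \<in> X" "y' \<in> X" "z' \<in> X" "right_colours a b c (g' \<circ> ?x) x' y' z'"
      using right_cols[OF g(2)] by blast
    have "g (c, Under, In) = g' (c, Under, In)" "g (c, Over, In) = g' (c, Over, In)" "g (a, Over, Out) = g' (a, Over, Out)"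
      using abc by (intro eq; simp add: I_def)+
    moreover have "g (c, Under, In) = x" "g (c, Over, In) = y \<star> x" "g (a, Over, Out) = z"
      "g' (c, Under, In) = x'" "g' (c, Over, In) = y' \<star> x'" "g' (a, Over, Out) = z'"
      using xyz(4) xyz'(4) by (simp_all only: RI)
    ultimately have "x = x'" "y \<star> x = y' \<star> x'" "z = z'" by simp_all
    moreover from this have "y = y'" using ast_cancel xyz xyz' by blast
    ultimately show "g h = g' h" using xyz(4) xyz'(4) h unfolding RI by (auto simp: I_def)
  next
    fix g g' assume g: "g \<in> ?H ?P" "g' \<in> ?H ?P'" and eq: "\<And>h. h \<notin> I \<Longrightarrow> g h = g' h"
    let ?lb = "half_label_pair (\<odot>) (\<star>) L g" and ?lb' = "half_label_pair (\<odot>) (\<star>) L' (g' \<circ> ?x)"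
    obtain x y z where xyz: "x \<in> X" "y \<in> X" "z \<in> X" "left_colours a b c g x y z" using left[OF g(1)] by blast
    obtain x' y' z' where xyz': "x' \<in> X" "y' \<in> X" "z' \<in> X" "right_colours a b c (g' \<circ> ?x) x' y' z'"
      using right_cols[OF g(2)] by blast
    have "g (c, Under, In) = g' (c, Under, In)" "g (c, Over, In) = g' (c, Over, In)" "g (a, Over, Out) = g' (a, Over, Out)"
      using abc by (intro eq; simp add: I_def)+
    moreover have "g (c, Under, In) = x" "g (c, Over, In) = y \<star> x" "g (a, Over, Out) = z"
      using xyz(4) by (simp_all only: left_colours_def)
    moreover have "g' (c, Under, In) = x'" "g' (c, Over, In) = y' \<star> x'" "g' (a, Over, Out) = z'"
      using xyz'(4) by (simp_all only: RI)
    ultimately have "x' = x" "y' \<star> x' = y \<star> x" "z' = z" by simp_all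
    moreover from this have "y' = y" using ast_cancel xyz xyz' by blast
    ultimately have R: "right_colours a b c (g' \<circ> ?x) x y z" using xyz'(4) by simp
    have lb: "?lb c = (x, y)" "?lb a = (y, z)" "?lb b = (x \<odot> y, z \<star> y)"
      using xyz(4) pos by (intro half_label_pair_eq; simp add: half_label_def left_colours_def)+
    have lb': "?lb' b = (x, z)" "?lb' a = (y \<star> x, z \<star> x)" "?lb' c = (x \<odot> z, y \<odot> z)"
      using R pos by (intro half_label_pair_eq; simp add: half_label_def right_colours_def L'_simps)+
    have out: "?lb v = ?lb' v" if "v \<in> verts L" "v \<notin> ?Q" for v
    proof -
      have "half_label (\<odot>) (\<star>) (positive L v) g v = half_label (\<odot>) (\<star>) (positive L v) (g' \<circ> ?x) v"
      proof (rule half_label_cong)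
        fix s p
        have "(v, s, p) \<notin> I" using that(2) by (auto simp: I_def)
        then show "g (v, s, p) = (g' \<circ> ?x) (v, s, p)" using fix_out[of v g' s p] eq that by simp
      qed
      then show ?thesis unfolding half_label_pair_def L'_simps(3) by simp
    qed
    have "eqv \<delta> (state_sum \<beta> L ?lb) (state_sum \<beta> L' ?lb')"
      by (rule state_sum_omega3[OF L abc pos arcs L' lb lb' out xyz(1-3)])
    moreover have "writhe L' = writhe L" by (simp add: writhe_def crossing_sign_def L'_simps)
    ultimately show "half_bracket L ?lb = half_bracket L' ?lb'"
      unfolding half_bracket_def by (simp add: graph_coset_eqI eqv_scale)
  qed
  then show ?thesis unfolding right bracket_multiset_whole[OF L Q(1)] .
qed

end

section \<open>Isomorphic diagrams\<close>

lemma glue_pairs_iff: "(a, b) \<in> glue_pairs S j \<longleftrightarrow> a \<in> halves_at S \<and> b = j a"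
  unfolding glue_pairs_def by blast

lemma half_colourings_mate:
  "g \<in> half_colourings X circ ast L Q P \<Longrightarrow> h \<in> halves L \<Longrightarrow> g (mate L h) = g h"
  unfolding half_colourings_def by blast

context parity_bracket
begin

text \<open>Renaming crossings transports half-edge colourings, label pairs and states.
  Corresponding states give isomorphic graphs with equal coefficients.\<close>

lemma bracket_multiset_iso:
  assumes L: "framed_graph L" and L': "framed_graph L'" and iso: "diagram_iso L L'"
  shows "\<Phi> L = \<Phi> L'"
proof -
  obtain \<phi> where circ: "circles L = circles L'" and \<phi>: "bij_betw \<phi> (verts L) (verts L')"
    and pos: "\<And>c. c \<in> verts L \<Longrightarrow> positive L' (\<phi> c) = positive L c"
    and mate: "\<And>h. h \<in> halves L \<Longrightarrow> mate L' (map_prod \<phi> id h) = map_prod \<phi> id (mate L h)"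
    using iso unfolding diagram_iso_def by blast
  define m where "m = map_prod \<phi> (id :: strand \<times> port \<Rightarrow> strand \<times> port)"
  define \<psi> where "\<psi> = inv_into (verts L) \<phi>"
  have \<phi>V: "\<phi> v \<in> verts L'" if "v \<in> verts L" for v using \<phi> that by (rule bij_betwE[rule_format])
  have inj: "\<phi> v = \<phi> v' \<longleftrightarrow> v = v'" if "v \<in> verts L" "v' \<in> verts L" for v v'
    using bij_betw_imp_inj_on[OF \<phi>] that by (meson inj_onD)
  have \<psi>: "\<psi> v \<in> verts L" "\<phi> (\<psi> v) = v" if "v \<in> verts L'" for v
    using bij_betwE[OF bij_betw_inv_into[OF \<phi>]] bij_betw_inv_into_right[OF \<phi>] that unfolding \<psi>_def by auto
  have \<psi>\<phi>: "\<psi> (\<phi> v) = v" if "v \<in> verts L" for v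
    using bij_betw_inv_into_left[OF \<phi> that] by (simp add: \<psi>_def)
  have m_bij: "bij_betw m (halves_at S) (halves_at (\<phi> ` S))" if "S \<subseteq> verts L" for S
    unfolding m_def using bij_betw_subset[OF \<phi> that refl] by (intro bij_betw_map_prod bij_id)
  have m_halves: "m h \<in> halves L'" if "h \<in> halves L" for h
    using that \<phi>V by (auto simp: m_def)
  have state: "graph_elt (state_graph L (restrict (st \<circ> \<phi>) (verts L))) = graph_elt (state_graph L' st)" for st
  proof (rule graph_elt_cong)
    let ?st = "restrict (st \<circ> \<phi>) (verts L)"
    let ?S = "{c \<in> verts L. ?st c \<noteq> Vertex}" and ?T = "{c \<in> verts L'. st c \<noteq> Vertex}"
    let ?L = "fgraph.truncate L" and ?L' = "fgraph.truncate L'"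
    have T: "?T = \<phi> ` ?S" using \<phi>V \<psi> by (auto simp: image_iff) metis
    have fr: "framed_graph ?L" "framed_graph ?L'" using L L' by simp_all
    have sub: "?S \<subseteq> verts ?L" "?T \<subseteq> verts ?L'" by auto
    show "framed_graph (state_graph L ?st)" "framed_graph (state_graph L' st)"
      unfolding state_graph_def by (rule framed_graph_splice[OF fr(1) gluing_smoothing sub(1)],
        rule framed_graph_splice[OF fr(2) gluing_smoothing sub(2)])
    have bij: "bij_betw m (halves L) (halves L')"
      using m_bij[of "verts L"] bij_betw_imp_surj_on[OF \<phi>] by simp
    have sm: "m (smoothing ?st h) = smoothing st (m h)" if "h \<in> halves L" for h
      using that by (cases h) (auto simp: m_def smoothing_def)
    let ?R = "mate_pairs ?L \<union> glue_pairs ?S (smoothing ?st)" and ?R' = "mate_pairs ?L' \<union> glue_pairs ?T (smoothing st)"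
    have subR: "?R \<subseteq> halves L \<times> halves L" "?R' \<subseteq> halves L' \<times> halves L'"
    proof -
      have "halves_at ?S \<subseteq> halves L" "halves_at ?T \<subseteq> halves L'" by auto
      then show "?R \<subseteq> halves L \<times> halves L" "?R' \<subseteq> halves L' \<times> halves L'"
        using mate_pairs_subset[OF fr(1)] mate_pairs_subset[OF fr(2)]
          order.trans[OF glue_pairs_subset[OF gluing_smoothing] Sigma_mono]
        by (simp_all only: Un_subset_iff truncate_simps simp_thms)
    qed
    have minj: "m h = m h' \<longleftrightarrow> h = h'" if "h \<in> halves L" "h' \<in> halves L" for h h'
      using bij_betw_imp_inj_on[OF bij] that by (meson inj_onD)
    have smh: "smoothing ?st h \<in> halves L" if "h \<in> halves L" for h
      using that by (cases h) (auto simp: smoothing_def)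
    have iff: "(p, q) \<in> ?R \<longleftrightarrow> (m p, m q) \<in> ?R'" if pq: "p \<in> halves L" "q \<in> halves L" for p q
    proof -
      have "(m p, m q) \<in> mate_pairs ?L' \<longleftrightarrow> m q = m (mate L p)"
      proof -
        have "mate ?L' (m p) = m (mate L p)" using mate[OF pq(1)] by (simp add: m_def)
        then show ?thesis using m_halves[OF pq(1)] unfolding mate_pairs_def by auto
      qed
      also have "\<dots> \<longleftrightarrow> q = mate L p" by (rule minj[OF pq(2) framed_graphD(1)[OF L pq(1)]])
      also have "\<dots> \<longleftrightarrow> (p, q) \<in> mate_pairs ?L" using pq(1) by (auto simp: mate_pairs_def)
      finally have 1: "(m p, m q) \<in> mate_pairs ?L' \<longleftrightarrow> (p, q) \<in> mate_pairs ?L" .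
      have mT: "m p \<in> halves_at ?T \<longleftrightarrow> p \<in> halves_at ?S"
        using pq(1) \<phi>V by (cases p) (simp add: m_def)
      have "(m p, m q) \<in> glue_pairs ?T (smoothing st) \<longleftrightarrow> m p \<in> halves_at ?T \<and> m q = smoothing st (m p)"
        by (rule glue_pairs_iff)
      also have "\<dots> \<longleftrightarrow> p \<in> halves_at ?S \<and> q = smoothing ?st p"
        unfolding mT sm[OF pq(1), symmetric] minj[OF pq(2) smh[OF pq(1)]] by (rule refl)
      also have "\<dots> \<longleftrightarrow> (p, q) \<in> glue_pairs ?S (smoothing ?st)" by (rule glue_pairs_iff[symmetric])
      finally show ?thesis using 1 by blast
    qed
    have "framed_iso (splice ?S (smoothing ?st) ?L\<lparr>circles := circles (splice ?S (smoothing ?st) ?L) + 0\<rparr>)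
      (splice ?T (smoothing st) ?L'\<lparr>circles := circles (splice ?T (smoothing st) ?L') + 0\<rparr>)"
    proof (rule framed_iso_spliceI[OF fr(1) gluing_smoothing sub(1) fr(2) gluing_smoothing sub(2)])
      have "\<phi> ` (verts L - ?S) = verts L' - ?T"
        unfolding T using inj_on_image_set_diff[OF bij_betw_imp_inj_on[OF \<phi>], of "verts L" ?S] bij_betw_imp_surj_on[OF \<phi>]
        by auto
      then show "bij_betw m (halves_at (verts ?L - ?S)) (halves_at (verts ?L' - ?T))"
        using m_bij[of "verts L - ?S"] by simp
      fix h h' assume "h \<in> halves_at (verts ?L - ?S)" "h' \<in> halves_at (verts ?L - ?S)"
      then have hh: "h \<in> halves L" "h' \<in> halves L" by auto
      then show "fst (m h) = fst (m h') \<longleftrightarrow> fst h = fst h'" using inj by (auto simp: m_def)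
      show "m (opposite h) = opposite (m h)" by (cases h) (simp add: m_def)
      assume "(h, h') \<in> splice_rel ?S (smoothing ?st) ?L"
      then show "(m h, m h') \<in> splice_rel ?T (smoothing st) ?L'"
        unfolding splice_rel_eq using rtrancl_bij_iff[OF bij subR iff hh] by simp
    next
      have "m ` halves_at ?S = halves_at ?T" using m_bij[of ?S] T by (simp add: bij_betw_def)
      then have "card {c \<in> halves L // ?R\<^sup>*. c \<subseteq> halves_at ?S} = card {c \<in> halves L' // ?R'\<^sup>*. c \<subseteq> halves_at ?T}"
        by (intro card_components_bij[OF bij subR iff]) auto
      then show "circles (splice ?S (smoothing ?st) ?L) + 0 = circles (splice ?T (smoothing st) ?L') + 0"
        using circ by (simp add: circles_splice splice_rel_eq)
    qed
    then show "framed_iso (state_graph L ?st) (state_graph L' st)"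
      by (simp add: state_graph_def framed_iso_def)
  qed
  have sum: "state_sum \<beta> L lb = state_sum \<beta> L' lb'" if lb: "\<And>c. c \<in> verts L \<Longrightarrow> lb' (\<phi> c) = lb c" for lb lb'
  proof -
    have bij: "bij_betw (\<lambda>st. restrict (st \<circ> \<phi>) (verts L)) (states L') (states L)"
      unfolding states_def
    proof (rule bij_betwI[of _ _ _ "\<lambda>st. restrict (st \<circ> \<psi>) (verts L')"])
      show "restrict (restrict (st \<circ> \<phi>) (verts L) \<circ> \<psi>) (verts L') = st" if "st \<in> verts L' \<rightarrow>\<^sub>E UNIV" for st
        using \<psi> that by (intro PiE_ext[OF _ that]) auto
      show "restrict (restrict (st \<circ> \<psi>) (verts L') \<circ> \<phi>) (verts L) = st" if "st \<in> verts L \<rightarrow>\<^sub>E UNIV" for st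
        using \<psi>\<phi> \<phi>V that by (intro PiE_ext[OF _ that]) auto
    qed auto
    have prod: "(\<Prod>c\<in>verts L. \<beta> (positive L c) (restrict (st \<circ> \<phi>) (verts L) c) (lb c)) =
        (\<Prod>c\<in>verts L'. \<beta> (positive L' c) (st c) (lb' c))" for st
    proof -
      have "(\<Prod>c\<in>verts L'. \<beta> (positive L' c) (st c) (lb' c)) = (\<Prod>c\<in>verts L. \<beta> (positive L' (\<phi> c)) (st (\<phi> c)) (lb' (\<phi> c)))"
        by (rule prod.reindex_bij_betw[OF \<phi>, symmetric])
      also have "\<dots> = (\<Prod>c\<in>verts L. \<beta> (positive L c) (restrict (st \<circ> \<phi>) (verts L) c) (lb c))"
        by (rule prod.cong) (simp_all add: pos lb)
      finally show ?thesis by simp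
    qed
    show ?thesis
      unfolding state_sum_def sum.reindex_bij_betw[OF bij, symmetric]
      by (rule sum.cong) (simp_all only: prod state)
  qed
  have writhe: "writhe L' = writhe L"
    unfolding writhe_def sum.reindex_bij_betw[OF \<phi>, symmetric] by (rule sum.cong) (simp_all add: crossing_sign_def pos)
  let ?H = "half_colourings X (\<odot>) (\<star>) L {} (\<lambda>g. \<forall>h\<in>halves_at {}. g (opposite h) = g h)"
    and ?H' = "half_colourings X (\<odot>) (\<star>) L' {} (\<lambda>g. \<forall>h\<in>halves_at {}. g (opposite h) = g h)"
  let ?m' = "map_prod \<psi> (id :: strand \<times> port \<Rightarrow> strand \<times> port)"
  have m': "?m' (m h) = h" if "h \<in> halves L" for h using that \<psi>\<phi> by (auto simp: m_def)
  have m'': "m (?m' h) = h" "?m' h \<in> halves L" if "h \<in> halves L'" for h using that \<psi> by (auto simp: m_def)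
  have lab: "half_label (\<odot>) (\<star>) b (restrict (g \<circ> m) (halves L)) c = half_label (\<odot>) (\<star>) b g (\<phi> c)"
    if "c \<in> verts L" for b g c
    using that by (simp add: half_label_def m_def)
  have mate': "mate L (?m' h) = ?m' (mate L' h)" if h: "h \<in> halves L'" for h
    using mate[OF m''(2)[OF h]] m''(1)[OF h] m'[OF framed_graphD(1)[OF L m''(2)[OF h]]]
    unfolding m_def[symmetric] by simp
  have bij: "bij_betw (\<lambda>g. restrict (g \<circ> m) (halves L)) ?H' ?H"
  proof (rule bij_betwI[of _ _ _ "\<lambda>g. restrict (g \<circ> ?m') (halves L')"])
    show "(\<lambda>g. restrict (g \<circ> m) (halves L)) \<in> ?H' \<rightarrow> ?H"
    proof
      fix g assume g: "g \<in> ?H'"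
      show "restrict (g \<circ> m) (halves L) \<in> ?H"
        unfolding half_colourings_def
      proof (intro CollectI conjI ballI)
        show "restrict (g \<circ> m) (halves L) \<in> halves L \<rightarrow>\<^sub>E X"
        proof (intro PiE_I)
          show "restrict (g \<circ> m) (halves L) h \<in> X" if "h \<in> halves L" for h
            using g m_halves[OF that] that by (simp only: half_colourings_def mem_Collect_eq PiE_iff restrict_apply' comp_apply)
        qed simp
        fix h assume h: "h \<in> halves L"
        have "g (mate L' (m h)) = g (m h)" by (rule half_colourings_mate[OF g m_halves[OF h]])
        then show "restrict (g \<circ> m) (halves L) (mate L h) = restrict (g \<circ> m) (halves L) h"
          using h framed_graphD(1)[OF L h] mate[OF h] by (simp add: m_def)
      next
        fix c assume c: "c \<in> verts L - {}"
        then have "\<exists>x\<in>X. \<exists>y\<in>X. half_label (\<odot>) (\<star>) (positive L' (\<phi> c)) g (\<phi> c) (x, y)"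
          using g \<phi>V[of c] unfolding half_colourings_def by blast
        then show "\<exists>x\<in>X. \<exists>y\<in>X. half_label (\<odot>) (\<star>) (positive L c) (restrict (g \<circ> m) (halves L)) c (x, y)"
          using c pos lab by simp
      qed simp
    qed
    show "(\<lambda>g. restrict (g \<circ> ?m') (halves L')) \<in> ?H \<rightarrow> ?H'"
    proof
      fix g assume g: "g \<in> ?H"
      show "restrict (g \<circ> ?m') (halves L') \<in> ?H'"
        unfolding half_colourings_def
      proof (intro CollectI conjI ballI)
        show "restrict (g \<circ> ?m') (halves L') \<in> halves L' \<rightarrow>\<^sub>E X"
        proof (intro PiE_I)
          show "restrict (g \<circ> ?m') (halves L') h \<in> X" if "h \<in> halves L'" for h
            using g m''(2)[OF that] that by (simp only: half_colourings_def mem_Collect_eq PiE_iff restrict_apply' comp_apply)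
        qed simp
        fix h assume h: "h \<in> halves L'"
        have "g (mate L (?m' h)) = g (?m' h)" by (rule half_colourings_mate[OF g m''(2)[OF h]])
        then show "restrict (g \<circ> ?m') (halves L') (mate L' h) = restrict (g \<circ> ?m') (halves L') h"
          using h framed_graphD(1)[OF L' h] mate'[OF h] by simp
      next
        fix c assume c: "c \<in> verts L' - {}"
        then have "\<exists>x\<in>X. \<exists>y\<in>X. half_label (\<odot>) (\<star>) (positive L (\<psi> c)) g (\<psi> c) (x, y)"
          using g \<psi>(1)[of c] unfolding half_colourings_def by blast
        moreover have "half_label (\<odot>) (\<star>) b (restrict (g \<circ> ?m') (halves L')) c = half_label (\<odot>) (\<star>) b g (\<psi> c)" for b
          using c by (simp add: half_label_def)
        ultimately show "\<exists>x\<in>X. \<exists>y\<in>X. half_label (\<odot>) (\<star>) (positive L' c) (restrict (g \<circ> ?m') (halves L')) c (x, y)"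
          using c pos[OF \<psi>(1)[of c]] \<psi>(2)[of c] by simp
      qed simp
    qed
    show "restrict (restrict (g \<circ> m) (halves L) \<circ> ?m') (halves L') = g" if "g \<in> ?H'" for g
      using m'' that by (intro PiE_ext[of _ "halves L'" "\<lambda>_. UNIV"]) (auto simp: half_colourings_def PiE_iff)
    show "restrict (restrict (g \<circ> ?m') (halves L') \<circ> m) (halves L) = g" if "g \<in> ?H" for g
      using m' m_halves that by (intro PiE_ext[of _ "halves L" "\<lambda>_. UNIV"]) (auto simp: half_colourings_def PiE_iff)
  qed
  have "image_mset (\<lambda>(k, g). half_bracket L' (half_label_pair (\<odot>) (\<star>) L' g)) (mset_set (({..<circles L'} \<rightarrow>\<^sub>E X) \<times> ?H')) =
      image_mset (\<lambda>(k, g). half_bracket L (half_label_pair (\<odot>) (\<star>) L g)) (mset_set (({..<circles L} \<rightarrow>\<^sub>E X) \<times> ?H))"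
  proof (rule image_mset_mset_set_bij)
    show "bij_betw (map_prod id (\<lambda>g. restrict (g \<circ> m) (halves L))) (({..<circles L'} \<rightarrow>\<^sub>E X) \<times> ?H') (({..<circles L} \<rightarrow>\<^sub>E X) \<times> ?H)"
      unfolding circ by (intro bij_betw_map_prod bij) simp
    fix kg :: "(nat \<Rightarrow> 'x) \<times> (half_edge \<Rightarrow> 'x)"
    have "half_bracket L (half_label_pair (\<odot>) (\<star>) L (restrict (g \<circ> m) (halves L))) =
        half_bracket L' (half_label_pair (\<odot>) (\<star>) L' g)" for g
    proof -
      have "half_label_pair (\<odot>) (\<star>) L' g (\<phi> c) = half_label_pair (\<odot>) (\<star>) L (restrict (g \<circ> m) (halves L)) c"
        if "c \<in> verts L" for c
        by (simp add: half_label_pair_def lab[OF that] pos[OF that])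
      then have "state_sum \<beta> L (half_label_pair (\<odot>) (\<star>) L (restrict (g \<circ> m) (halves L))) =
          state_sum \<beta> L' (half_label_pair (\<odot>) (\<star>) L' g)"
        by (rule sum)
      then show ?thesis by (simp add: half_bracket_def writhe)
    qed
    then show "(case map_prod id (\<lambda>g. restrict (g \<circ> m) (halves L)) kg of (k, g) \<Rightarrow> half_bracket L (half_label_pair (\<odot>) (\<star>) L g)) =
        (case kg of (k, g) \<Rightarrow> half_bracket L' (half_label_pair (\<odot>) (\<star>) L' g))"
      by (simp add: case_prod_unfold)
  qed
  then show ?thesis
    using bracket_multiset_half[OF L _ same_graph_splice_empty[OF L]]
      bracket_multiset_half[OF L' _ same_graph_splice_empty[OF L']] by simp
qed

end

section \<open>The oriented third moves\<close>

text \<open>Splits a half-edge into a point of the Gauss diagram and a port. The moves below permute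
  points while retaining ports.\<close>

definition half_at :: "nat \<times> strand \<Rightarrow> port \<Rightarrow> half_edge" where
  "half_at P q = (fst P, snd P, q)"

lemma half_at_eq_iff [simp]: "half_at P q = half_at P' q' \<longleftrightarrow> P = P' \<and> q = q'"
  by (cases P; cases P') (simp add: half_at_def)

lemma fst_half_at [simp]: "fst (half_at P q) = fst P"
  by (simp add: half_at_def)

lemma half_at_exhaust: obtains P q where "h = half_at P q"
  by (cases h) (metis fst_conv half_at_def snd_conv)

definition lift_point :: "(nat \<times> strand \<Rightarrow> nat \<times> strand) \<Rightarrow> half_edge \<Rightarrow> half_edge" where
  "lift_point f h = half_at (f (fst h, fst (snd h))) (snd (snd h))"

lemma lift_point_half_at [simp]: "lift_point f (half_at P q) = half_at (f P) q"
  by (simp add: lift_point_def half_at_def)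

lemma exchange_half_lift: "exchange_half a b c = lift_point (exchange a b c)"
  by (auto simp: fun_eq_iff exchange_half_def lift_point_def half_at_def split: prod.split)

abbreviation conj_diagram :: "(half_edge \<Rightarrow> half_edge) \<Rightarrow> diagram \<Rightarrow> diagram" where
  "conj_diagram x L \<equiv> L\<lparr>mate := x \<circ> mate L \<circ> x\<rparr>"

lemma framed_graph_conj_diagram:
  assumes L: "framed_graph L" and x: "\<And>h. x (x h) = h" "\<And>h. h \<in> halves L \<Longrightarrow> x h \<in> halves L"
  shows "framed_graph (conj_diagram x L)"
  unfolding framed_graph_truncate[symmetric, of "conj_diagram x L"]
  by (rule framed_graph_conj[of "fgraph.truncate L" _ x]) (use assms in simp_all)

text \<open>The Reidemeister move that creates the crossings \<open>k'\<close> and \<open>k''\<close> on the edges at the half-edges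
  \<open>(N s, p s)\<close>: leaving \<open>N s\<close> through the port \<open>p s\<close> one meets \<open>k'\<close> first.\<close>

definition side_swap :: "(strand \<Rightarrow> nat \<times> strand) \<Rightarrow> (strand \<Rightarrow> port) \<Rightarrow> nat \<Rightarrow> half_edge \<Rightarrow> half_edge" where
  "side_swap N p k'' =
    transpose (half_at (N Over) (p Over)) (half_at (k'', Over) (p Over)) \<circ>
    transpose (half_at (N Under) (p Under)) (half_at (k'', Under) (p Under))"

text \<open>Adds k' and k'' as a separate component in which each strand closes up through both.
  Exchanging one port of \<open>N s\<close> with the same port of k'' then opens this component into
  the edge at \<open>N s\<close>. Conjugation covers uniformly the case that the edges at the two
  points coincide.\<close>

definition beside :: "nat \<Rightarrow> nat \<Rightarrow> diagram \<Rightarrow> half_edge \<Rightarrow> half_edge" where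
  "beside k' k'' L = (\<lambda>(v, s, q).
    if v = k' then (k'', s, other_port q) else if v = k'' then (k', s, other_port q) else mate L (v, s, q))"

definition insert_pair ::
  "(strand \<Rightarrow> nat \<times> strand) \<Rightarrow> (strand \<Rightarrow> port) \<Rightarrow> nat \<Rightarrow> nat \<Rightarrow> bool \<Rightarrow> diagram \<Rightarrow> diagram" where
  "insert_pair N p k' k'' b L = L
    \<lparr> verts := verts L \<union> {k', k''},
      mate := side_swap N p k'' \<circ> beside k' k'' L \<circ> side_swap N p k'',
      positive := (positive L)(k' := b, k'' := \<not> b) \<rparr>"

lemma beside_other: "fst h \<noteq> k' \<Longrightarrow> fst h \<noteq> k'' \<Longrightarrow> beside k' k'' L h = mate L h"
  by (cases h) (simp add: beside_def)

context
  fixes L :: diagram and N :: "strand \<Rightarrow> nat \<times> strand" and p :: "strand \<Rightarrow> port" and k' k'' :: nat and b :: bool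
  assumes L: "framed_graph L" and N: "\<And>s. fst (N s) \<in> verts L" "N Over \<noteq> N Under"
    and fresh: "k' \<notin> verts L" "k'' \<notin> verts L" "k' \<noteq> k''"
begin

abbreviation "sw \<equiv> side_swap N p k''"
abbreviation "bs \<equiv> beside k' k'' L"
abbreviation "LI \<equiv> insert_pair N p k' k'' b L"

lemma N_inject: "N s = N t \<longleftrightarrow> s = t"
  using N(2) by (cases s; cases t) auto

lemma N_fresh: "fst (N s) \<noteq> k'" "fst (N s) \<noteq> k''" "N s \<noteq> (k', t)" "N s \<noteq> (k'', t)"
  "(k', t) \<noteq> N s" "(k'', t) \<noteq> N s"
  using N(1)[of s] fresh by (metis fst_conv)+

lemma side_swap_simps:
  "sw (half_at (N s) (p s)) = half_at (k'', s) (p s)"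
  "sw (half_at (k'', s) (p s)) = half_at (N s) (p s)"
  "(\<And>s. h \<noteq> half_at (N s) (p s) \<and> h \<noteq> half_at (k'', s) (p s)) \<Longrightarrow> sw h = h"
proof -
  show "sw (half_at (N s) (p s)) = half_at (k'', s) (p s)" "sw (half_at (k'', s) (p s)) = half_at (N s) (p s)"
    by (cases s; simp add: side_swap_def transpose_def N_inject N_fresh)+
  show "sw h = h" if "\<And>s. h \<noteq> half_at (N s) (p s) \<and> h \<noteq> half_at (k'', s) (p s)"
    using that[of Over] that[of Under] by (simp add: side_swap_def transpose_def)
qed

lemma side_swap_cases:
  obtains s where "h = half_at (N s) (p s)" | s where "h = half_at (k'', s) (p s)"
    | "\<And>s. h \<noteq> half_at (N s) (p s) \<and> h \<noteq> half_at (k'', s) (p s)"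
  by blast

lemma side_swap_side_swap: "sw (sw h) = h"
  by (rule side_swap_cases[of h]) (simp_all add: side_swap_simps)

lemma side_swap_halves: "h \<in> halves LI \<Longrightarrow> sw h \<in> halves LI"
  by (rule side_swap_cases[of h]) (use N in \<open>simp_all add: side_swap_simps insert_pair_def mem_Times_iff\<close>)

lemma beside_simps:
  "bs (half_at (k', s) q) = half_at (k'', s) (other_port q)"
  "bs (half_at (k'', s) q) = half_at (k', s) (other_port q)"
  "fst h \<in> verts L \<Longrightarrow> bs h = mate L h"
  using fresh by (cases h; auto simp: beside_def half_at_def)+

lemma framed_graph_insert_pair: "framed_graph LI"
proof -
  let ?L0 = "fgraph.truncate LI\<lparr>mate := bs\<rparr>"
  have v: "verts ?L0 = verts L \<union> {k', k''}" by (simp add: insert_pair_def)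
  have f0: "framed_graph ?L0"
    unfolding framed_graph_def
  proof (intro conjI ballI)
    show "finite (verts ?L0)" "verts ?L0 \<noteq> {} \<or> 0 < circles ?L0" using finite_verts[OF L] v by auto
    fix h assume "h \<in> halves ?L0"
    then have disj: "fst h \<in> verts L \<or> fst h = k' \<or> fst h = k''" using v by (simp add: mem_Times_iff) blast
    obtain P q where h: "h = half_at P q" by (rule half_at_exhaust)
    have "h = half_at (v, snd P) q" if "fst h = v" for v using that by (simp add: h half_at_def)
    then consider "fst h \<in> verts L" | s where "h = half_at (k', s) q" | s where "h = half_at (k'', s) q"
      using disj by blast
    then have "bs h \<in> halves ?L0 \<and> bs h \<noteq> h \<and> bs (bs h) = h"
    proof cases
      case 1
      then have "h \<in> halves L" by (simp add: mem_Times_iff)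
      note m = framed_graphD[OF L this]
      have "bs h = mate L h" "bs (mate L h) = mate L (mate L h)"
        by (rule beside_simps(3), use 1 m in auto)+
      then show ?thesis using m v by (auto simp: mem_Times_iff)
    qed (use v fresh in \<open>simp_all add: beside_simps mem_Times_iff\<close>)
    then show "mate ?L0 h \<in> halves ?L0" "mate ?L0 h \<noteq> h" "mate ?L0 (mate ?L0 h) = h" by simp_all
  qed
  have "framed_graph (fgraph.truncate LI)"
    by (rule framed_graph_conj[OF f0, of _ sw])
      (use side_swap_side_swap side_swap_halves in \<open>simp_all add: insert_pair_def\<close>)
  then show ?thesis by simp
qed

lemma mate_insert_pair: "mate LI (sw h) = sw (bs h)"
  by (simp add: insert_pair_def side_swap_side_swap)

lemma mate_insert_pair_simps:
  "mate LI (half_at (N s) (p s)) = half_at (k', s) (other_port (p s))"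
  "mate LI (half_at (k', s) (other_port (p s))) = half_at (N s) (p s)"
  "mate LI (half_at (k', s) (p s)) = half_at (k'', s) (other_port (p s))"
  "mate LI (half_at (k'', s) (other_port (p s))) = half_at (k', s) (p s)"
proof -
  have k': "sw (half_at (k', t) q) = half_at (k', t) q" for t q
    by (rule side_swap_simps(3)) (use N_fresh fresh in auto)
  have k'': "sw (half_at (k'', t) (other_port (p t))) = half_at (k'', t) (other_port (p t))" for t
    by (rule side_swap_simps(3)) (use N_fresh in auto)
  show "mate LI (half_at (N s) (p s)) = half_at (k', s) (other_port (p s))"
    using mate_insert_pair[of "half_at (k'', s) (p s)"] by (simp add: side_swap_simps beside_simps k')
  show "mate LI (half_at (k', s) (other_port (p s))) = half_at (N s) (p s)"
    using mate_insert_pair[of "half_at (k', s) (other_port (p s))"] by (simp add: side_swap_simps beside_simps k')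
  show "mate LI (half_at (k', s) (p s)) = half_at (k'', s) (other_port (p s))"
    using mate_insert_pair[of "half_at (k', s) (p s)"] by (simp add: beside_simps k' k'')
  show "mate LI (half_at (k'', s) (other_port (p s))) = half_at (k', s) (p s)"
    using mate_insert_pair[of "half_at (k'', s) (other_port (p s))"] by (simp add: beside_simps k' k'')
qed

text \<open>The creation is undone by deleting both crossings, which identifies it as an inverse
  second move.\<close>

lemma same_graph_insert_pair: "same_graph L (splice {k', k''} opposite LI)"
proof -
  let ?R = "splice_rel {k', k''} opposite LI"
  have v: "verts LI = verts L \<union> {k', k''}" "circles LI = circles L" by (simp_all add: insert_pair_def)
  note fr = framed_graph_insert_pair
  have S: "{k', k''} \<subseteq> verts LI" by (simp add: v)
  have pair: "(h, mate LI h) \<in> ?R" if "h \<in> halves LI" for h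
    using that unfolding splice_rel_def by (intro r_into_rtrancl) blast
  have opp: "(half_at (v, s) q, half_at (v, s) (other_port q)) \<in> ?R" if "v \<in> {k', k''}" for v s q
    unfolding splice_rel_def by (intro r_into_rtrancl) (use that in \<open>auto simp: half_at_def\<close>)
  have tr: "(a, c) \<in> ?R" if "(a, b) \<in> ?R" "(b, c) \<in> ?R" for a b c
    using that unfolding splice_rel_def by (rule rtrancl_trans)
  have sym: "(b, a) \<in> ?R" if "(a, b) \<in> ?R" for a b
    using that sym_splice_rel[OF fr gluing_opposite] by (meson symD)
  have strand: "(half_at (N s) (p s), half_at (k', s) (other_port (p s))) \<in> ?R"
    "(half_at (k', s) (other_port (p s)), half_at (k', s) (p s)) \<in> ?R"
    "(half_at (k', s) (p s), half_at (k'', s) (other_port (p s))) \<in> ?R"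
    "(half_at (k'', s) (other_port (p s)), half_at (k'', s) (p s)) \<in> ?R" for s
    using pair[of "half_at (N s) (p s)"] pair[of "half_at (k', s) (p s)"] N(1)
      opp[of k' s "other_port (p s)"] opp[of k'' s "other_port (p s)"]
    by (simp_all add: mate_insert_pair_simps v mem_Times_iff)
  have N_all: "(half_at (N s) (p s), half_at (v, s) q) \<in> ?R" if "v \<in> {k', k''}" for s v q
  proof -
    have "q = p s \<or> q = other_port (p s)" by (cases q; cases "p s") simp_all
    moreover have "(half_at (N s) (p s), half_at (k', s) (p s)) \<in> ?R" using strand tr by blast
    moreover from this have "(half_at (N s) (p s), half_at (k'', s) (other_port (p s))) \<in> ?R" using strand tr by blast
    moreover from this have "(half_at (N s) (p s), half_at (k'', s) (p s)) \<in> ?R" using strand tr by blast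
    ultimately show ?thesis using that strand by auto
  qed
  have refl: "(h, h) \<in> ?R" for h by (simp add: splice_rel_def)
  \<comment> \<open>Swapped half-edges lie on one path through the new crossings, so the conjugation
    is invisible after their deletion.\<close>
  have sw: "(h, sw h) \<in> ?R" for h
    by (rule side_swap_cases[of h]) (use N_all sym refl in \<open>simp_all add: side_swap_simps\<close>)
  have L_sub: "halves L \<subseteq> halves LI" using v by auto
  have vL: "verts LI - {k', k''} = verts L" using v fresh by auto
  have "mate (splice {k', k''} opposite LI) h = mate L h" if h: "h \<in> halves L" for h
  proof (rule mate_splice_eqI[OF fr gluing_opposite S])
    note m = framed_graphD[OF L h]
    show "h \<in> halves_at (verts LI - {k', k''})" "mate L h \<in> halves_at (verts LI - {k', k''})"
      using h m vL by simp_all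
    show "mate L h \<noteq> h" by (rule m)
    have "(sw h, sw (mate L h)) \<in> ?R"
      using pair[OF side_swap_halves[OF subsetD[OF L_sub h]]] h
      by (simp add: mate_insert_pair beside_simps mem_Times_iff)
    then show "(h, mate L h) \<in> ?R" using sw tr sym by blast
  qed
  \<comment> \<open>Every strand through the new crossings reaches some \<open>N s\<close>, so no
    circle splits off.\<close>
  moreover have "{c \<in> halves LI // ?R. c \<subseteq> halves_at {k', k''}} = {}"
  proof -
    have False if c: "c \<in> halves LI // ?R" "c \<subseteq> halves_at {k', k''}" for c
    proof -
      obtain h where h: "c = ?R `` {h}" using c(1) by (rule quotientE)
      then have "h \<in> halves_at {k', k''}" using c(2) refl by blast
      then obtain w s q where "h = half_at (w, s) q" "w \<in> {k', k''}"
        by (metis fst_half_at half_at_exhaust mem_Times_iff prod.collapse)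
      then have "half_at (N s) (p s) \<in> c" using N_all sym h by blast
      then have "fst (N s) \<in> {k', k''}" using c(2) by (metis fst_half_at mem_Times_iff subsetD)
      then show False using N_fresh by blast
    qed
    then show ?thesis by blast
  qed
  ultimately show ?thesis
    unfolding same_graph_def circles_splice verts_splice vL by (simp add: v)
qed

end

context parity_bracket
begin

text \<open>The second move is available with the positive crossing named first, hence the two
  orders of the new pair according to b.\<close>

lemma bracket_multiset_insert_pair:
  assumes "framed_graph L" "\<And>s. fst (N s) \<in> verts L" "N Over \<noteq> N Under"
    and fresh: "k' \<notin> verts L" "k'' \<notin> verts L" "k' \<noteq> k''"
  shows "\<Phi> (insert_pair N p k' k'' b L) = \<Phi> L"
proof -
  let ?L = "insert_pair N p k' k'' b L"
  note ctx = assms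
  have fr: "framed_graph ?L" by (rule framed_graph_insert_pair[OF ctx])
  have mem: "k' \<in> verts ?L" "k'' \<in> verts ?L" by (simp_all add: insert_pair_def)
  have arcs: "mate ?L (k', s, Out) = (k'', s, In) \<or> mate ?L (k'', s, Out) = (k', s, In)" for s
    using mate_insert_pair_simps(3,4)[OF ctx, where p = p and b = b and s = s] by (cases "p s") (simp_all add: half_at_def)
  have pos: "positive ?L k' = b" "positive ?L k'' = (\<not> b)" using fresh by (simp_all add: insert_pair_def)
  have "\<Phi> ?L = \<Phi> (splice {k', k''} opposite ?L)"
  proof (cases b)
    case True
    then show ?thesis using bracket_multiset_omega2[OF fr mem fresh(3) _ _ arcs] pos by simp
  next
    case False
    have "\<Phi> ?L = \<Phi> (splice {k'', k'} opposite ?L)"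
      using False pos arcs by (intro bracket_multiset_omega2[OF fr mem(2,1) fresh(3)[symmetric]]) auto
    then show ?thesis by (simp add: insert_commute)
  qed
  also have "\<dots> = \<Phi> L"
  proof (rule bracket_multiset_iso)
    note same = same_graph_insert_pair[OF ctx, where p = p and b = b]
    show "framed_graph (splice {k', k''} opposite ?L)"
      by (rule framed_graph_splice[OF fr gluing_opposite]) (use mem in simp)
    have "positive ?L c = positive L c" if "c \<in> verts L" for c
      using that fresh by (auto simp: insert_pair_def)
    then show "diagram_iso (splice {k', k''} opposite ?L) L"
      unfolding diagram_iso_def using same unfolding same_graph_def
      by (intro conjI exI[of _ id]) (simp_all add: map_prod.id)
  qed (rule assms(1))
  finally show ?thesis .
qed

text \<open>Write \<open>k\<close> for a crossing of the triangle and \<open>N s\<close> for the neighbour of \<open>(k, s)\<close>.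
  Creating \<open>k'\<close> and \<open>k''\<close> beyond the triangle, along each strand of \<open>k\<close>
  one passes \<open>k\<close>, \<open>N s\<close>, \<open>k'\<close>, \<open>k''\<close>.  The third move with \<open>k'\<close> in place of \<open>k\<close>, which has the opposite
  sign, leads to \<open>k\<close>, \<open>k'\<close>, \<open>N s\<close>, \<open>k''\<close>.  Up to the names of \<open>k\<close> and \<open>k''\<close> this is the
  result of the third move with \<open>k\<close> followed by the creation of a pair on the other side.\<close>

lemma bracket_multiset_flip:
  assumes L: "framed_graph L" and k: "k \<in> verts L" and N: "\<And>s. fst (N s) \<in> verts L" "\<And>s. fst (N s) \<noteq> k" "N Over \<noteq> N Under"
    and T: "fst T1 \<in> verts L" "fst T2 \<in> verts L" "fst T1 \<noteq> k" "fst T2 \<noteq> k" "T1 \<noteq> T2" "\<And>s. T1 \<noteq> N s" "\<And>s. T2 \<noteq> N s"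
    and fresh: "k' \<notin> verts L" "k'' \<notin> verts L" "k' \<noteq> k''"
    and arc: "\<And>s. mate L (half_at (k, s) (p s)) = half_at (N s) (other_port (p s))"
    and \<pi>: "\<And>s. \<pi> (k, s) = N s" "\<And>s. \<pi> (N s) = (k, s)" "\<pi> T1 = T2" "\<pi> T2 = T1"
      "\<And>P. P \<noteq> T1 \<Longrightarrow> P \<noteq> T2 \<Longrightarrow> fst P \<noteq> k \<Longrightarrow> (\<And>s. P \<noteq> N s) \<Longrightarrow> \<pi> P = P"
    and \<pi>': "\<And>s. \<pi>' (k', s) = N s" "\<And>s. \<pi>' (N s) = (k', s)" "\<pi>' T1 = T2" "\<pi>' T2 = T1"
      "\<And>P. P \<noteq> T1 \<Longrightarrow> P \<noteq> T2 \<Longrightarrow> fst P \<noteq> k' \<Longrightarrow> (\<And>s. P \<noteq> N s) \<Longrightarrow> \<pi>' P = P"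
    and flipped: "\<Phi> (insert_pair N p k' k'' (\<not> positive L k) L) =
      \<Phi> (conj_diagram (lift_point \<pi>') (insert_pair N p k' k'' (\<not> positive L k) L))"
  shows "\<Phi> L = \<Phi> (conj_diagram (lift_point \<pi>) L)"
proof -
  let ?b = "\<not> positive L k" and ?p' = "\<lambda>s. other_port (p s)"
  \<comment> \<open>The final renaming exchanges k and k'', which have the same sign: with the move
    at k done first, the order along a strand is k'', k', \<open>N s\<close>, k.\<close>
  let ?x = "lift_point \<pi>" and ?x' = "lift_point \<pi>'" and ?\<tau> = "transpose k k''"
  let ?t = "map_prod ?\<tau> (id :: strand \<times> port \<Rightarrow> strand \<times> port)"
  define L1 where "L1 = insert_pair N p k' k'' ?b L"
  define L2 where "L2 = conj_diagram ?x' L1"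
  define L' where "L' = conj_diagram ?x L"
  define L3 where "L3 = insert_pair N ?p' k' k'' ?b L'"
  have Nk: "N s \<noteq> (k, t)" "(k, t) \<noteq> N s" "N s \<noteq> (k', t)" "(k', t) \<noteq> N s" "N s \<noteq> (k'', t)" "(k'', t) \<noteq> N s" for s t
    using N(1,2)[of s] fresh by (metis fst_conv)+
  have Tk: "T1 \<noteq> (k, t)" "T2 \<noteq> (k, t)" "T1 \<noteq> (k', t)" "T2 \<noteq> (k', t)" "T1 \<noteq> (k'', t)" "T2 \<noteq> (k'', t)" for t
    using T fresh by (metis fst_conv)+
  have kk: "k \<noteq> k'" "k \<noteq> k''" using k fresh by auto
  have Ninj: "N s = N t \<longleftrightarrow> s = t" for s t using N(3) by (cases s; cases t) auto
  have points: "thesis" if "\<And>s. P = (k, s) \<Longrightarrow> thesis" "\<And>s. P = N s \<Longrightarrow> thesis" "P = T1 \<Longrightarrow> thesis" "P = T2 \<Longrightarrow> thesis"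
    "\<And>s. P = (k', s) \<Longrightarrow> thesis" "\<And>s. P = (k'', s) \<Longrightarrow> thesis"
    "\<lbrakk>P \<noteq> T1; P \<noteq> T2; fst P \<noteq> k; fst P \<noteq> k'; fst P \<noteq> k''; \<And>s. P \<noteq> N s\<rbrakk> \<Longrightarrow> thesis" for P thesis
    using that by (metis prod.collapse)
  have fixed: "\<pi> (k', s) = (k', s)" "\<pi> (k'', s) = (k'', s)" for s
    by (rule \<pi>(5); use kk Nk Tk[THEN not_sym] in simp)+
  have fixed': "\<pi>' (k, s) = (k, s)" "\<pi>' (k'', s) = (k'', s)" for s
    by (rule \<pi>'(5); use kk fresh Nk Tk[THEN not_sym] in simp)+
  have \<pi>\<pi>: "\<pi> (\<pi> P) = P" for P
    by (rule points[of P]) (use \<pi> fixed in \<open>simp_all\<close>)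
  have \<pi>'\<pi>': "\<pi>' (\<pi>' P) = P" for P
    by (rule points[of P]) (use \<pi>' fixed' in \<open>simp_all\<close>)
  have xx: "?x (?x h) = h" "?x' (?x' h) = h" for h
    by (rule half_at_exhaust[of h]; simp add: \<pi>\<pi> \<pi>'\<pi>')+
  have \<pi>_verts: "fst (\<pi> P) \<in> verts L \<longleftrightarrow> fst P \<in> verts L" for P
    by (rule points[of P]) (use \<pi> k N T fixed in \<open>simp_all\<close>)
  have \<pi>'_verts: "fst (\<pi>' P) \<in> verts L \<union> {k', k''} \<longleftrightarrow> fst P \<in> verts L \<union> {k', k''}" for P
    by (rule points[of P]) (use \<pi>' k N T fixed' in \<open>simp_all\<close>)
  have x_halves: "?x h \<in> halves L \<longleftrightarrow> h \<in> halves L" for h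
    by (rule half_at_exhaust[of h]) (simp add: mem_Times_iff \<pi>_verts)
  have L'f: "framed_graph L'"
    unfolding L'_def by (rule framed_graph_conj_diagram[OF L xx(1) x_halves[THEN iffD2]])
  have L'v: "verts L' = verts L" "circles L' = circles L" "positive L' = positive L" by (simp_all add: L'_def)
  have N': "fst (N s) \<in> verts L'" for s using N L'v by simp
  have fresh': "k' \<notin> verts L'" "k'' \<notin> verts L'" using fresh L'v by simp_all
  note ctx = L N(1,3) fresh and ctx' = L'f N' N(3) fresh' fresh(3)
  have L1f: "framed_graph L1" unfolding L1_def by (rule framed_graph_insert_pair[OF ctx])
  have L3f: "framed_graph L3" unfolding L3_def by (rule framed_graph_insert_pair[OF ctx'])
  have L1v: "verts L1 = verts L \<union> {k', k''}" "circles L1 = circles L" by (simp_all add: L1_def insert_pair_def)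
  have x'_halves: "?x' h \<in> halves L1 \<longleftrightarrow> h \<in> halves L1" for h
    by (rule half_at_exhaust[of h]) (simp only: lift_point_half_at mem_Times_iff fst_half_at L1v \<pi>'_verts UNIV_I)
  have L2f: "framed_graph L2"
    unfolding L2_def by (rule framed_graph_conj_diagram[OF L1f xx(2) x'_halves[THEN iffD2]])
  let ?y = "side_swap N p k''" and ?y' = "side_swap N ?p' k''"
  note y = side_swap_simps[OF ctx, where p = p] and y' = side_swap_simps[OF ctx', where p = ?p']
  \<comment> \<open>By \<open>m1\<close> and \<open>m2\<close>, \<open>L2\<close> and the renamed
    \<open>L3\<close> both arise from the diagram with the separate pair by relabelling half-edges,
    through \<psi>1 and \<psi>2. It remains to compare these two maps.\<close>
  define \<psi>1 where "\<psi>1 h = ?x' (?y h)" for h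
  define \<psi>2 where "\<psi>2 h = ?t (?y' (?x h))" for h
  have m1: "mate L2 (\<psi>1 h) = \<psi>1 (beside k' k'' L h)" for h
    using mate_insert_pair[OF ctx, where p = p and b = ?b and h = h] by (simp add: \<psi>1_def L2_def L1_def[symmetric] xx)
  have bx: "beside k' k'' L' (?x h) = ?x (beside k' k'' L h)" for h
  proof (rule half_at_exhaust[of h])
    fix P q assume h: "h = half_at P q"
    consider s where "P = (k', s)" | s where "P = (k'', s)" | "fst P \<noteq> k'" "fst P \<noteq> k''"
      by (metis prod.collapse)
    then show ?thesis
    proof cases
      case 3
      then have "fst (\<pi> P) \<noteq> k'" "fst (\<pi> P) \<noteq> k''"
        using fixed \<pi>\<pi> by (metis fst_conv prod.collapse)+
      then show ?thesis using 3 unfolding h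
        by (simp add: beside_other L'_def \<pi>\<pi>)
    qed (simp_all add: h fixed beside_simps[OF ctx] beside_simps[OF ctx'])
  qed
  have tt: "?t (?t h) = h" for h by (cases h) simp
  have m2: "?t (mate L3 (?t (\<psi>2 h))) = \<psi>2 (beside k' k'' L h)" for h
    using mate_insert_pair[OF ctx', where p = ?p' and b = ?b and h = "?x h"] by (simp add: \<psi>2_def L3_def[symmetric] bx tt)
  have t_at: "?t (half_at P q) = half_at (?\<tau> (fst P), snd P) q" for P q by (simp add: half_at_def)
  have \<tau>N: "(?\<tau> (fst (N s)), snd (N s)) = N s" for s
    using N(2)[of s] Nk[of s] by (metis prod.collapse transpose_apply_other)
  have \<tau>T: "(?\<tau> (fst T1), snd T1) = T1" "(?\<tau> (fst T2), snd T2) = T2"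
    using T(3,4) Tk by (metis prod.collapse transpose_apply_other)+
  have port: "q = p s \<or> q = other_port (p s)" for q s by (cases q; cases "p s") simp_all
  have \<psi>1_vals: "\<psi>1 (half_at (k, s) q) = half_at (k, s) q" "\<psi>1 (half_at (N s) (?p' s)) = half_at (k', s) (?p' s)"
    "\<psi>1 (half_at (N s) (p s)) = half_at (k'', s) (p s)"
    "\<psi>1 (half_at (k'', s) (p s)) = half_at (k', s) (p s)" "\<psi>1 (half_at (k'', s) (?p' s)) = half_at (k'', s) (?p' s)"
    "\<psi>1 (half_at (k', s) q) = half_at (N s) q" "\<psi>1 (half_at T1 q) = half_at T2 q" "\<psi>1 (half_at T2 q) = half_at T1 q" for s q
  proof -
    have y0: "?y (half_at (k, s) q) = half_at (k, s) q" "?y (half_at (N s) (?p' s)) = half_at (N s) (?p' s)"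
      "?y (half_at (k'', s) (?p' s)) = half_at (k'', s) (?p' s)" "?y (half_at (k', s) q) = half_at (k', s) q"
      "?y (half_at T1 q) = half_at T1 q" "?y (half_at T2 q) = half_at T2 q" for s q
      by (rule y(3); use Nk Tk T kk fresh Ninj in auto)+
    show "\<psi>1 (half_at (k, s) q) = half_at (k, s) q" "\<psi>1 (half_at (N s) (?p' s)) = half_at (k', s) (?p' s)"
      "\<psi>1 (half_at (N s) (p s)) = half_at (k'', s) (p s)"
      "\<psi>1 (half_at (k'', s) (p s)) = half_at (k', s) (p s)" "\<psi>1 (half_at (k'', s) (?p' s)) = half_at (k'', s) (?p' s)"
      "\<psi>1 (half_at (k', s) q) = half_at (N s) q" "\<psi>1 (half_at T1 q) = half_at T2 q" "\<psi>1 (half_at T2 q) = half_at T1 q"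
      by (simp_all add: \<psi>1_def y0 y(1,2) \<pi>'(1-4) fixed')
  qed
  have \<psi>2_vals: "\<psi>2 (half_at (k, s) (p s)) = half_at (N s) (p s)" "\<psi>2 (half_at (k, s) (?p' s)) = half_at (k, s) (?p' s)"
    "\<psi>2 (half_at (N s) (p s)) = half_at (k'', s) (p s)" "\<psi>2 (half_at (N s) (?p' s)) = half_at (k'', s) (?p' s)"
    "\<psi>2 (half_at (k'', s) (?p' s)) = half_at (N s) (?p' s)" "\<psi>2 (half_at (k'', s) (p s)) = half_at (k, s) (p s)"
    "\<psi>2 (half_at (k', s) q) = half_at (k', s) q" "\<psi>2 (half_at T1 q) = half_at T2 q" "\<psi>2 (half_at T2 q) = half_at T1 q" for s q
  proof -
    have y0: "?y' (half_at (k, s) q) = half_at (k, s) q" "?y' (half_at (N s) (p s)) = half_at (N s) (p s)"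
      "?y' (half_at (k'', s) (p s)) = half_at (k'', s) (p s)" "?y' (half_at (k', s) q) = half_at (k', s) q"
      "?y' (half_at T1 q) = half_at T1 q" "?y' (half_at T2 q) = half_at T2 q" for s q
      by (rule y'(3); use Nk Tk T kk fresh Ninj in auto)+
    show "\<psi>2 (half_at (k, s) (p s)) = half_at (N s) (p s)" "\<psi>2 (half_at (k, s) (?p' s)) = half_at (k, s) (?p' s)"
      "\<psi>2 (half_at (N s) (p s)) = half_at (k'', s) (p s)" "\<psi>2 (half_at (N s) (?p' s)) = half_at (k'', s) (?p' s)"
      "\<psi>2 (half_at (k'', s) (?p' s)) = half_at (N s) (?p' s)" "\<psi>2 (half_at (k'', s) (p s)) = half_at (k, s) (p s)"
      "\<psi>2 (half_at (k', s) q) = half_at (k', s) q" "\<psi>2 (half_at T1 q) = half_at T2 q" "\<psi>2 (half_at T2 q) = half_at T1 q"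
      using kk fresh
      by (simp_all only: \<psi>2_def lift_point_half_at \<pi>(1-4) fixed y0 y'(1,2) t_at \<tau>N \<tau>T)
        (simp_all add: transpose_def)
  qed
  \<comment> \<open>The two maps can differ only on the edges between k and its neighbours and at
    the new pair, a set closed under the mates of \<open>beside\<close>.\<close>
  have other: "\<psi>1 h = \<psi>2 h" if "\<And>s. h \<noteq> half_at (k, s) (p s)" "\<And>s. h \<noteq> half_at (N s) (?p' s)"
    "\<And>s q. h \<noteq> half_at (k', s) q" "\<And>s q. h \<noteq> half_at (k'', s) q" for h
  proof (rule half_at_exhaust[of h])
    fix P q assume h: "h = half_at P q"
    show ?thesis
    proof (rule points[of P])
      assume P: "P \<noteq> T1" "P \<noteq> T2" "fst P \<noteq> k" "fst P \<noteq> k'" "fst P \<noteq> k''" "\<And>s. P \<noteq> N s"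
      then have "\<pi> P = P" "\<pi>' P = P" using \<pi>(5) \<pi>'(5) by blast+
      moreover have "?y (half_at P q) = half_at P q" "?y' (half_at P q) = half_at P q"
        by (rule y(3), use P in auto) (rule y'(3), use P in auto)
      moreover have "(?\<tau> (fst P), snd P) = P" using P by (metis prod.collapse transpose_apply_other)
      ultimately show ?thesis by (simp add: h \<psi>1_def \<psi>2_def t_at del: map_prod_simp)
    next
      fix s assume P: "P = (k, s)"
      then have "q = ?p' s" using that(1)[of s] port[of q s] h by auto
      then show ?thesis by (simp only: h P \<psi>1_vals \<psi>2_vals)
    next
      fix s assume P: "P = N s"
      then have "q = p s" using that(2)[of s] port[of q s] h by auto
      then show ?thesis by (simp only: h P \<psi>1_vals \<psi>2_vals)
    qed (use that h in \<open>auto simp: \<psi>1_vals \<psi>2_vals\<close>)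
  qed
  have arc': "mate L (half_at (N s) (?p' s)) = half_at (k, s) (p s)" for s
  proof -
    have "half_at (k, s) (p s) \<in> halves L" using k by (simp add: mem_Times_iff)
    from framed_graphD(3)[OF L this] show ?thesis by (simp add: arc)
  qed
  have b: "beside k' k'' L (half_at (k, s) (p s)) = half_at (N s) (?p' s)"
    "beside k' k'' L (half_at (N s) (?p' s)) = half_at (k, s) (p s)"
    "beside k' k'' L (half_at (k', s) q) = half_at (k'', s) (other_port q)"
    "beside k' k'' L (half_at (k'', s) q) = half_at (k', s) (other_port q)" for s q
    using k N by (simp_all add: beside_simps[OF ctx] arc arc')
  have outer: "\<psi>1 (beside k' k'' L h) = \<psi>2 (beside k' k'' L h)"
    if h: "h \<in> halves L" "\<And>s. h \<noteq> half_at (k, s) (p s)" "\<And>s. h \<noteq> half_at (N s) (?p' s)" for h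
  proof (rule other)
    note m = framed_graphD[OF L h(1)]
    have bh: "beside k' k'' L h = mate L h" using h(1) by (intro beside_simps(3)[OF ctx]) auto
    show "beside k' k'' L h \<noteq> half_at (k, s) (p s)" "beside k' k'' L h \<noteq> half_at (N s) (?p' s)" for s
      using m(3) h(2,3) arc[of s] arc'[of s] unfolding bh by metis+
    show "beside k' k'' L h \<noteq> half_at (k', s) q" "beside k' k'' L h \<noteq> half_at (k'', s) q" for s q
      using m(1) fresh unfolding bh by (metis fst_conv fst_half_at mem_Times_iff)+
  qed
  have mates: "mate L3 (?t h) = ?t (mate L2 h)" if hL: "h \<in> halves L2" for h
  proof -
    have "?t (mate L3 (?t h)) = mate L2 h"
    proof -
      have yy: "?y (?y h) = h" "?x' (?x' h) = h" for h
        by (rule side_swap_side_swap[OF ctx]) (rule xx)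
      define g where "g = ?y (?x' h)"
      have g: "h = \<psi>1 g" by (simp add: g_def \<psi>1_def yy)
      have "h \<in> halves L1" using hL by (simp add: L2_def)
      then have "g \<in> halves L1"
        unfolding g_def L1_def
        by (intro side_swap_halves[OF ctx]) (use x'_halves in \<open>simp add: L1_def\<close>)
      then have gv: "fst g \<in> verts L \<or> fst g = k' \<or> fst g = k''" by (auto simp: L1v)
      \<comment> \<open>In the first four cases a half-edge of \<open>L2\<close> comes from
        different half-edges under the two maps; the argument given to \<open>m2\<close> names the
        second one.\<close>
      consider s where "g = half_at (k, s) (p s)" | s where "g = half_at (N s) (?p' s)"
        | s q where "g = half_at (k', s) q" | s q where "g = half_at (k'', s) q"
        | "g \<in> halves L" "\<And>s. g \<noteq> half_at (k, s) (p s)" "\<And>s. g \<noteq> half_at (N s) (?p' s)"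
          "\<And>s q. g \<noteq> half_at (k', s) q" "\<And>s q. g \<noteq> half_at (k'', s) q"
      proof -
        obtain P q where "g = half_at P q" by (rule half_at_exhaust)
        then show ?thesis using that gv by (metis UNIV_I fst_half_at mem_Times_iff prod.collapse)
      qed
      then show ?thesis
      proof cases
        case 1
        show ?thesis
          using m1[of g] m2[of "half_at (k'', s) (p s)"] unfolding g 1 by (simp add: b \<psi>1_vals \<psi>2_vals del: map_prod_simp)
      next
        case 2
        show ?thesis
          using m1[of g] m2[of "half_at (k', s) (?p' s)"] unfolding g 2 by (simp add: b \<psi>1_vals \<psi>2_vals del: map_prod_simp)
      next
        case 3
        from port[of q s] show ?thesis
        proof
          assume q: "q = p s"
          show ?thesis
            using m1[of g] m2[of "half_at (k, s) (p s)"] unfolding g 3 q by (simp add: b \<psi>1_vals \<psi>2_vals del: map_prod_simp)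
        next
          assume q: "q = ?p' s"
          show ?thesis
            using m1[of g] m2[of "half_at (k'', s) (?p' s)"] unfolding g 3 q by (simp add: b \<psi>1_vals \<psi>2_vals del: map_prod_simp)
        qed
      next
        case 4
        from port[of q s] show ?thesis
        proof
          assume q: "q = p s"
          show ?thesis
            using m1[of g] m2[of "half_at (k', s) (p s)"] unfolding g 4 q by (simp add: b \<psi>1_vals \<psi>2_vals del: map_prod_simp)
        next
          assume q: "q = ?p' s"
          show ?thesis
            using m1[of g] m2[of "half_at (N s) (?p' s)"] unfolding g 4 q by (simp add: b \<psi>1_vals \<psi>2_vals del: map_prod_simp)
        qed
      next
        case 5
        then show ?thesis
          using m1[of g] m2[of g] other[OF 5(2-5)] outer[OF 5(1-3)] unfolding g by simp
      qed
    qed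
    then show ?thesis using tt by metis
  qed
  have "diagram_iso L2 L3"
    unfolding diagram_iso_def
  proof (intro conjI exI[of _ ?\<tau>] ballI)
    show "circles L2 = circles L3" by (simp add: L2_def L1_def L3_def insert_pair_def L'v)
    show "bij_betw ?\<tau> (verts L2) (verts L3)"
    proof (rule bij_betwI[of _ _ _ ?\<tau>])
      have "verts L2 = verts L \<union> {k', k''}" "verts L3 = verts L \<union> {k', k''}"
        by (simp_all add: L2_def L1_def L3_def insert_pair_def L'v)
      then show "?\<tau> \<in> verts L2 \<rightarrow> verts L3" "?\<tau> \<in> verts L3 \<rightarrow> verts L2"
        using k by (auto simp: transpose_def)
    qed simp_all
    show "positive L3 (?\<tau> c) = positive L2 c" if "c \<in> verts L2" for c
      using kk fresh by (simp add: L2_def L1_def L3_def insert_pair_def L'v transpose_def)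
    show "mate L3 (?t h) = ?t (mate L2 h)" if "h \<in> halves L2" for h by (rule mates[OF that])
  qed
  then have "\<Phi> L2 = \<Phi> L3"
    by (rule bracket_multiset_iso[OF L2f L3f])
  moreover have "\<Phi> L3 = \<Phi> L'"
    unfolding L3_def by (rule bracket_multiset_insert_pair[OF ctx'])
  moreover have "\<Phi> L1 = \<Phi> L"
    unfolding L1_def by (rule bracket_multiset_insert_pair[OF ctx])
  moreover have "\<Phi> L1 = \<Phi> L2"
    unfolding L2_def L1_def by (rule flipped)
  ultimately show ?thesis unfolding L'_def by simp
qed

end

text \<open>The triangle edge opposite to the flipped crossing is not touched by the creation of the
  pair.\<close>

lemma mate_insert_pair_other:
  assumes L: "framed_graph L" and N: "\<And>s. fst (N s) \<in> verts L" "N Over \<noteq> N Under"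
    and fresh: "k' \<notin> verts L" "k'' \<notin> verts L" "k' \<noteq> k''"
    and P: "fst P \<in> verts L" "\<And>s. P \<noteq> N s" and Q: "fst Q \<in> verts L" "\<And>s. Q \<noteq> N s"
    and m: "mate L (half_at P q) = half_at Q q'"
  shows "mate (insert_pair N p k' k'' b L) (half_at P q) = half_at Q q'"
proof -
  note ctx = L N fresh
  have "side_swap N p k'' (half_at R r) = half_at R r" if "fst R \<in> verts L" "\<And>s. R \<noteq> N s" for R r
    by (rule side_swap_simps(3)[OF ctx]) (use that fresh in auto)
  then show ?thesis
    using mate_insert_pair[OF ctx, where h = "half_at P q" and p = p and b = b] P Q m
    by (simp add: beside_simps(3)[OF ctx])
qed

text \<open>Multiplication by a sign, with \<open>Out\<close> and \<open>In\<close> in the roles of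
  1 and -1.\<close>

definition along :: "bool \<Rightarrow> port \<Rightarrow> port" where
  "along b q = (if b then q else other_port q)"

lemma along_simps [simp]: "along True q = q" "along False q = other_port q"
    "along b (other_port q) = other_port (along b q)"
  by (simp_all add: along_def)

text \<open>With \<open>e = Out\<close> for \<open>\<eta> = 1\<close> and \<open>e = In\<close> for \<open>\<eta> = -1\<close> these are the conditions on the
  triangle in a third move.\<close>

definition movable_triangle :: "diagram \<Rightarrow> nat \<Rightarrow> nat \<Rightarrow> nat \<Rightarrow> port \<Rightarrow> bool" where
  "movable_triangle L a b c e \<longleftrightarrow> a \<in> verts L \<and> b \<in> verts L \<and> c \<in> verts L \<and> a \<noteq> b \<and> a \<noteq> c \<and> b \<noteq> c \<and>
    (let q = along (positive L a) (along (positive L b) (along (positive L c) e)) in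
      mate L (half_at (a, Over) q) = half_at (b, Over) (other_port q)) \<and>
    (let q = along (positive L a) e in mate L (half_at (a, Under) q) = half_at (c, Over) (other_port q)) \<and>
    (let q = along (positive L b) e in mate L (half_at (b, Under) q) = half_at (c, Under) (other_port q))"

lemma along_commute: "along b (along b' q) = along b' (along b q)"
  by (simp add: along_def)

lemma mate_half_at_sym:
  assumes "framed_graph L" "fst P \<in> verts L" "mate L (half_at P q) = half_at Q q'"
  shows "mate L (half_at Q q') = half_at P q"
  using framed_graphD(3)[OF assms(1), of "half_at P q"] assms(2,3) by (simp add: mem_Times_iff)

lemma ordered_arc_iff_mate:
  assumes L: "framed_graph L" and P: "fst P \<in> verts L" and Q: "fst Q \<in> verts L"
  shows "ordered_arc L n P Q \<longleftrightarrow>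
    mate L (half_at P (along (n = 1) Out)) = half_at Q (other_port (along (n = 1) Out))"
  using mate_half_at_sym[OF L P, of In Q Out] mate_half_at_sym[OF L Q, of Out P In]
  by (auto simp: ordered_arc_def arc_def along_def half_at_def)

lemma exchange_simps:
  assumes "a \<noteq> b" "a \<noteq> c" "b \<noteq> c"
  shows "exchange a b c (a, Over) = (b, Over)" "exchange a b c (b, Over) = (a, Over)"
    "exchange a b c (a, Under) = (c, Over)" "exchange a b c (c, Over) = (a, Under)"
    "exchange a b c (b, Under) = (c, Under)" "exchange a b c (c, Under) = (b, Under)"
    "\<lbrakk>P \<noteq> (a, Over); P \<noteq> (b, Over); P \<noteq> (a, Under); P \<noteq> (c, Over); P \<noteq> (b, Under); P \<noteq> (c, Under)\<rbrakk>
      \<Longrightarrow> exchange a b c P = P"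
  using assms by (simp_all add: exchange_def transpose_def)

context parity_bracket
begin

text \<open>For \<eta> = -1 this is the case computed above. For \<eta> = 1 the exchanged diagram
  has the computed form, and since the exchange is an involution the move is read backwards.\<close>

lemma bracket_multiset_triangle_positive:
  assumes L: "framed_graph L" and tri: "movable_triangle L a b c e"
    and pos: "positive L a" "positive L b" "positive L c"
  shows "\<Phi> L =
    \<Phi> (conj_diagram (exchange_half a b c) L)"
proof -
  let ?x = "exchange_half a b c"
  have abc: "a \<in> verts L" "b \<in> verts L" "c \<in> verts L" "a \<noteq> b" "a \<noteq> c" "b \<noteq> c"
    using tri by (simp_all add: movable_triangle_def)
  note xx = exchange_half_exchange_half[OF abc(4-6)] and fx = fst_exchange_half[OF abc(4-6)]
  have m: "mate L (half_at (a, Over) e) = half_at (b, Over) (other_port e)"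
    "mate L (half_at (a, Under) e) = half_at (c, Over) (other_port e)"
    "mate L (half_at (b, Under) e) = half_at (c, Under) (other_port e)"
    using tri pos by (simp_all add: movable_triangle_def along_def)
  have m': "mate L (half_at (b, Over) (other_port e)) = half_at (a, Over) e"
    "mate L (half_at (c, Over) (other_port e)) = half_at (a, Under) e"
    "mate L (half_at (c, Under) (other_port e)) = half_at (b, Under) e"
    by (rule mate_half_at_sym[OF L _ m(1)] mate_half_at_sym[OF L _ m(2)] mate_half_at_sym[OF L _ m(3)], simp add: abc)+
  show ?thesis
  proof (cases e)
    case In
    show ?thesis
      by (rule bracket_multiset_positive_omega3[OF L abc pos]) (use m' In in \<open>simp_all add: half_at_def\<close>)
  next
    case Out
    let ?L' = "conj_diagram ?x L"
    have x_halves: "?x h \<in> halves L" if "h \<in> halves L" for h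
      using fx(1,2)[of h] abc that by (cases "fst h \<in> {a, b, c}") (auto simp: mem_Times_iff)
    have L': "framed_graph ?L'" by (rule framed_graph_conj_diagram[OF L xx x_halves])
    have "\<Phi> ?L' = \<Phi> L"
    proof (rule bracket_multiset_positive_omega3[OF L'])
      show "mate ?L' (b, Over, Out) = (a, Over, In)" "mate ?L' (c, Over, Out) = (a, Under, In)"
        "mate ?L' (c, Under, Out) = (b, Under, In)"
        using m Out by (simp_all add: exchange_half_simps[OF abc(4-6)] half_at_def)
      show "L = ?L'\<lparr>mate := ?x \<circ> mate ?L' \<circ> ?x\<rparr>"
        using xx by (simp add: comp_def)
    qed (use abc pos in simp_all)
    then show ?thesis by simp
  qed
qed

text \<open>Induction on the number of negative crossings. A negative crossing of the triangle is
  replaced by the new positive k' beyond its neighbours. The two edges at it are then met from the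
  other side, which fits the flipped sign, so the induction hypothesis applies to the new
  triangle.\<close>

lemma bracket_multiset_triangle:
  assumes "framed_graph L" "movable_triangle L a b c e"
  shows "\<Phi> L =
    \<Phi> (conj_diagram (lift_point (exchange a b c)) L)"
  using assms
proof (induction "of_bool (\<not> positive L a) + of_bool (\<not> positive L b) + of_bool (\<not> positive L c) :: nat"
    arbitrary: L a b c e rule: less_induct)
  case less
  note L = less.prems(1) and IH = less.hyps
  have abc: "a \<in> verts L" "b \<in> verts L" "c \<in> verts L" "a \<noteq> b" "a \<noteq> c" "b \<noteq> c"
    using less.prems(2) by (simp_all add: movable_triangle_def)
  define q1 q2 q3 where q: "q1 = along (positive L a) (along (positive L b) (along (positive L c) e))"
    "q2 = along (positive L a) e" "q3 = along (positive L b) e"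
  have m: "mate L (half_at (a, Over) q1) = half_at (b, Over) (other_port q1)"
    "mate L (half_at (a, Under) q2) = half_at (c, Over) (other_port q2)"
    "mate L (half_at (b, Under) q3) = half_at (c, Under) (other_port q3)"
    using less.prems(2) by (simp_all add: movable_triangle_def Let_def q)
  have m': "mate L (half_at (b, Over) (other_port q1)) = half_at (a, Over) q1"
    "mate L (half_at (c, Over) (other_port q2)) = half_at (a, Under) q2"
    "mate L (half_at (c, Under) (other_port q3)) = half_at (b, Under) q3"
    by (rule mate_half_at_sym[OF L _ m(1)] mate_half_at_sym[OF L _ m(2)] mate_half_at_sym[OF L _ m(3)], simp add: abc)+
  obtain k' where k': "k' \<notin> verts L" using ex_new_if_finite[OF infinite_UNIV_nat finite_verts[OF L]] by blast
  obtain k'' where k'': "k'' \<notin> insert k' (verts L)"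
    using ex_new_if_finite[OF infinite_UNIV_nat] finite_verts[OF L] by (metis finite_insert)
  have fresh: "k' \<notin> verts L" "k'' \<notin> verts L" "k' \<noteq> k''" using k' k'' by auto
  have ne: "a \<noteq> k'" "b \<noteq> k'" "c \<noteq> k'" "a \<noteq> k''" "b \<noteq> k''" "c \<noteq> k''" using abc fresh by auto
  consider "positive L a" "positive L b" "positive L c" | (a) "\<not> positive L a" | (b) "\<not> positive L b" | (c) "\<not> positive L c"
    by blast
  then show ?case
  proof cases
    case 1
    then show ?thesis using bracket_multiset_triangle_positive[OF L less.prems(2)] by (simp add: exchange_half_lift)
  next
    case a
    \<comment> \<open>\<open>N\<close> gives the neighbours of the flipped crossing on its two
      strands. The port \<open>p s\<close> points from that crossing to the neighbour and, at the
      neighbour, away from the triangle.\<close>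
    define N where "N = case_strand (b, Over) (c, Over)"
    define p where "p = case_strand q1 q2"
    define L1 where "L1 = insert_pair N p k' k'' (\<not> positive L a) L"
    have Ns: "N Over = (b, Over)" "N Under = (c, Over)" "p Over = q1" "p Under = q2"
      by (simp_all add: N_def p_def)
    have N: "\<And>s. fst (N s) \<in> verts L" "N Over \<noteq> N Under" using abc by (simp_all add: N_def split: strand.split)
    note ctx = L N fresh
    have L1: "verts L1 = insert k' (insert k'' (verts L))" "positive L1 = (positive L)(k' := True, k'' := False)"
      using a by (auto simp: L1_def insert_pair_def)
    have L1f: "framed_graph L1" unfolding L1_def by (rule framed_graph_insert_pair[OF ctx])
    have T: "mate L1 (half_at (b, Under) q3) = half_at (c, Under) (other_port q3)"
      unfolding L1_def
      by (rule mate_insert_pair_other[OF ctx _ _ _ _ m(3)]) (use abc in \<open>simp_all add: N_def split: strand.split\<close>)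
    note at_N = mate_insert_pair_simps(1,2)[OF ctx, where p = p and b = "\<not> positive L a", folded L1_def]
    have "movable_triangle L1 k' b c e"
      using T at_N[of Over] at_N[of Under] abc ne fresh(3) a by (simp add: movable_triangle_def Let_def L1 Ns q)
    then have IH': "\<Phi> L1 =
      \<Phi> (conj_diagram (lift_point (exchange k' b c)) L1)"
      by (intro IH) (use a ne fresh(3) L1f in \<open>simp_all add: L1\<close>)
    show ?thesis
    proof (rule bracket_multiset_flip[of L a N "(b, Under)" "(c, Under)" k' k'' p])
      show "mate L (half_at (a, s) (p s)) = half_at (N s) (other_port (p s))" for s
        using m m' by (cases s) (simp_all add: Ns)
      show "exchange a b c P = P" if "P \<noteq> (b, Under)" "P \<noteq> (c, Under)" "fst P \<noteq> a" "\<And>s. P \<noteq> N s" for P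
        by (rule exchange_simps(7)) (use abc that(1-3) that(4)[of Over] that(4)[of Under] Ns in auto)
      show "exchange k' b c P = P" if "P \<noteq> (b, Under)" "P \<noteq> (c, Under)" "fst P \<noteq> k'" "\<And>s. P \<noteq> N s" for P
        by (rule exchange_simps(7)) (use abc ne that(1-3) that(4)[of Over] that(4)[of Under] Ns in auto)
    qed (use L N fresh abc ne IH' in \<open>auto simp: exchange_simps N_def L1_def split: strand.split\<close>)
  next
    case b
    define N where "N = case_strand (a, Over) (c, Under)"
    define p where "p = case_strand (other_port q1) q3"
    define L1 where "L1 = insert_pair N p k' k'' (\<not> positive L b) L"
    have Ns: "N Over = (a, Over)" "N Under = (c, Under)" "p Over = (other_port q1)" "p Under = q3"
      by (simp_all add: N_def p_def)
    have N: "\<And>s. fst (N s) \<in> verts L" "N Over \<noteq> N Under" using abc by (simp_all add: N_def split: strand.split)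
    note ctx = L N fresh
    have L1: "verts L1 = insert k' (insert k'' (verts L))" "positive L1 = (positive L)(k' := True, k'' := False)"
      using b by (auto simp: L1_def insert_pair_def)
    have L1f: "framed_graph L1" unfolding L1_def by (rule framed_graph_insert_pair[OF ctx])
    have T: "mate L1 (half_at (a, Under) q2) = half_at (c, Over) (other_port q2)"
      unfolding L1_def
      by (rule mate_insert_pair_other[OF ctx _ _ _ _ m(2)]) (use abc in \<open>simp_all add: N_def split: strand.split\<close>)
    note at_N = mate_insert_pair_simps(1,2)[OF ctx, where p = p and b = "\<not> positive L b", folded L1_def]
    have "movable_triangle L1 a k' c e"
      using T at_N[of Over] at_N[of Under] abc ne fresh(3) b by (simp add: movable_triangle_def Let_def L1 Ns q)
    then have IH': "\<Phi> L1 =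
      \<Phi> (conj_diagram (lift_point (exchange a k' c)) L1)"
      by (intro IH) (use b ne fresh(3) L1f in \<open>simp_all add: L1\<close>)
    show ?thesis
    proof (rule bracket_multiset_flip[of L b N "(a, Under)" "(c, Over)" k' k'' p])
      show "mate L (half_at (b, s) (p s)) = half_at (N s) (other_port (p s))" for s
        using m m' by (cases s) (simp_all add: Ns)
      show "exchange a b c P = P" if "P \<noteq> (a, Under)" "P \<noteq> (c, Over)" "fst P \<noteq> b" "\<And>s. P \<noteq> N s" for P
        by (rule exchange_simps(7)) (use abc that(1-3) that(4)[of Over] that(4)[of Under] Ns in auto)
      show "exchange a k' c P = P" if "P \<noteq> (a, Under)" "P \<noteq> (c, Over)" "fst P \<noteq> k'" "\<And>s. P \<noteq> N s" for P
        by (rule exchange_simps(7)) (use abc ne that(1-3) that(4)[of Over] that(4)[of Under] Ns in auto)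
    qed (use L N fresh abc ne IH' in \<open>auto simp: exchange_simps N_def L1_def split: strand.split\<close>)
  next
    case c
    define N where "N = case_strand (a, Under) (b, Under)"
    define p where "p = case_strand (other_port q2) (other_port q3)"
    define L1 where "L1 = insert_pair N p k' k'' (\<not> positive L c) L"
    have Ns: "N Over = (a, Under)" "N Under = (b, Under)" "p Over = (other_port q2)" "p Under = (other_port q3)"
      by (simp_all add: N_def p_def)
    have N: "\<And>s. fst (N s) \<in> verts L" "N Over \<noteq> N Under" using abc by (simp_all add: N_def split: strand.split)
    note ctx = L N fresh
    have L1: "verts L1 = insert k' (insert k'' (verts L))" "positive L1 = (positive L)(k' := True, k'' := False)"
      using c by (auto simp: L1_def insert_pair_def)
    have L1f: "framed_graph L1" unfolding L1_def by (rule framed_graph_insert_pair[OF ctx])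
    have T: "mate L1 (half_at (a, Over) q1) = half_at (b, Over) (other_port q1)"
      unfolding L1_def
      by (rule mate_insert_pair_other[OF ctx _ _ _ _ m(1)]) (use abc in \<open>simp_all add: N_def split: strand.split\<close>)
    note at_N = mate_insert_pair_simps(1,2)[OF ctx, where p = p and b = "\<not> positive L c", folded L1_def]
    \<comment> \<open>The sign of c does not occur in the conditions on the two edges at c, so their
      reversal is expressed by reversing \<eta>; on the top strand this cancels the change of
      sign.\<close>
    have "movable_triangle L1 a b k' (other_port e)"
      using T at_N[of Over] at_N[of Under] abc ne fresh(3) c by (simp add: movable_triangle_def Let_def L1 Ns q)
    then have IH': "\<Phi> L1 =
      \<Phi> (conj_diagram (lift_point (exchange a b k')) L1)"
      by (intro IH) (use c ne fresh(3) L1f in \<open>simp_all add: L1\<close>)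
    show ?thesis
    proof (rule bracket_multiset_flip[of L c N "(a, Over)" "(b, Over)" k' k'' p])
      show "mate L (half_at (c, s) (p s)) = half_at (N s) (other_port (p s))" for s
        using m m' by (cases s) (simp_all add: Ns)
      show "exchange a b c P = P" if "P \<noteq> (a, Over)" "P \<noteq> (b, Over)" "fst P \<noteq> c" "\<And>s. P \<noteq> N s" for P
        by (rule exchange_simps(7)) (use abc that(1-3) that(4)[of Over] that(4)[of Under] Ns in auto)
      show "exchange a b k' P = P" if "P \<noteq> (a, Over)" "P \<noteq> (b, Over)" "fst P \<noteq> k'" "\<And>s. P \<noteq> N s" for P
        by (rule exchange_simps(7)) (use abc ne that(1-3) that(4)[of Over] that(4)[of Under] Ns in auto)
    qed (use L N fresh abc ne IH' in \<open>auto simp: exchange_simps N_def L1_def split: strand.split\<close>)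
  qed
qed

lemma bracket_multiset_omega3:
  assumes L: "framed_graph L" and move: "omega3 L L'"
  shows "\<Phi> L = \<Phi> L'"
proof -
  obtain a b c \<eta> where abc: "a \<in> verts L" "b \<in> verts L" "c \<in> verts L" "a \<noteq> b" "a \<noteq> c" "b \<noteq> c"
    and \<eta>: "\<eta> \<in> {1, -1}"
    and arcs: "ordered_arc L (\<eta> * crossing_sign L a * crossing_sign L b * crossing_sign L c) (a, Over) (b, Over)"
      "ordered_arc L (\<eta> * crossing_sign L a) (a, Under) (c, Over)"
      "ordered_arc L (\<eta> * crossing_sign L b) (b, Under) (c, Under)"
    and L': "L' = L\<lparr>mate := exchange_half a b c \<circ> mate L \<circ> exchange_half a b c\<rparr>"
    using move unfolding omega3_def by blast
  \<comment> \<open>Multiplying by a sign corresponds to applying \<open>along\<close>, which turns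
    the three products of the move into the nested ports of \<open>movable_triangle\<close>.\<close>
  have sign: "along (n * crossing_sign L v = 1) Out = along (positive L v) (along (n = 1) Out)"
    "n * crossing_sign L v \<in> {1, -1}" if "n \<in> {1, -1}" for n v
    using that by (auto simp: crossing_sign_def along_def)
  have "movable_triangle L a b c (along (\<eta> = 1) Out)"
    unfolding movable_triangle_def Let_def
    using arcs abc sign(1)[OF \<eta>, of a] sign(1)[OF \<eta>, of b] sign(1)[OF sign(2)[OF \<eta>, of a], of b]
      sign(1)[OF sign(2)[OF sign(2)[OF \<eta>, of a], of b], of c]
      along_commute
    by (simp add: ordered_arc_iff_mate[OF L])
  from bracket_multiset_triangle[OF L this] show ?thesis by (simp add: L' exchange_half_lift)
qed

lemma bracket_multiset_step:
  assumes "diagram_step L L'"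
  shows "\<Phi> L = \<Phi> L'"
proof -
  have L: "framed_graph L" and L': "framed_graph L'"
    using assms by (simp_all add: diagram_step_def link_diagram_def)
  consider "diagram_iso L L'" | "omega1 L L'" | "omega2 L L'" | "omega3 L L'"
    using assms unfolding diagram_step_def by blast
  then show ?thesis
  proof cases
    case 1
    then show ?thesis by (rule bracket_multiset_iso[OF L L'])
  next
    case 2
    then show ?thesis unfolding omega1_def arc_def using bracket_multiset_omega1[OF L] by auto
  next
    case 3
    then obtain c d where cd: "c \<in> verts L" "d \<in> verts L" "c \<noteq> d" "positive L c \<noteq> positive L d"
      and arcs: "\<And>s. mate L (c, s, Out) = (d, s, In) \<or> mate L (d, s, Out) = (c, s, In)"
      and L': "L' = splice {c, d} opposite L"
      unfolding omega2_def arc_def fst_conv snd_conv by blast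
    show ?thesis
    proof (cases "positive L c")
      case True
      then show ?thesis using bracket_multiset_omega2[OF L cd(1-3) _ _ arcs] cd(4) L' by simp
    next
      case False
      have "mate L (d, s, Out) = (c, s, In) \<or> mate L (c, s, Out) = (d, s, In)" for s using arcs[of s] by blast
      from bracket_multiset_omega2[OF L cd(2,1) cd(3)[symmetric] _ False this] show ?thesis
        using cd(4) False L' by (simp add: insert_commute)
    qed
  qed (rule bracket_multiset_omega3[OF L])
qed

lemma bracket_multiset_same_virtual_link:
  assumes "same_virtual_link L L'"
  shows "\<Phi> L = \<Phi> L'"
  using assms unfolding same_virtual_link_def
  by (induction rule: equivclp_induct) (auto dest: bracket_multiset_step)

end

theorem theorem3p3:
  fixes X :: "'x set"
    and circ :: "'x \<Rightarrow> 'x \<Rightarrow> 'x" (infixl "\<odot>" 75)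
    and ast :: "'x \<Rightarrow> 'x \<Rightarrow> 'x" (infixl "\<star>" 75)
    and A B C D E F :: "'x \<Rightarrow> 'x \<Rightarrow> 'r::{comm_ring,comm_monoid_mult}"
    and \<delta> w :: 'r
  assumes "finite X" and "biquandle X (\<odot>) (\<star>)"
    and "w dvd 1"
    and "\<forall>x\<in>X.
      \<delta> * A x x + B x x = w \<and>
      \<delta> * D x x + E x x = unit_inv w \<and>
      C x x = 0 \<and> F x x = 0"
    and "\<forall>x\<in>X. \<forall>y\<in>X.
      A x y * F x y = 0 \<and> C x y * D x y = 0 \<and> B x y * F x y = 0 \<and> C x y * E x y = 0 \<and>
      A x y * D x y = 1 - C x y * F x y \<and>
      B x y * E x y = 1 - C x y * F x y \<and>
      \<delta> * A x y * D x y = - (A x y * E x y) - B x y * D x y"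
    and "\<forall>x\<in>X. \<forall>y\<in>X. \<forall>z\<in>X.
      A x y * A y z * A (x \<odot> y) (z \<star> y) + C x y * C y z * A (x \<odot> y) (z \<star> y) =
        A x z * A (y \<star> x) (z \<star> x) * A (x \<odot> z) (y \<odot> z) + A x z * C (y \<star> x) (z \<star> x) * C (x \<odot> z) (y \<odot> z) \<and>
      A x y * B y z * B (x \<odot> y) (z \<star> y) + C x y * B y z * C (x \<odot> y) (z \<star> y) =
        B x z * B (y \<star> x) (z \<star> x) * A (x \<odot> z) (y \<odot> z) + C x z * B (y \<star> x) (z \<star> x) * C (x \<odot> z) (y \<odot> z) \<and>
      B x y * A y z * B (x \<odot> y) (z \<star> y) + B x y * C y z * C (x \<odot> y) (z \<star> y) =
        B x z * A (y \<star> x) (z \<star> x) * B (x \<odot> z) (y \<odot> z) + C x z * C (y \<star> x) (z \<star> x) * B (x \<odot> z) (y \<odot> z) \<and>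
      A x y * C y z * A (x \<odot> y) (z \<star> y) + C x y * A y z * A (x \<odot> y) (z \<star> y) =
        C x z * A (y \<star> x) (z \<star> x) * A (x \<odot> z) (y \<odot> z) \<and>
      A x y * A y z * C (x \<odot> y) (z \<star> y) =
        A x z * A (y \<star> x) (z \<star> x) * C (x \<odot> z) (y \<odot> z) + A x z * C (y \<star> x) (z \<star> x) * A (x \<odot> z) (y \<odot> z) \<and>
      A x y * C y z * B (x \<odot> y) (z \<star> y) =
        B x z * B (y \<star> x) (z \<star> x) * C (x \<odot> z) (y \<odot> z) + C x z * B (y \<star> x) (z \<star> x) * A (x \<odot> z) (y \<odot> z) \<and>
      B x y * C y z * B (x \<odot> y) (z \<star> y) + B x y * A y z * C (x \<odot> y) (z \<star> y) =
        B x z * A (y \<star> x) (z \<star> x) * C (x \<odot> z) (y \<odot> z) \<and>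
      A x y * B y z * C (x \<odot> y) (z \<star> y) + C x y * B y z * B (x \<odot> y) (z \<star> y) =
        B x z * C (y \<star> x) (z \<star> x) * A (x \<odot> z) (y \<odot> z) \<and>
      C x y * A y z * B (x \<odot> y) (z \<star> y) =
        B x z * C (y \<star> x) (z \<star> x) * B (x \<odot> z) (y \<odot> z) + C x z * A (y \<star> x) (z \<star> x) * B (x \<odot> z) (y \<odot> z) \<and>
      C x y * C y z * B (x \<odot> y) (z \<star> y) =
        B x z * C (y \<star> x) (z \<star> x) * C (x \<odot> z) (y \<odot> z) \<and>
      A x y * C y z * C (x \<odot> y) (z \<star> y) =
        C x z * C (y \<star> x) (z \<star> x) * A (x \<odot> z) (y \<odot> z) \<and>
      C x y * A y z * C (x \<odot> y) (z \<star> y) =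
        C x z * A (y \<star> x) (z \<star> x) * C (x \<odot> z) (y \<odot> z) \<and>
      B x y * C y z * A (x \<odot> y) (z \<star> y) = 0 \<and>
      C x y * B y z * A (x \<odot> y) (z \<star> y) = 0 \<and>
      B x y * B y z * C (x \<odot> y) (z \<star> y) = 0 \<and>
      C x y * C y z * C (x \<odot> y) (z \<star> y) = 0 \<and>
      A x z * B (y \<star> x) (z \<star> x) * C (x \<odot> z) (y \<odot> z) = 0 \<and>
      A x z * C (y \<star> x) (z \<star> x) * B (x \<odot> z) (y \<odot> z) = 0 \<and>
      C x z * B (y \<star> x) (z \<star> x) * B (x \<odot> z) (y \<odot> z) = 0 \<and>
      C x z * C (y \<star> x) (z \<star> x) * C (x \<odot> z) (y \<odot> z) = 0 \<and>
      A x y * A y z * B (x \<odot> y) (z \<star> y) =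
        A x z * B (y \<star> x) (z \<star> x) * A (x \<odot> z) (y \<odot> z) + A x z * A (y \<star> x) (z \<star> x) * B (x \<odot> z) (y \<odot> z) + \<delta> * A x z * B (y \<star> x) (z \<star> x) * B (x \<odot> z) (y \<odot> z) + B x z * B (y \<star> x) (z \<star> x) * B (x \<odot> z) (y \<odot> z) \<and>
      B x z * A (y \<star> x) (z \<star> x) * A (x \<odot> z) (y \<odot> z) =
        B x y * A y z * A (x \<odot> y) (z \<star> y) + A x y * B y z * A (x \<odot> y) (z \<star> y) + \<delta> * B x y * B y z * A (x \<odot> y) (z \<star> y) + B x y * B y z * B (x \<odot> y) (z \<star> y)"
    and "same_virtual_link L\<^sub>1 L\<^sub>2" and "link_diagram L\<^sub>1" and "link_diagram L\<^sub>2"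
  shows "bracket_multiset X (\<odot>) (\<star>) (coefficients A B C D E F) \<delta> w L\<^sub>1 =
    bracket_multiset X (\<odot>) (\<star>) (coefficients A B C D E F) \<delta> w L\<^sub>2"
proof -
  interpret parity_bracket X circ ast A B C D E F \<delta> w
    by (rule parity_bracket.intro) (fact assms(1-6))+
  show ?thesis by (rule bracket_multiset_same_virtual_link[OF assms(7)])
qed

end
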